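(* Let $[m]=\eta(m\tau)$, $q=e^{2\pi i\tau}$, and let the signature $r\in\{2,3,4\}$ correspond to $M=4,3,2$ respectively. The Hauptmodul $\alpha_r$ and the weight-$1$ modular forms $\mathcal A_r,\mathcal B_r,\mathcal C_r$ for $\Gamma_0(M)$ (see context) have the following representations, where $\sum$ means $\sum_{n=1}^\infty$. $r=4$ ($M=2$): $\alpha_4=\dfrac{2^6[2]^{24}}{2^6[2]^{24}+[1]^{24}}$, $\;1-\alpha_4=\dfrac{[1]^{24}}{2^6[2]^{24}+[1]^{24}}$; $\mathcal A_4=\hat{\mathsf K}_4\circ\alpha_4=\dfrac{(2^6[2]^{24}+[1]^{24})^{1/4}}{[1]^2[2]^2}=\sqrt{1+24\sum\bigl(\sum_{d\mid n,\,d\text{ odd}}d\bigr)q^n}$; $\mathcal B_4=[1]^4/[2]^2=1+4\sum E_1(n;4)(-q)^n$; $\mathcal C_4=2^{3/2}[2]^4/[1]^2=2^{3/2}q^{1/4}\bigl[1+\sum E_1(4n+1;4)q^n\bigr]$. $r=3$ ($M=3$): $\alpha_3=\dfrac{3^3[3]^{12}}{3^3[3]^{12}+[1]^{12}}$, $\;1-\alpha_3=\dfrac{[1]^{12}}{3^3[3]^{12}+[1]^{12}}$; $\mathcal A_3=\hat{\mathsf K}_3\circ\alpha_3=\dfrac{(3^3[3]^{12}+[1]^{12})^{1/3}}{[1][3]}=1+6\sum E_1(n;3)q^n$; $\mathcal B_3=[1]^3/[3]=1-3\sum[E_1(n;3)-3E_1(n/3;3)]q^n$; $\mathcal C_3=3[3]^3/[1]=3q^{1/3}\bigl[1+\sum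 E_1(3n+1;3)q^n\bigr]$. $r=2$ ($M=4$): $\alpha_2=\dfrac{2^4[4]^8}{2^4[4]^8+[1]^8}=2^4[1]^8[4]^{16}/[2]^{24}$, $\;1-\alpha_2=\dfrac{[1]^8}{2^4[4]^8+[1]^8}=[1]^{16}[4]^8/[2]^{24}$; $\mathcal A_2=\hat{\mathsf K}_2\circ\alpha_2=\dfrac{(2^4[4]^8+[1]^8)^{1/2}}{[2]^2}=\dfrac{[2]^{10}}{[1]^4[4]^4}=1+4\sum E_1(n;4)q^n$; $\mathcal B_2=[1]^4/[2]^2=1+4\sum E_1(n;4)(-q)^n$; $\mathcal C_2=2^2[4]^4/[2]^2=4q^{1/2}\bigl[1+\sum E_1(2n+1;4)q^n\bigr]$. (The identities involving $\hat{\mathsf K}_r\circ\alpha_r$ and the roots are understood near the cusp $\tau=i\infty$, with the roots in $\mathcal A_r$ tending to $1$ there.)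
   Context: $\eta$ is the Dedekind eta function. $E_1(n;k)$ is the number of positive divisors of $n$ congruent to $1$ mod $k$ minus the number congruent to $-1$ mod $k$; it is $0$ if $n$ is not an integer. $\hat{\mathsf K}_r(\alpha)={}_2F_1(\tfrac1r,1-\tfrac1r;1;\alpha)$. $t_2=2^{12}[2]^{24}/[1]^{24}$, $t_3=3^6[3]^{12}/[1]^{12}$, $t_4=2^8[4]^8/[1]^8$ are Hauptmoduln for $\Gamma_0(2),\Gamma_0(3),\Gamma_0(4)$; put $\kappa_2=2^{12},\kappa_3=3^6,\kappa_4=2^8$. For $M=2,3,4$ write $j=P_M(t_M)/Q_M(t_M)$ in lowest terms ($j$ the elliptic modular invariant), set $h_M(t)=[P_M(t)/P_M(0)]^{-1/12}{}_2F_1(\tfrac1{12},\tfrac5{12};1;12^3Q_M(t)/P_M(t))$ near $t=0$, and let $\mathfrak h_M(\tau)$ be the continuation to the upper half plane of $h_M(t_M(\tau))$ from a neighborhood of $\tau=i\infty$. With $r=12/\psi(M)$ (so $r=4,3,2$ for $M=2,3,4$; $\psi(2)=3,\psi(3)=4,\psi(4)=6$) define $\alpha_r=t_M/(t_M+\kappa_M^{1/2})$, $\;\mathcal B_r=\mathfrak h_M$, $\;\mathcal A_r=(1-\alpha_r)^{-1/r}\mathcal B_r$, $\;\mathcal C_r=\bigl[\frac{1-\alpha_r}{\alpha_r}\bigr]^{-1/r}\mathcal B_r$, the powers being positive for $\tau$ on the positive imaginary axis near $i\infty$ and continued analytically. *)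

theory Defs
  imports "HOL-Complex_Analysis.Complex_Analysis" "HOL-Number_Theory.Cong"
begin

section \<open>The upper half plane and the cusp at infinity\<close>

definition uhp :: "complex set"
  where "uhp = {\<tau>. 0 < Im \<tau>}"

text \<open>Neighbourhoods of the cusp are the half planes \<open>{\<tau>. Y < Im \<tau>}\<close>.\<close>
definition at_cusp :: "complex filter"
  where "at_cusp = filtercomap Im at_top"

text \<open>\<open>qpow s \<tau>\<close> is \<open>q\<^sup>s\<close> for \<open>q = exp (2 \<pi> \<i> \<tau>)\<close>.\<close>
definition qpow :: "real \<Rightarrow> complex \<Rightarrow> complex"
  where "qpow s \<tau> = exp (2 * of_real pi * \<i> * of_real s * \<tau>)"

abbreviation nome :: "complex \<Rightarrow> complex"
  where "nome \<equiv> qpow 1"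

text \<open>
  Analytic continuation, to the whole upper half plane, of a function whose values matter only
  near the cusp. By the identity theorem there is at most one continuation on \<^term>\<open>uhp\<close>. A function
  that has no single-valued continuation is left as it is and remains meaningful only near the cusp;
  this is what happens for the power of \<open>1 - \<alpha>\<close> in signature 4, which branches at the elliptic points.
\<close>
definition continue_uhp :: "(complex \<Rightarrow> complex) \<Rightarrow> complex \<Rightarrow> complex"
  where "continue_uhp f =
    (if \<exists>g. g holomorphic_on uhp \<and> (\<forall>\<^sub>F \<tau> in at_cusp. g \<tau> = f \<tau>)
     then SOME g. g holomorphic_on uhp \<and> (\<forall>\<^sub>F \<tau> in at_cusp. g \<tau> = f \<tau>)
     else f)"

text \<open>
  The holomorphic branch near the cusp of the power \<open>f\<^sup>c\<close> that is positive on the positive imaginary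
  axis near the cusp. It is unique as a germ at the cusp. The principal branch \<open>powr\<close> would be wrong
  here, because functions such as \<open>\<alpha> / (1 - \<alpha>)\<close> wind around 0 near the cusp.
\<close>
definition is_positive_power :: "(complex \<Rightarrow> complex) \<Rightarrow> real \<Rightarrow> (complex \<Rightarrow> complex) \<Rightarrow> bool"
  where "is_positive_power f c g \<longleftrightarrow>
    (\<exists>Y>0. \<exists>L. L holomorphic_on {\<tau>. Y < Im \<tau>} \<and>
       (\<forall>\<tau>. Y < Im \<tau> \<longrightarrow> exp (L \<tau>) = f \<tau> \<and> g \<tau> = exp (of_real c * L \<tau>)) \<and>
       (\<forall>y>Y. \<exists>p>0. g (\<i> * of_real y) = of_real p))"

definition cusp_power :: "(complex \<Rightarrow> complex) \<Rightarrow> real \<Rightarrow> complex \<Rightarrow> complex"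
  where "cusp_power f c = continue_uhp (SOME g. is_positive_power f c g)"


section \<open>Eta function, elliptic modular invariant, hypergeometric function, divisor function\<close>

definition dedekind_eta :: "complex \<Rightarrow> complex"
  where "dedekind_eta \<tau> = qpow (1/24) \<tau> * (\<Prod>n. 1 - nome \<tau> ^ Suc n)"

text \<open>The bracket \<open>[m] = \<eta>(m\<tau>)\<close>.\<close>
definition eta_at :: "nat \<Rightarrow> complex \<Rightarrow> complex"
  where "eta_at m \<tau> = dedekind_eta (of_nat m * \<tau>)"

definition eisenstein4 :: "complex \<Rightarrow> complex"
  where "eisenstein4 \<tau> =
    1 + 240 * (\<Sum>\<^sub>\<infinity>n\<in>{1..}. of_nat (\<Sum>d | d dvd n. d ^ 3) * nome \<tau> ^ n)"

text \<open>\<open>j = E\<^sub>4\<^sup>3 / \<Delta>\<close> with \<open>\<Delta> = \<eta>\<^sup>2\<^sup>4\<close>, so that \<open>j = q\<^sup>-\<^sup>1 + 744 + \<dots>\<close> (value 1728 at \<open>\<i>\<close>).\<close>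
definition modular_j :: "complex \<Rightarrow> complex"
  where "modular_j \<tau> = eisenstein4 \<tau> ^ 3 / dedekind_eta \<tau> ^ 24"

definition hyp2f1 :: "complex \<Rightarrow> complex \<Rightarrow> complex \<Rightarrow> complex \<Rightarrow> complex"
  where "hyp2f1 a b c z = eval_fps (fps_hypergeo [a, b] [c] 1) z"

definition K_hat :: "nat \<Rightarrow> complex \<Rightarrow> complex"
  where "K_hat r \<alpha> = hyp2f1 (1 / of_nat r) (1 - 1 / of_nat r) 1 \<alpha>"

text \<open>The first argument is rational so that \<open>E\<^sub>1(n/3; 3)\<close> makes sense when 3 does not divide \<open>n\<close>.\<close>
definition E1 :: "rat \<Rightarrow> nat \<Rightarrow> int"
  where "E1 x k = (if x \<in> \<int>
     then int (card {d::nat. 0 < d \<and> int d dvd \<lfloor>x\<rfloor> \<and> [int d = 1] (mod int k)})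
        - int (card {d::nat. 0 < d \<and> int d dvd \<lfloor>x\<rfloor> \<and> [int d = - 1] (mod int k)})
     else 0)"


section \<open>Hauptmoduln of level 2, 3, 4 and the form \<open>\<hh>\<^sub>M\<close>\<close>

definition kappa :: "nat \<Rightarrow> real"
  where "kappa M = (if M = 2 then 2 ^ 12 else if M = 3 then 3 ^ 6 else 2 ^ 8)"

text \<open>The exponents \<open>24 div (M - 1)\<close> are 24, 12, 8 for \<open>M = 2, 3, 4\<close>.\<close>
definition hauptmodul :: "nat \<Rightarrow> complex \<Rightarrow> complex"
  where "hauptmodul M \<tau> =
    of_real (kappa M) * eta_at M \<tau> ^ (24 div (M - 1)) / eta_at 1 \<tau> ^ (24 div (M - 1))"

text \<open>
  \<open>j = P(t) / Q(t)\<close> in lowest terms. This determines \<open>(P, Q)\<close> up to a common nonzero constant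
  factor, which cancels in \<open>h_level\<close> below.
\<close>
definition j_fraction :: "nat \<Rightarrow> complex poly \<times> complex poly"
  where "j_fraction M = (SOME (P, Q). coprime P Q \<and>
    (\<forall>\<tau>\<in>uhp. poly Q (hauptmodul M \<tau>) \<noteq> 0 \<and>
       modular_j \<tau> = poly P (hauptmodul M \<tau>) / poly Q (hauptmodul M \<tau>)))"

text \<open>Only the values near \<open>t = 0\<close> matter, where the base of \<open>powr\<close> is close to 1.\<close>
definition h_level :: "nat \<Rightarrow> complex \<Rightarrow> complex"
  where "h_level M t = (let (P, Q) = j_fraction M in
    (poly P t / poly P 0) powr (- 1 / 12) * hyp2f1 (1/12) (5/12) 1 (12 ^ 3 * poly Q t / poly P t))"

definition h_form :: "nat \<Rightarrow> complex \<Rightarrow> complex"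
  where "h_form M = continue_uhp (\<lambda>\<tau>. h_level M (hauptmodul M \<tau>))"


section \<open>The forms of signature \<open>r = 2, 3, 4\<close>\<close>

text \<open>The inverse of \<open>r = 12 / \<psi>(M)\<close>, where \<open>\<psi>(2) = 3\<close>, \<open>\<psi>(3) = 4\<close>, \<open>\<psi>(4) = 6\<close>.\<close>
definition level :: "nat \<Rightarrow> nat"
  where "level r = (if r = 4 then 2 else if r = 3 then 3 else 4)"

definition alpha :: "nat \<Rightarrow> complex \<Rightarrow> complex"
  where "alpha r \<tau> = hauptmodul (level r) \<tau> /
     (hauptmodul (level r) \<tau> + of_real (sqrt (kappa (level r))))"

definition formB :: "nat \<Rightarrow> complex \<Rightarrow> complex"
  where "formB r = h_form (level r)"

definition formA :: "nat \<Rightarrow> complex \<Rightarrow> complex"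
  where "formA r \<tau> = cusp_power (\<lambda>\<tau>. 1 - alpha r \<tau>) (- 1 / real r) \<tau> * formB r \<tau>"

definition formC :: "nat \<Rightarrow> complex \<Rightarrow> complex"
  where "formC r \<tau> =
    cusp_power (\<lambda>\<tau>. (1 - alpha r \<tau>) / alpha r \<tau>) (- 1 / real r) \<tau> * formB r \<tau>"

end

theory Submission
  imports Defs "HOL-Computational_Algebra.Fundamental_Theorem_Algebra"
begin

text \<open>
  Let \<open>U(q) = \<phi>(q)\<^sup>2\<close> and \<open>a(q)\<close> be the weight-1 Lambert series of the odd characters mod 4 and mod 3.
  Special values of Kronecker's bilateral sum give product formulas for \<open>U\<close>, for \<open>U(z) - U(z\<^sup>2)\<close> and for the
  two cubic analogues, and these are the eta quotients and the \<open>q\<close>-expansions of the forms.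
  Comparing elliptic functions with the same poles (the addition formula of Frobenius and Stickelberger and the
  differential equation of \<open>\<wp>\<close>) at torsion points expresses \<open>E\<^sub>4\<close> and \<open>A\<^sub>4\<^sup>2\<close> through \<open>U(q)\<close>, \<open>U(-q)\<close>, and
  \<open>E\<^sub>4\<close> through \<open>a\<close>, which in turn gives \<open>j\<close> as a rational function of each Hauptmodul.

  On the hypergeometric side, both members of each algebraic transformation solve the same linear differential
  equation, which has only one normalized solution that is analytic at 0. Landen's transformation says that
  \<open>K\<^sub>2(\<alpha>\<^sub>2(q)) / U(q)\<close> takes the same value at \<open>q\<close> and at \<open>q\<^sup>2\<close>, so it is constant near 0. Pulling
  back along the Hauptmoduln yields \<open>K\<^sub>3\<close>, \<open>K\<^sub>4\<close> and the fourth power of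
  \<open>\<^sub>2F\<^sub>1(1/12, 5/12; 1; 1728/j)\<close>, which equals \<open>E\<^sub>4\<close>. Hence \<open>h\<^sub>M\<^sup>1\<^sup>2\<close> is the 12th power of an eta quotient,
  and two functions that tend to 1 at the cusp and have equal 12th powers agree near the cusp.
\<close>

section \<open>Lambert series\<close>

text \<open>Elliptic functions at points of order 2 or 3 do not give \<open>eisen4 q\<close> itself
  but a combination of it with its value at q^2 or q^3. The second relation comes from the roots of
  the nome: the same identity is written at all square or cube roots z of q, where the dissections
  express the theta functions through their value at q and one further function, and the sum over
  the roots is weighted so that the unwanted series cancels. Signature 2 has to come first, because
  its Landen transformation corresponds to squaring the nome, which contracts the disc to 0. The
  sextic map then gives 2F1(1/12, 5/12) at 1728/j, from which the cubic map gives signature 3; the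
  quadratic map gives signature 4. \<open>formA 4\<close> is a square root of \<open>odd_sum\<close>
  and is described only near the cusp. The other forms are, up to a power of q, holomorphic
  functions of q on the whole disc, and are identified on all of \<open>uhp\<close>.\<close>

lemma summable_power_mult_geometric:
  fixes r :: real
  assumes "0 < r" "r < 1"
  shows "summable (\<lambda>n. real n ^ k * r ^ n)"
proof -
  obtain c where c: "r < c" "c < 1" using assms dense by blast
  have "(\<lambda>n. (1 + 1 / real n) ^ k * r) \<longlonglongrightarrow> (1 + 0) ^ k * r"
    by (intro tendsto_intros lim_1_over_n)
  hence "\<forall>\<^sub>F n in sequentially. (1 + 1 / real n) ^ k * r < c"
    by (rule order_tendstoD) (use c in auto)
  then obtain N where N: "\<And>n. n \<ge> N \<Longrightarrow> (1 + 1 / real n) ^ k * r < c"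
    by (auto simp: eventually_sequentially)
  show ?thesis
  proof (rule summable_ratio_test[OF c(2), of "Suc N"])
    fix n assume n: "n \<ge> Suc N"
    have "norm (real (Suc n) ^ k * r ^ Suc n) = ((1 + 1 / real n) ^ k * r) * (real n ^ k * r ^ n)"
    proof -
      have "real (Suc n) = (1 + 1 / real n) * real n" using n by (simp add: field_simps)
      hence "real (Suc n) ^ k = (1 + 1 / real n) ^ k * real n ^ k" by (metis power_mult_distrib)
      thus ?thesis using assms by (simp add: abs_mult)
    qed
    also have "\<dots> \<le> c * (real n ^ k * r ^ n)"
      by (intro mult_right_mono) (use N[of n] n assms in auto)
    finally show "norm (real (Suc n) ^ k * r ^ Suc n) \<le> c * norm (real n ^ k * r ^ n)"
      using assms by simp
  qed
qed

text \<open>The exponent 3 is what the coefficients d^3 of the weight-4 Eisenstein series require;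
  every coefficient function in use is dominated by it.\<close>

definition tame :: "(nat \<Rightarrow> nat \<Rightarrow> complex) \<Rightarrow> bool"
  where "tame f \<longleftrightarrow> (\<exists>C. \<forall>m\<ge>1. \<forall>n\<ge>1. norm (f m n) \<le> C * (real m * real n) ^ 3)"

text \<open>The two indices are kept apart instead of being collected into a divisor sum: exchanging
  them, dilating one of them and twisting by a character of m * n are then mere reindexings.\<close>

definition lambert :: "(nat \<Rightarrow> nat \<Rightarrow> complex) \<Rightarrow> complex \<Rightarrow> complex"
  where "lambert f q = (\<Sum>\<^sub>\<infinity>(m,n)\<in>{1..}\<times>{1..}. f m n * q ^ (m * n))"

lemma abs_summable_on_times:
  fixes f g :: "nat \<Rightarrow> real"
  assumes "summable f" "summable g" "\<And>n. 0 \<le> f n" "\<And>n. 0 \<le> g n"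
  shows "(\<lambda>(m, n). f m * g n) summable_on A \<times> B"
proof -
  have f: "f summable_on UNIV" and g: "g summable_on UNIV"
    using assms by (auto intro!: norm_summable_imp_summable_on)
  have "(\<lambda>(m, n). f m * g n) summable_on UNIV \<times> UNIV"
  proof (rule summable_on_SigmaI[where g = "\<lambda>m. f m * infsum g UNIV"])
    fix m show "((\<lambda>n. case (m, n) of (m, n) \<Rightarrow> f m * g n) has_sum f m * infsum g UNIV) UNIV"
      using has_sum_cmult_right[OF has_sum_infsum[OF g], of "f m"] by simp
  qed (use f assms in \<open>auto intro: summable_on_cmult_left\<close>)
  thus ?thesis by (rule summable_on_subset_banach) auto
qed

text \<open>Since m + n - 1 <= m * n for positive m and n, the double series is dominated by a
  product of two single series in any r with |q| < r < 1.\<close>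

lemma lambert_abs_summable:
  assumes "norm q < 1" "tame f"
  shows "(\<lambda>p. norm (case p of (m, n) \<Rightarrow> f m n * q ^ (m * n))) summable_on {1..} \<times> {1..}"
proof -
  from assms(2) obtain C where C: "\<And>m n. m \<ge> 1 \<Longrightarrow> n \<ge> 1 \<Longrightarrow> norm (f m n) \<le> C * (real m * real n) ^ 3"
    unfolding tame_def by blast
  obtain r where r: "norm q < r" "r < 1" using assms dense by blast
  have r0: "0 < r" using r norm_ge_zero order_le_less_trans by blast
  let ?g = "\<lambda>n. real n ^ 3 * r ^ n"
  have "(\<lambda>(m, n). ?g m * ?g n) summable_on {1..} \<times> {1..}"
    by (rule abs_summable_on_times) (use summable_power_mult_geometric[of r 3] r r0 in auto)
  hence "(\<lambda>p. (C / r) * (case p of (m, n) \<Rightarrow> ?g m * ?g n)) summable_on {1..} \<times> {1..}"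
    by (rule summable_on_cmult_right)
  thus ?thesis
  proof (rule summable_on_comparison_test)
    fix p :: "nat \<times> nat" assume "p \<in> {1..} \<times> {1..}"
    then obtain m n where p: "p = (m, n)" "m \<ge> 1" "n \<ge> 1" by auto
    have le: "m + n - 1 \<le> m * n" using p
      by (cases m; cases n) auto
    have "norm q ^ (m * n) \<le> r ^ (m * n)" using r by (intro power_mono) auto
    also have "\<dots> \<le> r ^ (m + n - 1)" using r r0 le by (intro power_decreasing) auto
    also have "\<dots> = r ^ m * r ^ n / r" using p r0
      by (cases m) (auto simp: power_add field_simps)
    finally have "norm (f m n) * norm q ^ (m * n) \<le> (C * (real m * real n) ^ 3) * (r ^ m * r ^ n / r)"
      using C[of m n] p by (intro mult_mono) (auto intro: order_trans[OF norm_ge_zero])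
    thus "norm (case p of (m, n) \<Rightarrow> f m n * q ^ (m * n)) \<le> C / r * (case p of (m, n) \<Rightarrow> ?g m * ?g n)"
      by (simp add: p norm_mult norm_power power_mult_distrib mult_ac)
  qed auto
qed

lemma lambert_summable:
  assumes "norm q < 1" "tame f"
  shows "(\<lambda>(m, n). f m n * q ^ (m * n)) summable_on {1..} \<times> {1..}"
  using lambert_abs_summable[OF assms] by (rule abs_summable_summable)

lemma tameI:
  assumes "\<And>m n. m \<ge> 1 \<Longrightarrow> n \<ge> 1 \<Longrightarrow> norm (f m n) \<le> C * (real m * real n) ^ 3"
  shows "tame f"
  using assms unfolding tame_def by blast

lemma tame_pow:
  assumes "k \<le> 3" "\<And>m n. norm (f m n) \<le> C"
  shows "tame (\<lambda>m n. of_nat m ^ k * f m n)"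
proof (rule tameI)
  fix m n :: nat assume mn: "m \<ge> 1" "n \<ge> 1"
  have C: "0 \<le> C" using assms(2)[of 0 0] norm_ge_zero order_trans by blast
  have 1: "real m ^ k \<le> (real m * real n) ^ 3"
  proof -
    have "real m ^ k \<le> real m ^ 3" using mn assms by (intro power_increasing) auto
    also have "\<dots> \<le> (real m * real n) ^ 3" using mn
      by (intro power_mono) (auto simp: mult_le_cancel_left1)
    finally show ?thesis .
  qed
  have "norm (of_nat m ^ k * f m n) = real m ^ k * norm (f m n)" by (simp add: norm_mult norm_power)
  also have "\<dots> \<le> (real m * real n) ^ 3 * C" using 1 assms(2)[of m n] C by (intro mult_mono) auto
  finally show "norm (of_nat m ^ k * f m n) \<le> C * (real m * real n) ^ 3" by (simp add: mult.commute)
qed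

lemma tame_bounded:
  assumes "\<And>m n. norm (f m n) \<le> C"
  shows "tame f"
  using tame_pow[of 0 f C] assms by simp

lemma tame_cong:
  assumes "tame f" "\<And>m n. m \<ge> 1 \<Longrightarrow> n \<ge> 1 \<Longrightarrow> norm (g m n) \<le> norm (f m n)"
  shows "tame g"
proof -
  obtain C where "\<And>m n. m \<ge> 1 \<Longrightarrow> n \<ge> 1 \<Longrightarrow> norm (f m n) \<le> C * (real m * real n) ^ 3"
    using assms(1) unfolding tame_def by blast
  thus ?thesis by (intro tameI[of _ C]) (blast intro: order_trans assms(2))
qed

lemma tame_add [intro]: "tame f \<Longrightarrow> tame g \<Longrightarrow> tame (\<lambda>m n. f m n + g m n)"
proof -
  assume "tame f" "tame g"
  then obtain C D where "\<And>m n. m \<ge> 1 \<Longrightarrow> n \<ge> 1 \<Longrightarrow> norm (f m n) \<le> C * (real m * real n) ^ 3"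
    "\<And>m n. m \<ge> 1 \<Longrightarrow> n \<ge> 1 \<Longrightarrow> norm (g m n) \<le> D * (real m * real n) ^ 3" unfolding tame_def by blast
  thus ?thesis by (intro tameI[of _ "C + D"]) (simp add: norm_triangle_mono distrib_right)
qed

lemma tame_cmult [intro]: "tame f \<Longrightarrow> tame (\<lambda>m n. c * f m n)"
proof -
  assume "tame f"
  then obtain C where "\<And>m n. m \<ge> 1 \<Longrightarrow> n \<ge> 1 \<Longrightarrow> norm (f m n) \<le> C * (real m * real n) ^ 3"
    unfolding tame_def by blast
  thus ?thesis by (intro tameI[of _ "norm c * C"]) (auto simp: norm_mult mult.assoc intro!: mult_left_mono)
qed

lemma tame_swap:
  assumes "tame f" shows "tame (\<lambda>m n. f n m)"
proof -
  obtain C where C: "\<And>m n. m \<ge> 1 \<Longrightarrow> n \<ge> 1 \<Longrightarrow> norm (f m n) \<le> C * (real m * real n) ^ 3"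
    using assms unfolding tame_def by blast
  show ?thesis
  proof (rule tameI)
    fix m n :: nat assume "m \<ge> 1" "n \<ge> 1"
    thus "norm (f n m) \<le> C * (real m * real n) ^ 3"
      using C[of n m] by (simp add: mult.commute[of "real n"])
  qed
qed

lemma lambert_cong:
  assumes "\<And>m n. m \<ge> 1 \<Longrightarrow> n \<ge> 1 \<Longrightarrow> f m n = g m n"
  shows "lambert f q = lambert g q"
  unfolding lambert_def by (rule infsum_cong) (use assms in auto)

lemma lambert_add:
  assumes "norm q < 1" "tame f" "tame g"
  shows "lambert (\<lambda>m n. f m n + g m n) q = lambert f q + lambert g q"
proof -
  have "lambert f q + lambert g q =
     (\<Sum>\<^sub>\<infinity>p\<in>{1..}\<times>{1..}. (case p of (m,n) \<Rightarrow> f m n * q ^ (m * n)) + (case p of (m,n) \<Rightarrow> g m n * q ^ (m * n)))"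
    unfolding lambert_def by (rule infsum_add[symmetric]) (use assms lambert_summable in auto)
  also have "\<dots> = lambert (\<lambda>m n. f m n + g m n) q"
    unfolding lambert_def by (rule infsum_cong) (auto simp: algebra_simps)
  finally show ?thesis by simp
qed

lemma lambert_cmult: "lambert (\<lambda>m n. c * f m n) q = c * lambert f q"
proof -
  have "lambert (\<lambda>m n. c * f m n) q = (\<Sum>\<^sub>\<infinity>p\<in>{1..}\<times>{1..}. c * (case p of (m,n) \<Rightarrow> f m n * q ^ (m * n)))"
    unfolding lambert_def by (rule infsum_cong) (auto simp: algebra_simps)
  thus ?thesis by (simp add: infsum_cmult_right' lambert_def)
qed

lemma lambert_swap: "lambert (\<lambda>m n. f n m) q = lambert f q"
  unfolding lambert_def
  by (rule infsum_reindex_bij_witness[of _ "\<lambda>(m,n). (n,m)" "\<lambda>(m,n). (n,m)"]) (auto simp: mult.commute)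

lemma lambert_rows:
  assumes "norm q < 1" "tame f"
  shows "((\<lambda>m. \<Sum>\<^sub>\<infinity>n\<in>{1..}. f m n * q ^ (m * n)) has_sum lambert f q) {1..}"
    and "m \<ge> 1 \<Longrightarrow> (\<lambda>n. f m n * q ^ (m * n)) summable_on {1..}"
proof -
  note s = lambert_summable[OF assms]
  have "(\<lambda>m. \<Sum>\<^sub>\<infinity>n\<in>{1..}. f m n * q ^ (m * n)) summable_on {1..}"
    using summable_on_Sigma_banach[OF s] by simp
  moreover have "infsum (\<lambda>m. \<Sum>\<^sub>\<infinity>n\<in>{1..}. f m n * q ^ (m * n)) {1..} = lambert f q"
    unfolding lambert_def using infsum_Sigma'_banach[OF s] by simp
  ultimately show "((\<lambda>m. \<Sum>\<^sub>\<infinity>n\<in>{1..}. f m n * q ^ (m * n)) has_sum lambert f q) {1..}"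
    using has_sum_infsum by force
  show "(\<lambda>n. f m n * q ^ (m * n)) summable_on {1..}" if "m \<ge> 1"
    using summable_on_SigmaD1[of "\<lambda>m n. f m n * q ^ (m * n)" "{1..}" "\<lambda>_. {1..}" m] s that by simp
qed

text \<open>Collects the terms with m * n = N: the pair (m, n) becomes (N, m) with m a divisor of
  N.\<close>

lemma lambert_divisors:
  assumes "norm q < 1" "tame f"
  shows "((\<lambda>n. (\<Sum>d | d dvd n. f d (n div d)) * q ^ n) has_sum lambert f q) {1..}"
proof -
  have "((\<lambda>(m, n). f m n * q ^ (m * n)) has_sum lambert f q) ({1..} \<times> {1..})"
    unfolding lambert_def using lambert_summable[OF assms] by (rule has_sum_infsum)
  also have "?this \<longleftrightarrow> ((\<lambda>(n, d). f d (n div d) * q ^ n) has_sum lambert f q) (SIGMA n:{1..}. {d. d dvd n})"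
    by (rule has_sum_reindex_bij_witness[of _ "\<lambda>(n, d). (d, n div d)" "\<lambda>(m, n). (m * n, m)"])
      (auto simp: Suc_le_eq dvd_div_eq_0_iff intro: Nat.gr0I)
  finally have *: "((\<lambda>(n, d). f d (n div d) * q ^ n) has_sum lambert f q) (SIGMA n:{1..}. {d. d dvd n})" .
  have "((\<lambda>n. \<Sum>d | d dvd n. f d (n div d) * q ^ n) has_sum lambert f q) {1..}"
    by (rule has_sum_SigmaD[OF *]) (auto intro!: has_sum_finite finite_divisors_nat)
  thus ?thesis by (simp add: sum_distrib_right)
qed

lemma lambert_geometric:
  assumes "norm q < 1" "tame (\<lambda>m n. f m * w m ^ n)" "\<And>m. m \<ge> 1 \<Longrightarrow> norm (w m) \<le> 1"
  shows "((\<lambda>m. f m * (w m * q ^ m / (1 - w m * q ^ m))) has_sum lambert (\<lambda>m n. f m * w m ^ n) q) {1..}"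
proof -
  have "((\<lambda>m. \<Sum>\<^sub>\<infinity>n\<in>{1..}. f m * w m ^ n * q ^ (m * n)) has_sum lambert (\<lambda>m n. f m * w m ^ n) q) {1..}"
    by (rule lambert_rows[OF assms(1,2)])
  moreover have "(\<Sum>\<^sub>\<infinity>n\<in>{1..}. f m * w m ^ n * q ^ (m * n)) = f m * (w m * q ^ m / (1 - w m * q ^ m))" if "m \<in> {1..}" for m
  proof -
    have "norm q ^ m < 1" using assms(1) that by (simp add: power_less_one_iff)
    moreover have "norm (w m * q ^ m) \<le> 1 * norm q ^ m" unfolding norm_mult norm_power
      by (intro mult_right_mono) (use assms(3)[of m] that in auto)
    ultimately have n: "norm (w m * q ^ m) < 1" by linarith
    have "((\<lambda>n. (w m * q ^ m) ^ n) has_sum w m * q ^ m / (1 - w m * q ^ m)) {1..}"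
      using has_sum_geometric_from_1[OF n] by simp
    hence "((\<lambda>n. f m * (w m * q ^ m) ^ n) has_sum f m * (w m * q ^ m / (1 - w m * q ^ m))) {1..}"
      by (intro has_sum_cmult_right) simp
    thus ?thesis by (intro infsumI) (simp add: power_mult_distrib power_mult mult.assoc)
  qed
  ultimately show ?thesis by (metis (no_types, lifting) has_sum_cong)
qed

section \<open>Infinite products\<close>

text \<open>The infinite q-Pochhammer symbol (a; q).\<close>

definition qpoch :: "complex \<Rightarrow> complex \<Rightarrow> complex"
  where "qpoch a q = (\<Prod>n. 1 - a * q ^ n)"

text \<open>At the nome this is Dedekind's eta without its factor q^(1/24). Unlike eta it is
  single-valued in q.\<close>

definition euler :: "complex \<Rightarrow> complex"
  where "euler q = qpoch q q"

lemma qpoch_convergent: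
  fixes a q :: complex
  assumes "norm q < 1"
  shows "convergent_prod (\<lambda>n. 1 - a * q ^ n)"
proof -
  have "summable (\<lambda>n. norm a * norm q ^ n)"
    using assms by (intro summable_mult summable_geometric) auto
  hence "summable (\<lambda>n. norm (1 - a * q ^ n - 1))" by (simp add: norm_mult norm_power)
  thus ?thesis by (intro abs_convergent_prod_imp_convergent_prod summable_imp_abs_convergent_prod)
qed

lemma qpoch_has_prod:
  "norm q < 1 \<Longrightarrow> (\<lambda>n. 1 - a * q ^ n) has_prod qpoch a q"
  unfolding qpoch_def by (rule convergent_prod_has_prod[OF qpoch_convergent])

lemma qpoch_LIMSEQ:
  assumes "norm q < 1"
  shows "(\<lambda>N. \<Prod>n<N. 1 - a * q ^ n) \<longlonglongrightarrow> qpoch a q"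
  using has_prod_imp_tendsto'[OF qpoch_has_prod[OF assms]] .

lemma qpoch_nonzero:
  assumes "norm q < 1" "\<And>n. a * q ^ n \<noteq> 1"
  shows "qpoch a q \<noteq> 0"
  unfolding qpoch_def by (rule prodinf_nonzero[OF qpoch_convergent[OF assms(1)]]) (use assms(2) in \<open>metis eq_iff_diff_eq_0\<close>)

lemma qpoch_Suc:
  assumes "norm q < 1"
  shows "qpoch a q = (1 - a) * qpoch (a * q) q"
proof -
  have "(\<lambda>N. \<Prod>n<Suc N. 1 - a * q ^ n) \<longlonglongrightarrow> qpoch a q"
    using qpoch_LIMSEQ[OF assms] by (rule LIMSEQ_Suc)
  moreover have "(\<lambda>N. (1 - a) * (\<Prod>n<N. 1 - a * q * q ^ n)) \<longlonglongrightarrow> (1 - a) * qpoch (a * q) q"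
    by (intro tendsto_intros qpoch_LIMSEQ assms)
  moreover have "(\<Prod>n<Suc N. 1 - a * q ^ n) = (1 - a) * (\<Prod>n<N. 1 - a * q * q ^ n)" for N
    by (subst prod.lessThan_Suc_shift) (simp add: mult.assoc)
  ultimately show ?thesis using LIMSEQ_unique by auto
qed

lemma qpoch_one: "norm q < 1 \<Longrightarrow> qpoch 1 q = 0"
  using qpoch_Suc[of q 1] by simp

lemma qpoch_mult_neg:
  assumes "norm q < 1"
  shows "qpoch a q * qpoch (- a) q = qpoch (a\<^sup>2) (q\<^sup>2)"
proof -
  have q2: "norm (q\<^sup>2) < 1" using assms by (simp add: norm_power power_less_one_iff)
  have "(\<lambda>N. (\<Prod>n<N. 1 - a * q ^ n) * (\<Prod>n<N. 1 - (- a) * q ^ n)) \<longlonglongrightarrow> qpoch a q * qpoch (- a) q"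
    by (intro tendsto_intros qpoch_LIMSEQ assms)
  moreover have "(\<Prod>n<N. 1 - a * q ^ n) * (\<Prod>n<N. 1 - (- a) * q ^ n) = (\<Prod>n<N. 1 - a\<^sup>2 * (q\<^sup>2) ^ n)" for N
    unfolding prod.distrib[symmetric] by (intro prod.cong refl) (simp add: power2_eq_square algebra_simps power_mult_distrib)
  ultimately show ?thesis using qpoch_LIMSEQ[OF q2, of "a\<^sup>2"] LIMSEQ_unique by auto
qed

lemma qpoch_mult_cube_roots:
  assumes "norm q < 1" "w ^ 2 + w + 1 = 0"
  shows "qpoch a q * qpoch (w * a) q * qpoch (w\<^sup>2 * a) q = qpoch (a ^ 3) (q ^ 3)"
proof -
  have q2: "norm (q ^ 3) < 1" using assms by (simp add: norm_power power_less_one_iff)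
  have "(\<lambda>N. (\<Prod>n<N. 1 - a * q ^ n) * (\<Prod>n<N. 1 - w * a * q ^ n) * (\<Prod>n<N. 1 - w\<^sup>2 * a * q ^ n)) \<longlonglongrightarrow>
      qpoch a q * qpoch (w * a) q * qpoch (w\<^sup>2 * a) q"
    by (intro tendsto_intros qpoch_LIMSEQ assms)
  moreover have "(\<Prod>n<N. 1 - a * q ^ n) * (\<Prod>n<N. 1 - w * a * q ^ n) * (\<Prod>n<N. 1 - w\<^sup>2 * a * q ^ n) =
     (\<Prod>n<N. 1 - a ^ 3 * (q ^ 3) ^ n)" for N
    unfolding prod.distrib[symmetric]
  proof (intro prod.cong refl)
    fix n
    have "(1 - z) * (1 - w * z) * (1 - w\<^sup>2 * z) = 1 - z ^ 3" for z
      using assms(2) by algebra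
    from this[of "a * q ^ n"] show "(1 - a * q ^ n) * (1 - w * a * q ^ n) * (1 - w\<^sup>2 * a * q ^ n) = 1 - a ^ 3 * (q ^ 3) ^ n"
      by (simp add: power_mult_distrib mult.assoc power_mult[symmetric] mult.commute[of 3])
  qed
  ultimately show ?thesis using qpoch_LIMSEQ[OF q2, of "a ^ 3"] LIMSEQ_unique by auto
qed

text \<open>Sorts the exponents by their residue modulo k; the partial products up to N * k already
  agree, and their limit is taken along this subsequence.\<close>

lemma qpoch_split:
  assumes "norm q < 1" "k > 0"
  shows "(\<Prod>j<k. qpoch (a * q ^ j) (q ^ k)) = qpoch a q"
proof -
  have qk: "norm (q ^ k) < 1" using assms by (simp add: norm_power power_less_one_iff)
  have "(\<lambda>N. \<Prod>j<k. \<Prod>n<N. 1 - a * q ^ j * (q ^ k) ^ n) \<longlonglongrightarrow> (\<Prod>j<k. qpoch (a * q ^ j) (q ^ k))"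
    by (intro tendsto_prod qpoch_LIMSEQ qk)
  moreover have "(\<Prod>j<k. \<Prod>n<N. 1 - a * q ^ j * (q ^ k) ^ n) = (\<Prod>n<N * k. 1 - a * q ^ n)" for N
  proof -
    have "(\<Prod>n<N * k. 1 - a * q ^ n) = (\<Prod>m<N. \<Prod>n\<in>{m*k..<m*k+k}. 1 - a * q ^ n)"
      by (rule prod.nat_group[symmetric])
    also have "\<dots> = (\<Prod>m<N. \<Prod>j<k. 1 - a * q ^ j * (q ^ k) ^ m)"
    proof (rule prod.cong[OF refl])
      fix m
      show "(\<Prod>n\<in>{m*k..<m*k+k}. 1 - a * q ^ n) = (\<Prod>j<k. 1 - a * q ^ j * (q ^ k) ^ m)"
        by (rule prod.reindex_bij_witness[of _ "\<lambda>j. m * k + j" "\<lambda>n. n - m * k"])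
          (auto simp: power_mult[symmetric] mult.assoc simp flip: power_add mult.commute[of m k])
    qed
    also have "\<dots> = (\<Prod>j<k. \<Prod>n<N. 1 - a * q ^ j * (q ^ k) ^ n)"
      by (rule prod.swap)
    finally show ?thesis by simp
  qed
  moreover have "(\<lambda>N. \<Prod>n<N * k. 1 - a * q ^ n) \<longlonglongrightarrow> qpoch a q"
    by (rule filterlim_compose[OF qpoch_LIMSEQ[OF assms(1)]])
      (use assms(2) in \<open>auto intro!: filterlim_subseq simp: strict_mono_def\<close>)
  ultimately show ?thesis using LIMSEQ_unique by auto
qed

lemma prod_uniform_limit:
  fixes f :: "nat \<Rightarrow> complex \<Rightarrow> complex"
  assumes "compact A" "\<And>n. continuous_on A (f n)" "summable M" "\<And>n x. x \<in> A \<Longrightarrow> norm (f n x) \<le> M n"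
    and "\<And>x. x \<in> A \<Longrightarrow> (\<lambda>N. \<Prod>n<N. 1 + f n x) \<longlonglongrightarrow> g x"
  shows "uniform_limit A (\<lambda>N x. \<Prod>n<N. 1 + f n x) g sequentially"
proof -
  have "uniformly_convergent_on A (\<lambda>N x. \<Sum>n<N. norm (f n x))"
    by (rule Weierstrass_m_test'[OF _ assms(3)]) (use assms(4) in auto)
  hence "uniformly_convergent_on A (\<lambda>N x. \<Prod>n<N. 1 + f n x)"
    by (intro uniformly_convergent_on_prod assms)
  then obtain l where l: "uniform_limit A (\<lambda>N x. \<Prod>n<N. 1 + f n x) l sequentially"
    unfolding uniformly_convergent_on_def by blast
  have "l x = g x" if "x \<in> A" for x
    using tendsto_uniform_limitI[OF l that] assms(5)[OF that] LIMSEQ_unique by blast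
  thus ?thesis using l by (simp cong: uniform_limit_cong')
qed

lemma isCont_qpoch:
  assumes "norm q < 1"
  shows "isCont (\<lambda>a. qpoch a q) a"
proof -
  have "uniform_limit (cball a 1) (\<lambda>N x. \<Prod>n<N. 1 + (- x * q ^ n)) (\<lambda>x. qpoch x q) sequentially"
  proof (rule prod_uniform_limit)
    show "summable (\<lambda>n. (norm a + 1) * norm q ^ n)"
      using assms by (intro summable_mult summable_geometric) auto
    fix n x assume "x \<in> cball a 1"
    hence "norm x \<le> norm a + 1"
      by (metis mem_cball dist_norm norm_minus_commute norm_triangle_sub add_left_mono order_trans)
    thus "norm (- x * q ^ n) \<le> (norm a + 1) * norm q ^ n"
      by (simp add: norm_mult norm_power mult_right_mono)
  qed (use qpoch_LIMSEQ[OF assms] in \<open>auto intro!: continuous_intros\<close>)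
  hence "continuous_on (cball a 1) (\<lambda>x. qpoch x q)"
    by (rule uniform_limit_theorem[rotated]) (auto intro!: always_eventually continuous_intros)
  hence "continuous_on (ball a 1) (\<lambda>x. qpoch x q)"
    by (rule continuous_on_subset) auto
  thus ?thesis by (simp add: continuous_on_eq_continuous_at)
qed

lemma euler_holomorphic: "euler holomorphic_on ball 0 1"
proof (rule holomorphic_uniform_sequence[of _ "\<lambda>N x. \<Prod>n<N. 1 + (- x * x ^ n)"])
  fix x :: complex assume "x \<in> ball 0 1"
  then obtain d where d: "norm x < d" "d < 1" using dense by auto
  show "\<exists>d>0. cball x d \<subseteq> ball 0 1 \<and> uniform_limit (cball x d) (\<lambda>N x. \<Prod>n<N. 1 + (- x * x ^ n)) euler sequentially"
  proof (intro exI[of _ "d - norm x"] conjI)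
    have le: "norm z \<le> d" if "z \<in> cball x (d - norm x)" for z
      using that norm_triangle_sub[of z x] by (auto simp: dist_norm norm_minus_commute)
    show "cball x (d - norm x) \<subseteq> ball 0 1" using le d by force
    show "uniform_limit (cball x (d - norm x)) (\<lambda>N x. \<Prod>n<N. 1 + (- x * x ^ n)) euler sequentially"
    proof (rule prod_uniform_limit)
      show "summable (\<lambda>n. d * d ^ n)" using d norm_ge_zero[of x]
        by (intro summable_mult summable_geometric) (auto simp del: norm_ge_zero)
      show "norm (- z * z ^ n) \<le> d * d ^ n" if "z \<in> cball x (d - norm x)" for n z
        using le[OF that] power_mono[OF le[OF that] norm_ge_zero, of "Suc n"] by (simp add: norm_mult norm_power)
      show "(\<lambda>N. \<Prod>n<N. 1 + - z * z ^ n) \<longlonglongrightarrow> euler z" if "z \<in> cball x (d - norm x)" for z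
        using qpoch_LIMSEQ[of z z] le[OF that] d by (simp add: euler_def)
    qed (auto intro!: continuous_intros)
  qed (use d in auto)
qed (auto intro!: holomorphic_intros)

lemma euler_nonzero:
  assumes "norm q < 1" shows "euler q \<noteq> 0"
  unfolding euler_def
proof (rule qpoch_nonzero[OF assms])
  fix n
  have "norm (q * q ^ n) < 1" using assms power_less_one_iff[of "norm q" "Suc n"]
    by (simp add: norm_mult norm_power)
  thus "q * q ^ n \<noteq> 1" by auto
qed

lemma euler_0: "euler 0 = 1"
proof -
  have "euler 0 = (\<Prod>n. 1 :: complex)" unfolding euler_def qpoch_def by simp
  thus ?thesis by simp
qed

text \<open>Numerator and denominator are monic of the same degree, so the value at infinity is the
  constant 1 and only simple poles remain. The induction adds one factor at a time.\<close>

lemma partial_fractions: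
  fixes a b :: "'i \<Rightarrow> complex"
  assumes "finite K" "inj_on a K" "\<And>k. k \<in> K \<Longrightarrow> X \<noteq> a k"
  shows "(\<Prod>k\<in>K. (X - b k) / (X - a k)) =
    1 + (\<Sum>n\<in>K. (a n - b n) * (\<Prod>k\<in>K - {n}. (a n - b k) / (a n - a k)) / (X - a n))"
  using assms
proof (induction K arbitrary: X rule: finite_induct)
  case empty
  thus ?case by simp
next
  case (insert m K)
  let ?r = "\<lambda>n. (a n - b n) * (\<Prod>k\<in>K - {n}. (a n - b k) / (a n - a k))"
  have inj: "inj_on a K" and ne: "\<And>n. n \<in> K \<Longrightarrow> a n \<noteq> a m"
    using insert.prems(1) insert.hyps(2) by (auto simp: inj_on_def)
  have X: "X \<noteq> a m" "\<And>n. n \<in> K \<Longrightarrow> X \<noteq> a n" using insert by auto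
  \<comment> \<open>The induction hypothesis is used a second time with X at the new pole; this
    evaluates the residue there.\<close>
  have am: "(\<Prod>k\<in>K. (a m - b k) / (a m - a k)) = 1 + (\<Sum>n\<in>K. ?r n / (a m - a n))"
    by (rule insert.IH[OF inj]) (use ne in metis)
  have rn: "(\<Prod>k\<in>insert m K - {n}. (a n - b k) / (a n - a k)) =
      (a n - b m) / (a n - a m) * (\<Prod>k\<in>K - {n}. (a n - b k) / (a n - a k))" if "n \<in> K" for n
  proof -
    have "insert m K - {n} = insert m (K - {n})" using that insert by auto
    thus ?thesis using insert by simp
  qed
  have rm: "insert m K - {m} = K" using insert by auto
  have "(\<Prod>k\<in>insert m K. (X - b k) / (X - a k)) = (X - b m) / (X - a m) * (1 + (\<Sum>n\<in>K. ?r n / (X - a n)))"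
    using insert.IH[OF inj X(2)] insert by simp
  also have "\<dots> = (X - b m) / (X - a m) + (\<Sum>n\<in>K. (X - b m) / (X - a m) * (?r n / (X - a n)))"
    by (simp add: distrib_left sum_distrib_left)
  also have "(\<Sum>n\<in>K. (X - b m) / (X - a m) * (?r n / (X - a n))) =
     (\<Sum>n\<in>K. (a n - b m) / (a n - a m) * ?r n / (X - a n) + (a m - b m) / (X - a m) * (?r n / (a m - a n)))"
  proof (intro sum.cong refl)
    fix n assume n: "n \<in> K"
    have "(X - b m) / (X - a m) / (X - a n) =
      (a n - b m) / (a n - a m) / (X - a n) + (a m - b m) / (X - a m) / (a m - a n)"
    proof -
      have "a n - a m \<noteq> 0" "a m - a n \<noteq> 0" "X - a m \<noteq> 0" "X - a n \<noteq> 0"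
        using X(1) X(2)[OF n] ne[OF n] ne[OF n, symmetric] by simp_all
      thus ?thesis by (simp add: divide_simps) (simp add: algebra_simps)
    qed
    hence "?r n * ((X - b m) / (X - a m) / (X - a n)) =
      ?r n * ((a n - b m) / (a n - a m) / (X - a n) + (a m - b m) / (X - a m) / (a m - a n))" by simp
    thus "(X - b m) / (X - a m) * (?r n / (X - a n)) =
      (a n - b m) / (a n - a m) * ?r n / (X - a n) + (a m - b m) / (X - a m) * (?r n / (a m - a n))"
      by (simp add: distrib_left mult_ac)
  qed
  also have "\<dots> = (\<Sum>n\<in>K. (a n - b m) / (a n - a m) * ?r n / (X - a n)) +
     (a m - b m) / (X - a m) * (\<Sum>n\<in>K. ?r n / (a m - a n))"
    by (simp add: sum.distrib sum_distrib_left)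
  also have "(X - b m) / (X - a m) = 1 + (a m - b m) / (X - a m)"
    using X by (simp add: field_simps)
  also have "1 + (a m - b m) / (X - a m) + ((\<Sum>n\<in>K. (a n - b m) / (a n - a m) * ?r n / (X - a n)) +
     (a m - b m) / (X - a m) * (\<Sum>n\<in>K. ?r n / (a m - a n))) =
     1 + ((a m - b m) * (\<Prod>k\<in>K. (a m - b k) / (a m - a k)) / (X - a m) +
       (\<Sum>n\<in>K. (a n - b m) / (a n - a m) * ?r n / (X - a n)))"
  proof -
    have "1 + c / d + (S + c / d * T) = 1 + (c * (1 + T) / d + S)" for c d S T :: complex
      by (simp add: distrib_left add_divide_distrib)
    thus ?thesis unfolding am .
  qed
  also have "(\<Sum>n\<in>K. (a n - b m) / (a n - a m) * ?r n / (X - a n)) =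
     (\<Sum>n\<in>K. (a n - b n) * (\<Prod>k\<in>insert m K - {n}. (a n - b k) / (a n - a k)) / (X - a n))"
    by (intro sum.cong refl) (simp add: rn mult_ac)
  finally show ?case using insert rm by simp
qed

section \<open>A bilateral sum of Kronecker\<close>

text \<open>Reindexing about the middle index turns the range 0..2N into -N..N, the shape of a
  truncated bilateral sum.\<close>

lemma sum_centered:
  fixes f :: "nat \<Rightarrow> complex"
  shows "sum f {..2 * N} = (\<Sum>m\<le>N. f (N - m)) + (\<Sum>m<N. f (N + Suc m))"
proof -
  have "{..2 * N} = {..N} \<union> {N<..2 * N}" by auto
  moreover have "sum f ({..N} \<union> {N<..2 * N}) = sum f {..N} + sum f {N<..2 * N}"
    by (rule sum.union_disjoint) auto
  ultimately have "sum f {..2 * N} = sum f {..N} + sum f {N<..2 * N}" by (rule ssubst)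
  also have "sum f {..N} = (\<Sum>m\<le>N. f (N - m))"
    by (rule sum.reindex_bij_witness[of _ "\<lambda>m. N - m" "\<lambda>m. N - m"]) auto
  also have "sum f {N<..2 * N} = (\<Sum>m<N. f (N + Suc m))"
    by (rule sum.reindex_bij_witness[of _ "\<lambda>m. N + Suc m" "\<lambda>m. m - Suc N"]) auto
  finally show ?thesis .
qed

lemma prod_centered:
  fixes f :: "nat \<Rightarrow> complex"
  shows "prod f {..2 * N} = (\<Prod>m\<le>N. f (N - m)) * (\<Prod>m<N. f (N + Suc m))"
proof -
  have "{..2 * N} = {..N} \<union> {N<..2 * N}" by auto
  moreover have "prod f ({..N} \<union> {N<..2 * N}) = prod f {..N} * prod f {N<..2 * N}"
    by (rule prod.union_disjoint) auto
  ultimately have "prod f {..2 * N} = prod f {..N} * prod f {N<..2 * N}" by (rule ssubst)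
  also have "prod f {..N} = (\<Prod>m\<le>N. f (N - m))"
    by (rule prod.reindex_bij_witness[of _ "\<lambda>m. N - m" "\<lambda>m. N - m"]) auto
  also have "prod f {N<..2 * N} = (\<Prod>m<N. f (N + Suc m))"
    by (rule prod.reindex_bij_witness[of _ "\<lambda>m. N + Suc m" "\<lambda>m. m - Suc N"]) auto
  finally show ?thesis .
qed

lemma prod_punctured:
  fixes f :: "nat \<Rightarrow> complex"
  assumes "n \<le> L"
  shows "prod f ({..L} - {n}) = (\<Prod>j<n. f (n - Suc j)) * (\<Prod>j<L - n. f (n + Suc j))"
proof -
  have "{..L} - {n} = {..<n} \<union> {n<..L}" using assms by auto
  moreover have "prod f ({..<n} \<union> {n<..L}) = prod f {..<n} * prod f {n<..L}"
    by (rule prod.union_disjoint) auto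
  ultimately have "prod f ({..L} - {n}) = prod f {..<n} * prod f {n<..L}" by (rule ssubst)
  also have "prod f {..<n} = (\<Prod>j<n. f (n - Suc j))"
    by (rule prod.nat_diff_reindex[symmetric])
  also have "prod f {n<..L} = (\<Prod>j<L - n. f (n + Suc j))"
    by (rule prod.reindex_bij_witness[of _ "\<lambda>m. n + Suc m" "\<lambda>m. m - Suc n"]) auto
  finally show ?thesis .
qed

lemma power_neq_one:
  fixes q :: complex
  assumes "norm q < 1" shows "q ^ Suc n \<noteq> 1"
proof
  assume "q ^ Suc n = 1"
  hence "norm q ^ Suc n = 1" by (metis norm_one norm_power)
  thus False using assms power_less_one_iff[of "norm q" "Suc n"] by simp
qed

text \<open>Partial fractions for the quotient with poles q^k and zeros q^k / y, where k <= 2N.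
  Taking X = x * q^N puts the middle pole at x = 1, so that the expansion is symmetric about it. In
  the residue at the pole of index n, \<open>p\<close> collects the factors from smaller indices and
  \<open>s\<close> those from larger ones. The factor y^(N+1) clears the 1/y that each of the N + 1
  lower zeros contributes.\<close>

lemma finite_kronecker:
  fixes q x y :: complex
  assumes q: "q \<noteq> 0" "norm q < 1" and y: "y \<noteq> 0" and x: "\<And>n. x * q ^ n \<noteq> 1" "\<And>n. x \<noteq> q ^ n"
  defines "p \<equiv> \<lambda>n. \<Prod>j<n. (1 - y * q ^ Suc j) / (1 - q ^ Suc j)"
    and "s \<equiv> \<lambda>n. \<Prod>j<n. (1 - q ^ Suc j / y) / (1 - q ^ Suc j)"
  shows "(\<Prod>j\<le>N. (1 - x * y * q ^ j) / (1 - x * q ^ j)) * (\<Prod>j<N. (x - q ^ Suc j / y) / (x - q ^ Suc j)) =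
    y ^ Suc N + (1 - y) * ((\<Sum>m\<le>N. y ^ m * p (N - m) * s (N + m) / (1 - x * q ^ m)) +
      (\<Sum>m<N. (q / y) ^ Suc m * p (N + Suc m) * s (N - Suc m) / (q ^ Suc m - x)))"
proof -
  define a where "a k = q ^ k" for k
  define b where "b k = q ^ k / y" for k
  define X where "X = x * q ^ N"
  have inj: "inj_on a {..2 * N}"
  proof (rule inj_onI)
    have *: "a k \<noteq> a l" if kl: "k < l" for k l
    proof
      assume "a k = a l"
      moreover have "q ^ l = q ^ k * q ^ (l - k)" using kl by (simp flip: power_add)
      ultimately have "q ^ k * 1 = q ^ k * q ^ (l - k)" by (simp add: a_def)
      hence "q ^ (l - k) = 1" using q by simp
      moreover obtain d where "l - k = Suc d" using kl by (cases "l - k") auto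
      ultimately show False using power_neq_one[OF q(2), of d] by simp
    qed
    fix k l assume "a k = a l" thus "k = l" using *[of k l] *[of l k] by (cases k l rule: linorder_cases) auto
  qed
  have X: "X \<noteq> a k" for k
  proof (cases "k \<le> N")
    case True
    hence "X - a k = q ^ k * (x * q ^ (N - k) - 1)" by (simp add: X_def a_def algebra_simps flip: power_add)
    thus ?thesis using x(1)[of "N - k"] q by auto
  next
    case False
    hence "X - a k = q ^ N * (x - q ^ (k - N))" by (simp add: X_def a_def algebra_simps flip: power_add)
    thus ?thesis using x(2)[of "k - N"] q by auto
  qed
  have x0: "1 - x * q ^ j \<noteq> 0" "x - q ^ j \<noteq> 0" "q ^ j - x \<noteq> 0" for j using x[of j] by auto
  have pf: "(\<Prod>k\<in>{..2 * N}. (X - b k) / (X - a k)) =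
    1 + (\<Sum>n\<in>{..2 * N}. (a n - b n) * (\<Prod>k\<in>{..2 * N} - {n}. (a n - b k) / (a n - a k)) / (X - a n))"
    by (rule partial_fractions) (use inj X in auto)
  have lhs: "(\<Prod>k\<in>{..2 * N}. (X - b k) / (X - a k)) =
     (\<Prod>j\<le>N. (1 - x * y * q ^ j) / (1 - x * q ^ j) / y) * (\<Prod>j<N. (x - q ^ Suc j / y) / (x - q ^ Suc j))"
    unfolding prod_centered
  proof (intro arg_cong2[where f = "(*)"] prod.cong refl)
    fix j assume "j \<in> {..N}"
    hence "q ^ N = q ^ (N - j) * q ^ j" by (simp flip: power_add)
    hence "X - b (N - j) = - (q ^ (N - j) / y) * (1 - x * y * q ^ j)" "X - a (N - j) = - (q ^ (N - j)) * (1 - x * q ^ j)"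
      using y by (simp_all add: X_def b_def a_def field_simps)
    thus "(X - b (N - j)) / (X - a (N - j)) = (1 - x * y * q ^ j) / (1 - x * q ^ j) / y"
      using q x0(1)[of j] y by simp
  next
    fix j
    have "X - b (N + Suc j) = q ^ N * (x - q ^ Suc j / y)" "X - a (N + Suc j) = q ^ N * (x - q ^ Suc j)"
      by (simp_all add: X_def a_def b_def power_add algebra_simps)
    thus "(X - b (N + Suc j)) / (X - a (N + Suc j)) = (x - q ^ Suc j / y) / (x - q ^ Suc j)"
      using q by simp
  qed
  have res: "(a n - b n) * (\<Prod>k\<in>{..2 * N} - {n}. (a n - b k) / (a n - a k)) =
    q ^ n * (1 - 1 / y) * (1 / y) ^ n * p n * s (2 * N - n)" if n: "n \<le> 2 * N" for n
  proof -
    have "(\<Prod>j<n. (a n - b (n - Suc j)) / (a n - a (n - Suc j))) = (\<Prod>j<n. 1 / y * ((1 - y * q ^ Suc j) / (1 - q ^ Suc j)))"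
    proof (intro prod.cong refl)
      fix j assume "j \<in> {..<n}"
      hence "q ^ n = q ^ (n - Suc j) * q ^ Suc j" by (simp flip: power_add del: power_Suc)
      hence "a n - b (n - Suc j) = - (q ^ (n - Suc j)) / y * (1 - y * q ^ Suc j)"
        "a n - a (n - Suc j) = - (q ^ (n - Suc j)) * (1 - q ^ Suc j)"
        using y by (simp_all add: a_def b_def field_simps)
      thus "(a n - b (n - Suc j)) / (a n - a (n - Suc j)) = 1 / y * ((1 - y * q ^ Suc j) / (1 - q ^ Suc j))"
        using q by simp
    qed
    moreover have "(\<Prod>j<2 * N - n. (a n - b (n + Suc j)) / (a n - a (n + Suc j))) = s (2 * N - n)"
      unfolding s_def
    proof (intro prod.cong refl)
      fix j
      have "a n - b (n + Suc j) = q ^ n * (1 - q ^ Suc j / y)" "a n - a (n + Suc j) = q ^ n * (1 - q ^ Suc j)"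
        by (simp_all add: a_def b_def power_add algebra_simps)
      thus "(a n - b (n + Suc j)) / (a n - a (n + Suc j)) = (1 - q ^ Suc j / y) / (1 - q ^ Suc j)"
        using q by simp
    qed
    ultimately have "(\<Prod>k\<in>{..2 * N} - {n}. (a n - b k) / (a n - a k)) = (1 / y) ^ n * p n * s (2 * N - n)"
      unfolding prod_punctured[OF n] p_def by (simp only: prod.distrib prod_constant card_lessThan)
    thus ?thesis by (simp add: a_def b_def algebra_simps)
  qed
  have "y ^ Suc N * (\<Prod>k\<in>{..2 * N}. (X - b k) / (X - a k)) =
     y ^ Suc N + y ^ Suc N * (\<Sum>n\<in>{..2 * N}. q ^ n * (1 - 1 / y) * (1 / y) ^ n * p n * s (2 * N - n) / (X - a n))"
    unfolding pf by (simp add: distrib_left res cong: sum.cong_simp)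
  also have "(\<Sum>n\<in>{..2 * N}. q ^ n * (1 - 1 / y) * (1 / y) ^ n * p n * s (2 * N - n) / (X - a n)) =
    (\<Sum>m\<le>N. (1 - y) / y ^ Suc N * (y ^ m * p (N - m) * s (N + m) / (1 - x * q ^ m))) +
      (\<Sum>m<N. (1 - y) / y ^ Suc N * ((q / y) ^ Suc m * p (N + Suc m) * s (N - Suc m) / (q ^ Suc m - x)))"
    unfolding sum_centered
  proof (intro arg_cong2[where f = "(+)"] sum.cong refl)
    fix m assume m: "m \<in> {..N}"
    have N: "2 * N - (N - m) = N + m" using m by auto
    have "q ^ N = q ^ (N - m) * q ^ m" using m by (simp flip: power_add)
    hence 1: "X - a (N - m) = - (q ^ (N - m)) * (1 - x * q ^ m)" by (simp add: X_def a_def algebra_simps)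
    have "y ^ N = y ^ (N - m) * y ^ m" using m by (simp flip: power_add)
    hence 2: "(1 / y) ^ (N - m) = y ^ m / y ^ N" using y by (simp add: field_simps)
    show "q ^ (N - m) * (1 - 1 / y) * (1 / y) ^ (N - m) * p (N - m) * s (2 * N - (N - m)) / (X - a (N - m)) =
       (1 - y) / y ^ Suc N * (y ^ m * p (N - m) * s (N + m) / (1 - x * q ^ m))"
      unfolding 1 2 N using q y x0(1)[of m] by (simp add: divide_simps) (simp add: algebra_simps)
  next
    fix m assume m: "m \<in> {..<N}"
    have N: "2 * N - (N + Suc m) = N - Suc m" using m by auto
    have 1: "X - a (N + Suc m) = - (q ^ N) * (q ^ Suc m - x)" by (simp add: X_def a_def power_add algebra_simps)
    have 2: "(1 / y) ^ (N + Suc m) = 1 / (y ^ N * y ^ Suc m)" "q ^ (N + Suc m) = q ^ N * q ^ Suc m"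
      by (simp_all only: power_add power_one_over) simp_all
    show "q ^ (N + Suc m) * (1 - 1 / y) * (1 / y) ^ (N + Suc m) * p (N + Suc m) * s (2 * N - (N + Suc m)) / (X - a (N + Suc m)) =
       (1 - y) / y ^ Suc N * ((q / y) ^ Suc m * p (N + Suc m) * s (N - Suc m) / (q ^ Suc m - x))"
      unfolding 1 2 N power_divide using q y x0(3)[of "Suc m"] by (simp add: divide_simps del: power_Suc) (simp add: algebra_simps power_add)
  qed
  also have "y ^ Suc N * \<dots> = (1 - y) * ((\<Sum>m\<le>N. y ^ m * p (N - m) * s (N + m) / (1 - x * q ^ m)) +
      (\<Sum>m<N. (q / y) ^ Suc m * p (N + Suc m) * s (N - Suc m) / (q ^ Suc m - x)))"
    using y unfolding sum_distrib_left[symmetric] by (simp del: power_Suc add: distrib_left)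
  also have "y ^ Suc N * (\<Prod>k\<in>{..2 * N}. (X - b k) / (X - a k)) =
    (\<Prod>j\<le>N. (1 - x * y * q ^ j) / (1 - x * q ^ j)) * (\<Prod>j<N. (x - q ^ Suc j / y) / (x - q ^ Suc j))"
  proof -
    have "(\<Prod>j\<le>N. (1 - x * y * q ^ j) / (1 - x * q ^ j) / y) = (\<Prod>j\<le>N. (1 - x * y * q ^ j) / (1 - x * q ^ j)) / y ^ Suc N"
      by (subst prod_dividef) (simp del: power_Suc)
    thus ?thesis unfolding lhs using y by (simp del: power_Suc)
  qed
  finally show ?thesis .
qed

text \<open>Tannery's theorem: each term converges, and the bounded sequences \<open>p\<close> and
  \<open>s\<close> leave the summable c as majorant.\<close>

lemma tendsto_weighted_sum:
  fixes c :: "nat \<Rightarrow> complex" and p s :: "nat \<Rightarrow> complex"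
  assumes c: "summable (\<lambda>n. norm (c n))" and p: "p \<longlonglongrightarrow> P" and s: "s \<longlonglongrightarrow> S"
  shows "(\<lambda>N. \<Sum>m<N. c m * p (N - Suc m) * s (N + Suc m)) \<longlonglongrightarrow> (\<Sum>n. c n) * P * S"
proof -
  obtain B where B: "\<And>n. norm (p n) \<le> B" using convergent_imp_Bseq[of p] p by (auto simp: convergent_def Bseq_def)
  obtain D where D: "\<And>n. norm (s n) \<le> D" using convergent_imp_Bseq[of s] s by (auto simp: convergent_def Bseq_def)
  have BD: "0 \<le> B" "0 \<le> D" using B[of 0] D[of 0] by (meson norm_ge_zero order_trans)+
  let ?a = "\<lambda>m N. if m < N then c m * p (N - Suc m) * s (N + Suc m) else 0"
  have "(\<lambda>N. suminf (\<lambda>m. ?a m N)) \<longlonglongrightarrow> suminf (\<lambda>m. c m * P * S)"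
  proof (rule tannerys_theorem[THEN conjunct2, THEN conjunct2])
    fix m
    have "(\<lambda>N. c m * p N * s (N + (m + m + 2))) \<longlonglongrightarrow> c m * P * S"
      by (intro tendsto_intros p LIMSEQ_ignore_initial_segment[OF s])
    hence "(\<lambda>N. ?a m (N + Suc m)) \<longlonglongrightarrow> c m * P * S" by (simp add: add_ac)
    thus "?a m \<longlonglongrightarrow> c m * P * S" by (rule LIMSEQ_offset)
  next
    show "eventually (\<lambda>(k, n). norm (?a k n) \<le> norm (c k) * B * D) (at_top \<times>\<^sub>F at_top)"
      using BD by (intro always_eventually) (auto simp: norm_mult intro!: mult_mono B D)
    show "summable (\<lambda>k. norm (c k) * B * D)" by (intro summable_mult2 c)
  qed auto
  also have "(\<lambda>N. suminf (\<lambda>m. ?a m N)) = (\<lambda>N. \<Sum>m<N. c m * p (N - Suc m) * s (N + Suc m))"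
  proof
    fix N
    have "suminf (\<lambda>m. ?a m N) = sum (\<lambda>m. ?a m N) {..<N}" by (rule suminf_finite) auto
    thus "suminf (\<lambda>m. ?a m N) = (\<Sum>m<N. c m * p (N - Suc m) * s (N + Suc m))" by simp
  qed
  also have "suminf (\<lambda>m. c m * P * S) = suminf c * P * S"
    unfolding mult.assoc by (rule suminf_mult2[OF summable_norm_cancel[OF c], symmetric])
  finally show ?thesis .
qed

lemma summable_geometric_mult:
  fixes b :: "nat \<Rightarrow> complex"
  assumes "norm z < 1" "b \<longlonglongrightarrow> l"
  shows "summable (\<lambda>n. norm (z ^ n * b n))"
proof -
  obtain B where B: "\<And>n. norm (b n) \<le> B" using convergent_imp_Bseq[of b] assms(2) by (auto simp: convergent_def Bseq_def)
  have "summable (\<lambda>n. norm z ^ n * B)" using assms by (intro summable_mult2 summable_geometric) auto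
  thus ?thesis
    by (rule summable_comparison_test') (auto simp: norm_mult norm_power intro!: mult_left_mono B)
qed

text \<open>The limit of \<open>finite_kronecker\<close>; the stray y^(N+1) dies because |y| < 1.
  The second series consists of the terms of negative index of the sum of y^n / (1 - x q^n) over all
  integers n, with the power of q cleared from the denominator; it converges because |q| <
  |y|.\<close>

theorem kronecker_bilateral:
  fixes q x y :: complex
  assumes q: "q \<noteq> 0" and y: "norm q < norm y" "norm y < 1" and x: "x \<noteq> 0" "\<And>n. x * q ^ n \<noteq> 1" "\<And>n. x \<noteq> q ^ n"
  shows "summable (\<lambda>n. norm (y ^ n / (1 - x * q ^ n)))"
    and "summable (\<lambda>n. norm ((q / y) ^ Suc n / (q ^ Suc n - x)))"
    and "(\<Sum>n. y ^ n / (1 - x * q ^ n)) + (\<Sum>n. (q / y) ^ Suc n / (q ^ Suc n - x)) =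
      euler q ^ 2 * qpoch (x * y) q * qpoch (q / (x * y)) q /
        (qpoch x q * qpoch (q / x) q * qpoch y q * qpoch (q / y) q)"
proof -
  have q1: "norm q < 1" using y by linarith
  have y0: "y \<noteq> 0" using y by auto
  have q0: "(\<lambda>n. q ^ n) \<longlonglongrightarrow> 0" using q1 by (rule LIMSEQ_power_zero)
  have nz: "1 - x * q ^ n \<noteq> 0" "q ^ n - x \<noteq> 0" for n using x(2,3)[of n] by auto
  have "(\<lambda>n. inverse (1 - x * q ^ n)) \<longlonglongrightarrow> inverse (1 - x * 0)"
    by (intro tendsto_intros q0) auto
  from summable_geometric_mult[OF y(2) this]
  show s1: "summable (\<lambda>n. norm (y ^ n / (1 - x * q ^ n)))" by (simp add: field_class.field_divide_inverse)
  have "(\<lambda>n. (q / y) * inverse (q ^ Suc n - x)) \<longlonglongrightarrow> (q / y) * inverse (0 - x)"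
    by (intro tendsto_intros LIMSEQ_Suc[OF q0]) (use x in auto)
  moreover have "norm (q / y) < 1" using y y0 by (simp add: norm_divide)
  ultimately have "summable (\<lambda>n. norm ((q / y) ^ n * ((q / y) * inverse (q ^ Suc n - x))))"
    by (intro summable_geometric_mult)
  thus s2: "summable (\<lambda>n. norm ((q / y) ^ Suc n / (q ^ Suc n - x)))"
    by (simp add: field_class.field_divide_inverse mult_ac)
  define p where "p n = (\<Prod>j<n. (1 - y * q ^ Suc j) / (1 - q ^ Suc j))" for n
  define s where "s n = (\<Prod>j<n. (1 - q ^ Suc j / y) / (1 - q ^ Suc j))" for n
  define c where "c n = y ^ n / (1 - x * q ^ n)" for n
  define d where "d n = (q / y) ^ Suc n / (q ^ Suc n - x)" for n
  let ?L = "\<lambda>N. (\<Prod>j\<le>N. (1 - x * y * q ^ j) / (1 - x * q ^ j)) * (\<Prod>j<N. (x - q ^ Suc j / y) / (x - q ^ Suc j))"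
  have e0: "euler q \<noteq> 0" by (rule euler_nonzero[OF q1])
  have x0: "qpoch x q \<noteq> 0" by (rule qpoch_nonzero[OF q1 x(2)])
  have qx0: "qpoch (q / x) q \<noteq> 0"
  proof (rule qpoch_nonzero[OF q1])
    show "q / x * q ^ n \<noteq> 1" for n using x(3)[of "Suc n"] x(1) by (auto simp: field_simps)
  qed
  have "p = (\<lambda>n. (\<Prod>j<n. 1 - y * q * q ^ j) / (\<Prod>j<n. 1 - q * q ^ j))"
    by (simp add: p_def fun_eq_iff prod_dividef mult.assoc)
  moreover have "\<dots> \<longlonglongrightarrow> qpoch (y * q) q / qpoch q q"
    by (intro tendsto_divide qpoch_LIMSEQ q1) (use e0 in \<open>simp add: euler_def\<close>)
  ultimately have p: "p \<longlonglongrightarrow> qpoch (y * q) q / euler q" by (simp add: euler_def)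
  have "s = (\<lambda>n. (\<Prod>j<n. 1 - (q / y) * q ^ j) / (\<Prod>j<n. 1 - q * q ^ j))"
    by (simp add: s_def fun_eq_iff prod_dividef)
  moreover have "\<dots> \<longlonglongrightarrow> qpoch (q / y) q / qpoch q q"
    by (intro tendsto_divide qpoch_LIMSEQ q1) (use e0 in \<open>simp add: euler_def\<close>)
  ultimately have s: "s \<longlonglongrightarrow> qpoch (q / y) q / euler q" by (simp add: euler_def)
  \<comment> \<open>Written with \<open>Suc N\<close> and a compensating shift by 2 in
    \<open>s\<close>, the sum over m <= N takes the form treated by
    \<open>tendsto_weighted_sum\<close>.\<close>
  have fin: "?L N = y ^ Suc N + (1 - y) * ((\<Sum>m<Suc N. c m * p (Suc N - Suc m) * s (Suc N + Suc m - 2)) +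
      (\<Sum>m<N. d m * s (N - Suc m) * p (N + Suc m)))" for N
    unfolding finite_kronecker[OF q q1 y0 x(2,3)] p_def[symmetric] s_def[symmetric] c_def d_def lessThan_Suc_atMost
    by (simp add: mult_ac)
  have l1: "(\<lambda>N. \<Sum>m<N. d m * s (N - Suc m) * p (N + Suc m)) \<longlonglongrightarrow> (\<Sum>n. d n) * (qpoch (q / y) q / euler q) * (qpoch (y * q) q / euler q)"
    by (rule tendsto_weighted_sum) (use s2 p s in \<open>simp_all add: d_def\<close>)
  have s': "(\<lambda>n. s (n - 2)) \<longlonglongrightarrow> qpoch (q / y) q / euler q"
    by (rule LIMSEQ_offset[of _ 2]) (use s in simp)
  have "(\<lambda>N. \<Sum>m<N. c m * p (N - Suc m) * s (N + Suc m - 2)) \<longlonglongrightarrow> (\<Sum>n. c n) * (qpoch (y * q) q / euler q) * (qpoch (q / y) q / euler q)"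
    by (rule tendsto_weighted_sum) (use s1 p s' in \<open>simp_all add: c_def\<close>)
  hence l2: "(\<lambda>N. \<Sum>m<Suc N. c m * p (Suc N - Suc m) * s (Suc N + Suc m - 2)) \<longlonglongrightarrow> (\<Sum>n. c n) * (qpoch (y * q) q / euler q) * (qpoch (q / y) q / euler q)"
    by (rule LIMSEQ_Suc)
  have "?L \<longlonglongrightarrow> 0 + (1 - y) * ((\<Sum>n. c n) * (qpoch (y * q) q / euler q) * (qpoch (q / y) q / euler q) +
     (\<Sum>n. d n) * (qpoch (q / y) q / euler q) * (qpoch (y * q) q / euler q))"
    unfolding fin by (intro tendsto_intros l1 l2 LIMSEQ_Suc[OF LIMSEQ_power_zero] y)
  moreover have "?L = (\<lambda>N. (\<Prod>j<Suc N. 1 - x * y * q ^ j) / (\<Prod>j<Suc N. 1 - x * q ^ j) *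
      ((\<Prod>j<N. 1 - q / (x * y) * q ^ j) / (\<Prod>j<N. 1 - q / x * q ^ j)))"
  proof
    fix N
    have "(x - q ^ Suc j / y) / (x - q ^ Suc j) = (1 - q / (x * y) * q ^ j) / (1 - q / x * q ^ j)" for j
    proof -
      have "x - q ^ Suc j / y = x * (1 - q / (x * y) * q ^ j)" "x - q ^ Suc j = x * (1 - q / x * q ^ j)"
        using x(1) y0 by (simp_all add: field_simps)
      thus ?thesis using x(1) by simp
    qed
    thus "?L N = (\<Prod>j<Suc N. 1 - x * y * q ^ j) / (\<Prod>j<Suc N. 1 - x * q ^ j) *
      ((\<Prod>j<N. 1 - q / (x * y) * q ^ j) / (\<Prod>j<N. 1 - q / x * q ^ j))"
      unfolding lessThan_Suc_atMost prod_dividef[symmetric] by simp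
  qed
  moreover have "\<dots> \<longlonglongrightarrow> qpoch (x * y) q / qpoch x q * (qpoch (q / (x * y)) q / qpoch (q / x) q)"
    by (intro tendsto_mult tendsto_divide LIMSEQ_Suc[OF qpoch_LIMSEQ] qpoch_LIMSEQ q1 x0 qx0)
  ultimately have "qpoch (x * y) q / qpoch x q * (qpoch (q / (x * y)) q / qpoch (q / x) q) =
    (1 - y) * ((\<Sum>n. c n) * (qpoch (y * q) q / euler q) * (qpoch (q / y) q / euler q) +
     (\<Sum>n. d n) * (qpoch (q / y) q / euler q) * (qpoch (y * q) q / euler q))"
    using LIMSEQ_unique by auto
  also have "\<dots> = ((1 - y) * qpoch (y * q) q) * qpoch (q / y) q / euler q ^ 2 * ((\<Sum>n. c n) + (\<Sum>n. d n))"
  proof -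
    have "t * (S * (P / E) * (Q / E) + D * (Q / E) * (P / E)) = (t * P) * Q / E ^ 2 * (S + D)" for t S P Q E D :: complex
      by (cases "E = 0") (simp_all add: field_simps power2_eq_square)
    thus ?thesis .
  qed
  also have "(1 - y) * qpoch (y * q) q = qpoch y q" by (rule qpoch_Suc[OF q1, symmetric])
  finally have *: "qpoch (x * y) q / qpoch x q * (qpoch (q / (x * y)) q / qpoch (q / x) q) =
    qpoch y q * qpoch (q / y) q / euler q ^ 2 * ((\<Sum>n. c n) + (\<Sum>n. d n))" .
  have yn: "qpoch y q \<noteq> 0"
  proof (rule qpoch_nonzero[OF q1])
    fix n
    have "norm (y * q ^ n) \<le> norm y * 1" unfolding norm_mult norm_power
      by (intro mult_left_mono power_le_one) (use q1 in auto)
    hence "norm (y * q ^ n) < 1" using y(2) by linarith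
    thus "y * q ^ n \<noteq> 1" by auto
  qed
  have yn': "qpoch (q / y) q \<noteq> 0"
  proof (rule qpoch_nonzero[OF q1])
    fix n
    have "norm (q / y) < 1" using y y0 by (simp add: norm_divide)
    moreover have "norm (q / y * q ^ n) \<le> norm (q / y) * 1" unfolding norm_mult[of "q / y"] norm_power
      by (intro mult_left_mono power_le_one) (use q1 in auto)
    ultimately have "norm (q / y * q ^ n) < 1" by linarith
    thus "q / y * q ^ n \<noteq> 1" by auto
  qed
  show "(\<Sum>n. y ^ n / (1 - x * q ^ n)) + (\<Sum>n. (q / y) ^ Suc n / (q ^ Suc n - x)) =
      euler q ^ 2 * qpoch (x * y) q * qpoch (q / (x * y)) q /
        (qpoch x q * qpoch (q / x) q * qpoch y q * qpoch (q / y) q)"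
  proof -
    have "T = E ^ 2 * A * C / (B * D * Y * Z)"
      if "A / B * (C / D) = Y * Z / E ^ 2 * T" "Y \<noteq> 0" "Z \<noteq> 0" "E \<noteq> 0" for A B C D E T Y Z :: complex
      using that by (cases "B = 0 \<or> D = 0") (auto simp: field_simps)
    from this[OF * yn yn' e0] show ?thesis unfolding c_def d_def .
  qed
qed

section \<open>Theta functions of levels 4 and 3\<close>

definition chi3 :: "nat \<Rightarrow> complex"
  where "chi3 n = (if n mod 3 = 1 then 1 else if n mod 3 = 2 then -1 else 0)"

definition chi4 :: "nat \<Rightarrow> complex"
  where "chi4 n = (if n mod 4 = 1 then 1 else if n mod 4 = 3 then -1 else 0)"

lemma norm_chi3: "norm (chi3 n) \<le> 1" and norm_chi4: "norm (chi4 n) \<le> 1"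
  by (auto simp: chi3_def chi4_def)

text \<open>Jacobi's two-squares series. The theta function itself never occurs, only its square in
  this Lambert form.\<close>

definition phi_sq :: "complex \<Rightarrow> complex"
  where "phi_sq q = 1 + 4 * lambert (\<lambda>m n. chi4 m) q"

text \<open>The cubic theta function a(q) of the Borweins, the theta series of the hexagonal
  lattice.\<close>

definition cubic_a :: "complex \<Rightarrow> complex"
  where "cubic_a q = 1 + 6 * lambert (\<lambda>m n. chi3 m) q"

lemma lambert_dilate:
  assumes "k > 0"
  shows "lambert (\<lambda>m n. if k dvd n then f m (n div k) else 0) q = lambert f (q ^ k)"
proof -
  have "lambert (\<lambda>m n. if k dvd n then f m (n div k) else 0) q =
      (\<Sum>\<^sub>\<infinity>(m,n)\<in>{1..}\<times>{n. 1 \<le> n \<and> k dvd n}. f m (n div k) * q ^ (m * n))"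
    unfolding lambert_def by (rule infsum_cong_neutral) (auto split: if_splits)
  also have "\<dots> = lambert f (q ^ k)"
    unfolding lambert_def
  proof (rule infsum_reindex_bij_witness[of _ "\<lambda>(m,n). (m, k * n)" "\<lambda>(m,n). (m, n div k)"], goal_cases)
    case (2 p)
    thus ?case using assms by (auto simp: Suc_le_eq elim!: dvdE)
  next
    case (4 p)
    thus ?case using assms by (auto simp: Suc_le_eq)
  next
    case (5 p)
    thus ?case by (auto simp: power_mult[symmetric] mult_ac elim!: dvdE)
  qed (use assms in auto)
  finally show ?thesis .
qed

lemma lambert_dilate_const:
  assumes "k > 0"
  shows "lambert (\<lambda>m n. if k dvd n then f m else 0) q = lambert (\<lambda>m n. f m) (q ^ k)"
  using lambert_dilate[OF assms, of "\<lambda>m n. f m"] .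

lemma lambert_rows_eq:
  assumes "norm q < 1" "tame f" "\<And>m. m \<ge> 1 \<Longrightarrow> ((\<lambda>n. f m n * (q ^ m) ^ n) has_sum R m) {1..}"
  shows "(R has_sum lambert f q) {1..}"
proof -
  have "(\<Sum>\<^sub>\<infinity>n\<in>{1..}. f m n * q ^ (m * n)) = R m" if "m \<in> {1..}" for m
    using infsumI[OF assms(3)[of m]] that by (simp add: power_mult)
  hence "((\<lambda>m. \<Sum>\<^sub>\<infinity>n\<in>{1..}. f m n * q ^ (m * n)) has_sum lambert f q) {1..} \<longleftrightarrow> (R has_sum lambert f q) {1..}"
    by (rule has_sum_cong)
  thus ?thesis using lambert_rows(1)[OF assms(1,2)] by blast
qed

lemma has_sum_atLeast1_sums:
  fixes f :: "nat \<Rightarrow> complex"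
  assumes "(f has_sum S) {1..}"
  shows "(\<lambda>n. f (Suc n)) sums S"
proof -
  have "((\<lambda>n. f (Suc n)) has_sum S) UNIV \<longleftrightarrow> (f has_sum S) {1..}"
    by (rule has_sum_reindex_bij_witness[of _ "\<lambda>n. n - 1" Suc]) auto
  thus ?thesis using assms has_sum_imp_sums by blast
qed

text \<open>Multiples of an odd character modulo 3 or 4 live on the residues 1 and -1. Written out
  along these two classes they are the two halves of a bilateral sum.\<close>

lemma has_sum_two_classes:
  fixes g a b :: "nat \<Rightarrow> complex"
  assumes k: "k > 2" and s: "summable (\<lambda>n. norm (a n))" "summable (\<lambda>n. norm (b n))"
    and g: "\<And>n. g (k * n + 1) = a n" "\<And>n. g (k * n + (k - 1)) = b n"
    and z: "\<And>m. m mod k \<noteq> 1 \<Longrightarrow> m mod k \<noteq> k - 1 \<Longrightarrow> g m = 0"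
  shows "(g has_sum (suminf a + suminf b)) {1..}"
proof -
  have A: "(a has_sum suminf a) UNIV" and B: "(b has_sum suminf b) UNIV"
    using s by (auto intro: norm_summable_imp_has_sum summable_sums summable_norm_cancel)
  have 1: "k * (m div k) + 1 = m" if "m mod k = 1" for m using mult_div_mod_eq[of k m] that by simp
  have 2: "k * (m div k) + (k - 1) = m" if "m mod k = k - 1" for m using mult_div_mod_eq[of k m] that by simp
  have 3: "(k * n + 1) div k = n" "(k * n + 1) mod k = 1" for n
    using div_mult_self4[of k n 1] mod_mult_self4[of k n 1] k by simp_all
  have 4: "(k * n + (k - 1)) div k = n" "(k * n + (k - 1)) mod k = k - 1" for n
    using div_mult_self4[of k n "k - 1"] mod_mult_self4[of k n "k - 1"] k by simp_all
  have "(a has_sum suminf a) UNIV \<longleftrightarrow> (g has_sum suminf a) {m. m mod k = 1}"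
    by (rule has_sum_reindex_bij_witness[of _ "\<lambda>m. m div k" "\<lambda>n. k * n + 1"])
      (use k g(1) 1 3 in auto)
  moreover have "(b has_sum suminf b) UNIV \<longleftrightarrow> (g has_sum suminf b) {m. m mod k = k - 1}"
    by (rule has_sum_reindex_bij_witness[of _ "\<lambda>m. m div k" "\<lambda>n. k * n + (k - 1)"])
      (use k g(2) 2 4 in auto)
  ultimately have "(g has_sum (suminf a + suminf b)) ({m. m mod k = 1} \<union> {m. m mod k = k - 1})"
    using A B k by (intro has_sum_Un_disjoint) auto
  also have "?this \<longleftrightarrow> ?thesis"
  proof (rule has_sum_cong_neutral)
    have "m \<ge> 1" if "m mod k = 1 \<or> m mod k = k - 1" for m using that k by (cases m) auto
    thus "g m = 0" if "m \<in> {m. m mod k = 1} \<union> {m. m mod k = k - 1} - {1..}" for m using that by auto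
  qed (use z in auto)
  finally show ?thesis .
qed

lemma norm_power_lt: "norm q < 1 \<Longrightarrow> m > 0 \<Longrightarrow> norm (q ^ m :: complex) < 1"
  by (simp add: norm_power power_less_one_iff)

lemma qpoch_power_nonzero:
  assumes "norm z < 1" "j > 0" "k > 0"
  shows "qpoch (z ^ j) (z ^ k) \<noteq> 0"
proof (rule qpoch_nonzero[OF norm_power_lt[OF assms(1,3)]])
  fix n
  have "norm (z ^ (j + k * n)) < 1" using assms by (intro norm_power_lt) auto
  thus "z ^ j * (z ^ k) ^ n \<noteq> 1" by (auto simp: power_add power_mult)
qed

text \<open>The character is (i^n - (-i)^n) / (2i), so the sum is a difference of two geometric
  series.\<close>

lemma has_sum_chi4:
  assumes "norm z < 1"
  shows "((\<lambda>n. chi4 n * z ^ n) has_sum z / (1 + z\<^sup>2)) {1..}"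
proof -
  have *: "chi4 n = (\<i> ^ n - (- \<i>) ^ n) / (2 * \<i>)" for n
  proof -
    define k r where "k = n div 4" and "r = n mod 4"
    have n: "n = 4 * k + r" and r: "r \<in> {0,1,2,3}" by (auto simp: k_def r_def)
    have "\<i> ^ 4 = 1" "(-\<i>) ^ 4 = 1" by (simp_all add: power4_eq_xxxx)
    thus ?thesis using r unfolding n by (auto simp: chi4_def power_add power_mult power2_eq_square power3_eq_cube complex_eq_iff)
  qed
  have n: "norm (\<i> * z) < 1" "norm (- \<i> * z) < 1" using assms by (simp_all add: norm_mult)
  have "((\<lambda>n. 1 / (2 * \<i>) * (\<i> * z) ^ n + - 1 / (2 * \<i>) * (- \<i> * z) ^ n) has_sum
     1 / (2 * \<i>) * (\<i> * z / (1 - \<i> * z)) + - 1 / (2 * \<i>) * (- \<i> * z / (1 - - \<i> * z))) {1..}"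
    by (intro has_sum_cmult_right has_sum_add has_sum_geometric_from_1 n)
  moreover have "1 / (2 * \<i>) * (\<i> * z / (1 - \<i> * z)) + - 1 / (2 * \<i>) * (- \<i> * z / (1 - - \<i> * z)) = z / (1 + z\<^sup>2)"
  proof -
    have "1 - w \<noteq> 0" if "norm w < 1" for w :: complex using that by auto
    note nz = this[OF n(1)] this[OF n(2)]
    have "1 + z\<^sup>2 = (1 - \<i> * z) * (1 - - \<i> * z)" by (simp add: algebra_simps power2_eq_square)
    moreover have "z / 2 / a + z / 2 / b = z / (a * b)" if "a \<noteq> 0" "b \<noteq> 0" "b = 2 - a" for a b :: complex
      using that(1,2) by (simp add: divide_simps) (simp add: that(3) algebra_simps)
    from this[OF nz] have "z / 2 / (1 - \<i> * z) + z / 2 / (1 - - \<i> * z) = z / ((1 - \<i> * z) * (1 - - \<i> * z))" by simp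
    ultimately show ?thesis by simp
  qed
  moreover have "1 / (2 * \<i>) * (\<i> * z) ^ n + - 1 / (2 * \<i>) * (- \<i> * z) ^ n = chi4 n * z ^ n" for n
    unfolding * power_mult_distrib by (simp add: field_simps)
  ultimately show ?thesis by simp
qed

lemma tame_chi: "tame (\<lambda>m n. chi3 m)" "tame (\<lambda>m n. chi3 n)" "tame (\<lambda>m n. chi4 m)" "tame (\<lambda>m n. chi4 n)"
  by (rule tame_bounded[of _ 1]; simp add: norm_chi3 norm_chi4)+

lemma lambert_0: "lambert f 0 = 0"
proof -
  have "lambert f 0 = infsum (\<lambda>_. 0) ({1..}\<times>{1..} :: (nat \<times> nat) set)"
    unfolding lambert_def by (rule infsum_cong) auto
  thus ?thesis by simp
qed

lemma euler_split2:
  assumes "norm q < 1"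
  shows "qpoch q (q\<^sup>2) = euler q / euler (q\<^sup>2)"
proof -
  have "(\<Prod>j<2. qpoch (q * q ^ j) (q ^ 2)) = qpoch q q" by (rule qpoch_split[OF assms]) auto
  hence "qpoch q (q\<^sup>2) * qpoch (q\<^sup>2) (q\<^sup>2) = qpoch q q"
    by (simp add: numeral_2_eq_2 mult.commute)
  thus ?thesis using euler_nonzero[OF norm_power_lt[OF assms, of 2]] by (simp add: euler_def field_simps)
qed

lemma qpoch_neg_nome2:
  assumes "norm q < 1"
  shows "qpoch (- (q\<^sup>2)) (q\<^sup>2) = euler (q ^ 4) / euler (q\<^sup>2)"
    and "qpoch (- q) (q\<^sup>2) = euler (q\<^sup>2) ^ 2 / (euler q * euler (q ^ 4))"
proof -
  note e = euler_nonzero[OF assms] euler_nonzero[OF norm_power_lt[OF assms, of 2]] euler_nonzero[OF norm_power_lt[OF assms, of 4]]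
  have q2: "norm (q\<^sup>2) < 1" using norm_power_lt[OF assms, of 2] by simp
  have q4: "(q\<^sup>2)\<^sup>2 = q ^ 4" by (simp flip: power_mult)
  have "qpoch (q\<^sup>2) (q\<^sup>2) * qpoch (- (q\<^sup>2)) (q\<^sup>2) = qpoch ((q\<^sup>2)\<^sup>2) ((q\<^sup>2)\<^sup>2)" by (rule qpoch_mult_neg[OF q2])
  thus "qpoch (- (q\<^sup>2)) (q\<^sup>2) = euler (q ^ 4) / euler (q\<^sup>2)"
    using e unfolding q4 by (simp add: euler_def field_simps)
  have "qpoch q (q\<^sup>2) * qpoch (- q) (q\<^sup>2) = qpoch (q\<^sup>2) ((q\<^sup>2)\<^sup>2)" by (rule qpoch_mult_neg[OF q2])
  hence "euler q / euler (q\<^sup>2) * qpoch (- q) (q\<^sup>2) = euler (q\<^sup>2) / euler (q ^ 4)"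
    unfolding euler_split2[OF assms] euler_split2[OF q2] unfolding q4 .
  thus "qpoch (- q) (q\<^sup>2) = euler (q\<^sup>2) ^ 2 / (euler q * euler (q ^ 4))"
    using e by (simp add: field_simps power2_eq_square[of "euler (q\<^sup>2)"])
qed

lemma euler_minus:
  assumes "norm q < 1"
  shows "euler (- q) = euler (q\<^sup>2) ^ 3 / (euler q * euler (q ^ 4))"
proof -
  have "euler (- q) = qpoch (- q) (q\<^sup>2) * euler (q\<^sup>2)"
    using euler_split2[of "- q"] euler_nonzero[OF norm_power_lt[OF assms, of 2]] assms by (simp add: field_simps)
  thus ?thesis unfolding qpoch_neg_nome2(2)[OF assms] by (simp add: power2_eq_square[of "euler _"] power3_eq_cube)
qed

text \<open>Kronecker's sum with base q^2 at x = -1, y = q. Both halves are the Lambert series with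
  terms q^m / (1 + q^(2m)); the term of index 0 contributes the extra 1/2, and the total is half of
  \<open>phi_sq q\<close>.\<close>

lemma phi_sq_product:
  assumes "norm q < 1"
  shows "phi_sq q = euler (q\<^sup>2) ^ 10 / (euler q ^ 4 * euler (q ^ 4) ^ 4)"
proof (cases "q = 0")
  case True
  thus ?thesis by (simp add: phi_sq_def lambert_0 euler_0)
next
  case False
  note e = euler_nonzero[OF assms] euler_nonzero[OF norm_power_lt[OF assms, of 2]] euler_nonzero[OF norm_power_lt[OF assms, of 4]]
  have n: "norm ((q\<^sup>2) ^ n) < 1" if "n > 0" for n using norm_power_lt[OF assms, of "2 * n"] that by (simp add: power_mult)
  have qn: "(q\<^sup>2) ^ n \<noteq> -1" for n using n[of n] by (cases "n = 0") auto
  have "((\<lambda>m. q ^ m / (1 + (q ^ m)\<^sup>2)) has_sum lambert (\<lambda>m n. chi4 n) q) {1..}"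
    by (rule lambert_rows_eq[OF assms]) (use has_sum_chi4 norm_power_lt[OF assms] tame_chi in auto)
  hence "((\<lambda>m. q ^ m / (1 + (q\<^sup>2) ^ m)) has_sum lambert (\<lambda>m n. chi4 m) q) {1..}"
    using lambert_swap[of "\<lambda>m n. chi4 m"] by (simp add: power_mult[symmetric] mult.commute)
  hence s: "(\<lambda>n. q ^ Suc n / (1 + (q\<^sup>2) ^ Suc n)) sums lambert (\<lambda>m n. chi4 m) q"
    by (rule has_sum_atLeast1_sums)
  hence s': "(\<lambda>n. q ^ n / (1 + (q\<^sup>2) ^ n)) sums (lambert (\<lambda>m n. chi4 m) q + 1 / 2)"
    using sums_Suc[of "\<lambda>n. q ^ n / (1 + (q\<^sup>2) ^ n)"] by simp
  have K: "(\<Sum>n. q ^ n / (1 - (-1) * (q\<^sup>2) ^ n)) + (\<Sum>n. (q\<^sup>2 / q) ^ Suc n / ((q\<^sup>2) ^ Suc n - (-1))) =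
    euler (q\<^sup>2) ^ 2 * qpoch ((-1) * q) (q\<^sup>2) * qpoch (q\<^sup>2 / ((-1) * q)) (q\<^sup>2) /
        (qpoch (-1) (q\<^sup>2) * qpoch (q\<^sup>2 / (-1)) (q\<^sup>2) * qpoch q (q\<^sup>2) * qpoch (q\<^sup>2 / q) (q\<^sup>2))"
  proof (rule kronecker_bilateral(3))
    show "norm (q\<^sup>2) < norm q" using assms False power_strict_decreasing[of 1 2 "norm q"] by (simp add: norm_power)
    show "- 1 * (q\<^sup>2) ^ n \<noteq> 1" for n using qn[of n] by (metis minus_equation_iff mult_minus1)
    show "- 1 \<noteq> (q\<^sup>2) ^ n" for n using qn[of n] by metis
  qed (use assms False in auto)
  have qq: "q\<^sup>2 / q = q" "q\<^sup>2 / (-1 * q) = - q" "-1 * q = - q" "q\<^sup>2 / -1 = - (q\<^sup>2)" using False by (simp_all add: power2_eq_square)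
  have m1: "qpoch (-1) (q\<^sup>2) = 2 * qpoch (- (q\<^sup>2)) (q\<^sup>2)"
    using qpoch_Suc[of "q\<^sup>2" "-1"] norm_power_lt[OF assms, of 2] by simp
  have s1: "(\<Sum>n. q ^ n / (1 - (-1) * (q\<^sup>2) ^ n)) = lambert (\<lambda>m n. chi4 m) q + 1 / 2"
    using sums_unique[OF s'] by simp
  have s2: "(\<Sum>n. q ^ Suc n / ((q\<^sup>2) ^ Suc n - (-1))) = lambert (\<lambda>m n. chi4 m) q"
    using sums_unique[OF s] by (simp add: add.commute del: power_Suc)
  have "1 / 2 + 2 * lambert (\<lambda>m n. chi4 m) q =
    euler (q\<^sup>2) ^ 2 * qpoch (- q) (q\<^sup>2) ^ 2 / (2 * qpoch (- (q\<^sup>2)) (q\<^sup>2) ^ 2 * qpoch q (q\<^sup>2) ^ 2)"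
    using K unfolding qq s1 s2 m1 by (simp add: power2_eq_square mult_ac add.commute)
  moreover have "phi_sq q = 2 * (1 / 2 + 2 * lambert (\<lambda>m n. chi4 m) q)" by (simp add: phi_sq_def)
  ultimately have "phi_sq q = 2 * (euler (q\<^sup>2) ^ 2 * qpoch (- q) (q\<^sup>2) ^ 2 / (2 * qpoch (- (q\<^sup>2)) (q\<^sup>2) ^ 2 * qpoch q (q\<^sup>2) ^ 2))"
    by (simp only:)
  moreover have "2 * (B ^ 2 * (B ^ 2 / (A * D)) ^ 2 / (2 * (D / B) ^ 2 * (A / B) ^ 2)) = B ^ 10 / (A ^ 4 * D ^ 4)"
    if "A \<noteq> 0" "B \<noteq> 0" "D \<noteq> 0" for A B D :: complex
    using that by (simp add: field_simps eval_nat_numeral)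
  ultimately show ?thesis unfolding qpoch_neg_nome2[OF assms] euler_split2[OF assms] using e by simp
qed

lemma phi_sq_minus_product:
  assumes "norm q < 1"
  shows "phi_sq (- q) = euler q ^ 4 / euler (q\<^sup>2) ^ 2"
proof -
  note e = euler_nonzero[OF assms] euler_nonzero[OF norm_power_lt[OF assms, of 2]] euler_nonzero[OF norm_power_lt[OF assms, of 4]]
  have "phi_sq (- q) = euler (q\<^sup>2) ^ 10 / (euler (- q) ^ 4 * euler (q ^ 4) ^ 4)"
    using phi_sq_product[of "- q"] assms by simp
  moreover have "B ^ 10 / ((B ^ 3 / (A * D)) ^ 4 * D ^ 4) = A ^ 4 / B ^ 2"
    if "A \<noteq> 0" "B \<noteq> 0" "D \<noteq> 0" for A B D :: complex
    using that by (simp add: field_simps eval_nat_numeral)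
  ultimately show ?thesis unfolding euler_minus[OF assms] using e by simp
qed

text \<open>In the Lambert series the even n reproduce the series at z^2. The odd n leave
  \<open>chi4 m\<close> times z^m / (1 - z^(2m)), and over the classes m = 1, 3 modulo 4 this is z
  times Kronecker's sum with base z^8 at x = z^2, y = z^4.\<close>

lemma phi_sq_dissection:
  assumes "norm z < 1"
  shows "phi_sq z - phi_sq (z\<^sup>2) = 4 * z * (euler (z ^ 8) ^ 4 / euler (z ^ 4) ^ 2)"
proof (cases "z = 0")
  case False
  note e = euler_nonzero[OF norm_power_lt[OF assms, of 4]] euler_nonzero[OF norm_power_lt[OF assms, of 8]]
  have zn: "norm (z ^ n) < 1" if "n > 0" for n using norm_power_lt[OF assms that] .
  have zn': "z ^ n \<noteq> 1" if "n > 0" for n using zn[OF that] by auto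
  have zlt: "norm (z ^ m) < norm (z ^ n)" if "n < m" for m n
    using power_strict_decreasing[OF that, of "norm z"] assms False by (simp add: norm_power)
  let ?f = "\<lambda>m n. if odd n then chi4 m else 0"
  let ?R = "\<lambda>m. chi4 m * (z ^ m / (1 - z ^ (2 * m)))"
  have tf: "tame ?f" by (rule tame_bounded[of _ 1]) (auto simp: norm_chi4)
  have te: "tame (\<lambda>m n. if even n then chi4 m else 0)" by (rule tame_bounded[of _ 1]) (auto simp: norm_chi4)
  have "lambert (\<lambda>m n. chi4 m) z = lambert (\<lambda>m n. ?f m n + (if even n then chi4 m else 0)) z"
    by (rule lambert_cong) auto
  also have "\<dots> = lambert ?f z + lambert (\<lambda>m n. chi4 m) (z\<^sup>2)"
    unfolding lambert_add[OF assms tf te] by (simp add: lambert_dilate_const)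
  finally have 1: "phi_sq z - phi_sq (z\<^sup>2) = 4 * lambert ?f z" by (simp add: phi_sq_def)
  have R: "(?R has_sum lambert ?f z) {1..}"
  proof (rule lambert_rows_eq[OF assms tf])
    fix m :: nat assume m: "m \<ge> 1"
    have n: "norm ((z ^ m)\<^sup>2) < 1" using zn[of "m * 2"] m by (simp add: power_mult)
    have "((\<lambda>n. z ^ m * ((z ^ m)\<^sup>2) ^ n) has_sum z ^ m * (1 / (1 - (z ^ m)\<^sup>2))) UNIV"
      using n by (intro has_sum_cmult_right norm_summable_imp_has_sum geometric_sums)
        (simp_all add: norm_power summable_geometric)
    also have "?this \<longleftrightarrow> ((\<lambda>n. (z ^ m) ^ n) has_sum z ^ m * (1 / (1 - (z ^ m)\<^sup>2))) {n. odd n}"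
      by (rule has_sum_reindex_bij_witness[of _ "\<lambda>n. n div 2" "\<lambda>n. 2 * n + 1"])
        (auto simp: power_add power_mult power2_eq_square power_mult_distrib)
    finally have "((\<lambda>n. chi4 m * (z ^ m) ^ n) has_sum chi4 m * (z ^ m * (1 / (1 - (z ^ m)\<^sup>2)))) {n. odd n}"
      by (rule has_sum_cmult_right)
    also have "?this \<longleftrightarrow> ((\<lambda>n. ?f m n * (z ^ m) ^ n) has_sum chi4 m * (z ^ m * (1 / (1 - (z ^ m)\<^sup>2)))) {1..}"
      by (rule has_sum_cong_neutral) (auto elim!: oddE)
    finally show "((\<lambda>n. ?f m n * (z ^ m) ^ n) has_sum ?R m) {1..}"
      by (simp add: power_mult[symmetric] mult.commute)
  qed
  let ?a = "\<lambda>n. (z ^ 4) ^ n / (1 - z\<^sup>2 * (z ^ 8) ^ n)"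
  let ?b = "\<lambda>n. (z ^ 8 / z ^ 4) ^ Suc n / ((z ^ 8) ^ Suc n - z\<^sup>2)"
  have x1: "z\<^sup>2 * (z ^ 8) ^ n \<noteq> 1" for n using zn'[of "2 + 8 * n"] by (simp only: power_add power_mult) simp
  have x2: "z\<^sup>2 \<noteq> (z ^ 8) ^ n" for n
    using zlt[of 2 "8 * n"] zlt[of 0 2] by (cases "n = 0") (auto simp flip: power_mult)
  have K: "summable (\<lambda>n. norm (?a n))" "summable (\<lambda>n. norm (?b n))"
    "suminf ?a + suminf ?b = euler (z ^ 8) ^ 2 * qpoch (z\<^sup>2 * z ^ 4) (z ^ 8) * qpoch (z ^ 8 / (z\<^sup>2 * z ^ 4)) (z ^ 8) /
        (qpoch (z\<^sup>2) (z ^ 8) * qpoch (z ^ 8 / z\<^sup>2) (z ^ 8) * qpoch (z ^ 4) (z ^ 8) * qpoch (z ^ 8 / z ^ 4) (z ^ 8))"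
    by (rule kronecker_bilateral; use False x1 x2 zn[of 4] zlt[of 4 8] in simp)+
  have "(?R has_sum ((\<Sum>n. z * ?a n) + (\<Sum>n. z * ?b n))) {1..}"
  proof (rule has_sum_two_classes[of 4])
    show "?R (4 * n + 1) = z * ?a n" for n
    proof -
      have c: "chi4 (4 * n + 1) = 1" by (simp only: chi4_def mod_mult_self4) simp
      have "z ^ (2 * (4 * n + 1)) = z\<^sup>2 * (z ^ 8) ^ n" "z ^ (4 * n + 1) = z * (z ^ 4) ^ n"
        by (simp_all flip: power_add power_mult power_Suc)
      thus ?thesis unfolding c by simp
    qed
    show "?R (4 * n + (4 - 1)) = z * ?b n" for n
    proof -
      have c: "chi4 (4 * n + 3) = -1" by (simp only: chi4_def mod_mult_self4) simp
      have "z ^ 8 / z ^ 4 = z ^ 4" using False by (simp add: field_simps flip: power_add)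
      moreover have "(z ^ 8) ^ Suc n - z\<^sup>2 = - (z\<^sup>2 * (1 - z ^ (2 * (4 * n + 3))))"
        by (simp add: algebra_simps flip: power_add power_mult)
      moreover have "z * (z ^ 4) ^ Suc n = z\<^sup>2 * z ^ (4 * n + 3)"
        by (simp flip: power_add power_mult power_Suc)
      ultimately show ?thesis using False c by (simp del: power_Suc)
    qed
  next
    fix m :: nat assume "m mod 4 \<noteq> 1" "m mod 4 \<noteq> 4 - 1"
    thus "?R m = 0" by (simp add: chi4_def)
  next
    show "summable (\<lambda>n. norm (z * ?a n))" unfolding norm_mult[of z] by (rule summable_mult[OF K(1)])
    show "summable (\<lambda>n. norm (z * ?b n))" unfolding norm_mult[of z] by (rule summable_mult[OF K(2)])
  qed auto
  hence "lambert ?f z = (\<Sum>n. z * ?a n) + (\<Sum>n. z * ?b n)" by (rule has_sum_unique[OF R])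
  also have "\<dots> = z * (suminf ?a + suminf ?b)"
    by (simp only: suminf_mult[OF summable_norm_cancel[OF K(1)]] suminf_mult[OF summable_norm_cancel[OF K(2)]] distrib_left)
  also have "suminf ?a + suminf ?b = euler (z ^ 8) ^ 2 / qpoch (z ^ 4) (z ^ 8) ^ 2"
  proof -
    have "z ^ 8 / z ^ 4 = z ^ 4" "z ^ 8 / z\<^sup>2 = z ^ 6" "z\<^sup>2 * z ^ 4 = z ^ 6" "z ^ 8 / z ^ 6 = z\<^sup>2"
      using False by (simp_all add: field_simps flip: power_add)
    moreover have "qpoch (z\<^sup>2) (z ^ 8) \<noteq> 0" "qpoch (z ^ 6) (z ^ 8) \<noteq> 0"
      by (intro qpoch_power_nonzero assms; simp)+
    ultimately show ?thesis unfolding K(3) by (simp add: power2_eq_square)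
  qed
  also have "qpoch (z ^ 4) (z ^ 8) = euler (z ^ 4) / euler (z ^ 8)"
    using euler_split2[OF zn[of 4]] by (simp flip: power_mult)
  finally have "lambert ?f z = z * (euler (z ^ 8) ^ 2 / (euler (z ^ 4) / euler (z ^ 8)) ^ 2)" .
  moreover have "4 * (z * (B ^ 2 / (A / B) ^ 2)) = 4 * z * (B ^ 4 / A ^ 2)" if "A \<noteq> 0" "B \<noteq> 0" for A B :: complex
    using that by (simp add: field_simps eval_nat_numeral)
  from this[OF e] have "4 * (z * (euler (z ^ 8) ^ 2 / (euler (z ^ 4) / euler (z ^ 8)) ^ 2)) = 4 * z * (euler (z ^ 8) ^ 4 / euler (z ^ 4) ^ 2)"
    by simp
  ultimately show ?thesis unfolding 1 by (rule ssubst)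
qed simp

section \<open>Cube roots of unity and products for the cubic theta functions\<close>

definition omega :: complex
  where "omega = (- 1 + \<i> * of_real (sqrt 3)) / 2"

lemma omega_sq: "omega\<^sup>2 + omega + 1 = 0"
proof -
  have "(\<i> * of_real (sqrt 3))\<^sup>2 = - 3"
    by (simp add: power_mult_distrib flip: of_real_power)
  thus ?thesis unfolding omega_def by (simp add: power2_eq_square field_simps)
qed

lemma omega_cube: "omega ^ 3 = 1"
  using omega_sq by algebra

lemma norm_omega: "norm omega = 1"
  using omega_cube by (metis norm_power norm_one power_eq_1_iff norm_ge_zero zero_less_numeral zero_neq_numeral)

lemma omega_ne: "omega \<noteq> 1" "omega \<noteq> 0" "omega\<^sup>2 \<noteq> 1" "1 + omega \<noteq> 0"
proof -
  show "omega \<noteq> 1" using omega_sq by auto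
  show "omega \<noteq> 0" using omega_sq by auto
  show "1 + omega \<noteq> 0"
  proof
    assume "1 + omega = 0"
    moreover have "omega\<^sup>2 = - (1 + omega)" using omega_sq by algebra
    ultimately show False using \<open>omega \<noteq> 0\<close> by simp
  qed
  show "omega\<^sup>2 \<noteq> 1"
  proof
    assume "omega\<^sup>2 = 1"
    hence "omega = -2" using omega_sq by (simp add: add_eq_0_iff)
    hence "norm omega = norm (-2 :: complex)" by (rule arg_cong)
    thus False unfolding norm_omega by simp
  qed
qed

lemma omega_pow_chi3: "omega ^ k - (omega\<^sup>2) ^ k = (omega - omega\<^sup>2) * chi3 k"
proof -
  define j r where "j = k div 3" and "r = k mod 3"
  have n: "k = 3 * j + r" and r: "r \<in> {0,1,2}" by (auto simp: j_def r_def)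
  have "(omega\<^sup>2) ^ (3 * j) = (omega ^ 3) ^ (2 * j)" unfolding power_mult[symmetric] by (simp add: mult.left_commute)
  hence c: "omega ^ (3 * j) = 1" "(omega\<^sup>2) ^ (3 * j) = 1" by (simp_all add: power_mult omega_cube)
  have 4: "(omega\<^sup>2)\<^sup>2 = omega" "omega ^ 4 = omega" using omega_cube by algebra+
  show ?thesis using r unfolding n power_add c by (auto simp: chi3_def 4)
qed

lemma euler_split3:
  assumes "norm q < 1"
  shows "qpoch q (q ^ 3) * qpoch (q\<^sup>2) (q ^ 3) = euler q / euler (q ^ 3)"
proof -
  have "(\<Prod>j<3. qpoch (q * q ^ j) (q ^ 3)) = qpoch q q" by (rule qpoch_split[OF assms]) auto
  hence "qpoch q (q ^ 3) * qpoch (q\<^sup>2) (q ^ 3) * qpoch (q ^ 3) (q ^ 3) = qpoch q q"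
    by (simp add: eval_nat_numeral)
  thus ?thesis using euler_nonzero[OF norm_power_lt[OF assms, of 3]] by (simp add: euler_def field_simps)
qed

text \<open>As in the quartic case the multiples of 3 among the n give the series at z^3. The rest
  is a combination of two Kronecker sums with base z^9 and x = z^3, at y = z^3 and y = z^6. The
  second one vanishes: there x * y is the base, and the numerator contains
  \<open>qpoch 1\<close>.\<close>

lemma cubic_a_dissection:
  assumes "norm z < 1"
  shows "cubic_a z - cubic_a (z ^ 3) = 6 * z * (euler (z ^ 9) ^ 3 / euler (z ^ 3))"
proof (cases "z = 0")
  case False
  note e = euler_nonzero[OF norm_power_lt[OF assms, of 3]] euler_nonzero[OF norm_power_lt[OF assms, of 9]]
  have zn: "norm (z ^ n) < 1" if "n > 0" for n using norm_power_lt[OF assms that] .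
  have zn': "z ^ n \<noteq> 1" if "n > 0" for n using zn[OF that] by auto
  have zlt: "norm (z ^ m) < norm (z ^ n)" if "n < m" for m n
    using power_strict_decreasing[OF that, of "norm z"] assms False by (simp add: norm_power)
  let ?f = "\<lambda>m n. if 3 dvd n then 0 else chi3 m"
  let ?R = "\<lambda>m. chi3 m * ((z ^ m + z ^ (2 * m)) / (1 - z ^ (3 * m)))"
  have tf: "tame ?f" by (rule tame_bounded[of _ 1]) (auto simp: norm_chi3)
  have te: "tame (\<lambda>m n. if 3 dvd n then chi3 m else 0)" by (rule tame_bounded[of _ 1]) (auto simp: norm_chi3)
  have "lambert (\<lambda>m n. chi3 m) z = lambert (\<lambda>m n. ?f m n + (if 3 dvd n then chi3 m else 0)) z"
    by (rule lambert_cong) auto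
  also have "\<dots> = lambert ?f z + lambert (\<lambda>m n. chi3 m) (z ^ 3)"
    unfolding lambert_add[OF assms tf te] by (simp add: lambert_dilate_const)
  finally have 1: "cubic_a z - cubic_a (z ^ 3) = 6 * lambert ?f z" by (simp add: cubic_a_def)
  have R: "(?R has_sum lambert ?f z) {1..}"
  proof (rule lambert_rows_eq[OF assms tf])
    fix m :: nat assume m: "m \<ge> 1"
    define w where "w = z ^ m"
    have w: "norm w < 1" using zn m by (simp add: w_def)
    have n: "norm (w ^ 3) < 1" using norm_power_lt[OF w] by simp
    have "summable (\<lambda>n. norm ((w ^ 3) ^ n))" using n by (simp add: norm_power summable_geometric)
    have "((\<lambda>n. if 3 dvd n then 0 else w ^ n) has_sum ((\<Sum>n. w * (w ^ 3) ^ n) + (\<Sum>n. w\<^sup>2 * (w ^ 3) ^ n))) {1..}"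
    proof (rule has_sum_two_classes[of 3])
      show "(if 3 dvd (3 * n + 1) then 0 else w ^ (3 * n + 1)) = w * (w ^ 3) ^ n" for n
        by (simp add: power_mult) presburger
      show "(if 3 dvd (3 * n + (3 - 1)) then 0 else w ^ (3 * n + (3 - 1))) = w\<^sup>2 * (w ^ 3) ^ n" for n
        by (simp add: power_mult power_add power2_eq_square) presburger
      show "(if 3 dvd m then 0 else w ^ m) = 0" if "m mod 3 \<noteq> 1" "m mod 3 \<noteq> 3 - 1" for m
        using that by presburger
    qed (use n in \<open>auto simp: norm_mult norm_power intro!: summable_mult summable_geometric\<close>)
    also have "(\<Sum>n. w * (w ^ 3) ^ n) + (\<Sum>n. w\<^sup>2 * (w ^ 3) ^ n) = (w + w\<^sup>2) / (1 - w ^ 3)"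
      using n by (simp add: suminf_mult suminf_geometric summable_geometric add_divide_distrib)
    finally have "((\<lambda>n. chi3 m * (if 3 dvd n then 0 else w ^ n)) has_sum chi3 m * ((w + w\<^sup>2) / (1 - w ^ 3))) {1..}"
      by (rule has_sum_cmult_right)
    moreover have "chi3 m * (if 3 dvd n then 0 else w ^ n) = ?f m n * (z ^ m) ^ n" for n by (simp add: w_def)
    moreover have "chi3 m * ((w + w\<^sup>2) / (1 - w ^ 3)) = ?R m" by (simp add: w_def power_mult[symmetric] mult.commute)
    ultimately show "((\<lambda>n. ?f m n * (z ^ m) ^ n) has_sum ?R m) {1..}" by simp
  qed
  let ?a = "\<lambda>j n. (z ^ (3 * j)) ^ n / (1 - z ^ 3 * (z ^ 9) ^ n)"
  let ?b = "\<lambda>j n. (z ^ 9 / z ^ (3 * j)) ^ Suc n / ((z ^ 9) ^ Suc n - z ^ 3)"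
  have x1: "z ^ 3 * (z ^ 9) ^ n \<noteq> 1" for n using zn'[of "3 + 9 * n"] by (simp only: power_add power_mult) simp
  have x2: "z ^ 3 \<noteq> (z ^ 9) ^ n" for n
    using zlt[of 3 "9 * n"] zlt[of 0 3] zlt[of "9 * n" 3] by (cases "n = 0") (auto simp flip: power_mult)
  have K: "summable (\<lambda>n. norm (?a j n))" "summable (\<lambda>n. norm (?b j n))"
    "suminf (?a j) + suminf (?b j) = euler (z ^ 9) ^ 2 * qpoch (z ^ 3 * z ^ (3 * j)) (z ^ 9) * qpoch (z ^ 9 / (z ^ 3 * z ^ (3 * j))) (z ^ 9) /
        (qpoch (z ^ 3) (z ^ 9) * qpoch (z ^ 9 / z ^ 3) (z ^ 9) * qpoch (z ^ (3 * j)) (z ^ 9) * qpoch (z ^ 9 / z ^ (3 * j)) (z ^ 9))"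
    if "j \<in> {1,2}" for j
    by (rule kronecker_bilateral; use False x1 x2 zn[of "3 * j"] zlt[of "3 * j" 9] that in auto)+
  have "(?R has_sum ((\<Sum>n. z * ?a 1 n + z\<^sup>2 * ?a 2 n) + (\<Sum>n. z * ?b 1 n + z\<^sup>2 * ?b 2 n))) {1..}"
  proof (rule has_sum_two_classes[of 3])
    show "?R (3 * n + 1) = z * ?a 1 n + z\<^sup>2 * ?a 2 n" for n
    proof -
      have c: "chi3 (3 * n + 1) = 1" by (simp only: chi3_def mod_mult_self4) simp
      have "z ^ (3 * (3 * n + 1)) = z ^ 3 * (z ^ 9) ^ n" "z ^ (3 * n + 1) = z * (z ^ (3 * 1)) ^ n"
        "z ^ (2 * (3 * n + 1)) = z\<^sup>2 * (z ^ (3 * 2)) ^ n"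
        by (simp_all flip: power_add power_mult power_Suc)
      thus ?thesis unfolding c by (simp add: add_divide_distrib)
    qed
    show "?R (3 * n + (3 - 1)) = z * ?b 1 n + z\<^sup>2 * ?b 2 n" for n
    proof -
      have c: "chi3 (3 * n + 2) = -1" by (simp only: chi3_def mod_mult_self4) simp
      have "z ^ 9 / z ^ (3 * 1) = z ^ 6" "z ^ 9 / z ^ (3 * 2) = z ^ 3" using False by (simp_all add: field_simps flip: power_add)
      moreover have "(z ^ 9) ^ Suc n - z ^ 3 = - (z ^ 3 * (1 - z ^ (3 * (3 * n + 2))))"
        by (simp add: algebra_simps flip: power_add power_mult)
      moreover have "z * (z ^ 6) ^ Suc n = z ^ 3 * z ^ (2 * (3 * n + 2))" "z\<^sup>2 * (z ^ 3) ^ Suc n = z ^ 3 * z ^ (3 * n + 2)"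
        by (simp_all flip: power_add power_mult power_Suc)
      ultimately show ?thesis using False c by (simp add: add_divide_distrib add.commute del: power_Suc)
    qed
  next
    fix m :: nat assume "m mod 3 \<noteq> 1" "m mod 3 \<noteq> 3 - 1"
    thus "?R m = 0" by (simp add: chi3_def)
  next
    have "summable (\<lambda>n. norm (z * ?a 1 n) + norm (z\<^sup>2 * ?a 2 n))" unfolding norm_mult[of z] norm_mult[of "z\<^sup>2"]
      by (intro summable_add summable_mult K(1)) auto
    thus "summable (\<lambda>n. norm (z * ?a 1 n + z\<^sup>2 * ?a 2 n))"
      by (rule summable_comparison_test') (simp only: real_norm_def abs_norm_cancel norm_triangle_ineq)
    have "summable (\<lambda>n. norm (z * ?b 1 n) + norm (z\<^sup>2 * ?b 2 n))" unfolding norm_mult[of z] norm_mult[of "z\<^sup>2"]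
      by (intro summable_add summable_mult K(2)) auto
    thus "summable (\<lambda>n. norm (z * ?b 1 n + z\<^sup>2 * ?b 2 n))"
      by (rule summable_comparison_test') (simp only: real_norm_def abs_norm_cancel norm_triangle_ineq)
  qed auto
  hence "lambert ?f z = (\<Sum>n. z * ?a 1 n + z\<^sup>2 * ?a 2 n) + (\<Sum>n. z * ?b 1 n + z\<^sup>2 * ?b 2 n)" by (rule has_sum_unique[OF R])
  also have "(\<Sum>n. z * ?a 1 n + z\<^sup>2 * ?a 2 n) = z * suminf (?a 1) + z\<^sup>2 * suminf (?a 2)"
    using K(1)[of 1, THEN summable_norm_cancel] K(1)[of 2, THEN summable_norm_cancel]
    by (subst suminf_add[symmetric]) (simp_all only: suminf_mult summable_mult insert_iff simp_thms)
  also have "(\<Sum>n. z * ?b 1 n + z\<^sup>2 * ?b 2 n) = z * suminf (?b 1) + z\<^sup>2 * suminf (?b 2)"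
    using K(2)[of 1, THEN summable_norm_cancel] K(2)[of 2, THEN summable_norm_cancel]
    by (subst suminf_add[symmetric]) (simp_all only: suminf_mult summable_mult insert_iff simp_thms)
  also have "z * suminf (?a 1) + z\<^sup>2 * suminf (?a 2) + (z * suminf (?b 1) + z\<^sup>2 * suminf (?b 2)) =
    z * (suminf (?a 1) + suminf (?b 1)) + z\<^sup>2 * (suminf (?a 2) + suminf (?b 2))"
    by (simp only: distrib_left add_ac)
  also have "suminf (?a 2) + suminf (?b 2) = 0"
  proof -
    have "z ^ 9 / (z ^ 3 * z ^ (3 * 2)) = 1" using False by (simp add: field_simps flip: power_add)
    thus ?thesis using K(3)[of 2] qpoch_one[OF zn[of 9]] by simp
  qed
  also have "suminf (?a 1) + suminf (?b 1) = euler (z ^ 9) ^ 3 / euler (z ^ 3)"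
  proof -
    have p: "z ^ 9 / (z ^ 3 * z ^ (3 * 1)) = z ^ 3" "z ^ 3 * z ^ (3 * 1) = z ^ 6" "z ^ 9 / z ^ 3 = z ^ 6" "z ^ 9 / z ^ (3 * 1) = z ^ 6"
      "z ^ (3 * 1) = z ^ 3" "z ^ 9 / z ^ 6 = z ^ 3" "z ^ 3 * z ^ 3 = z ^ 6"
      using False by (simp_all add: field_simps flip: power_add)
    have "qpoch (z ^ 3) (z ^ 9) \<noteq> 0" "qpoch (z ^ 6) (z ^ 9) \<noteq> 0"
      by (intro qpoch_power_nonzero assms; simp)+
    hence "suminf (?a 1) + suminf (?b 1) = euler (z ^ 9) ^ 2 / (qpoch (z ^ 3) (z ^ 9) * qpoch (z ^ 6) (z ^ 9))"
      using K(3)[of 1] unfolding p by (simp add: power2_eq_square)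
    also have "qpoch (z ^ 3) (z ^ 9) * qpoch (z ^ 6) (z ^ 9) = euler (z ^ 3) / euler (z ^ 9)"
      using euler_split3[OF zn[of 3]] by (simp flip: power_mult)
    finally show ?thesis by (simp add: power2_eq_square power3_eq_cube)
  qed
  finally show ?thesis unfolding 1 by simp
qed simp

text \<open>On residues modulo 3 the function \<open>chi3 (m + n)\<close> is the symmetrization of
  3/2 times \<open>chi3 m\<close> on the n divisible by 3, minus half of \<open>chi3 m\<close>;
  exchanging the indices does not change a Lambert series.\<close>

lemma lambert_chi3_sum:
  assumes "norm q < 1"
  shows "lambert (\<lambda>m n. chi3 (m + n)) q = 3 * lambert (\<lambda>m n. chi3 m) (q ^ 3) - lambert (\<lambda>m n. chi3 m) q"
proof -
  let ?A = "\<lambda>m n. if 3 dvd n then chi3 m else 0" and ?B = "\<lambda>m n. chi3 m"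
  let ?h = "\<lambda>m n. 3 / 2 * ?A m n + (- 1 / 2) * ?B m n"
  have t: "tame ?A" "tame ?B" by (rule tame_bounded[of _ 1], auto simp: norm_chi3)+
  have th: "tame ?h" by (intro tame_add tame_cmult t)
  have "lambert (\<lambda>m n. chi3 (m + n)) q = lambert (\<lambda>m n. ?h m n + ?h n m) q"
  proof (rule lambert_cong)
    fix m n :: nat
    have e: "(m + n) mod 3 = (m mod 3 + n mod 3) mod 3" by (rule mod_add_eq[symmetric])
    have "m mod 3 \<in> {0,1,2}" "n mod 3 \<in> {0,1,2}" by auto
    thus "chi3 (m + n) = ?h m n + ?h n m"
      unfolding chi3_def dvd_eq_mod_eq_0 e by (elim insertE emptyE; simp)
  qed
  also have "\<dots> = lambert ?h q + lambert (\<lambda>m n. ?h n m) q"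
    by (rule lambert_add[OF assms th tame_swap[OF th]])
  also have "lambert (\<lambda>m n. ?h n m) q = lambert ?h q" by (rule lambert_swap)
  also have "lambert ?h q = 3 / 2 * lambert ?A q + (- 1 / 2) * lambert ?B q"
    unfolding lambert_add[OF assms tame_cmult[OF t(1)] tame_cmult[OF t(2)]] lambert_cmult ..
  also have "lambert ?A q = lambert ?B (q ^ 3)" by (rule lambert_dilate_const) auto
  finally show ?thesis by simp
qed

text \<open>Kronecker's sum at x = y = omega would give the product at once, but |y| = 1 lies on the
  boundary of its domain and the half with powers of y diverges there. Its divergent part is the
  geometric series 1 / (1 - y). What is left converges beyond the unit circle, so the identity
  extends to omega by a radial limit from inside.\<close>

lemma cubic_b_product:
  assumes "norm q < 1"
  shows "3 * cubic_a (q ^ 3) - cubic_a q = 2 * (euler q ^ 3 / euler (q ^ 3))"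
proof (cases "q = 0")
  case True
  thus ?thesis by (simp add: cubic_a_def lambert_0 euler_0)
next
  case False
  have w: "omega\<^sup>2 * omega = 1" "omega * omega\<^sup>2 = 1" using omega_cube by (simp_all add: power2_eq_square power3_eq_cube mult.assoc)
  have nw: "norm (omega ^ n) = 1" for n by (simp add: norm_power norm_omega)
  have qn: "norm (q ^ Suc n) < 1" for n using norm_power_lt[OF assms, of "Suc n"] by simp
  have ne: "omega ^ k * q ^ n \<noteq> 1" if "n > 0 \<or> omega ^ k \<noteq> 1" for k n
  proof (cases "n = 0")
    case False
    hence "norm (omega ^ k * q ^ n) < 1" using norm_power_lt[OF assms, of n] by (simp add: norm_mult nw)
    thus ?thesis by auto
  qed (use that in auto)
  have x1: "omega * q ^ n \<noteq> 1" for n using ne[of n 1] omega_ne by simp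
  have x2: "omega\<^sup>2 * q ^ n \<noteq> 1" for n using ne[of n 2] omega_ne by simp
  have x3: "omega \<noteq> q ^ n" for n using x2[of n] w by metis
  obtain K where K: "1 < K" "K * norm q < 1"
  proof -
    have "1 < 1 / norm q" using assms False by simp
    then obtain K where "1 < K" "K < 1 / norm q" using dense by blast
    thus ?thesis using False by (intro that[of K]) (simp_all add: field_simps)
  qed
  \<comment> \<open>After removal of the geometric series the coefficients decay like q^n. The
    square of omega in \<open>?b\<close> is its inverse, which appears when q^n - omega is
    normalized to constant term 1; \<open>B\<close> drops the index 0, since the terms of negative
    index start at -1.\<close>
  let ?a = "\<lambda>n. omega * q ^ n / (1 - omega * q ^ n)"
  let ?b = "\<lambda>n. omega\<^sup>2 * q ^ n / (1 - omega\<^sup>2 * q ^ n)"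
  define A where "A y = (\<Sum>n. ?a n * y ^ n)" for y
  define B where "B y = (\<Sum>n. ?b n * y ^ n) - ?b 0" for y
  define R where "R y = euler q ^ 2 * qpoch (omega * y) q * qpoch (q / (omega * y)) q /
        (qpoch omega q * qpoch (q / omega) q * qpoch y q * qpoch (q / y) q)" for y
  have q0: "(\<lambda>n. q ^ n) \<longlonglongrightarrow> 0" using assms by (rule LIMSEQ_power_zero)
  have sum: "summable (\<lambda>n. x * q ^ n / (1 - x * q ^ n) * y ^ n)" if "norm y \<le> K" for x y
  proof -
    have "(\<lambda>n. x * inverse (1 - x * q ^ n)) \<longlonglongrightarrow> x * inverse (1 - x * 0)"
      by (intro tendsto_intros q0) auto
    moreover have "norm (q * y) < 1"
    proof -
      have "norm (q * y) \<le> norm q * K" unfolding norm_mult by (intro mult_left_mono that) auto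
      thus ?thesis using K by (simp add: mult.commute)
    qed
    ultimately have "summable (\<lambda>n. norm ((q * y) ^ n * (x * inverse (1 - x * q ^ n))))"
      by (intro summable_geometric_mult)
    hence "summable (\<lambda>n. (q * y) ^ n * (x * inverse (1 - x * q ^ n)))" by (rule summable_norm_cancel)
    thus ?thesis by (simp add: field_class.field_divide_inverse power_mult_distrib mult_ac)
  qed
  have cont: "isCont (\<lambda>y. \<Sum>n. x * q ^ n / (1 - x * q ^ n) * y ^ n) y0" if "norm y0 = 1" for x y0
    by (rule isCont_powser[of _ "of_real K"]) (use sum[of "of_real K" x] K that in auto)
  have eq: "1 / (1 - y) + A y - B (1 / y) = R y" if y: "1 / K < norm y" "norm y < 1" for y
  proof -
    have y0: "y \<noteq> 0" using y K by auto
    have qy: "norm q < norm y" using y K by (simp add: field_simps) (smt (verit) mult_less_cancel_left_pos mult.commute)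
    have ny: "norm (1 / y) \<le> K" using y y0 K by (simp add: norm_divide field_simps)
    have "(\<Sum>n. y ^ n / (1 - omega * q ^ n)) + (\<Sum>n. (q / y) ^ Suc n / (q ^ Suc n - omega)) = R y"
      unfolding R_def by (rule kronecker_bilateral(3)[OF False qy y(2) omega_ne(2) x1 x3])
    moreover have "(\<Sum>n. y ^ n / (1 - omega * q ^ n)) = 1 / (1 - y) + A y"
    proof -
      have "(\<Sum>n. y ^ n + ?a n * y ^ n) = (\<Sum>n. y ^ n) + A y" unfolding A_def
        by (intro suminf_add[symmetric] summable_geometric sum) (use y K in auto)
      moreover have "y ^ n + ?a n * y ^ n = y ^ n / (1 - omega * q ^ n)" for n
        using x1[of n] by (simp add: field_simps)
      ultimately show ?thesis using y by (simp add: suminf_geometric)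
    qed
    moreover have "(\<Sum>n. (q / y) ^ Suc n / (q ^ Suc n - omega)) = - B (1 / y)"
    proof -
      have s: "summable (\<lambda>n. ?b n * (1 / y) ^ n)" by (rule sum[OF ny])
      have "B (1 / y) = (\<Sum>n. ?b (Suc n) * (1 / y) ^ Suc n)"
        unfolding B_def using suminf_split_head[OF s] by simp
      also have "\<dots> = (\<Sum>n. - ((q / y) ^ Suc n / (q ^ Suc n - omega)))"
      proof (rule suminf_cong)
        fix n
        have d: "1 - omega\<^sup>2 * q ^ Suc n = - (omega\<^sup>2 * (q ^ Suc n - omega))" using w by (simp add: algebra_simps)
        show "?b (Suc n) * (1 / y) ^ Suc n = - ((q / y) ^ Suc n / (q ^ Suc n - omega))"
          unfolding d power_divide power_one using omega_ne(2) by (simp del: power_Suc)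
      qed
      also have "\<dots> = - (\<Sum>n. (q / y) ^ Suc n / (q ^ Suc n - omega))"
        by (rule suminf_minus) (rule summable_norm_cancel[OF kronecker_bilateral(2)[OF False qy y(2) omega_ne(2) x1 x3]])
      finally show ?thesis by simp
    qed
    ultimately show ?thesis by simp
  qed
  have oi: "1 / omega = omega\<^sup>2" "q / omega = omega\<^sup>2 * q" "q / (omega * omega) = omega * q"
    using w omega_ne(2) by (simp_all add: field_simps power2_eq_square)
  have qo: "qpoch omega q \<noteq> 0" by (rule qpoch_nonzero[OF assms x1])
  have qo': "qpoch (omega\<^sup>2 * q) q \<noteq> 0"
    by (rule qpoch_nonzero[OF assms]) (use x2[of "Suc n" for n] in \<open>simp add: mult.assoc\<close>)
  have cq: "isCont (\<lambda>y. qpoch (f y) q) omega" if "isCont f omega" for f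
    by (rule isCont_o2[OF that isCont_qpoch[OF assms]])
  have ci: "isCont (\<lambda>y. c / y) omega" for c using omega_ne(2) by (intro isCont_divide continuous_ident continuous_const)
  have "isCont (\<lambda>y. qpoch (omega * y) q) omega" "isCont (\<lambda>y. qpoch (q / (omega * y)) q) omega"
    "isCont (\<lambda>y. qpoch y q) omega" "isCont (\<lambda>y. qpoch (q / y) q) omega"
    using ci[of "q / omega"] by (auto intro!: cq ci isCont_mult continuous_const continuous_ident)
  hence "isCont R omega"
    unfolding R_def by (intro isCont_divide isCont_mult continuous_const) (use qo qo' oi in auto)
  hence limR: "(R \<longlongrightarrow> R omega) (at omega)" by (simp add: isCont_def)
  have limL: "((\<lambda>y. 1 / (1 - y) + A y - B (1 / y)) \<longlongrightarrow> 1 / (1 - omega) + A omega - B (1 / omega)) (at omega)"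
  proof -
    have "isCont A omega" unfolding A_def by (rule cont) (simp add: norm_omega)
    moreover have "isCont B (1 / omega)" unfolding B_def
      by (intro isCont_diff continuous_const cont) (simp add: norm_divide norm_omega)
    hence "isCont (\<lambda>y. B (1 / y)) omega" by (rule isCont_o2[OF ci])
    ultimately have "isCont (\<lambda>y. 1 / (1 - y) + A y - B (1 / y)) omega"
      using omega_ne(1) by (intro isCont_diff isCont_add isCont_divide continuous_const continuous_ident) auto
    thus ?thesis by (simp add: isCont_def)
  qed
  have filt: "filterlim (\<lambda>t. of_real t * omega) (at omega) (at_left 1)"
  proof (rule filterlim_atI)
    have "((\<lambda>t. of_real t * omega) \<longlongrightarrow> of_real 1 * omega) (at_left 1)" by (intro tendsto_intros)
    thus "((\<lambda>t. of_real t * omega) \<longlongrightarrow> omega) (at_left 1)" by simp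
    have "\<forall>\<^sub>F t in at_left 1. t \<in> {0<..<1::real}" by (rule eventually_at_leftI[of 0]) auto
    thus "\<forall>\<^sub>F t in at_left 1. of_real t * omega \<noteq> omega"
      by eventually_elim (auto simp: omega_ne)
  qed
  have lim1: "1 / (1 - omega) + A omega - B (1 / omega) = R omega"
  proof (rule tendsto_unique)
    show "((\<lambda>t. R (of_real t * omega)) \<longlongrightarrow> R omega) (at_left 1)"
      by (rule filterlim_compose[OF limR filt])
    have "((\<lambda>t. 1 / (1 - of_real t * omega) + A (of_real t * omega) - B (1 / (of_real t * omega))) \<longlongrightarrow>
        1 / (1 - omega) + A omega - B (1 / omega)) (at_left 1)"
      by (rule filterlim_compose[OF limL filt])
    moreover have "\<forall>\<^sub>F t in at_left 1. t \<in> {1 / K<..<1}"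
      using K by (intro eventually_at_leftI[of "1 / K"]) auto
    hence "\<forall>\<^sub>F t in at_left 1. 1 / (1 - of_real t * omega) + A (of_real t * omega) - B (1 / (of_real t * omega)) = R (of_real t * omega)"
    proof eventually_elim
      case (elim t)
      hence "0 < t" using K by (auto intro: less_trans[of 0 "1 / K"])
      thus ?case using elim by (intro eq) (auto simp: norm_mult norm_omega)
    qed
    ultimately show "((\<lambda>t. R (of_real t * omega)) \<longlongrightarrow> 1 / (1 - omega) + A omega - B (1 / omega)) (at_left 1)"
      using tendsto_cong by fast
  qed auto
  have lam: "(\<Sum>n. x * q ^ n / (1 - x * q ^ n) * x ^ n) - x / (1 - x) = lambert (\<lambda>m n. x ^ (m + n)) q"
    if x: "norm x = 1" for x
  proof -
    have t: "tame (\<lambda>m n. x ^ m * x ^ n)" by (rule tame_bounded[of _ 1]) (simp add: norm_mult norm_power x)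
    have "((\<lambda>m. x ^ m * (x * q ^ m / (1 - x * q ^ m))) has_sum lambert (\<lambda>m n. x ^ m * x ^ n) q) {1..}"
      by (rule lambert_geometric[OF assms t]) (simp add: x)
    hence "(\<lambda>n. x ^ Suc n * (x * q ^ Suc n / (1 - x * q ^ Suc n))) sums lambert (\<lambda>m n. x ^ m * x ^ n) q"
      by (rule has_sum_atLeast1_sums)
    hence "(\<lambda>n. x * q ^ Suc n / (1 - x * q ^ Suc n) * x ^ Suc n) sums lambert (\<lambda>m n. x ^ (m + n)) q"
      by (simp only: mult.commute power_add)
    hence "(\<lambda>n. x * q ^ n / (1 - x * q ^ n) * x ^ n) sums (lambert (\<lambda>m n. x ^ (m + n)) q + x * q ^ 0 / (1 - x * q ^ 0) * x ^ 0)"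
      by (rule sums_Suc)
    from sums_unique[OF this, symmetric] show ?thesis by simp
  qed
  have no2: "norm (omega\<^sup>2) = 1" by (simp add: norm_power norm_omega)
  have dl: "lambert (\<lambda>m n. omega ^ (m + n)) q - lambert (\<lambda>m n. (omega\<^sup>2) ^ (m + n)) q =
      (omega - omega\<^sup>2) * lambert (\<lambda>m n. chi3 (m + n)) q"
  proof -
    have t: "tame (\<lambda>m n. omega ^ (m + n))" "tame (\<lambda>m n. (omega\<^sup>2) ^ (m + n))"
      by (rule tame_bounded[of _ 1], simp add: norm_power norm_omega)+
    have "lambert (\<lambda>m n. omega ^ (m + n)) q + (-1) * lambert (\<lambda>m n. (omega\<^sup>2) ^ (m + n)) q =
      lambert (\<lambda>m n. omega ^ (m + n) + (-1) * (omega\<^sup>2) ^ (m + n)) q"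
      by (simp only: lambert_add[OF assms t(1) tame_cmult[OF t(2)]] lambert_cmult)
    also have "\<dots> = lambert (\<lambda>m n. (omega - omega\<^sup>2) * chi3 (m + n)) q"
      by (rule lambert_cong) (simp add: omega_pow_chi3[symmetric])
    finally show ?thesis by (simp add: lambert_cmult)
  qed
  have dA: "A omega = lambert (\<lambda>m n. omega ^ (m + n)) q + omega / (1 - omega)"
    using lam[OF norm_omega] unfolding A_def by (simp add: algebra_simps)
  have dB: "B (1 / omega) = lambert (\<lambda>m n. (omega\<^sup>2) ^ (m + n)) q"
    using lam[OF no2] unfolding B_def oi by simp
  have L: "R omega = 1 / (1 - omega) + omega / (1 - omega) + (omega - omega\<^sup>2) * lambert (\<lambda>m n. chi3 (m + n)) q"
  proof -
    have "R = a + c + D" if "La - Lb = D" "A = La + c" "B = Lb" "a + A - B = R" for R a c D La Lb A B :: complex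
      using that by (auto simp: algebra_simps)
    from this[OF dl dA dB lim1] show ?thesis .
  qed
  define P1 where "P1 = qpoch (omega * q) q"
  define P2 where "P2 = qpoch (omega\<^sup>2 * q) q"
  have q1: "qpoch omega q = (1 - omega) * P1" "qpoch (omega * omega) q = (1 - omega * omega) * P2"
    unfolding P1_def P2_def using qpoch_Suc[OF assms, of omega] qpoch_Suc[OF assms, of "omega * omega"]
    by (simp_all add: power2_eq_square)
  have P0: "P1 \<noteq> 0" "P2 \<noteq> 0" using qo qo' q1 by (auto simp: P2_def)
  have e3: "euler q * P1 * P2 = euler (q ^ 3)"
    unfolding P1_def P2_def euler_def by (rule qpoch_mult_cube_roots[OF assms omega_sq])
  have e0: "euler q \<noteq> 0" by (rule euler_nonzero[OF assms])
  have "R omega = (1 + omega) / (1 - omega) * (euler q ^ 3 / euler (q ^ 3))"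
  proof -
    have "(1 - omega * omega) = (1 + omega) * (1 - omega)" by (simp add: algebra_simps)
    hence "R omega = euler q ^ 2 * ((1 + omega) * (1 - omega) * P2) * P1 / ((1 - omega) * P1 * P2 * ((1 - omega) * P1) * P2)"
      unfolding R_def oi q1 P1_def[symmetric] P2_def[symmetric] by simp
    also have "\<dots> = (1 + omega) / (1 - omega) * (euler q ^ 3 / (euler q * P1 * P2))"
      using P0 e0 omega_ne by (simp add: divide_simps) (simp add: power2_eq_square power3_eq_cube)
    finally show ?thesis unfolding e3 .
  qed
  moreover have "1 / (1 - omega) + omega / (1 - omega) + (omega - omega\<^sup>2) * L = (1 + omega) / (1 - omega) * (1 + 3 * L)" for L
  proof -
    \<comment> \<open>This makes the coefficient of the Lambert series a multiple of the constant
      term, and the common factor can be cancelled.\<close>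
    have "(omega - omega\<^sup>2) * (1 - omega) = 3 * (1 + omega)" using omega_sq by algebra
    moreover have "1 - omega \<noteq> 0" using omega_ne by simp
    ultimately have "omega - omega\<^sup>2 = 3 * (1 + omega) / (1 - omega)" by (metis nonzero_eq_divide_eq)
    thus ?thesis by (simp only: add_divide_distrib[symmetric]) (simp add: distrib_left mult_ac add_divide_distrib)
  qed
  ultimately have "(1 + omega) / (1 - omega) * (1 + 3 * lambert (\<lambda>m n. chi3 (m + n)) q) =
      (1 + omega) / (1 - omega) * (euler q ^ 3 / euler (q ^ 3))"
    using L by (simp only:)
  moreover have "(1 + omega) / (1 - omega) \<noteq> 0" using omega_ne by simp
  ultimately have "1 + 3 * lambert (\<lambda>m n. chi3 (m + n)) q = euler q ^ 3 / euler (q ^ 3)"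
    by (metis mult_left_cancel)
  moreover have "3 * cubic_a (q ^ 3) - cubic_a q = 2 * (1 + 3 * lambert (\<lambda>m n. chi3 (m + n)) q)"
    by (simp add: cubic_a_def lambert_chi3_sum[OF assms] algebra_simps)
  ultimately show ?thesis by (simp only:)
qed

section \<open>Elliptic functions on the punctured disc\<close>

text \<open>With g the divided difference of f at a, one has f' = g + (z - a) g'. Dividing by z - a
  and letting z tend to a gives f''(a) = 2 g'(a), while g / (z - a) is the quotient in
  question.\<close>

lemma tendsto_second_order:
  assumes "f holomorphic_on S" "open S" "a \<in> S" "deriv f a = 0"
  shows "((\<lambda>x. (f x - f a) / (x - a)\<^sup>2) \<longlongrightarrow> deriv (deriv f) a / 2) (at a)"
proof -
  define g where "g z = (if z = a then deriv f a else (f z - f a) / (z - a))" for z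
  have g: "g holomorphic_on S"
    using pole_lemma[OF assms(1), of a] assms(2,3) unfolding g_def by (simp add: interior_open)
  have fg: "f z = f a + (z - a) * g z" for z by (simp add: g_def)
  have gd: "(g has_field_derivative deriv g z) (at z)" if "z \<in> S" for z
    by (rule holomorphic_derivI[OF g assms(2) that])
  have df: "deriv f z = g z + (z - a) * deriv g z" if "z \<in> S" for z
  proof -
    have "((\<lambda>z. f a + (z - a) * g z) has_field_derivative g z + (z - a) * deriv g z) (at z)"
      by (auto intro!: derivative_eq_intros gd[OF that])
    moreover have "(\<lambda>z. f a + (z - a) * g z) = f" by (rule ext) (rule fg[symmetric])
    ultimately have "(f has_field_derivative g z + (z - a) * deriv g z) (at z)" by (simp only:)
    thus ?thesis by (rule DERIV_imp_deriv)
  qed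
  have lim1: "((\<lambda>z. g z / (z - a)) \<longlongrightarrow> deriv g a) (at a)"
    using gd[OF assms(3)] assms(4) by (simp add: has_field_derivative_iff g_def)
  have ddf: "((\<lambda>z. deriv f z / (z - a)) \<longlongrightarrow> deriv (deriv f) a) (at a)"
    using holomorphic_derivI[OF holomorphic_deriv[OF assms(1,2)] assms(2,3)] assms(4)
    by (simp add: has_field_derivative_iff)
  have "isCont (deriv g) a"
    using holomorphic_on_imp_continuous_on[OF holomorphic_deriv[OF g assms(2)]] assms(2,3)
    by (simp add: continuous_on_eq_continuous_at)
  hence "((\<lambda>z. g z / (z - a) + deriv g z) \<longlongrightarrow> deriv g a + deriv g a) (at a)"
    by (intro tendsto_add lim1) (simp add: isCont_def)
  moreover have "\<forall>\<^sub>F z in at a. g z / (z - a) + deriv g z = deriv f z / (z - a)"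
    using eventually_at_in_open[OF assms(2,3)]
    by eventually_elim (auto simp: df field_simps)
  ultimately have "((\<lambda>z. deriv f z / (z - a)) \<longlongrightarrow> deriv g a + deriv g a) (at a)"
    using tendsto_cong by fast
  from tendsto_unique[OF _ this ddf] have "deriv (deriv f) a = 2 * deriv g a" by simp
  moreover have "\<forall>\<^sub>F z in at a. g z / (z - a) = (f z - f a) / (z - a)\<^sup>2"
    by (rule eventually_at_filter[THEN iffD2], rule always_eventually) (auto simp: g_def power2_eq_square)
  from tendsto_cong[OF this] lim1 have "((\<lambda>z. (f z - f a) / (z - a)\<^sup>2) \<longlongrightarrow> deriv g a) (at a)" by (rule iffD1)
  ultimately show ?thesis by simp
qed

text \<open>Wide enough to contain in its interior a closed fundamental ring for multiplication by
  q, and the unit circle with the torsion points that are used.\<close>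

definition annulus :: "complex \<Rightarrow> complex set"
  where "annulus q = {x. norm q < norm x \<and> norm x < 1 / norm q}"

text \<open>Liouville's argument: on the compact ring from sqrt |q| to 1 / sqrt |q| the modulus has
  a maximum, and multiplication by q or 1/q carries every other point of the annulus into this ring.
  The maximum is therefore attained at an interior point, and the maximum modulus principle
  applies.\<close>

lemma elliptic_constant:
  assumes q: "q \<noteq> 0" "norm q < 1" and f: "f holomorphic_on annulus q"
    and per: "\<And>x. 1 < norm x \<Longrightarrow> norm x < 1 / norm q \<Longrightarrow> f (q * x) = f x"
  shows "f constant_on annulus q"
proof -
  define r where "r = sqrt (norm q)"
  have r: "0 < r" "r < 1" "r * r = norm q" using q by (auto simp: r_def)
  have rq: "norm q < r" using r by (metis mult_less_cancel_left_pos mult.right_neutral)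
  have r1: "1 < 1 / r" "1 / r < 1 / norm q" using r rq q by (auto simp: divide_strict_left_mono)
  define K where "K = {x::complex. r \<le> norm x \<and> norm x \<le> 1 / r}"
  have KA: "K \<subseteq> annulus q" using r1 rq by (auto simp: K_def annulus_def)
  have "K = cball 0 (1 / r) - ball 0 r" by (auto simp: K_def)
  hence "compact K" by (simp add: compact_diff)
  moreover have "K \<noteq> {}" using r r1 by (auto simp: K_def intro!: exI[of _ 1])
  moreover have "continuous_on K (\<lambda>x. norm (f x))"
    using holomorphic_on_imp_continuous_on[OF f] KA by (intro continuous_on_norm) (rule continuous_on_subset)
  ultimately obtain \<xi> where xi: "\<xi> \<in> K" "\<And>x. x \<in> K \<Longrightarrow> norm (f x) \<le> norm (f \<xi>)"
    using continuous_attains_sup[of K "\<lambda>x. norm (f x)"] by blast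
  have max: "norm (f x) \<le> norm (f \<xi>)" if x: "x \<in> annulus q" for x
  proof -
    consider "norm x < r" | "x \<in> K" | "1 / r < norm x" unfolding K_def by force
    thus ?thesis
    proof cases
      case 1
      have n: "norm (x / q) = norm x / norm q" by (simp add: norm_divide)
      have "norm x / norm q < r / norm q" using 1 q by (intro divide_strict_right_mono) auto
      also have "r / norm q = 1 / r" using r(1) by (simp flip: r(3))
      finally have le: "norm (x / q) < 1 / r" using n by simp
      moreover have gt: "1 < norm (x / q)" using n x q by (simp add: annulus_def)
      ultimately have "x / q \<in> K" using r by (simp add: K_def)
      moreover have "f (q * (x / q)) = f (x / q)" using le gt r1 by (intro per) auto
      ultimately show ?thesis using xi(2)[of "x / q"] q by simp
    next
      case 3
      have "1 < norm x" using 3 r1 by linarith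
      moreover have "norm x < 1 / norm q" using x by (simp add: annulus_def)
      ultimately have "f (q * x) = f x" by (rule per)
      moreover have "q * x \<in> K"
      proof -
        have "r * r * (1 / r) < r * r * norm x" using 3 r by (intro mult_strict_left_mono) auto
        moreover have "r * r * (1 / r) = r" using r(1) by simp
        ultimately have "r \<le> norm (q * x)" unfolding norm_mult r(3)[symmetric] by linarith
        moreover have "norm q * norm x < 1" using \<open>norm x < 1 / norm q\<close> q by (simp add: field_simps)
        ultimately show ?thesis using r1 by (simp add: K_def norm_mult)
      qed
      ultimately show ?thesis using xi(2)[of "q * x"] by simp
    qed (use xi in auto)
  qed
  have "annulus q = {x. norm q < norm (x - 0) \<and> norm (x - 0) < 1 / norm q}" by (simp add: annulus_def)
  hence "connected (annulus q)" using connected_annulus(1)[of "norm q" "0::complex" "1 / norm q"] by simp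
  moreover have "open (annulus q)"
    unfolding annulus_def by (intro open_Collect_conj open_Collect_less continuous_intros)
  ultimately show ?thesis
    using maximum_modulus_principle[OF f _ _ _ order_refl, of \<xi>] max xi(1) KA by blast
qed

locale punctured_disc =
  fixes q :: complex
  assumes q0: "q \<noteq> 0" and q1: "norm q < 1"
begin

text \<open>The constant term vanishes because \<open>1 / 0 = 0\<close>.\<close>
definition lser :: "nat \<Rightarrow> complex \<Rightarrow> complex"
  where "lser k x = (\<Sum>n. of_nat n ^ k * (q ^ n / (1 - q ^ n)) * x ^ n)"

definition radius :: real
  where "radius = 1 / norm q"

lemma radius: "1 < radius" "norm q * radius = 1"
  using q0 q1 by (simp_all add: radius_def)

lemma lser_summable:
  assumes "norm x < radius"
  shows "summable (\<lambda>n. of_nat n ^ k * (q ^ n / (1 - q ^ n)) * x ^ n)"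
proof -
  have qx: "norm (q * x) < 1" using assms q0 by (simp add: norm_mult radius_def field_simps)
  obtain r where r: "norm (q * x) < r" "r < 1" using qx dense by blast
  have r0: "0 < r" using r norm_ge_zero order_le_less_trans by blast
  have "(\<lambda>n. inverse (1 - q ^ n)) \<longlonglongrightarrow> inverse (1 - 0)"
    by (intro tendsto_intros LIMSEQ_power_zero q1) auto
  then obtain B where B: "\<And>n. norm (inverse (1 - q ^ n)) \<le> B"
    using convergent_imp_Bseq[of "\<lambda>n. inverse (1 - q ^ n)"] by (auto simp: convergent_def Bseq_def)
  have "summable (\<lambda>n. real n ^ k * r ^ n * B)"
    by (intro summable_mult2 summable_power_mult_geometric r r0)
  thus ?thesis
  proof (rule summable_comparison_test')
    fix n :: nat
    have "norm (of_nat n ^ k * (q ^ n / (1 - q ^ n)) * x ^ n) = real n ^ k * norm (q * x) ^ n * norm (inverse (1 - q ^ n))"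
      by (simp add: norm_mult norm_power norm_divide norm_inverse power_mult_distrib field_class.field_divide_inverse mult_ac)
    also have "\<dots> \<le> real n ^ k * r ^ n * B"
      using r r0 B[of n] by (intro mult_mono power_mono) auto
    finally show "norm (of_nat n ^ k * (q ^ n / (1 - q ^ n)) * x ^ n) \<le> real n ^ k * r ^ n * B" .
  qed
qed

lemma lser_deriv:
  assumes "norm x < radius" "x \<noteq> 0"
  shows "(lser k has_field_derivative lser (Suc k) x / x) (at x)"
proof -
  define c where "c n = of_nat n ^ k * (q ^ n / (1 - q ^ n))" for n
  have lc: "lser k = (\<lambda>x. \<Sum>n. c n * x ^ n)" by (simp add: lser_def c_def fun_eq_iff)
  obtain K where K: "norm x < K" "K < radius" using assms dense by blast
  have s: "summable (\<lambda>n. c n * y ^ n)" if "norm y < radius" for y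
    using lser_summable[OF that, of k] by (simp add: c_def)
  have K0: "0 < K" using K norm_ge_zero order_le_less_trans by blast
  have "(lser k has_field_derivative (\<Sum>n. diffs c n * x ^ n)) (at x)"
    unfolding lc by (rule termdiffs_strong[of _ "of_real K"]) (use K K0 s[of "of_real K"] in auto)
  moreover have "(\<Sum>n. diffs c n * x ^ n) = lser (Suc k) x / x"
  proof -
    have "summable (\<lambda>n. diffs c n * x ^ n)" by (rule termdiff_converges[OF assms(1)]) (rule s)
    hence "(\<lambda>n. of_nat n * c n * x ^ (n - Suc 0)) sums (\<Sum>n. diffs c n * x ^ n)" by (rule diffs_equiv)
    hence "(\<lambda>n. x * (of_nat n * c n * x ^ (n - Suc 0))) sums (x * (\<Sum>n. diffs c n * x ^ n))" by (rule sums_mult)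
    also have "(\<lambda>n. x * (of_nat n * c n * x ^ (n - Suc 0))) = (\<lambda>n. of_nat n ^ Suc k * (q ^ n / (1 - q ^ n)) * x ^ n)"
    proof
      fix n show "x * (of_nat n * c n * x ^ (n - Suc 0)) = of_nat n ^ Suc k * (q ^ n / (1 - q ^ n)) * x ^ n"
        by (cases n) (auto simp: c_def mult_ac)
    qed
    finally have "lser (Suc k) x = x * (\<Sum>n. diffs c n * x ^ n)" unfolding lser_def by (rule sums_unique[symmetric])
    thus ?thesis using assms by simp
  qed
  ultimately show ?thesis by simp
qed

lemma lser_inv_deriv:
  assumes "1 / radius < norm x"
  shows "((\<lambda>x. lser k (1 / x)) has_field_derivative - lser (Suc k) (1 / x) / x) (at x)"
proof -
  have r0: "0 < radius" using radius by linarith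
  have x0: "x \<noteq> 0" using assms r0 by auto
  have "norm (1 / x) < radius" using assms x0 r0 by (simp add: norm_divide field_simps)
  hence d1: "(lser k has_field_derivative lser (Suc k) (1 / x) / (1 / x)) (at (1 / x))" using x0 by (intro lser_deriv) auto
  have d2: "((\<lambda>x. 1 / x) has_field_derivative - 1 / x\<^sup>2) (at x)"
    using x0 by (auto intro!: derivative_eq_intros simp: power2_eq_square)
  note DERIV_chain2[where f = "lser k" and g = "\<lambda>x. 1 / x", OF d1 d2]
  thus ?thesis using x0 by (simp add: power2_eq_square)
qed

lemma annulus_iff: "x \<in> annulus q \<longleftrightarrow> norm x < radius \<and> 1 / radius < norm x"
  by (auto simp: annulus_def radius_def)

lemma annulus_nz: "x \<in> annulus q \<Longrightarrow> x \<noteq> 0"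
  using q0 by (auto simp: annulus_def)

lemma open_annulus: "open (annulus q)"
  unfolding annulus_def by (intro open_Collect_conj open_Collect_less continuous_intros)

lemma unit_annulus: "norm x = 1 \<Longrightarrow> x \<in> annulus q"
  using radius by (simp add: annulus_iff)

text \<open>With x = exp u, \<open>wp\<close> is Weierstrass's function of u minus the constant (1 -
  24 * lser 1 1) / 12, and \<open>wp1\<close>, \<open>wp2\<close> are its derivatives in u.
  \<open>zeta\<close> is minus Weierstrass's zeta function up to a linear term in u, which is chosen
  so that it is single-valued in x. \<open>wp_reg\<close> is \<open>wp\<close> without its double
  pole at 1.\<close>

definition zeta :: "complex \<Rightarrow> complex"
  where "zeta x = (1 + x) / (2 * (1 - x)) + lser 0 x - lser 0 (1 / x)"

definition wp_reg :: "complex \<Rightarrow> complex"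
  where "wp_reg x = lser 1 x + lser 1 (1 / x)"

definition wp :: "complex \<Rightarrow> complex"
  where "wp x = x / (1 - x)\<^sup>2 + wp_reg x"

definition wp1 :: "complex \<Rightarrow> complex"
  where "wp1 x = x * (1 + x) / (1 - x) ^ 3 + lser 2 x - lser 2 (1 / x)"

definition wp2 :: "complex \<Rightarrow> complex"
  where "wp2 x = x * (1 + 4 * x + x\<^sup>2) / (1 - x) ^ 4 + lser 3 x + lser 3 (1 / x)"

lemma zeta_deriv:
  assumes "x \<in> annulus q" "x \<noteq> 1"
  shows "(zeta has_field_derivative wp x / x) (at x)"
proof -
  have x: "norm x < radius" "1 / radius < norm x" "x \<noteq> 0" using assms annulus_nz by (auto simp: annulus_iff)
  have "((\<lambda>x. (1 + x) / (2 * (1 - x))) has_field_derivative 1 / (1 - x)\<^sup>2) (at x)"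
    using assms(2) by (auto intro!: derivative_eq_intros) (simp add: divide_simps, simp add: eval_nat_numeral algebra_simps)
  from DERIV_diff[OF DERIV_add[OF this lser_deriv[OF x(1,3), of 0]] lser_inv_deriv[OF x(2), of 0]]
  have "(zeta has_field_derivative 1 / (1 - x)\<^sup>2 + lser 1 x / x - - lser 1 (1 / x) / x) (at x)"
    unfolding zeta_def by simp
  also have "1 / (1 - x)\<^sup>2 + lser 1 x / x - - lser 1 (1 / x) / x = wp x / x"
    using x(3) by (simp add: wp_def wp_reg_def add_divide_distrib)
  finally show ?thesis .
qed

lemma wp_reg_deriv:
  assumes "x \<in> annulus q"
  shows "(wp_reg has_field_derivative (lser 2 x - lser 2 (1 / x)) / x) (at x)"
proof -
  have x: "norm x < radius" "1 / radius < norm x" "x \<noteq> 0" using assms annulus_nz by (auto simp: annulus_iff)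
  from DERIV_add[OF lser_deriv[OF x(1,3), of 1] lser_inv_deriv[OF x(2), of 1]]
  show ?thesis unfolding wp_reg_def by (simp add: numeral_2_eq_2 diff_divide_distrib)
qed

lemma wp_deriv:
  assumes "x \<in> annulus q" "x \<noteq> 1"
  shows "(wp has_field_derivative wp1 x / x) (at x)"
proof -
  have x0: "x \<noteq> 0" using assms annulus_nz by auto
  have "((\<lambda>x. x / (1 - x)\<^sup>2) has_field_derivative (1 + x) / (1 - x) ^ 3) (at x)"
    using assms(2) by (auto intro!: derivative_eq_intros) (simp add: divide_simps, simp add: eval_nat_numeral algebra_simps)
  from DERIV_add[OF this wp_reg_deriv[OF assms(1)]] x0 show ?thesis
    unfolding wp_def by (simp add: wp1_def add_divide_distrib diff_divide_distrib add_diff_eq)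
qed

lemma wp1_deriv:
  assumes "x \<in> annulus q" "x \<noteq> 1"
  shows "(wp1 has_field_derivative wp2 x / x) (at x)"
proof -
  have x: "norm x < radius" "1 / radius < norm x" "x \<noteq> 0" using assms annulus_nz by (auto simp: annulus_iff)
  have "((\<lambda>x. x * (1 + x) / (1 - x) ^ 3) has_field_derivative (1 + 4 * x + x\<^sup>2) / (1 - x) ^ 4) (at x)"
    using assms(2) by (auto intro!: derivative_eq_intros) (simp add: divide_simps, simp add: eval_nat_numeral algebra_simps)
  from DERIV_diff[OF DERIV_add[OF this lser_deriv[OF x(1,3), of 2]] lser_inv_deriv[OF x(2), of 2]] x(3)
  show ?thesis unfolding wp1_def by (simp add: wp2_def add_divide_distrib eval_nat_numeral)
qed

lemma zeta_inverse: "x \<noteq> 0 \<Longrightarrow> x \<noteq> 1 \<Longrightarrow> zeta (1 / x) = - zeta x"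
proof -
  assume x: "x \<noteq> 0" "x \<noteq> 1"
  hence "1 - x \<noteq> 0" "x - 1 \<noteq> 0" by auto
  hence "(1 + 1 / x) / (2 * (1 - 1 / x)) = - ((1 + x) / (2 * (1 - x)))"
    using x by (simp add: divide_simps) (simp add: algebra_simps)
  thus ?thesis by (simp add: zeta_def)
qed

lemma wp_inverse: "x \<noteq> 0 \<Longrightarrow> x \<noteq> 1 \<Longrightarrow> wp (1 / x) = wp x"
  unfolding wp_def wp_reg_def by (simp add: divide_simps) (simp add: power2_eq_square algebra_simps)

text \<open>The difference of the two series cancels the denominators 1 - q^n and leaves the
  geometric series in q * x.\<close>

lemma lser_shift:
  assumes "norm x < radius"
  shows "lser 0 (q * x) = lser 0 x - q * x / (1 - q * x)"
proof -
  have n: "norm (q * x) < 1" using assms q0 by (simp add: norm_mult radius_def field_simps)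
  hence n1: "1 - q * x \<noteq> 0" by auto
  have "(\<lambda>n. (q * x) ^ Suc n) sums ((q * x) * (1 / (1 - q * x)))"
    unfolding power_Suc by (intro sums_mult geometric_sums n)
  moreover have "(\<lambda>n. q ^ Suc n / (1 - q ^ Suc n) * x ^ Suc n) sums lser 0 x"
  proof -
    have "(\<lambda>n. q ^ n / (1 - q ^ n) * x ^ n) sums lser 0 x"
      using summable_sums[OF lser_summable[OF assms, of 0]] by (simp add: lser_def)
    thus ?thesis by (subst sums_Suc_iff) simp
  qed
  ultimately have "(\<lambda>n. q ^ Suc n / (1 - q ^ Suc n) * x ^ Suc n - (q * x) ^ Suc n) sums (lser 0 x - q * x * (1 / (1 - q * x)))"
    by (intro sums_diff)
  also have "(\<lambda>n. q ^ Suc n / (1 - q ^ Suc n) * x ^ Suc n - (q * x) ^ Suc n) = (\<lambda>n. q ^ Suc n / (1 - q ^ Suc n) * (q * x) ^ Suc n)"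
  proof
    fix n
    have "1 - q ^ Suc n \<noteq> 0" using power_neq_one[OF q1, of n] by simp
    thus "q ^ Suc n / (1 - q ^ Suc n) * x ^ Suc n - (q * x) ^ Suc n = q ^ Suc n / (1 - q ^ Suc n) * (q * x) ^ Suc n"
      by (simp add: field_simps power_mult_distrib del: power_Suc)
  qed
  finally have "(\<lambda>n. q ^ n / (1 - q ^ n) * (q * x) ^ n) sums (lser 0 x - q * x * (1 / (1 - q * x)) + 0)"
    by (subst (asm) sums_Suc_iff) simp
  from sums_unique[OF this] show ?thesis by (simp add: lser_def)
qed

lemma zeta_shift:
  assumes "1 < norm x" "norm x < radius"
  shows "zeta (q * x) = zeta x + 1"
proof -
  have x0: "x \<noteq> 0" "x \<noteq> 1" using assms by auto
  have n: "norm (q * x) < 1" using assms q0 by (simp add: norm_mult radius_def field_simps)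
  hence n1: "1 - q * x \<noteq> 0" by auto
  have "norm (1 / (q * x)) < radius" using assms q0 x0 by (simp add: norm_divide norm_mult radius_def field_simps)
  from lser_shift[OF this] have "lser 0 (1 / x) = lser 0 (1 / (q * x)) - (1 / x) / (1 - 1 / x)"
    using q0 by simp
  moreover have "lser 0 (q * x) = lser 0 x - q * x / (1 - q * x)" by (rule lser_shift[OF assms(2)])
  moreover have "(1 / x) / (1 - 1 / x) = 1 / (x - 1)" using x0 by (simp add: divide_simps)
  ultimately have "zeta (q * x) - zeta x - 1 = (1 + q * x) / (2 * (1 - q * x)) - q * x / (1 - q * x) - 1 / (x - 1) - (1 + x) / (2 * (1 - x)) - 1"
    unfolding zeta_def by simp
  also have "\<dots> = 0"
  proof -
    have "1 - x \<noteq> 0" "x - 1 \<noteq> 0" using x0 by auto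
    thus ?thesis using n1 by (simp add: divide_simps) (simp add: algebra_simps)
  qed
  finally show ?thesis by (simp add: diff_eq_eq add.commute)
qed

text \<open>Differentiating the shift law removes the additive constant: the quasi-period of
  \<open>zeta\<close> becomes a true period of \<open>wp\<close>, which is then passed on to
  \<open>wp1\<close> and \<open>wp2\<close>.\<close>

lemma shift_deriv:
  assumes F: "\<And>x. 1 < norm x \<Longrightarrow> norm x < radius \<Longrightarrow> F (q * x) = F x + c"
    and G: "\<And>x. x \<in> annulus q \<Longrightarrow> x \<noteq> 1 \<Longrightarrow> (F has_field_derivative G x / x) (at x)"
    and x: "1 < norm x" "norm x < radius"
  shows "G (q * x) = G x"
proof -
  have x0: "x \<noteq> 0" using x by auto
  have r: "1 / radius = norm q" by (simp add: radius_def)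
  have xa: "x \<in> annulus q" using x q1 by (auto simp: annulus_iff r)
  have n: "norm (q * x) < 1" using x q0 by (simp add: norm_mult radius_def field_simps)
  have qx: "q * x \<in> annulus q" using x radius q0 n by (auto simp: annulus_iff r norm_mult)
  have qx1: "q * x \<noteq> 1" using n by auto
  have "((\<lambda>x. F (q * x)) has_field_derivative G (q * x) / (q * x) * q) (at x)"
  proof (rule DERIV_chain2[where f = F])
    show "(F has_field_derivative G (q * x) / (q * x)) (at (q * x))" by (rule G[OF qx qx1])
    show "((*) q has_field_derivative q) (at x)" by (auto intro!: derivative_eq_intros)
  qed
  moreover have "((\<lambda>x. F x + c) has_field_derivative G x / x + 0) (at x)"
    by (intro DERIV_add DERIV_const G xa) (use x in auto)
  hence "((\<lambda>x. F (q * x)) has_field_derivative G x / x + 0) (at x)"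
  proof (rule has_field_derivative_transform_within_open)
    show "open {x::complex. 1 < norm x \<and> norm x < radius}"
      by (intro open_Collect_conj open_Collect_less continuous_intros)
  qed (use x F in auto)
  ultimately have "G (q * x) / (q * x) * q = G x / x" using DERIV_unique by fastforce
  thus ?thesis using x0 q0 by simp
qed

lemma wp_shift: "1 < norm x \<Longrightarrow> norm x < radius \<Longrightarrow> wp (q * x) = wp x"
  using shift_deriv[OF zeta_shift zeta_deriv] .

lemma wp2_shift: "1 < norm x \<Longrightarrow> norm x < radius \<Longrightarrow> wp2 (q * x) = wp2 x"
proof -
  have 1: "wp1 (q * x) = wp1 x + 0" if "1 < norm x" "norm x < radius" for x
    using shift_deriv[of wp 0 wp1 x] wp_shift wp_deriv that by simp
  show "1 < norm x \<Longrightarrow> norm x < radius \<Longrightarrow> wp2 (q * x) = wp2 x"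
    by (rule shift_deriv[OF 1 wp1_deriv])
qed

end

section \<open>Differential equation and addition formula by comparison of poles\<close>

context punctured_disc
begin

lemma wp_reg_holomorphic: "wp_reg holomorphic_on annulus q"
  unfolding holomorphic_on_def using wp_reg_deriv field_differentiable_def has_field_derivative_at_within by blast

lemma lser_holomorphic: "(\<lambda>x. lser k x) holomorphic_on annulus q" "(\<lambda>x. lser k (1 / x)) holomorphic_on annulus q"
  unfolding holomorphic_on_def field_differentiable_def
  using lser_deriv[of _ k] lser_inv_deriv[of _ k] annulus_nz annulus_iff has_field_derivative_at_within by blast+

lemma deriv2_wp_reg: "deriv wp_reg 1 = 0" "deriv (deriv wp_reg) 1 = 2 * lser 3 1"
proof -
  have 1: "1 \<in> annulus q" by (rule unit_annulus) simp
  have d: "deriv wp_reg x = (lser 2 x - lser 2 (1 / x)) / x" if "x \<in> annulus q" for x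
    using wp_reg_deriv[OF that] by (rule DERIV_imp_deriv)
  from d[OF 1] show "deriv wp_reg 1 = 0" by simp
  have 11: "norm (1::complex) < radius" "1 / radius < norm (1::complex)" using 1 by (simp_all add: annulus_iff)
  have "((\<lambda>x. (lser 2 x - lser 2 (1 / x)) / x) has_field_derivative 2 * lser 3 1) (at 1)"
    using DERIV_divide[OF DERIV_diff[OF lser_deriv[OF 11(1), of 2] lser_inv_deriv[OF 11(2), of 2]] DERIV_ident]
    by (simp add: numeral_3_eq_3)
  hence "(deriv wp_reg has_field_derivative 2 * lser 3 1) (at 1)"
    by (rule has_field_derivative_transform_within_open[OF _ open_annulus 1]) (simp add: d)
  thus "deriv (deriv wp_reg) 1 = 2 * lser 3 1" by (rule DERIV_imp_deriv)
qed

lemma wp_reg_continuous: "x \<in> annulus q \<Longrightarrow> isCont wp_reg x"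
  by (rule DERIV_isCont[OF wp_reg_deriv])

lemma isCont_lser: "x \<in> annulus q \<Longrightarrow> isCont (lser k) x" "x \<in> annulus q \<Longrightarrow> isCont (\<lambda>x. lser k (1 / x)) x"
  using DERIV_isCont[OF lser_deriv] DERIV_isCont[OF lser_inv_deriv] annulus_nz annulus_iff by blast+

text \<open>With p = x / (1 - x)^2 the singular part of \<open>wp2\<close> is 6 p^2 + p, so in
  \<open>Q\<close> the square of p cancels. The remaining terms in p combine to -12 p (wp_reg x -
  wp_reg 1), which has a limit at 1 because \<open>wp_reg\<close> is stationary there. Thus
  \<open>Q\<close> extends to an elliptic function without poles.\<close>

theorem wp_ode:
  assumes "x \<in> annulus q" "x \<noteq> 1"
  shows "wp2 x = 6 * wp x ^ 2 + (1 - 24 * lser 1 1) * wp x - 10 * lser 3 1 + 24 * lser 1 1 ^ 2 - 2 * lser 1 1"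
proof -
  \<comment> \<open>The coefficient of \<open>wp\<close> is forced: 1 - E has to be 12 * wp_reg 1.
    The number \<open>v\<close> is the limit of \<open>Q\<close> at 1.\<close>
  define E where "E = 1 - 24 * lser 1 1"
  define v where "v = - 10 * lser 3 1 + 24 * lser 1 1 ^ 2 - 2 * lser 1 1"
  define Q where "Q x = wp2 x - 6 * wp x ^ 2 - E * wp x" for x
  define f where "f x = (if x = 1 then v else Q x)" for x
  have 1: "1 \<in> annulus q" by (rule unit_annulus) simp
  have R1: "wp_reg 1 = 2 * lser 1 1" by (simp add: wp_reg_def)
  have Q: "Q x = lser 3 x + lser 3 (1 / x) - 6 * wp_reg x ^ 2 - E * wp_reg x -
      12 * x * ((wp_reg x - wp_reg 1) / (x - 1)\<^sup>2)" if "x \<noteq> 1" for x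
  proof -
    define p where "p = x / (1 - x)\<^sup>2"
    have "x * (1 + 4 * x + x\<^sup>2) / (1 - x) ^ 4 = 6 * p ^ 2 + p"
      using that unfolding p_def by (simp add: divide_simps) (simp add: eval_nat_numeral algebra_simps)
    moreover have "12 * x * ((wp_reg x - wp_reg 1) / (x - 1)\<^sup>2) = 12 * p * (wp_reg x - wp_reg 1)"
      unfolding p_def by (simp add: power2_commute)
    ultimately show ?thesis
      unfolding Q_def wp2_def wp_def p_def[symmetric] R1 E_def by (simp add: power2_eq_square algebra_simps)
  qed
  have "((\<lambda>x. lser 3 x + lser 3 (1 / x) - 6 * wp_reg x ^ 2 - E * wp_reg x -
      12 * x * ((wp_reg x - wp_reg 1) / (x - 1)\<^sup>2)) \<longlongrightarrow>
      lser 3 1 + lser 3 (1 / 1) - 6 * wp_reg 1 ^ 2 - E * wp_reg 1 - 12 * 1 * (deriv (deriv wp_reg) 1 / 2)) (at 1)"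
    by (intro tendsto_diff tendsto_add tendsto_mult tendsto_power tendsto_const tendsto_ident_at
      tendsto_second_order[OF wp_reg_holomorphic open_annulus 1] deriv2_wp_reg
      wp_reg_continuous[OF 1, unfolded isCont_def] isCont_lser[OF 1, unfolded isCont_def])
  also have "lser 3 1 + lser 3 (1 / 1) - 6 * wp_reg 1 ^ 2 - E * wp_reg 1 - 12 * 1 * (deriv (deriv wp_reg) 1 / 2) = v"
    unfolding deriv2_wp_reg R1 E_def v_def by (simp add: power2_eq_square algebra_simps)
  finally have "((\<lambda>x. lser 3 x + lser 3 (1 / x) - 6 * wp_reg x ^ 2 - E * wp_reg x -
      12 * x * ((wp_reg x - wp_reg 1) / (x - 1)\<^sup>2)) \<longlongrightarrow> f 1) (at 1)" by (simp only: f_def if_True refl)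
  hence "(f \<longlongrightarrow> f 1) (at 1)"
  proof (rule Lim_transform_eventually)
    have "\<forall>\<^sub>F x in at 1. x \<noteq> (1::complex)" by (rule eventually_neq_at_within)
    thus "\<forall>\<^sub>F x in at 1. lser 3 x + lser 3 (1 / x) - 6 * wp_reg x ^ 2 - E * wp_reg x -
      12 * x * ((wp_reg x - wp_reg 1) / (x - 1)\<^sup>2) = f x"
    proof eventually_elim
      case (elim x)
      thus ?case unfolding f_def using Q[OF elim] by (simp only: if_False)
    qed
  qed
  hence lim: "(f \<longlongrightarrow> f 1) (at 1 within annulus q)" by (rule Lim_at_imp_Lim_at_within)
  have holQ: "Q holomorphic_on annulus q - {1}"
  proof -
    have "wp2 holomorphic_on annulus q - {1}" unfolding wp2_def
      by (intro holomorphic_intros holomorphic_on_subset[OF lser_holomorphic(1)] holomorphic_on_subset[OF lser_holomorphic(2)]) auto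
    moreover have "wp holomorphic_on annulus q - {1}" unfolding wp_def
      by (intro holomorphic_intros holomorphic_on_subset[OF wp_reg_holomorphic]) auto
    ultimately show ?thesis unfolding Q_def by (intro holomorphic_intros)
  qed
  have "f holomorphic_on annulus q"
  proof (rule no_isolated_singularity'[of "{1}"])
    show "f holomorphic_on annulus q - {1}"
      by (rule holomorphic_transform[OF holQ]) (auto simp: f_def)
  qed (use lim open_annulus in auto)
  moreover have "f (q * x) = f x" if "1 < norm x" "norm x < 1 / norm q" for x
  proof -
    have "norm (q * x) < 1" using that q0 by (simp add: norm_mult field_simps)
    hence "q * x \<noteq> 1" "x \<noteq> 1" using that by auto
    thus ?thesis using wp_shift[of x] wp2_shift[of x] that by (simp add: f_def Q_def radius_def)
  qed
  ultimately have "f constant_on annulus q" by (rule elliptic_constant[OF q0 q1])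
  hence "f x = f 1" using assms(1) 1 unfolding constant_on_def by metis
  thus ?thesis using assms(2) by (simp add: f_def Q_def v_def E_def algebra_simps)
qed

text \<open>For fixed y the difference of the two sides is elliptic in x, since the quasi-periods of
  \<open>zeta x\<close> and \<open>zeta (x * y)\<close> cancel. Its only possible poles are x = 1
  and x = 1 / y. The substitution of 1 / (x * y) for x exchanges them, so that only x = 1 has to be
  examined.\<close>

theorem frobenius_stickelberger:
  assumes x: "x \<in> annulus q" "x \<noteq> 1" "x * y \<noteq> 1" and y: "norm y = 1" "y \<noteq> 1"
  shows "(zeta x + zeta y - zeta (x * y)) ^ 2 = wp x + wp y + wp (x * y) + (1 - 24 * lser 1 1) / 4"
proof -
  have y0: "y \<noteq> 0" using y by auto
  define S where "S x = zeta x + zeta y - zeta (x * y)" for x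
  define H where "H x = S x ^ 2 - wp x - wp (x * y)" for x
  define v where "v = wp y + (1 - 24 * lser 1 1) / 4"
  define c where "c = 1 / y"
  define f where "f x = (if x = 1 \<or> x = c then v else H x)" for x
  have cy: "c * y = 1" "c \<noteq> 0" "norm c = 1" "c \<noteq> 1" using y y0 by (auto simp: c_def norm_divide)
  have xc: "x * y = 1 \<longleftrightarrow> x = c" for x using y0 by (auto simp: c_def field_simps)
  have 1: "1 \<in> annulus q" by (rule unit_annulus) simp
  have ya: "x * y \<in> annulus q \<longleftrightarrow> x \<in> annulus q" for x using y by (simp add: annulus_def norm_mult)
  have yan: "y \<in> annulus q" by (rule unit_annulus[OF y(1)])
  \<comment> \<open>The part of \<open>S\<close> that is regular at 1. It vanishes there, so the
    simple pole of the square is removable and contributes the derivative of h.\<close>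
  define h where "h x = lser 0 x - lser 0 (1 / x) + zeta y - zeta (x * y)" for x
  have hd: "(h has_field_derivative 2 * lser 1 1 - wp y) (at 1)"
  proof -
    have 11: "norm (1::complex) < radius" "1 / radius < norm (1::complex)" using 1 by (simp_all add: annulus_iff)
    have z: "((\<lambda>x. zeta (x * y)) has_field_derivative wp y / y * y) (at 1)"
    proof (rule DERIV_chain2[where f = zeta])
      show "(zeta has_field_derivative wp y / y) (at (1 * y))" using zeta_deriv[OF yan y(2)] by simp
      show "((\<lambda>x. x * y) has_field_derivative y) (at 1)" by (auto intro!: derivative_eq_intros)
    qed
    show ?thesis
      using DERIV_diff[OF DERIV_add[OF DERIV_diff[OF lser_deriv[OF 11(1), of 0] lser_inv_deriv[OF 11(2), of 0]] DERIV_const[of "zeta y"]] z] y0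
      unfolding h_def by simp
  qed
  have h1: "h 1 = 0" by (simp add: h_def)
  have Hh: "H x = 1 / 4 - (1 + x) * ((h x - h 1) / (x - 1)) + h x ^ 2 - wp_reg x - wp (x * y)" if "x \<noteq> 1" for x
  proof -
    define j where "j = (1 + x) / (2 * (1 - x))"
    have S: "S x = j + h x" by (simp add: S_def h_def zeta_def[of x] j_def)
    have "j ^ 2 - x / (1 - x)\<^sup>2 = 1 / 4"
      using that unfolding j_def by (simp add: divide_simps) (simp add: power2_eq_square algebra_simps)
    moreover have "2 * j * h x = - ((1 + x) * ((h x - h 1) / (x - 1)))"
      using that unfolding j_def h1 by (simp add: divide_simps) (simp add: algebra_simps)
    moreover have "(j + b) ^ 2 - (p + r) - w = 1 / 4 - d + b ^ 2 - r - w"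
      if "j ^ 2 - p = 1 / 4" "2 * j * b = - d" for j b p r w d :: complex
    proof -
      have "(j + b) ^ 2 - (p + r) - w = (j ^ 2 - p) + 2 * j * b + b ^ 2 - r - w" by (simp add: power2_eq_square algebra_simps)
      thus ?thesis by (simp add: that)
    qed
    ultimately show ?thesis unfolding H_def S wp_def[of x] by blast
  qed
  have lim1: "(H \<longlongrightarrow> v) (at 1)"
  proof -
    have "((\<lambda>x. (h x - h 1) / (x - 1)) \<longlongrightarrow> 2 * lser 1 1 - wp y) (at 1)"
      using hd by (simp add: has_field_derivative_iff)
    moreover have "(h \<longlongrightarrow> h 1) (at 1)" using DERIV_isCont[OF hd] by (simp add: isCont_def)
    moreover have "((\<lambda>x. wp (x * y)) \<longlongrightarrow> wp (1 * y)) (at 1)"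
    proof -
      have "isCont wp (1 * y)" using DERIV_isCont[OF wp_deriv[OF yan y(2)]] by simp
      moreover have "isCont (\<lambda>x. x * y) 1" by (intro continuous_intros)
      ultimately have "isCont (\<lambda>x. wp (x * y)) 1" by (rule isCont_o2[rotated])
      thus ?thesis by (simp add: isCont_def)
    qed
    ultimately have "((\<lambda>x. 1 / 4 - (1 + x) * ((h x - h 1) / (x - 1)) + h x ^ 2 - wp_reg x - wp (x * y)) \<longlongrightarrow>
      1 / 4 - (1 + 1) * (2 * lser 1 1 - wp y) + h 1 ^ 2 - wp_reg 1 - wp (1 * y)) (at 1)"
      by (intro tendsto_diff tendsto_add tendsto_mult tendsto_power tendsto_const tendsto_ident_at
        wp_reg_continuous[OF 1, unfolded isCont_def])
    also have "1 / 4 - (1 + 1) * (2 * lser 1 1 - wp y) + h 1 ^ 2 - wp_reg 1 - wp (1 * y) = v"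
      by (simp add: h1 v_def wp_reg_def)
    finally show ?thesis
    proof (rule Lim_transform_eventually)
      have "\<forall>\<^sub>F x in at 1. x \<noteq> (1::complex)" by (rule eventually_neq_at_within)
      thus "\<forall>\<^sub>F x in at 1. 1 / 4 - (1 + x) * ((h x - h 1) / (x - 1)) + h x ^ 2 - wp_reg x - wp (x * y) = H x"
        by eventually_elim (rule Hh[symmetric])
    qed
  qed
  \<comment> \<open>\<open>zeta\<close> is odd and \<open>wp\<close> is even under inversion, so
    \<open>S\<close> is invariant under this substitution and the two \<open>wp\<close> terms change
    places.\<close>
  have sym: "H (1 / (x * y)) = H x" if "x \<noteq> 0" "x \<noteq> 1" "x \<noteq> c" for x
  proof -
    have a: "1 / (x * y) * y = 1 / x" using y0 by simp
    have n: "x * y \<noteq> 0" "x * y \<noteq> 1" using that y0 xc[of x] by auto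
    note zeta_inverse[OF n] wp_inverse[OF n] zeta_inverse[OF that(1,2)] wp_inverse[OF that(1,2)]
    thus ?thesis unfolding H_def S_def a by (simp add: power2_eq_square algebra_simps)
  qed
  have limc: "(H \<longlongrightarrow> v) (at c)"
  proof -
    have "filterlim (\<lambda>x. 1 / (x * y)) (at 1) (at c)"
    proof (rule filterlim_atI)
      have "((\<lambda>x. 1 / (x * y)) \<longlongrightarrow> 1 / (c * y)) (at c)" using cy by (intro tendsto_intros) auto
      thus "((\<lambda>x. 1 / (x * y)) \<longlongrightarrow> 1) (at c)" by (simp add: cy)
      show "\<forall>\<^sub>F x in at c. 1 / (x * y) \<noteq> 1" using xc y0 by (auto simp: eventually_at_filter)
    qed
    hence "((\<lambda>x. H (1 / (x * y))) \<longlongrightarrow> v) (at c)" by (rule filterlim_compose[OF lim1])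
    thus ?thesis
    proof (rule Lim_transform_eventually)
      have "\<forall>\<^sub>F x in at c. x \<in> - {0, 1} - {c}"
        using cy by (intro eventually_at_in_open) auto
      thus "\<forall>\<^sub>F x in at c. H (1 / (x * y)) = H x" by eventually_elim (auto intro: sym)
    qed
  qed
  have limf: "(f \<longlongrightarrow> f z) (at z within annulus q)" if "z \<in> {1, c}" for z
  proof -
    have "(H \<longlongrightarrow> v) (at z)" using that lim1 limc by auto
    moreover have "open (- ({1, c} - {z}))" by (intro open_Compl finite_imp_closed) auto
    hence "\<forall>\<^sub>F x in at z. x \<in> - ({1, c} - {z}) - {z}" by (rule eventually_at_in_open) auto
    hence "\<forall>\<^sub>F x in at z. H x = f x" by eventually_elim (auto simp: f_def)
    ultimately have "(f \<longlongrightarrow> v) (at z)" by (rule Lim_transform_eventually)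
    moreover have "f z = v" using that by (auto simp: f_def)
    ultimately show ?thesis by (simp add: Lim_at_imp_Lim_at_within)
  qed
  have holz: "zeta holomorphic_on annulus q - {1}"
    unfolding holomorphic_on_def field_differentiable_def using zeta_deriv has_field_derivative_at_within by blast
  have holw: "wp holomorphic_on annulus q - {1}"
    unfolding holomorphic_on_def field_differentiable_def using wp_deriv has_field_derivative_at_within by blast
  have comp: "(\<lambda>x. g (x * y)) holomorphic_on annulus q - {1, c}" if "g holomorphic_on annulus q - {1}" for g
    by (rule holomorphic_on_compose_gen[OF _ that, of "\<lambda>x. x * y", unfolded o_def])
      (use ya xc in \<open>auto intro!: holomorphic_intros\<close>)
  have holH: "H holomorphic_on annulus q - {1, c}"
    unfolding H_def S_def
    by (intro holomorphic_intros comp holz holw holomorphic_on_subset[OF holz] holomorphic_on_subset[OF holw]) auto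
  have "f holomorphic_on annulus q"
  proof (rule no_isolated_singularity'[of "{1, c}"])
    show "f holomorphic_on annulus q - {1, c}"
      by (rule holomorphic_transform[OF holH]) (auto simp: f_def)
  qed (use limf open_annulus in auto)
  moreover have "f (q * x) = f x" if "1 < norm x" "norm x < 1 / norm q" for x
  proof -
    have "norm (q * x) < 1" using that q0 by (simp add: norm_mult field_simps)
    hence "q * x \<noteq> 1" "q * x \<noteq> c" "x \<noteq> 1" "x \<noteq> c" using that cy by auto
    moreover have "zeta (q * x) = zeta x + 1" "wp (q * x) = wp x"
      by (rule zeta_shift wp_shift; use that in \<open>simp add: radius_def\<close>)+
    moreover have "zeta (q * x * y) = zeta (x * y) + 1" "wp (q * x * y) = wp (x * y)"
      unfolding mult.assoc by (rule zeta_shift wp_shift; use that y in \<open>simp add: radius_def norm_mult\<close>)+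
    ultimately show ?thesis by (simp add: f_def H_def S_def algebra_simps)
  qed
  ultimately have "f constant_on annulus q" by (rule elliptic_constant[OF q0 q1])
  hence "f x = f 1" using x(1) 1 unfolding constant_on_def by metis
  hence "H x = v" using x xc by (simp add: f_def)
  thus ?thesis unfolding H_def S_def v_def by (simp add: algebra_simps)
qed

lemma lser_lambert:
  assumes "norm x = 1" "k \<le> 3"
  shows "lser k x = lambert (\<lambda>m n. of_nat m ^ k * x ^ m) q"
proof -
  have t: "tame (\<lambda>m n. of_nat m ^ k * x ^ m)"
    using tame_pow[OF assms(2), of "\<lambda>m n. x ^ m" 1] assms(1) by (simp add: norm_power)
  have "((\<lambda>m. of_nat m ^ k * x ^ m * (1 * q ^ m / (1 - 1 * q ^ m))) has_sum lambert (\<lambda>m n. of_nat m ^ k * x ^ m * 1 ^ n) q) {1..}"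
    by (rule lambert_geometric[OF q1]) (use t in auto)
  hence "(\<lambda>m. of_nat (Suc m) ^ k * x ^ Suc m * (q ^ Suc m / (1 - q ^ Suc m))) sums lambert (\<lambda>m n. of_nat m ^ k * x ^ m) q"
    using has_sum_atLeast1_sums[of "\<lambda>m. of_nat m ^ k * x ^ m * (1 * q ^ m / (1 - 1 * q ^ m))"]
    by (simp only: mult_1 mult_1_right power_one)
  hence "(\<lambda>m. of_nat (Suc m) ^ k * (q ^ Suc m / (1 - q ^ Suc m)) * x ^ Suc m) sums lambert (\<lambda>m n. of_nat m ^ k * x ^ m) q"
    by (simp only: mult_ac)
  hence "(\<lambda>m. of_nat m ^ k * (q ^ m / (1 - q ^ m)) * x ^ m) sums (lambert (\<lambda>m n. of_nat m ^ k * x ^ m) q + of_nat 0 ^ k * (q ^ 0 / (1 - q ^ 0)) * x ^ 0)"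
    by (rule sums_Suc)
  from sums_unique[OF this] show ?thesis unfolding lser_def by simp
qed

end

section \<open>Eisenstein series\<close>

definition power_lambert :: "nat \<Rightarrow> complex \<Rightarrow> complex"
  where "power_lambert k q = lambert (\<lambda>m n. of_nat m ^ k) q"

definition eisen4 :: "complex \<Rightarrow> complex"
  where "eisen4 q = 1 + 240 * power_lambert 3 q"

text \<open>This is 2 E2(q^2) - E2(q) for the Eisenstein series E2, a weight-2 form of level 2; it
  turns out to be the square of \<open>formA 4\<close>.\<close>

definition odd_sum :: "complex \<Rightarrow> complex"
  where "odd_sum q = 1 + 24 * lambert (\<lambda>m n. if odd m then of_nat m else 0) q"

lemma tame_weight:
  assumes "k \<le> 3" "\<And>m n. norm (f m n) \<le> 1"
  shows "tame (\<lambda>m n. of_nat m ^ k * f m n)"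
  using tame_pow[OF assms] .

lemma tame_weight1: "(\<And>m n. norm (f m n) \<le> 1) \<Longrightarrow> tame (\<lambda>m n. of_nat m * f m n)"
  using tame_pow[of 1 f 1] by simp

lemma tame_of_nat_pow: "k \<le> 3 \<Longrightarrow> tame (\<lambda>m n. of_nat m ^ k)"
  using tame_pow[of k "\<lambda>m n. 1" 1] by simp

lemma tame_if: "tame f \<Longrightarrow> tame (\<lambda>m n. if P m n then f m n else 0)"
  by (rule tame_cong) auto

lemma lambert_dilate_left:
  assumes "k > 0"
  shows "lambert (\<lambda>m n. if k dvd m then f (m div k) n else 0) q = lambert f (q ^ k)"
  using lambert_dilate[OF assms, of "\<lambda>m n. f n m" q]
    lambert_swap[of "\<lambda>m n. if k dvd n then f (n div k) m else 0" q] lambert_swap[of f]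
  by simp

lemma lambert_scale_nome: "lambert f (w * q) = lambert (\<lambda>m n. f m n * w ^ (m * n)) q"
  unfolding lambert_def by (rule infsum_cong) (auto simp: power_mult_distrib)

lemma power_lambert_dilate_left:
  assumes "k > 0"
  shows "lambert (\<lambda>m n. if k dvd m then of_nat m ^ j else 0) q = of_nat k ^ j * power_lambert j (q ^ k)"
proof -
  have "lambert (\<lambda>m n. if k dvd m then of_nat m ^ j else 0) q =
      lambert (\<lambda>m n. if k dvd m then (\<lambda>m n. of_nat k ^ j * of_nat m ^ j) (m div k) n else 0) q"
    by (rule lambert_cong) (auto simp: power_mult_distrib elim!: dvdE)
  also have "\<dots> = lambert (\<lambda>m n. of_nat k ^ j * of_nat m ^ j) (q ^ k)"
    by (rule lambert_dilate_left[OF assms])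
  finally show ?thesis by (simp add: lambert_cmult power_lambert_def)
qed

lemma power_lambert_dilate_right:
  assumes "k > 0"
  shows "lambert (\<lambda>m n. if k dvd n then of_nat m ^ j else 0) q = power_lambert j (q ^ k)"
  unfolding power_lambert_def by (rule lambert_dilate_const[OF assms])

lemma power_lambert_dilate_both:
  assumes "k > 0"
  shows "lambert (\<lambda>m n. if k dvd m \<and> k dvd n then of_nat m ^ j else 0) q = of_nat k ^ j * power_lambert j ((q ^ k) ^ k)"
proof -
  have "lambert (\<lambda>m n. if k dvd m \<and> k dvd n then of_nat m ^ j else 0) q =
      lambert (\<lambda>m n. if k dvd n then (\<lambda>m n. if k dvd m then of_nat m ^ j else 0) m (n div k) else 0) q"
    by (rule lambert_cong) auto
  also have "\<dots> = lambert (\<lambda>m n. if k dvd m then of_nat m ^ j else 0) (q ^ k)"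
    by (rule lambert_dilate[OF assms])
  finally show ?thesis by (simp add: power_lambert_dilate_left[OF assms])
qed

lemma power_minus_one_parity: "(- 1 :: complex) ^ (m * n) = (if even m \<or> even n then 1 else -1)"
  by auto

text \<open>The sign (-1)^(m n) equals -1 + 2 [m even] + 2 [n even] - 2 [both even]. Dilating m by 2
  costs a factor 8, whence 18 = 2 * 8 + 2 and 16 = 2 * 8.\<close>

lemma power_lambert_minus:
  assumes "norm z < 1"
  shows "power_lambert 3 z + power_lambert 3 (- z) = 18 * power_lambert 3 (z\<^sup>2) - 16 * power_lambert 3 (z ^ 4)"
proof -
  let ?A = "\<lambda>m n. of_nat m ^ 3 :: complex" and ?B = "\<lambda>m n. if even m then of_nat m ^ 3 else 0 :: complex"
    and ?C = "\<lambda>m n. if even n then of_nat m ^ 3 else 0 :: complex" and ?D = "\<lambda>m n. if even m \<and> even n then of_nat m ^ 3 else 0 :: complex"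
  have t: "tame ?A" "tame ?B" "tame ?C" "tame ?D"
    by (intro tame_if tame_of_nat_pow order_refl)+
  have "power_lambert 3 (- z) = lambert (\<lambda>m n. ?A m n * (-1) ^ (m * n)) z"
    unfolding power_lambert_def using lambert_scale_nome[of ?A "-1" z] by simp
  also have "\<dots> = lambert (\<lambda>m n. (-1) * ?A m n + (2 * ?B m n + (2 * ?C m n + (-2) * ?D m n))) z"
    by (rule lambert_cong) (auto simp: power_minus_one_parity)
  also have "\<dots> = (-1) * lambert ?A z + (2 * lambert ?B z + (2 * lambert ?C z + (-2) * lambert ?D z))"
    by (simp only: lambert_add[OF assms] lambert_cmult tame_add tame_cmult t)
  also have "\<dots> = - power_lambert 3 z + 18 * power_lambert 3 (z\<^sup>2) - 16 * power_lambert 3 (z ^ 4)"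
    using power_lambert_dilate_left[of 2 3 z] power_lambert_dilate_right[of 2 3 z] power_lambert_dilate_both[of 2 3 z]
    by (simp add: power_lambert_def[symmetric] flip: power_mult)
  finally show ?thesis by simp
qed

lemma omega_power_sum: "1 + omega ^ k + (omega\<^sup>2) ^ k = (if 3 dvd k then 3 else 0)"
proof -
  define j r where "j = k div 3" and "r = k mod 3"
  have n: "k = 3 * j + r" and r: "r \<in> {0,1,2}" by (auto simp: j_def r_def)
  have "(omega\<^sup>2) ^ (3 * j) = (omega ^ 3) ^ (2 * j)" unfolding power_mult[symmetric] by (simp add: mult.left_commute)
  hence c: "omega ^ (3 * j) = 1" "(omega\<^sup>2) ^ (3 * j) = 1" by (simp_all add: power_mult omega_cube)
  have 4: "(omega\<^sup>2)\<^sup>2 = omega" "omega ^ 4 = omega" using omega_cube by algebra+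
  have s: "1 + omega + omega\<^sup>2 = 0" "1 + omega\<^sup>2 + omega = 0" using omega_sq by (simp_all add: add_ac)
  have d: "3 dvd k \<longleftrightarrow> r = 0" by (simp add: r_def dvd_eq_mod_eq_0)
  show ?thesis unfolding d using r unfolding n power_add c by (auto simp: 4 s)
qed

text \<open>The sum over the cube roots of unity gives 3 when 3 divides m * n and 0 otherwise;
  inclusion and exclusion over m and n yields 84 = 3 * 27 + 3 and 81 = 3 * 27.\<close>

lemma power_lambert_omega:
  assumes "norm z < 1"
  shows "power_lambert 3 z + power_lambert 3 (omega * z) + power_lambert 3 (omega\<^sup>2 * z) =
    84 * power_lambert 3 (z ^ 3) - 81 * power_lambert 3 (z ^ 9)"
proof -
  let ?A = "\<lambda>m n. of_nat m ^ 3 :: complex" and ?B = "\<lambda>m n. if 3 dvd m then of_nat m ^ 3 else 0 :: complex"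
    and ?C = "\<lambda>m n. if 3 dvd n then of_nat m ^ 3 else 0 :: complex" and ?D = "\<lambda>m n. if 3 dvd m \<and> 3 dvd n then of_nat m ^ 3 else 0 :: complex"
  let ?E = "\<lambda>w m n. of_nat m ^ 3 * w ^ (m * n) :: complex"
  have t: "tame ?A" "tame ?B" "tame ?C" "tame ?D"
    by (intro tame_if tame_of_nat_pow order_refl)+
  have tE: "tame (?E omega)" "tame (?E (omega\<^sup>2))"
    by (intro tame_weight order_refl; simp add: norm_power norm_omega)+
  have "power_lambert 3 z + (power_lambert 3 (omega * z) + power_lambert 3 (omega\<^sup>2 * z)) =
      lambert ?A z + (lambert (?E omega) z + lambert (?E (omega\<^sup>2)) z)"
    unfolding power_lambert_def lambert_scale_nome ..
  also have "\<dots> = lambert (\<lambda>m n. ?A m n + (?E omega m n + ?E (omega\<^sup>2) m n)) z"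
    by (simp only: lambert_add[OF assms] tame_add t tE)
  also have "\<dots> = lambert (\<lambda>m n. 3 * ?B m n + (3 * ?C m n + (-3) * ?D m n)) z"
  proof (rule lambert_cong)
    fix m n :: nat
    have "?A m n + (?E omega m n + ?E (omega\<^sup>2) m n) = of_nat m ^ 3 * (1 + omega ^ (m * n) + (omega\<^sup>2) ^ (m * n))"
      by (simp add: algebra_simps)
    also have "\<dots> = of_nat m ^ 3 * (if 3 dvd m * n then 3 else 0)" by (simp only: omega_power_sum)
    also have "3 dvd m * n \<longleftrightarrow> 3 dvd m \<or> 3 dvd n" by (rule prime_dvd_mult_iff) (simp add: prime_nat_numeral_eq)
    finally show "?A m n + (?E omega m n + ?E (omega\<^sup>2) m n) = 3 * ?B m n + (3 * ?C m n + (-3) * ?D m n)" by auto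
  qed
  also have "\<dots> = 3 * lambert ?B z + (3 * lambert ?C z + (-3) * lambert ?D z)"
    by (simp only: lambert_add[OF assms] lambert_cmult tame_add tame_cmult t)
  also have "\<dots> = 84 * power_lambert 3 (z ^ 3) - 81 * power_lambert 3 (z ^ 9)"
    using power_lambert_dilate_left[of 3 3 z] power_lambert_dilate_right[of 3 3 z] power_lambert_dilate_both[of 3 3 z]
    by (simp add: power_lambert_def[symmetric] flip: power_mult)
  finally show ?thesis by (simp add: add_ac)
qed

section \<open>Values at points of order 4, 3 and 2\<close>

context punctured_disc
begin

lemma lser_add_lambert:
  assumes "norm x = 1" "norm y = 1" "k \<le> 3"
  shows "lser k x + lser k y = lambert (\<lambda>m n. of_nat m ^ k * (x ^ m + y ^ m)) q"
proof -
  have t: "tame (\<lambda>m n. of_nat m ^ k * w ^ m)" if "norm w = 1" for w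
    using tame_weight[OF assms(3), of "\<lambda>m n. w ^ m"] that by (simp add: norm_power)
  show ?thesis unfolding lser_lambert[OF assms(1,3)] lser_lambert[OF assms(2,3)] distrib_left
    by (rule lambert_add[OF q1 t[OF assms(1)] t[OF assms(2)], symmetric])
qed

text \<open>Jacobi's four-squares theorem. The addition formula is taken at x = y = i: there
  \<open>zeta\<close> is i / 2 times \<open>phi_sq q\<close>, and at the product -1 the odd function
  \<open>zeta\<close> vanishes.\<close>

lemma phi_sq_squared_nonzero: "phi_sq q ^ 2 = 1 + 8 * lambert (\<lambda>m n. if 4 dvd m then 0 else of_nat m) q"
proof -
  have i: "1 / \<i> = - \<i>" "\<i> * \<i> = - 1" "\<i> \<noteq> 1" by (simp_all add: complex_eq_iff)
  have z0: "zeta (-1) = 0" by (simp add: zeta_def)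
  have t: "tame (\<lambda>m n. \<i> ^ m)" "tame (\<lambda>m n. (- \<i>) ^ m)" by (rule tame_bounded[of _ 1], simp add: norm_power)+
  have chi: "\<i> ^ m + (-1) * (- \<i>) ^ m = 2 * \<i> * chi4 m" for m
  proof -
    define k r where "k = m div 4" and "r = m mod 4"
    have n: "m = 4 * k + r" and r: "r \<in> {0,1,2,3}" by (auto simp: k_def r_def)
    have "\<i> ^ 4 = 1" "(-\<i>) ^ 4 = 1" by (simp_all add: power4_eq_xxxx)
    thus ?thesis using r unfolding n by (auto simp: chi4_def power_add power_mult power2_eq_square power3_eq_cube)
  qed
  have "lser 0 \<i> - lser 0 (- \<i>) = lambert (\<lambda>m n. \<i> ^ m) q + (-1) * lambert (\<lambda>m n. (- \<i>) ^ m) q"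
    using lser_lambert[of \<i> 0] lser_lambert[of "- \<i>" 0] by simp
  also have "\<dots> = lambert (\<lambda>m n. \<i> ^ m + (-1) * (- \<i>) ^ m) q"
    by (simp only: lambert_add[OF q1] lambert_cmult tame_cmult t)
  also have "\<dots> = 2 * \<i> * lambert (\<lambda>m n. chi4 m) q" unfolding chi by (rule lambert_cmult)
  finally have "zeta \<i> = (1 + \<i>) / (2 * (1 - \<i>)) + 2 * \<i> * lambert (\<lambda>m n. chi4 m) q"
    unfolding zeta_def i by simp
  also have "(1 + \<i>) / (2 * (1 - \<i>)) = \<i> / 2" by (simp add: complex_eq_iff Re_divide Im_divide)
  finally have zi: "zeta \<i> = \<i> / 2 * phi_sq q" by (simp add: phi_sq_def algebra_simps)
  have "(zeta \<i> + zeta \<i> - zeta (\<i> * \<i>)) ^ 2 = wp \<i> + wp \<i> + wp (\<i> * \<i>) + (1 - 24 * lser 1 1) / 4"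
    by (rule frobenius_stickelberger) (use i unit_annulus[of \<i>] in auto)
  hence 1: "- (phi_sq q ^ 2) = 2 * wp \<i> + wp (-1) + (1 - 24 * lser 1 1) / 4"
  proof -
    have "(\<i> / 2 * p + \<i> / 2 * p - 0) ^ 2 = - (p ^ 2)" for p
    proof -
      have "(\<i> / 2 * p + \<i> / 2 * p - 0) ^ 2 = (\<i> * p) ^ 2" by simp
      thus ?thesis unfolding power_mult_distrib by simp
    qed
    thus ?thesis using \<open>_ = wp \<i> + wp \<i> + wp (\<i> * \<i>) + _\<close> unfolding i(2) z0 zi by (simp only: mult_2)
  qed
  have "\<i> / (1 - \<i>)\<^sup>2 = - 1 / 2" by (simp add: power2_eq_square complex_eq_iff Re_divide Im_divide)
  hence wi: "wp \<i> = - 1 / 2 + (lser 1 \<i> + lser 1 (- \<i>))" unfolding wp_def wp_reg_def i by simp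
  have wm: "wp (-1) = - 1 / 4 + 2 * lser 1 (-1)" unfolding wp_def wp_reg_def by simp
  have t1: "tame (\<lambda>m n. of_nat m * w ^ m)" if "norm w = 1" for w
    using tame_weight1[of "\<lambda>m n. w ^ m"] that by (simp add: norm_power)
  have L: "lser 1 w = lambert (\<lambda>m n. of_nat m * w ^ m) q" if "norm w = 1" for w
    using lser_lambert[OF that, of 1] by simp
  have "phi_sq q ^ 2 = 1 + (6 * lser 1 1 + ((-2) * lser 1 \<i> + ((-2) * lser 1 (-\<i>) + (-2) * lser 1 (-1))))"
  proof -
    have "phi_sq q ^ 2 = - (2 * wp \<i> + wp (-1) + (1 - 24 * lser 1 1) / 4)" using 1 by (metis add.inverse_inverse)
    moreover have "F = 1 + (6 * s + ((-2) * a + ((-2) * b + (-2) * c)))"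
      if "F = - (2 * (- 1 / 2 + (a + b)) + (- 1 / 4 + 2 * c) + (1 - 24 * s) / 4)" for F a b c s :: complex
      unfolding that by (simp add: field_simps)
    ultimately show ?thesis unfolding wi wm by blast
  qed
  also have "6 * lser 1 1 + ((-2) * lser 1 \<i> + ((-2) * lser 1 (-\<i>) + (-2) * lser 1 (-1))) =
    lambert (\<lambda>m n. 6 * (of_nat m * 1 ^ m) + ((-2) * (of_nat m * \<i> ^ m) + ((-2) * (of_nat m * (-\<i>) ^ m) + (-2) * (of_nat m * (-1) ^ m)))) q"
    using L[of 1] L[of \<i>] L[of "- \<i>"] L[of "-1"] t1[of 1] t1[of \<i>] t1[of "- \<i>"] t1[of "-1"]
    by (simp only: lambert_add[OF q1] lambert_cmult tame_cmult tame_add norm_one norm_ii norm_minus_cancel)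
  also have "\<dots> = lambert (\<lambda>m n. 8 * (if 4 dvd m then 0 else of_nat m)) q"
  proof (rule lambert_cong)
    fix m n :: nat
    define k r where "k = m div 4" and "r = m mod 4"
    have n: "m = 4 * k + r" and r: "r \<in> {0,1,2,3}" by (auto simp: k_def r_def)
    have p: "\<i> ^ m = \<i> ^ r" "(-\<i>) ^ m = (-\<i>) ^ r" "(-1) ^ m = ((-1) ^ r :: complex)"
      unfolding n power_add power_mult by (simp_all add: power4_eq_xxxx)
    have d: "4 dvd m \<longleftrightarrow> r = 0" by (simp add: r_def dvd_eq_mod_eq_0)
    show "6 * (of_nat m * 1 ^ m) + ((-2) * (of_nat m * \<i> ^ m) + ((-2) * (of_nat m * (-\<i>) ^ m) + (-2) * (of_nat m * (-1) ^ m))) =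
      8 * (if 4 dvd m then 0 else of_nat m :: complex)"
      unfolding p d using r by (auto simp: power2_eq_square power3_eq_cube)
  qed
  also have "\<dots> = 8 * lambert (\<lambda>m n. if 4 dvd m then 0 else of_nat m) q" by (rule lambert_cmult)
  finally show ?thesis .
qed

text \<open>At x = y = omega the product is 1 / omega, so the addition formula involves only
  \<open>zeta omega\<close>, a multiple of \<open>cubic_a q\<close>, and \<open>wp omega\<close>. It
  expresses \<open>wp omega\<close> through the square of \<open>cubic_a q\<close>, and the
  differential equation at omega then gives the fourth power.\<close>

lemma cubic_a_fourth_nonzero: "cubic_a q ^ 4 = 1 + 24 * power_lambert 3 q + 216 * power_lambert 3 (q ^ 3)"
proof -
  have oo: "omega * omega = omega\<^sup>2" "1 / omega = omega\<^sup>2" "omega ^ 3 = 1" "norm (omega\<^sup>2) = 1"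
    using omega_cube omega_ne(2) by (simp_all add: power2_eq_square power3_eq_cube field_simps norm_mult norm_omega)
  have on: "1 - omega \<noteq> 0" using omega_ne by simp
  define c where "c = (1 + omega) / (1 - omega)"
  have o2: "omega\<^sup>2 = - 1 - omega" using omega_sq by algebra
  have "(1 + omega)\<^sup>2 * 3 = - (1 - omega)\<^sup>2" using omega_sq by algebra
  hence c2: "c\<^sup>2 = - 1 / 3" using on unfolding c_def power_divide by (simp add: field_simps)
  have "(omega - omega\<^sup>2) * (1 - omega) = 3 * (1 + omega)" using omega_sq by algebra
  hence c3: "omega - omega\<^sup>2 = 3 * c" using on unfolding c_def by (metis nonzero_eq_divide_eq times_divide_eq_right)
  have t: "tame (\<lambda>m n. omega ^ m)" "tame (\<lambda>m n. (omega\<^sup>2) ^ m)" by (rule tame_bounded[of _ 1], simp add: norm_power norm_omega)+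
  have "lser 0 omega - lser 0 (omega\<^sup>2) = lambert (\<lambda>m n. omega ^ m) q + (-1) * lambert (\<lambda>m n. (omega\<^sup>2) ^ m) q"
    using lser_lambert[OF norm_omega, of 0] lser_lambert[OF oo(4), of 0] by simp
  also have "\<dots> = lambert (\<lambda>m n. omega ^ m + (-1) * (omega\<^sup>2) ^ m) q"
    by (simp only: lambert_add[OF q1] lambert_cmult tame_cmult t)
  also have "\<dots> = lambert (\<lambda>m n. 3 * c * chi3 m) q"
    by (rule lambert_cong) (use omega_pow_chi3 c3 in simp)
  also have "\<dots> = 3 * c * lambert (\<lambda>m n. chi3 m) q" by (rule lambert_cmult)
  finally have "zeta omega = (1 + omega) / (2 * (1 - omega)) + 3 * c * lambert (\<lambda>m n. chi3 m) q"
    unfolding zeta_def oo by simp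
  also have "(1 + omega) / (2 * (1 - omega)) = c / 2" by (simp add: c_def)
  finally have zo: "zeta omega = c / 2 * cubic_a q" by (simp add: cubic_a_def algebra_simps)
  have zo2: "zeta (omega\<^sup>2) = - zeta omega" "wp (omega\<^sup>2) = wp omega"
    using zeta_inverse[OF omega_ne(2,1)] wp_inverse[OF omega_ne(2,1)] unfolding oo by auto
  have "(zeta omega + zeta omega - zeta (omega * omega)) ^ 2 = wp omega + wp omega + wp (omega * omega) + (1 - 24 * lser 1 1) / 4"
    by (rule frobenius_stickelberger) (use omega_ne unit_annulus[OF norm_omega] norm_omega oo in auto)
  hence "(3 * (c / 2 * cubic_a q)) ^ 2 = 3 * wp omega + (1 - 24 * lser 1 1) / 4"
    unfolding oo zo2 zo by (simp add: algebra_simps)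
  moreover have "(3 * (c / 2 * cubic_a q)) ^ 2 = 9 / 4 * c\<^sup>2 * cubic_a q ^ 2" by (simp add: power2_eq_square)
  hence "(3 * (c / 2 * cubic_a q)) ^ 2 = - 3 / 4 * cubic_a q ^ 2" unfolding c2 by simp
  ultimately have "3 * wp omega = - 3 / 4 * cubic_a q ^ 2 - (1 - 24 * lser 1 1) / 4" by (simp only: add_diff_cancel_right')
  hence w: "wp omega = - (cubic_a q ^ 2) / 4 - (1 - 24 * lser 1 1) / 12"
    by (simp add: field_simps)
  have l1: "lser 1 1 = power_lambert 1 q" "lser 3 1 = power_lambert 3 q"
    using lser_lambert[of 1 1] lser_lambert[of 1 3] by (simp_all add: power_lambert_def)
  have "omega * (1 + 4 * omega + omega\<^sup>2) * 3 = (1 - omega) ^ 4" using omega_sq by algebra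
  hence "omega * (1 + 4 * omega + omega\<^sup>2) / (1 - omega) ^ 4 = 1 / 3" using on by (simp add: field_simps)
  hence "wp2 omega = 1 / 3 + (lser 3 omega + lser 3 (omega\<^sup>2))" unfolding wp2_def oo by simp
  also have "lser 3 omega + lser 3 (omega\<^sup>2) = lambert (\<lambda>m n. of_nat m ^ 3 * (omega ^ m + (omega\<^sup>2) ^ m)) q"
    by (rule lser_add_lambert) (use norm_omega oo in auto)
  finally have w2: "wp2 omega = 1 / 3 + lambert (\<lambda>m n. of_nat m ^ 3 * (omega ^ m + (omega\<^sup>2) ^ m)) q" (is "_ = _ + ?L") .
  have "wp2 omega = 6 * wp omega ^ 2 + (1 - 24 * lser 1 1) * wp omega - 10 * lser 3 1 + 24 * lser 1 1 ^ 2 - 2 * lser 1 1"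
    by (rule wp_ode) (use omega_ne unit_annulus[OF norm_omega] in auto)
  \<comment> \<open>The weight-2 series t cancels, because the differential equation for
    Weierstrass's own function does not contain it.\<close>
  moreover have "6 * (- (A ^ 2) / 4 - (1 - 24 * t) / 12) ^ 2 + (1 - 24 * t) * (- (A ^ 2) / 4 - (1 - 24 * t) / 12) -
      10 * s + 24 * t ^ 2 - 2 * t = 3 / 8 * A ^ 4 - 1 / 24 - 10 * s" for A s t :: complex
    by (simp add: power2_eq_square field_simps eval_nat_numeral)
  ultimately have e: "1 / 3 + ?L = 3 / 8 * cubic_a q ^ 4 - 1 / 24 - 10 * power_lambert 3 q"
    unfolding w w2 l1 by (simp only:)
  have "cubic_a q ^ 4 = 8 / 3 * (3 / 8 * cubic_a q ^ 4 - 1 / 24 - 10 * power_lambert 3 q) + 1 / 9 + 80 / 3 * power_lambert 3 q"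
    by (simp add: right_diff_distrib)
  hence "cubic_a q ^ 4 = 1 + 8 / 3 * (10 * power_lambert 3 q + ?L)"
    unfolding e[symmetric] by (simp add: distrib_left)
  also have "8 / 3 * (10 * power_lambert 3 q + ?L) =
      8 / 3 * (9 * power_lambert 3 q + lambert (\<lambda>m n. of_nat m ^ 3 + of_nat m ^ 3 * (omega ^ m + (omega\<^sup>2) ^ m)) q)"
  proof -
    have "tame (\<lambda>m n. of_nat m ^ 3 * omega ^ m + of_nat m ^ 3 * (omega\<^sup>2) ^ m)"
      by (intro tame_add tame_weight order_refl; simp add: norm_power norm_omega)
    hence "tame (\<lambda>m n. of_nat m ^ 3 * (omega ^ m + (omega\<^sup>2) ^ m))" by (simp only: distrib_left)
    thus ?thesis using lambert_add[OF q1 tame_of_nat_pow[of 3]] by (simp add: power_lambert_def)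
  qed
  also have "lambert (\<lambda>m n. of_nat m ^ 3 + of_nat m ^ 3 * (omega ^ m + (omega\<^sup>2) ^ m)) q =
     lambert (\<lambda>m n. 3 * (if 3 dvd m then of_nat m ^ 3 else 0)) q"
  proof (rule lambert_cong)
    fix m n :: nat
    have "of_nat m ^ 3 + of_nat m ^ 3 * (omega ^ m + (omega\<^sup>2) ^ m) = of_nat m ^ 3 * (1 + omega ^ m + (omega\<^sup>2) ^ m)"
      by (simp add: algebra_simps)
    thus "of_nat m ^ 3 + of_nat m ^ 3 * (omega ^ m + (omega\<^sup>2) ^ m) = 3 * (if 3 dvd m then of_nat m ^ 3 else 0)"
      unfolding omega_power_sum by simp
  qed
  also have "\<dots> = 81 * power_lambert 3 (q ^ 3)"
    using power_lambert_dilate_left[of 3 3 q] by (simp add: lambert_cmult)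
  finally show ?thesis by (simp add: algebra_simps)
qed

text \<open>The differential equation at the half period x = -1, where \<open>wp\<close> is -1/6 of
  \<open>odd_sum q\<close> up to the additive normalization of \<open>wp\<close>.\<close>

lemma odd_sum_squared_nonzero: "odd_sum q ^ 2 = 1 + 48 * power_lambert 3 q + 192 * power_lambert 3 (q\<^sup>2)"
proof -
  have l1: "lser 1 1 = power_lambert 1 q" "lser 3 1 = power_lambert 3 q"
    "lser 1 (-1) = lambert (\<lambda>m n. of_nat m * (-1) ^ m) q" "lser 3 (-1) = lambert (\<lambda>m n. of_nat m ^ 3 * (-1) ^ m) q"
    using lser_lambert[of 1 1] lser_lambert[of 1 3] lser_lambert[of "-1" 1] lser_lambert[of "-1" 3] by (simp_all add: power_lambert_def)
  have t: "tame (\<lambda>m n. of_nat m)" "tame (\<lambda>m n. if odd m then of_nat m else 0)" using tame_of_nat_pow[of 1] by (simp_all add: tame_if)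
  have t3: "tame (\<lambda>m n. of_nat m ^ 3)" "tame (\<lambda>m n. if even m then of_nat m ^ 3 else 0)" using tame_of_nat_pow[of 3] by (simp_all add: tame_if)
  have "lser 1 (-1) = lambert (\<lambda>m n. of_nat m + (-2) * (if odd m then of_nat m else 0)) q"
    unfolding l1 by (rule lambert_cong) auto
  also have "\<dots> = power_lambert 1 q + (-2) * lambert (\<lambda>m n. if odd m then of_nat m else 0) q"
    using lambert_add[OF q1 t(1) tame_cmult[OF t(2), of "-2"]] by (simp only: power_lambert_def lambert_cmult power_one_right)
  finally have lm: "lser 1 (-1) = power_lambert 1 q + (-2) * lambert (\<lambda>m n. if odd m then of_nat m else 0) q" .
  have wm: "wp (-1) = - 1 / 4 + 2 * lser 1 (-1)" unfolding wp_def wp_reg_def by simp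
  have w: "wp (-1) = - (odd_sum q) / 6 - (1 - 24 * lser 1 1) / 12"
    unfolding wm lm odd_sum_def l1(1) by (simp add: field_simps)
  have "lser 3 (-1) = lambert (\<lambda>m n. (-1) * of_nat m ^ 3 + 2 * (if even m then of_nat m ^ 3 else 0)) q"
    unfolding l1 by (rule lambert_cong) auto
  also have "\<dots> = (-1) * power_lambert 3 q + 2 * lambert (\<lambda>m n. if even m then of_nat m ^ 3 else 0) q"
    using lambert_add[OF q1 tame_cmult[OF t3(1), of "-1"] tame_cmult[OF t3(2), of 2]] by (simp only: power_lambert_def lambert_cmult)
  also have "lambert (\<lambda>m n. if even m then of_nat m ^ 3 else 0) q = 8 * power_lambert 3 (q\<^sup>2)"
    using power_lambert_dilate_left[of 2 3 q] by simp
  finally have w2: "wp2 (-1) = 1 / 8 + 2 * (- power_lambert 3 q + 16 * power_lambert 3 (q\<^sup>2))"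
    unfolding wp2_def by simp
  have "wp2 (-1) = 6 * wp (-1) ^ 2 + (1 - 24 * lser 1 1) * wp (-1) - 10 * lser 3 1 + 24 * lser 1 1 ^ 2 - 2 * lser 1 1"
    by (rule wp_ode) (use unit_annulus[of "-1"] in auto)
  moreover have "6 * (- A / 6 - (1 - 24 * t) / 12) ^ 2 + (1 - 24 * t) * (- A / 6 - (1 - 24 * t) / 12) -
      10 * s + 24 * t ^ 2 - 2 * t = 1 / 6 * A ^ 2 - 1 / 24 - 10 * s" for A s t :: complex
    by (simp add: power2_eq_square field_simps)
  ultimately have e: "1 / 8 + 2 * (- power_lambert 3 q + 16 * power_lambert 3 (q\<^sup>2)) = 1 / 6 * odd_sum q ^ 2 - 1 / 24 - 10 * power_lambert 3 q"
    unfolding w w2 l1 by (simp only:)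
  have "odd_sum q ^ 2 = 6 * (1 / 6 * odd_sum q ^ 2 - 1 / 24 - 10 * power_lambert 3 q) + 1 / 4 + 60 * power_lambert 3 q"
    by (simp add: right_diff_distrib)
  thus ?thesis unfolding e[symmetric] by (simp add: distrib_left)
qed

end

lemma power_lambert_0: "power_lambert k 0 = 0"
  by (simp add: power_lambert_def lambert_0)

lemma phi_sq_squared:
  assumes "norm q < 1"
  shows "phi_sq q ^ 2 = 1 + 8 * lambert (\<lambda>m n. if 4 dvd m then 0 else of_nat m) q"
  using punctured_disc.phi_sq_squared_nonzero[of q] assms
  by (cases "q = 0") (auto simp: punctured_disc_def phi_sq_def lambert_0)

lemma cubic_a_fourth:
  assumes "norm q < 1"
  shows "cubic_a q ^ 4 = 1 + 24 * power_lambert 3 q + 216 * power_lambert 3 (q ^ 3)"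
  using punctured_disc.cubic_a_fourth_nonzero[of q] assms
  by (cases "q = 0") (auto simp: punctured_disc_def cubic_a_def lambert_0 power_lambert_0)

lemma odd_sum_squared:
  assumes "norm q < 1"
  shows "odd_sum q ^ 2 = 1 + 48 * power_lambert 3 q + 192 * power_lambert 3 (q\<^sup>2)"
  using punctured_disc.odd_sum_squared_nonzero[of q] assms
  by (cases "q = 0") (auto simp: punctured_disc_def odd_sum_def lambert_0 power_lambert_0)

text \<open>A comparison of coefficients in the four-squares series at q and -q. Besides 24 times
  the sum over odd m there remain the terms with n even and those with m = 2 modulo 4; both are the
  odd-divisor series at q^2, with opposite factors.\<close>

lemma odd_sum_phi_sq:
  assumes "norm q < 1"
  shows "odd_sum q = 2 * phi_sq q ^ 2 - phi_sq (- q) ^ 2"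
proof -
  let ?F = "\<lambda>m n. if 4 dvd m then 0 else of_nat m :: complex"
  let ?O = "\<lambda>m n. if odd m then of_nat m else 0 :: complex"
  let ?A = "\<lambda>m n. if even n then (if odd m then of_nat m else 0) else 0 :: complex"
  let ?B = "\<lambda>m n. if even m then (if odd (m div 2) then of_nat (m div 2) else 0) else 0 :: complex"
  have t1: "tame (\<lambda>m n. of_nat m)" using tame_of_nat_pow[of 1] by simp
  have t: "tame ?F" "tame ?O" "tame ?A" "tame ?B"
    by (rule tame_cong[OF t1], simp)+
  have tF: "tame (\<lambda>m n. ?F m n * (-1) ^ (m * n))"
    by (rule tame_cong[OF t(1)]) (simp add: norm_mult norm_power)
  have q': "norm (- q) < 1" using assms by simp
  have m: "lambert ?F (- q) = lambert (\<lambda>m n. ?F m n * (-1) ^ (m * n)) q"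
    using lambert_scale_nome[of ?F "-1" q] by simp
  have "2 * phi_sq q ^ 2 - phi_sq (- q) ^ 2 = 1 + (16 * lambert ?F q + (-8) * lambert (\<lambda>m n. ?F m n * (-1) ^ (m * n)) q)"
    unfolding phi_sq_squared[OF assms] phi_sq_squared[OF q'] m by simp
  also have "16 * lambert ?F q + (-8) * lambert (\<lambda>m n. ?F m n * (-1) ^ (m * n)) q =
      lambert (\<lambda>m n. 16 * ?F m n + (-8) * (?F m n * (-1) ^ (m * n))) q"
    by (simp only: lambert_add[OF assms] lambert_cmult tame_cmult t tF)
  also have "\<dots> = lambert (\<lambda>m n. 24 * ?O m n + ((-16) * ?A m n + 16 * ?B m n)) q"
  proof (rule lambert_cong)
    fix m n :: nat
    show "16 * ?F m n + (-8) * (?F m n * (-1) ^ (m * n)) = 24 * ?O m n + ((-16) * ?A m n + 16 * ?B m n)"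
    proof (cases "even m")
      case True
      then obtain k where "m = 2 * k" by (elim evenE)
      thus ?thesis by (auto simp: power_minus_one_parity)
    next
      case False
      hence "\<not> 4 dvd m" by (metis dvd_trans even_numeral)
      thus ?thesis using False by (auto simp: power_minus_one_parity)
    qed
  qed
  also have "\<dots> = 24 * lambert ?O q + ((-16) * lambert ?A q + 16 * lambert ?B q)"
    by (simp only: lambert_add[OF assms] lambert_cmult tame_cmult tame_add t)
  also have "lambert ?A q = lambert ?O (q\<^sup>2)" by (rule lambert_dilate_const) simp
  also have "lambert ?B q = lambert ?O (q\<^sup>2)" by (rule lambert_dilate_left[of 2 ?O]) simp
  finally show ?thesis by (simp add: odd_sum_def)
qed

lemma phi_sq_add_minus:
  assumes "norm z < 1"
  shows "phi_sq z + phi_sq (- z) = 2 * phi_sq (z\<^sup>2)"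
proof -
  let ?A = "\<lambda>m n. if even n then chi4 m else 0"
  have tE: "tame (\<lambda>m n. chi4 m * (-1) ^ (m * n))"
    by (rule tame_cong[OF tame_chi(3)]) (simp add: norm_mult norm_power)
  have "lambert (\<lambda>m n. chi4 m) z + lambert (\<lambda>m n. chi4 m) (- z) =
      lambert (\<lambda>m n. chi4 m) z + lambert (\<lambda>m n. chi4 m * (-1) ^ (m * n)) z"
    using lambert_scale_nome[of "\<lambda>m n. chi4 m" "-1" z] by simp
  also have "\<dots> = lambert (\<lambda>m n. chi4 m + chi4 m * (-1) ^ (m * n)) z"
    by (rule lambert_add[OF assms tame_chi(3) tE, symmetric])
  also have "\<dots> = lambert (\<lambda>m n. 2 * ?A m n) z"
  proof (rule lambert_cong)
    fix m n :: nat
    have "chi4 m = 0" if "even m" using that by (auto simp: chi4_def elim!: evenE) presburger+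
    thus "chi4 m + chi4 m * (-1) ^ (m * n) = 2 * ?A m n" by (auto simp: power_minus_one_parity)
  qed
  also have "\<dots> = 2 * lambert (\<lambda>m n. chi4 m) (z\<^sup>2)"
    unfolding lambert_cmult by (simp add: lambert_dilate_const)
  finally have L: "lambert (\<lambda>m n. chi4 m) z + lambert (\<lambda>m n. chi4 m) (- z) = 2 * lambert (\<lambda>m n. chi4 m) (z\<^sup>2)" .
  have "phi_sq z + phi_sq (- z) = 2 + 4 * (lambert (\<lambda>m n. chi4 m) z + lambert (\<lambda>m n. chi4 m) (- z))"
    by (simp add: phi_sq_def)
  thus ?thesis unfolding L by (simp add: phi_sq_def)
qed

text \<open>Together with \<open>phi_sq_add_minus\<close> this is the arithmetic-geometric mean step
  for \<open>phi_sq\<close>.\<close>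

lemma phi_sq_mult_minus:
  assumes "norm z < 1"
  shows "phi_sq z * phi_sq (- z) = phi_sq (- (z\<^sup>2)) ^ 2"
proof -
  note e = euler_nonzero[OF assms] euler_nonzero[of "z\<^sup>2"] euler_nonzero[of "z ^ 4"]
  have z: "norm (z\<^sup>2) < 1" "norm (z ^ 4) < 1" "(z\<^sup>2)\<^sup>2 = z ^ 4"
    using norm_power_lt[OF assms, of 2] norm_power_lt[OF assms, of 4] by (simp_all flip: power_mult)
  have "B ^ 10 / (A ^ 4 * D ^ 4) * (A ^ 4 / B ^ 2) = (B ^ 4 / D ^ 2) ^ 2" if "A \<noteq> 0" "B \<noteq> 0" "D \<noteq> 0" for A B D :: complex
    using that by (simp add: field_simps eval_nat_numeral)
  from this[OF euler_nonzero[OF assms] euler_nonzero[OF z(1)] euler_nonzero[OF z(2)]] show ?thesis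
    unfolding phi_sq_product[OF assms] phi_sq_minus_product[OF assms] phi_sq_minus_product[OF z(1)] z(3) .
qed

text \<open>\<open>odd_sum_squared\<close> at the two square roots of q and at q itself. With u =
  phi_sq q and v the odd part of \<open>phi_sq\<close> at the root z, all theta values involved are
  polynomials in u and v.\<close>

theorem eisen4_quartic:
  assumes "norm q < 1"
  shows "eisen4 q = 16 * phi_sq q ^ 4 - 16 * phi_sq q ^ 2 * phi_sq (- q) ^ 2 + phi_sq (- q) ^ 4"
    and "eisen4 (q\<^sup>2) = phi_sq q ^ 4 - phi_sq q ^ 2 * phi_sq (- q) ^ 2 + phi_sq (- q) ^ 4"
proof -
  define z where "z = csqrt q"
  have zq: "z\<^sup>2 = q" "z ^ 4 = q\<^sup>2" by (simp_all add: z_def) (metis power2_csqrt power_mult mult_2_right numeral_Bit0)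
  have z: "norm z < 1"
  proof -
    have "norm z ^ 2 < 1" using assms by (simp add: zq flip: norm_power)
    thus ?thesis by (simp add: power_less_one_iff)
  qed
  hence z': "norm (- z) < 1" by simp
  define u where "u = phi_sq q"
  define v where "v = phi_sq z - u"
  have pz: "phi_sq z = u + v" by (simp add: v_def)
  have pmz: "phi_sq (- z) = u - v" using phi_sq_add_minus[OF z] pz unfolding zq u_def by (simp add: algebra_simps)
  have pmq: "phi_sq (- q) ^ 2 = u ^ 2 - v ^ 2"
    using phi_sq_mult_minus[OF z] unfolding pz pmz zq by (simp add: power2_eq_square algebra_simps)
  have Wz: "odd_sum z = 2 * (u + v) ^ 2 - (u - v) ^ 2" "odd_sum (- z) = 2 * (u - v) ^ 2 - (u + v) ^ 2"
    using odd_sum_phi_sq[OF z] odd_sum_phi_sq[OF z'] by (simp_all add: pz pmz)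
  have Wq: "odd_sum q = 2 * u ^ 2 - (u ^ 2 - v ^ 2)"
    using odd_sum_phi_sq[OF assms] unfolding pmq u_def .
  \<comment> \<open>The weight 4 on the last square makes the series at q^2 cancel: -48 * 16 + 4 *
    192 = 0. What is left is 6 + 1440 * power_lambert 3 q.\<close>
  have "odd_sum z ^ 2 + odd_sum (- z) ^ 2 + 4 * odd_sum q ^ 2 =
     6 + 48 * (power_lambert 3 z + power_lambert 3 (- z)) + 576 * power_lambert 3 q + 768 * power_lambert 3 (q\<^sup>2)"
    unfolding odd_sum_squared[OF z] odd_sum_squared[OF z'] odd_sum_squared[OF assms] power2_minus zq(1) by simp
  also have "\<dots> = 6 * eisen4 q"
    unfolding power_lambert_minus[OF z] zq by (simp add: eisen4_def)
  finally have E: "eisen4 q = (odd_sum z ^ 2 + odd_sum (- z) ^ 2 + 4 * odd_sum q ^ 2) / 6" by simp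
  have E2: "eisen4 (q\<^sup>2) = (5 * odd_sum q ^ 2 - eisen4 q) / 4"
    unfolding odd_sum_squared[OF assms] eisen4_def by simp
  have p4: "phi_sq (- q) ^ 4 = (u ^ 2 - v ^ 2) ^ 2"
    unfolding pmq[symmetric] by (simp flip: power_mult)
  show *: "eisen4 q = 16 * phi_sq q ^ 4 - 16 * phi_sq q ^ 2 * phi_sq (- q) ^ 2 + phi_sq (- q) ^ 4"
    unfolding E Wz Wq p4 pmq u_def[symmetric] by (simp add: power2_eq_square power4_eq_xxxx field_simps)
  show "eisen4 (q\<^sup>2) = phi_sq q ^ 4 - phi_sq q ^ 2 * phi_sq (- q) ^ 2 + phi_sq (- q) ^ 4"
    unfolding E2 * Wq p4 pmq u_def[symmetric] by (simp add: power2_eq_square power4_eq_xxxx field_simps)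
qed

section \<open>The cubic theta functions b and c, and relations over the cube roots of the
  nome\<close>

definition cubic_b :: "complex \<Rightarrow> complex"
  where "cubic_b q = euler q ^ 3 / euler (q ^ 3)"

text \<open>In terms of a cube root of the nome.\<close>
definition cubic_c_root :: "complex \<Rightarrow> complex"
  where "cubic_c_root z = 3 * z * (euler (z ^ 9) ^ 3 / euler (z ^ 3))"

text \<open>Each factor is split by exponents modulo 3. Over the three cube roots of unity the
  classes 1 and 2 collapse by (1 - u)(1 - omega u)(1 - omega^2 u) = 1 - u^3, while the class 0 is
  common and gives a cube.\<close>

lemma prod_euler_omega:
  assumes "norm z < 1"
  shows "euler z * euler (omega * z) * euler (omega\<^sup>2 * z) = euler (z ^ 3) ^ 4 / euler (z ^ 9)"
proof -
  have z3: "norm (z ^ 3) < 1" "(z ^ 3) ^ 3 = z ^ 9" "(z ^ 3)\<^sup>2 = z ^ 6" "(z\<^sup>2) ^ 3 = z ^ 6"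
    using norm_power_lt[OF assms, of 3] by (simp_all flip: power_mult)
  have "omega ^ 4 = omega" using omega_cube by algebra
  hence "(omega * z)\<^sup>2 = omega\<^sup>2 * z\<^sup>2" "(omega\<^sup>2 * z)\<^sup>2 = omega * z\<^sup>2"
    by (simp_all add: power_mult_distrib)
  moreover have "(omega * z) ^ 3 = z ^ 3" "(omega\<^sup>2 * z) ^ 3 = z ^ 3"
    using omega_cube by algebra+
  ultimately have o: "(omega * z) ^ 3 = z ^ 3" "(omega\<^sup>2 * z) ^ 3 = z ^ 3" "(omega * z)\<^sup>2 = omega\<^sup>2 * z\<^sup>2" "(omega\<^sup>2 * z)\<^sup>2 = omega * z\<^sup>2"
    by blast+
  have n: "norm (omega * z) < 1" "norm (omega\<^sup>2 * z) < 1" using assms by (simp_all add: norm_mult norm_power norm_omega)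
  note e = euler_nonzero[OF z3(1)]
  have s: "euler w = qpoch w (w ^ 3) * qpoch (w\<^sup>2) (w ^ 3) * euler (w ^ 3)" if "norm w < 1" for w
    using euler_split3[OF that] euler_nonzero[of "w ^ 3"] norm_power_lt[OF that, of 3] by (simp add: field_simps)
  have "euler z * euler (omega * z) * euler (omega\<^sup>2 * z) =
     (qpoch z (z ^ 3) * qpoch (omega * z) (z ^ 3) * qpoch (omega\<^sup>2 * z) (z ^ 3)) *
     (qpoch (z\<^sup>2) (z ^ 3) * qpoch (omega * z\<^sup>2) (z ^ 3) * qpoch (omega\<^sup>2 * z\<^sup>2) (z ^ 3)) * euler (z ^ 3) ^ 3"
    unfolding s[OF assms] s[OF n(1)] s[OF n(2)] o by (simp add: power3_eq_cube)
  also have "\<dots> = (qpoch (z ^ 3) ((z ^ 3) ^ 3) * qpoch ((z ^ 3)\<^sup>2) ((z ^ 3) ^ 3)) * euler (z ^ 3) ^ 3"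
    unfolding qpoch_mult_cube_roots[OF z3(1) omega_sq] z3(3,4) ..
  also have "\<dots> = euler (z ^ 3) / euler (z ^ 9) * euler (z ^ 3) ^ 3"
    unfolding euler_split3[OF z3(1)] unfolding z3(2) ..
  finally show ?thesis by (simp add: eval_nat_numeral)
qed

text \<open>Replacing z by omega * z leaves every function of z^3 unchanged and multiplies
  \<open>cubic_c_root\<close> by omega, so one dissection yields the values of a and b at all three
  cube roots.\<close>

lemma cubic_relations:
  assumes "norm z < 1"
  defines "a \<equiv> cubic_a (z ^ 3)" and "c \<equiv> cubic_c_root z"
  shows "cubic_a z = a + 2 * c" "cubic_a (omega * z) = a + 2 * omega * c" "cubic_a (omega\<^sup>2 * z) = a + 2 * omega\<^sup>2 * c"
    and "cubic_b z = a - c" "cubic_b (omega * z) = a - omega * c" "cubic_b (omega\<^sup>2 * z) = a - omega\<^sup>2 * c"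
proof -
  have o: "(omega * z) ^ 3 = z ^ 3" "(omega\<^sup>2 * z) ^ 3 = z ^ 3" "(omega * z) ^ 9 = z ^ 9" "(omega\<^sup>2 * z) ^ 9 = z ^ 9"
    using omega_cube by algebra+
  have n: "norm (omega * z) < 1" "norm (omega\<^sup>2 * z) < 1" using assms by (simp_all add: norm_mult norm_power norm_omega)
  have A: "cubic_a w = cubic_a (w ^ 3) + 2 * cubic_c_root w" if "norm w < 1" for w
    using cubic_a_dissection[OF that] by (simp add: cubic_c_root_def algebra_simps)
  have B: "cubic_b w = cubic_a (w ^ 3) - cubic_c_root w" if "norm w < 1" for w
  proof -
    have "2 * cubic_b w = 2 * (cubic_a (w ^ 3) - cubic_c_root w)"
      unfolding cubic_b_def cubic_b_product[OF that, symmetric] A[OF that] by simp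
    thus ?thesis by (metis mult_left_cancel zero_neq_numeral)
  qed
  have C: "cubic_c_root (omega * z) = omega * c" "cubic_c_root (omega\<^sup>2 * z) = omega\<^sup>2 * c"
    unfolding c_def cubic_c_root_def o by simp_all
  show "cubic_a z = a + 2 * c" "cubic_a (omega * z) = a + 2 * omega * c" "cubic_a (omega\<^sup>2 * z) = a + 2 * omega\<^sup>2 * c"
    unfolding A[OF assms(1)] A[OF n(1)] A[OF n(2)] o C by (simp_all add: a_def c_def)
  show "cubic_b z = a - c" "cubic_b (omega * z) = a - omega * c" "cubic_b (omega\<^sup>2 * z) = a - omega\<^sup>2 * c"
    unfolding B[OF assms(1)] B[OF n(1)] B[OF n(2)] o C by (simp_all add: a_def c_def)
qed

text \<open>The product of b over the three cube roots is (a - c)(a - omega c)(a - omega^2 c) = a^3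
  - c^3 by the relations, and b(z^3)^3 by the Euler products.\<close>

theorem cubic_identity:
  assumes "norm z < 1"
  shows "cubic_a (z ^ 3) ^ 3 = cubic_b (z ^ 3) ^ 3 + cubic_c_root z ^ 3"
proof -
  define a where "a = cubic_a (z ^ 3)"
  define c where "c = cubic_c_root z"
  have o: "(omega * z) ^ 3 = z ^ 3" "(omega\<^sup>2 * z) ^ 3 = z ^ 3" using omega_cube by algebra+
  have z9: "(z ^ 3) ^ 3 = z ^ 9" by (simp flip: power_mult)
  have "(a - c) * (a - omega * c) * (a - omega\<^sup>2 * c) = cubic_b z * cubic_b (omega * z) * cubic_b (omega\<^sup>2 * z)"
    using cubic_relations(4-6)[OF assms] by (simp add: a_def c_def)
  also have "\<dots> = (euler z * euler (omega * z) * euler (omega\<^sup>2 * z)) ^ 3 / euler (z ^ 3) ^ 3"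
    unfolding cubic_b_def o by (simp add: power3_eq_cube)
  also have "\<dots> = cubic_b (z ^ 3) ^ 3"
  proof -
    have "(A ^ 4 / B) ^ 3 / A ^ 3 = (A ^ 3 / B) ^ 3" if "A \<noteq> 0" for A B :: complex
      using that by (simp add: field_simps eval_nat_numeral)
    thus ?thesis unfolding prod_euler_omega[OF assms] cubic_b_def z9
      using euler_nonzero[OF norm_power_lt[OF assms, of 3]] by simp
  qed
  also have "(a - c) * (a - omega * c) * (a - omega\<^sup>2 * c) = a ^ 3 - c ^ 3"
    using omega_sq by algebra
  finally show ?thesis by (simp add: a_def c_def algebra_simps)
qed

text \<open>The fourth powers of a over the three cube roots, plus 9 times the fourth power at z^3:
  the weight 9 cancels the series at z^9, as 24 * 81 = 9 * 216, and leaves 12 times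
  \<open>eisen4\<close>.\<close>

theorem eisen4_cubic:
  assumes "norm z < 1"
  shows "eisen4 (z ^ 3) = cubic_a (z ^ 3) ^ 4 + 8 * cubic_a (z ^ 3) * cubic_c_root z ^ 3"
proof -
  define a where "a = cubic_a (z ^ 3)"
  define c where "c = cubic_c_root z"
  have o: "(omega * z) ^ 3 = z ^ 3" "(omega\<^sup>2 * z) ^ 3 = z ^ 3" using omega_cube by algebra+
  have z9: "(z ^ 3) ^ 3 = z ^ 9" by (simp flip: power_mult)
  have n: "norm (omega * z) < 1" "norm (omega\<^sup>2 * z) < 1" "norm (z ^ 3) < 1"
    using assms norm_power_lt[OF assms, of 3] by (simp_all add: norm_mult norm_power norm_omega)
  have "(a + 2 * c) ^ 4 + (a + 2 * omega * c) ^ 4 + (a + 2 * omega\<^sup>2 * c) ^ 4 + 9 * a ^ 4 =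
      cubic_a z ^ 4 + cubic_a (omega * z) ^ 4 + cubic_a (omega\<^sup>2 * z) ^ 4 + 9 * cubic_a (z ^ 3) ^ 4"
    using cubic_relations(1-3)[OF assms] by (simp add: a_def c_def)
  also have "\<dots> = 12 + 24 * (power_lambert 3 z + power_lambert 3 (omega * z) + power_lambert 3 (omega\<^sup>2 * z)) +
      864 * power_lambert 3 (z ^ 3) + 1944 * power_lambert 3 (z ^ 9)"
    unfolding cubic_a_fourth[OF assms] cubic_a_fourth[OF n(1)] cubic_a_fourth[OF n(2)] cubic_a_fourth[OF n(3)] o z9 by simp
  also have "\<dots> = 12 * eisen4 (z ^ 3)"
    unfolding power_lambert_omega[OF assms] eisen4_def by simp
  also have "(a + 2 * c) ^ 4 + (a + 2 * omega * c) ^ 4 + (a + 2 * omega\<^sup>2 * c) ^ 4 + 9 * a ^ 4 = 12 * (a ^ 4 + 8 * a * c ^ 3)"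
    using omega_sq by algebra
  finally have "eisen4 (z ^ 3) = a ^ 4 + 8 * a * c ^ 3" by (metis mult_left_cancel zero_neq_numeral)
  thus ?thesis by (simp add: a_def c_def)
qed

section \<open>The hypergeometric equation at 0\<close>

text \<open>The indicial equation at 0 has the double root 0: the coefficient of degree m reads (m +
  1)^2 F_(m+1) plus terms in lower coefficients of F. Hence the solutions that are analytic at 0 are
  determined by their constant term.\<close>

lemma fps_singular_ode_zero:
  fixes F P Q R :: "complex fps"
  assumes "P $ 0 = 1" "Q $ 0 = 1" "F $ 0 = 0"
    and ode: "fps_X * P * fps_deriv (fps_deriv F) + Q * fps_deriv F + R * F = 0"
  shows "F = 0"
proof (rule fps_ext)
  fix n show "F $ n = 0 $ n"
  proof (induction n rule: less_induct)
    case (less n)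
    show ?case
    proof (cases n)
      case 0
      thus ?thesis using assms by simp
    next
      case (Suc m)
      have z: "F $ k = 0" if "k \<le> m" for k using less.IH[of k] that Suc by simp
      have "(P * (fps_X * fps_deriv (fps_deriv F))) $ m = (\<Sum>i=0..m. P $ i * (fps_X * fps_deriv (fps_deriv F)) $ (m - i))"
        by (rule fps_mult_nth)
      also have "\<dots> = (\<Sum>i=0..m. if i = 0 then of_nat m * of_nat (Suc m) * F $ Suc m else 0)"
      proof (intro sum.cong refl)
        fix i assume i: "i \<in> {0..m}"
        show "P $ i * (fps_X * fps_deriv (fps_deriv F)) $ (m - i) = (if i = 0 then of_nat m * of_nat (Suc m) * F $ Suc m else 0)"
        proof (cases "i = 0")
          case True
          thus ?thesis using assms(1) by (cases m) (simp_all add: algebra_simps)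
        next
          case False
          hence "m - i = 0 \<or> F $ Suc (m - i) = 0" using i z[of "Suc (m - i)"] by auto
          thus ?thesis using False by (cases "m - i") auto
        qed
      qed
      finally have 1: "(P * (fps_X * fps_deriv (fps_deriv F))) $ m = of_nat m * of_nat (Suc m) * F $ Suc m" by simp
      have "(Q * fps_deriv F) $ m = (\<Sum>i=0..m. Q $ i * fps_deriv F $ (m - i))"
        by (rule fps_mult_nth)
      also have "\<dots> = (\<Sum>i=0..m. if i = 0 then of_nat (Suc m) * F $ Suc m else 0)"
      proof (intro sum.cong refl)
        fix i assume i: "i \<in> {0..m}"
        show "Q $ i * fps_deriv F $ (m - i) = (if i = 0 then of_nat (Suc m) * F $ Suc m else 0)"
        proof (cases "i = 0")
          case False
          hence "F $ Suc (m - i) = 0" using i by (intro z) auto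
          thus ?thesis using False by simp
        qed (use assms(2) in simp)
      qed
      finally have 2: "(Q * fps_deriv F) $ m = of_nat (Suc m) * F $ Suc m" by simp
      have 3: "(R * F) $ m = 0" unfolding fps_mult_nth by (intro sum.neutral) (simp add: z)
      have "(P * (fps_X * fps_deriv (fps_deriv F)) + Q * fps_deriv F + R * F) $ m = 0"
      proof -
        have "fps_X * P * D = P * (fps_X * D)" for D by (simp only: mult_ac)
        from ode[unfolded this] show ?thesis by (simp only: fps_zero_nth)
      qed
      hence "of_nat m * of_nat (Suc m) * F $ Suc m + of_nat (Suc m) * F $ Suc m = 0"
        unfolding fps_add_nth 1 2 3 by simp
      moreover have "of_nat m * of_nat (Suc m) * y + of_nat (Suc m) * y = of_nat (Suc m) * (of_nat (Suc m) * y)" for y :: complex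
        by (simp add: algebra_simps)
      ultimately have "of_nat (Suc m) * (of_nat (Suc m) * F $ Suc m) = 0" by (simp only:)
      hence "F $ Suc m = 0" by (simp only: mult_eq_0_iff of_nat_eq_0_iff nat.distinct simp_thms)
      thus ?thesis using Suc by simp
    qed
  qed
qed

text \<open>The equation is demanded only off 0, where pullbacks with coefficients such as 1 / s can
  be computed; \<open>singular_ode_unique\<close> extends it to 0 by continuity.\<close>

definition solves_ode :: "(complex \<Rightarrow> complex) \<Rightarrow> (complex \<Rightarrow> complex) \<Rightarrow> (complex \<Rightarrow> complex) \<Rightarrow> (complex \<Rightarrow> complex) \<Rightarrow> bool"
  where "solves_ode p q r f \<longleftrightarrow> f analytic_on {0} \<and>
    (\<forall>\<^sub>F s in at 0. s * p s * deriv (deriv f) s + q s * deriv f s + r s * f s = 0)"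

lemma singular_ode_unique:
  fixes f p q r :: "complex \<Rightarrow> complex"
  assumes sol: "solves_ode p q r f" "solves_ode p q r g" and p: "p analytic_on {0}" "q analytic_on {0}" "r analytic_on {0}"
    and 1: "p 0 = 1" "q 0 = 1" and 0: "f 0 = g 0"
  shows "\<forall>\<^sub>F s in nhds 0. f s = g s"
proof -
  have f: "f analytic_on {0}" "g analytic_on {0}"
    and odef: "\<forall>\<^sub>F s in at 0. s * p s * deriv (deriv f) s + q s * deriv f s + r s * f s = 0"
    and odeg: "\<forall>\<^sub>F s in at 0. s * p s * deriv (deriv g) s + q s * deriv g s + r s * g s = 0"
    using sol by (auto simp: solves_ode_def)
  obtain F G P Q R where e: "f has_fps_expansion F" "g has_fps_expansion G" "p has_fps_expansion P" "q has_fps_expansion Q" "r has_fps_expansion R"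
    using analytic_at_imp_has_fps_expansion_0 f p by metis
  have d: "deriv f has_fps_expansion fps_deriv F" "deriv (deriv f) has_fps_expansion fps_deriv (fps_deriv F)"
     "deriv g has_fps_expansion fps_deriv G" "deriv (deriv g) has_fps_expansion fps_deriv (fps_deriv G)"
    by (intro has_fps_expansion_deriv e)+
  let ?H = "fps_X * P * fps_deriv (fps_deriv (F - G)) + Q * fps_deriv (F - G) + R * (F - G)"
  let ?h = "\<lambda>s. s * p s * (deriv (deriv f) s - deriv (deriv g) s) + q s * (deriv f s - deriv g s) + r s * (f s - g s)"
  have h: "?h has_fps_expansion ?H"
    unfolding fps_deriv_sub by (intro fps_expansion_intros e d)
  have "\<forall>\<^sub>F s in at 0. ?h s = 0"
    using odef odeg
  proof eventually_elim
    case (elim s)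
    have "?h s = (s * p s * deriv (deriv f) s + q s * deriv f s + r s * f s) - (s * p s * deriv (deriv g) s + q s * deriv g s + r s * g s)"
      by (simp add: algebra_simps)
    thus ?case unfolding elim by simp
  qed
  moreover have "isCont ?h 0" using has_fps_expansion_imp_continuous[OF h, of UNIV] by simp
  ultimately have "?h 0 = 0"
  proof -
    have "(?h \<longlongrightarrow> ?h 0) (at 0)" using \<open>isCont ?h 0\<close> by (simp only: isCont_def)
    moreover have "(?h \<longlongrightarrow> 0) (at 0)" by (rule tendsto_eventually) fact
    ultimately show ?thesis using tendsto_unique[OF at_neq_bot] by blast
  qed
  with \<open>\<forall>\<^sub>F s in at 0. ?h s = 0\<close> have "\<forall>\<^sub>F s in nhds 0. ?h s = 0"
    by (simp only: eventually_nhds_conv_at simp_thms)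
  hence "?h has_fps_expansion 0" by (simp add: has_fps_expansion_0_iff)
  with h have H: "?H = 0" by (rule fps_expansion_unique_complex)
  have "F - G = 0"
  proof (rule fps_singular_ode_zero[OF _ _ _ H])
    show "P $ 0 = 1" "Q $ 0 = 1" "(F - G) $ 0 = 0"
      using has_fps_expansion_imp_0_eq_fps_nth_0[OF e(1)] has_fps_expansion_imp_0_eq_fps_nth_0[OF e(2)]
        has_fps_expansion_imp_0_eq_fps_nth_0[OF e(3)] has_fps_expansion_imp_0_eq_fps_nth_0[OF e(4)] 1 0 by simp_all
  qed
  moreover have "(\<lambda>s. f s - g s) has_fps_expansion F - G" by (intro fps_expansion_intros e)
  ultimately have "\<forall>\<^sub>F s in nhds 0. f s - g s = 0" by (simp add: has_fps_expansion_0_iff)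
  thus ?thesis by eventually_elim simp
qed

lemma hypergeo_conv_radius:
  fixes a b :: real
  assumes "0 < a" "a \<le> 1" "0 < b" "b \<le> 1"
  shows "fps_conv_radius (fps_hypergeo [complex_of_real a, complex_of_real b] [1] 1) \<ge> 1"
proof -
  let ?F = "fps_hypergeo [complex_of_real a, complex_of_real b] [1] 1"
  have rec: "?F $ Suc n = ((of_real a + of_nat n) * (of_real b + of_nat n) / (of_nat (Suc n) * (1 + of_nat n))) * ?F $ n" for n
    by (subst fps_hypergeo_rec) (simp only: foldl_Cons foldl_Nil mult_1_left)
  have "norm (?F $ n) \<le> 1" for n
  proof (induction n)
    case (Suc n)
    have "norm ((of_real a + of_nat n) * (of_real b + of_nat n) / (of_nat (Suc n) * (1 + of_nat n)) :: complex) =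
      (a + real n) * (b + real n) / (real (Suc n) * (1 + real n))"
    proof -
      have "((of_real a + of_nat n) * (of_real b + of_nat n) / (of_nat (Suc n) * (1 + of_nat n)) :: complex) =
        of_real ((a + real n) * (b + real n) / (real (Suc n) * (1 + real n)))" by simp
      thus ?thesis using assms by (simp only: norm_of_real) (simp add: abs_mult)
    qed
    also have "\<dots> \<le> 1" using assms by (simp add: divide_le_eq_1) (intro mult_mono, auto)
    finally show ?case unfolding rec by (subst norm_mult) (rule mult_le_one[OF _ norm_ge_zero Suc])
  qed simp
  hence le: "norm (?F $ n * of_real r ^ n) \<le> r ^ n" if "0 < r" for n r
    unfolding norm_mult using that mult_right_mono[of "norm (?F $ n)" 1 "r ^ n"] by (simp add: norm_power)
  have "1 \<le> conv_radius (fps_nth ?F)"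
  proof (rule conv_radius_geI_ex')
    fix r :: real assume r: "0 < r" "ereal r < 1"
    hence "summable (\<lambda>n. r ^ n)" by (intro summable_geometric) (simp add: one_ereal_def)
    thus "summable (\<lambda>n. ?F $ n * of_real r ^ n)"
      by (rule summable_comparison_test') (rule le[OF r(1)])
  qed
  thus ?thesis by (simp add: fps_conv_radius_def)
qed

lemma hyp2f1_facts:
  fixes a b :: real
  assumes "0 < a" "a \<le> 1" "0 < b" "b \<le> 1"
  defines "f \<equiv> hyp2f1 (of_real a) (of_real b) 1"
  shows "f holomorphic_on ball 0 1" "f 0 = 1"
    and "\<forall>\<^sub>F x in nhds 0. x * (1 - x) * deriv (deriv f) x + (1 - (of_real a + of_real b + 1) * x) * deriv f x - of_real a * of_real b * f x = 0"
proof -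
  define F where "F = fps_hypergeo [complex_of_real a, complex_of_real b] [1] 1"
  have r: "fps_conv_radius F \<ge> 1" unfolding F_def by (rule hypergeo_conv_radius[OF assms(1-4)])
  have fF: "f = eval_fps F" by (simp add: f_def hyp2f1_def F_def fun_eq_iff)
  show "f 0 = 1" by (simp add: fF eval_fps_at_0 F_def)
  show "f holomorphic_on ball 0 1" unfolding fF
  proof (rule holomorphic_on_eval_fps, rule subsetI)
    fix x :: complex assume "x \<in> ball 0 1"
    hence "ereal (norm x) < 1" by (simp add: one_ereal_def)
    also note r
    finally show "x \<in> eball 0 (fps_conv_radius F)" by (simp add: in_eball_iff)
  qed
  have e: "f has_fps_expansion F" unfolding fF using r by (intro eval_fps_has_fps_expansion) (auto intro: less_le_trans[of 0 1])
  have d: "deriv f has_fps_expansion fps_deriv F" "deriv (deriv f) has_fps_expansion fps_deriv (fps_deriv F)"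
    by (intro has_fps_expansion_deriv e)+
  let ?A = "complex_of_real a" and ?B = "complex_of_real b"
  let ?H = "fps_X * (1 - fps_X) * fps_deriv (fps_deriv F) + (1 - fps_const (?A + ?B + 1) * fps_X) * fps_deriv F - fps_const (?A * ?B) * F"
  have "(\<lambda>x. x * (1 - x) * deriv (deriv f) x + (1 - (?A + ?B + 1) * x) * deriv f x - (?A * ?B) * f x) has_fps_expansion ?H"
    by (intro fps_expansion_intros e d)
  moreover have "?H = 0"
  proof (rule fps_ext)
    fix n
    have rec: "F $ Suc n = ((?A + of_nat n) * (?B + of_nat n) / (of_nat (Suc n) * (1 + of_nat n))) * F $ n"
      unfolding F_def by (subst fps_hypergeo_rec) (simp only: foldl_Cons foldl_Nil mult_1_left)
    have nz: "of_nat (Suc n) \<noteq> (0 :: complex)" "1 + of_nat n \<noteq> (0 :: complex)" by (simp_all del: of_nat_Suc) (metis of_nat_Suc of_nat_eq_0_iff old.nat.distinct(2))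
    hence rec': "of_nat (Suc n) * (1 + of_nat n) * F $ Suc n = (?A + of_nat n) * (?B + of_nat n) * F $ n"
      unfolding rec by (simp del: of_nat_Suc)
    have "?H = fps_X * fps_deriv (fps_deriv F) - fps_X * (fps_X * fps_deriv (fps_deriv F)) + fps_deriv F
        - fps_const (?A + ?B + 1) * (fps_X * fps_deriv F) - fps_const (?A * ?B) * F"
      by (simp add: algebra_simps)
    hence "?H $ n = of_nat (Suc n) * (1 + of_nat n) * F $ Suc n - (?A + of_nat n) * (?B + of_nat n) * F $ n"
      by (cases n) (simp_all add: algebra_simps eval_nat_numeral split: nat.splits)
    thus "?H $ n = 0 $ n" unfolding rec' by simp
  qed
  ultimately show "\<forall>\<^sub>F x in nhds 0. x * (1 - x) * deriv (deriv f) x + (1 - (?A + ?B + 1) * x) * deriv f x - ?A * ?B * f x = 0"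
    by (simp add: has_fps_expansion_0_iff)
qed

text \<open>
  The pullback of the hypergeometric equation along \<open>x\<close>, twisted by \<open>w\<close>. The functions \<open>\<rho>\<close> and \<open>\<xi>\<close> are the
  logarithmic derivatives of \<open>w\<close> and \<open>x\<close>, and \<open>\<kappa> = \<xi>\<^sup>2 x / (1 - x)\<close>.
\<close>
lemma hypergeo_pullback:
  fixes a b :: real and p q r w x \<rho> \<rho>' \<xi> \<xi>' \<kappa> :: "complex \<Rightarrow> complex"
  assumes ab: "0 < a" "a \<le> 1" "0 < b" "b \<le> 1"
    and S: "open S" "0 \<in> S" and x: "x holomorphic_on S" "x 0 = 0" and w: "w holomorphic_on S"
    and dw: "\<And>s. s \<in> S - {0} \<Longrightarrow> (w has_field_derivative \<rho> s * w s) (at s)"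
    and d\<rho>: "\<And>s. s \<in> S - {0} \<Longrightarrow> (\<rho> has_field_derivative \<rho>' s) (at s)"
    and dx: "\<And>s. s \<in> S - {0} \<Longrightarrow> (x has_field_derivative \<xi> s * x s) (at s)"
    and d\<xi>: "\<And>s. s \<in> S - {0} \<Longrightarrow> (\<xi> has_field_derivative \<xi>' s) (at s)"
    and k: "\<And>s. s \<in> S - {0} \<Longrightarrow> x s \<noteq> 0 \<and> x s \<noteq> 1 \<and> x s * \<xi> s ^ 2 = \<kappa> s * (1 - x s)"
    and C1: "\<And>s. s \<in> S - {0} \<Longrightarrow> s * p s * (2 * \<rho> s * \<xi> s + \<xi>' s + (of_real a + of_real b) * \<kappa> s) + q s * \<xi> s = 0"
    and C2: "\<And>s. s \<in> S - {0} \<Longrightarrow> s * p s * (\<rho> s ^ 2 + \<rho>' s + of_real a * of_real b * \<kappa> s) + q s * \<rho> s + r s = 0"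
  shows "solves_ode p q r (\<lambda>s. w s * hyp2f1 (of_real a) (of_real b) 1 (x s))"
proof -
  define f where "f \<equiv> \<lambda>s. w s * hyp2f1 (of_real a) (of_real b) 1 (x s)"
  define A where "A = complex_of_real a"
  define B where "B = complex_of_real b"
  define G where "G = hyp2f1 A B 1"
  note G = hyp2f1_facts[OF ab, folded A_def B_def, folded G_def]
  have fG: "f = (\<lambda>s. w s * G (x s))" by (simp add: f_def G_def A_def B_def)
  from G(3) obtain U where U: "open U" "0 \<in> U"
    and ode: "\<And>y. y \<in> U \<Longrightarrow> y * (1 - y) * deriv (deriv G) y + (1 - (A + B + 1) * y) * deriv G y - A * B * G y = 0"
    unfolding eventually_nhds by blast
  define V where "V = U \<inter> ball 0 1"
  have V: "open V" "0 \<in> V" using U by (auto simp: V_def)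
  have GV: "G holomorphic_on V" by (rule holomorphic_on_subset[OF G(1)]) (auto simp: V_def)
  define T where "T = S \<inter> x -` V"
  have T: "open T" "0 \<in> T"
    using continuous_open_preimage[OF holomorphic_on_imp_continuous_on[OF x(1)] S(1) V(1)] S(2) x(2) V(2)
    by (auto simp: T_def)
  have TS: "T \<subseteq> S" by (auto simp: T_def)
  have "f holomorphic_on T"
    unfolding fG by (intro holomorphic_on_mult holomorphic_on_subset[OF w TS] holomorphic_on_compose_gen[OF holomorphic_on_subset[OF x(1) TS] GV, unfolded o_def])
      (auto simp: T_def)
  hence fa: "f analytic_on {0}" using T analytic_at by blast
  define G1 where "G1 = deriv G"
  define G2 where "G2 = deriv (deriv G)"
  have dG: "(G has_field_derivative G1 y) (at y)" "(G1 has_field_derivative G2 y) (at y)" if "y \<in> V" for y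
    unfolding G1_def G2_def using holomorphic_derivI[OF GV V(1) that] holomorphic_derivI[OF holomorphic_deriv[OF GV V(1)] V(1) that] .
  have oT: "open (T - {0})" using T by (simp add: open_delete)
  have dGx: "((\<lambda>s. G (x s)) has_field_derivative G1 (x s) * (\<xi> s * x s)) (at s)"
    "((\<lambda>s. G1 (x s)) has_field_derivative G2 (x s) * (\<xi> s * x s)) (at s)" if "s \<in> T - {0}" for s
  proof -
    have s: "s \<in> S - {0}" "x s \<in> V" using that by (auto simp: T_def)
    show "((\<lambda>s. G (x s)) has_field_derivative G1 (x s) * (\<xi> s * x s)) (at s)"
      by (rule DERIV_chain2[OF dG(1)[OF s(2)] dx[OF s(1)]])
    show "((\<lambda>s. G1 (x s)) has_field_derivative G2 (x s) * (\<xi> s * x s)) (at s)"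
      by (rule DERIV_chain2[OF dG(2)[OF s(2)] dx[OF s(1)]])
  qed
  define f1 where "f1 s = w s * (\<rho> s * G (x s) + x s * \<xi> s * G1 (x s))" for s
  define f2 where "f2 s = w s * ((\<rho> s ^ 2 + \<rho>' s) * G (x s) + (2 * \<rho> s * \<xi> s + \<xi>' s + \<xi> s ^ 2) * (x s * G1 (x s)) + (x s * \<xi> s) ^ 2 * G2 (x s))" for s
  have df: "(f has_field_derivative f1 s) (at s)" if "s \<in> T - {0}" for s
  proof -
    have s: "s \<in> S - {0}" using that by (auto simp: T_def)
    show ?thesis unfolding fG f1_def
      by (rule DERIV_cong[OF DERIV_mult[OF dw[OF s] dGx(1)[OF that]]]) (simp add: algebra_simps)
  qed
  have df1: "(f1 has_field_derivative f2 s) (at s)" if "s \<in> T - {0}" for s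
  proof -
    have s: "s \<in> S - {0}" using that by (auto simp: T_def)
    show ?thesis unfolding f1_def f2_def
      by (rule DERIV_cong[OF DERIV_mult[OF dw[OF s] DERIV_add[OF DERIV_mult[OF d\<rho>[OF s] dGx(1)[OF that]]
         DERIV_mult[OF DERIV_mult[OF dx[OF s] d\<xi>[OF s]] dGx(2)[OF that]]]]])
        (simp add: algebra_simps power2_eq_square)
  qed
  have e1: "deriv f s = f1 s" if "s \<in> T - {0}" for s by (rule DERIV_imp_deriv[OF df[OF that]])
  have e2: "deriv (deriv f) s = f2 s" if "s \<in> T - {0}" for s
  proof (rule DERIV_imp_deriv)
    show "(deriv f has_field_derivative f2 s) (at s)"
      by (rule has_field_derivative_transform_within_open[OF df1[OF that] oT that]) (simp add: e1)
  qed
  have key: "s * p s * f2 s + q s * f1 s + r s * f s = 0" if "s \<in> T - {0}" for s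
  proof -
    have s: "s \<in> S - {0}" "x s \<in> U" using that by (auto simp: T_def V_def)
    note kk = k[OF s(1)]
    have o: "x s * (1 - x s) * G2 (x s) = A * B * G (x s) - (1 - (A + B + 1) * x s) * G1 (x s)"
      using ode[OF s(2)] unfolding G1_def G2_def by (simp add: algebra_simps)
    \<comment> \<open>Multiplication by 1 - x allows the second derivative of the hypergeometric
      function to be eliminated without division. What remains is a combination of G(x) and x G'(x),
      whose coefficients are the left sides of \<open>C2\<close> and \<open>C1\<close>.\<close>
    have "(1 - x s) * (s * p s * f2 s + q s * f1 s + r s * f s) = w s *
       ((1 - x s) * (s * p s * (\<rho> s ^ 2 + \<rho>' s) + q s * \<rho> s + r s) * G (x s)
        + (1 - x s) * (s * p s * (2 * \<rho> s * \<xi> s + \<xi>' s + \<xi> s ^ 2) + q s * \<xi> s) * (x s * G1 (x s))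
        + s * p s * (x s * \<xi> s ^ 2) * (x s * (1 - x s) * G2 (x s)))"
      unfolding f1_def f2_def fG by (simp add: algebra_simps power2_eq_square)
    also have "\<dots> = w s * (1 - x s) * ((s * p s * (\<rho> s ^ 2 + \<rho>' s + A * B * \<kappa> s) + q s * \<rho> s + r s) * G (x s)
        + (s * p s * (2 * \<rho> s * \<xi> s + \<xi>' s + (A + B) * \<kappa> s) + q s * \<xi> s) * (x s * G1 (x s)))"
    proof -
      have "W * ((1 - X) * (S * (R2 + R1) + QR + r') * g + (1 - X) * (S * (t + Y + Z ^ 2) + QZ) * (X * g1) + S * (X * Z ^ 2) * (X * (1 - X) * g2)) =
        W * (1 - X) * ((S * (R2 + R1 + A * B * K) + QR + r') * g + (S * (t + Y + (A + B) * K) + QZ) * (X * g1))"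
        if "X * Z ^ 2 = K * (1 - X)" "X * (1 - X) * g2 = A * B * g - (1 - (A + B + 1) * X) * g1"
        for W X S R2 R1 QR r' g t Y Z QZ g1 g2 K :: complex
        using that by algebra
      thus ?thesis using kk o by blast
    qed
    also have "\<dots> = 0" using C1[OF s(1)] C2[OF s(1)] unfolding A_def B_def by simp
    finally show ?thesis using kk by simp
  qed
  have "\<forall>\<^sub>F s in at 0. s \<in> T - {0}" by (rule eventually_at_in_open[OF T])
  hence "\<forall>\<^sub>F s in at 0. s * p s * deriv (deriv f) s + q s * deriv f s + r s * f s = 0"
    by eventually_elim (use e1 e2 key in auto)
  with fa show ?thesis by (simp add: solves_ode_def f_def)
qed

lemma hyp2f1_0: "hyp2f1 a b c 0 = 1"
  by (simp add: hyp2f1_def eval_fps_at_0)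

section \<open>Algebraic transformations of hypergeometric functions\<close>

lemma one_plus_nonzero: "norm z < 1 \<Longrightarrow> 1 + z \<noteq> (0 :: complex)"
  by (metis add_eq_0_iff norm_minus_cancel norm_one order_less_irrefl)

lemma small_nonzero:
  fixes s :: complex
  assumes "norm s < 1 / 100"
  shows "1 - s \<noteq> 0" "1 + s \<noteq> 0" "1 + 8 * s \<noteq> 0" "1 - 2 * s \<noteq> 0" "2 - s \<noteq> 0" "1 - s + s\<^sup>2 \<noteq> 0" "1 - 20 * s - 8 * s\<^sup>2 \<noteq> 0"
proof -
  have s2: "norm (s\<^sup>2) \<le> norm s" using assms by (simp add: norm_mult power2_eq_square mult_left_le)
  show "1 - s \<noteq> 0" "1 + s \<noteq> 0" "1 + 8 * s \<noteq> 0" "1 - 2 * s \<noteq> 0"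
    using one_plus_nonzero[of "- s"] one_plus_nonzero[of s] one_plus_nonzero[of "8 * s"] one_plus_nonzero[of "- (2 * s)"] assms
    by (simp_all add: norm_mult)
  show "2 - s \<noteq> 0" using one_plus_nonzero[of "- s / 2"] assms by (auto simp: norm_divide field_simps)
  have "norm (- s + s\<^sup>2) < 1" using norm_triangle_ineq[of "- s" "s\<^sup>2"] s2 assms by simp
  from one_plus_nonzero[OF this] show "1 - s + s\<^sup>2 \<noteq> 0" by (simp add: algebra_simps)
  have "norm (- (20 * s) + (- 8) * s\<^sup>2) < 1" using norm_triangle_ineq[of "- (20 * s)" "(- 8) * s\<^sup>2"] s2 assms by (simp add: norm_mult)
  from one_plus_nonzero[OF this] show "1 - 20 * s - 8 * s\<^sup>2 \<noteq> 0" by (simp add: algebra_simps)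
qed

lemma Ln_one_plus_deriv:
  assumes "norm (z s) < 1" "(z has_field_derivative d) (at s)"
  shows "((\<lambda>s. exp (c * Ln (1 + z s))) has_field_derivative (c * d / (1 + z s)) * exp (c * Ln (1 + z s))) (at s)"
proof -
  have nn: "1 + z s \<notin> \<real>\<^sub>\<le>\<^sub>0"
  proof
    assume "1 + z s \<in> \<real>\<^sub>\<le>\<^sub>0"
    hence "Re (1 + z s) \<le> 0" by (simp only: complex_nonpos_Reals_iff)
    hence "1 \<le> \<bar>Re (z s)\<bar>" by simp
    thus False using abs_Re_le_cmod[of "z s"] assms(1) by linarith
  qed
  have "1 + z s \<noteq> 0" by (rule one_plus_nonzero[OF assms(1)])
  have "((\<lambda>s. 1 + z s) has_field_derivative d) (at s)" using assms(2) by (auto intro!: derivative_eq_intros)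
  from DERIV_chain2[where f = Ln and g = "\<lambda>s. 1 + z s", OF has_field_derivative_Ln[OF nn] this]
  have "((\<lambda>s. Ln (1 + z s)) has_field_derivative inverse (1 + z s) * d) (at s)" .
  from DERIV_fun_exp[OF DERIV_cmult[OF this, of c]] show ?thesis
    by (simp only: divide_inverse mult_ac)
qed

lemma holomorphic_fromI:
  assumes "\<And>s. s \<in> S \<Longrightarrow> (f has_field_derivative f' s) (at s)"
  shows "f holomorphic_on S"
  using assms unfolding holomorphic_on_def field_differentiable_def using has_field_derivative_at_within by blast

text \<open>The untwisted pullback along the identity; it provides the common target equation of the
  cubic, quartic and sextic transformations.\<close>

lemma hypergeo_self_ode:
  fixes a b :: real
  assumes "0 < a" "a \<le> 1" "0 < b" "b \<le> 1" "a + b = 1"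
  shows "solves_ode (\<lambda>s. 1 - s) (\<lambda>s. 1 - 2 * s) (\<lambda>_. - (of_real a * of_real b)) (hyp2f1 (of_real a) (of_real b) 1)"
proof -
  have ab: "of_real a + of_real b = (1 :: complex)" using assms(5) by (metis of_real_add of_real_1)
  have "solves_ode (\<lambda>s. 1 - s) (\<lambda>s. 1 - 2 * s) (\<lambda>_. - (of_real a * of_real b)) (\<lambda>s. 1 * hyp2f1 (of_real a) (of_real b) 1 s)"
    by (rule hypergeo_pullback[where S = "ball 0 1" and \<rho> = "\<lambda>_. 0" and \<rho>' = "\<lambda>_. 0" and \<xi> = "\<lambda>s. 1 / s"
          and \<xi>' = "\<lambda>s. - 1 / s\<^sup>2" and \<kappa> = "\<lambda>s. 1 / (s * (1 - s))" and x = "\<lambda>s. s", OF assms(1-4)])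
      (auto intro!: derivative_eq_intros simp: ab divide_simps power2_eq_square algebra_simps)
  thus ?thesis by simp
qed

lemma power_cancel_weight:
  fixes w z K G :: complex
  assumes "w ^ n * z = 1" "K = w * G"
  shows "G ^ n = z * K ^ n"
proof -
  have "z * K ^ n = (w ^ n * z) * G ^ n" unfolding assms(2) power_mult_distrib by (simp only: ac_simps)
  thus ?thesis unfolding assms(1) by simp
qed

text \<open>For s = alpha_3 the argument on the left is 1728/j. That 1 - x is a square divided by (1
  + 8s)^3 matches the square root type of the point 1, where the exponents of 2F1(1/12, 5/12; 1)
  differ by 1/2.\<close>

theorem cubic_pullback:
  "\<forall>\<^sub>F s in nhds 0. hyp2f1 (1/12) (5/12) 1 (64 * s * (1 - s) ^ 3 / (1 + 8 * s) ^ 3) ^ 4 = (1 + 8 * s) * K_hat 3 s ^ 4"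
proof -
  define S :: "complex set" where "S = ball 0 (1 / 100)"
  \<comment> \<open>The branch of (1 + 8s)^(-1/4) with value 1 at 0. It disappears from the
    statement because fourth powers are taken.\<close>
  define w :: "complex \<Rightarrow> complex" where "w s = exp (- 1 / 4 * Ln (1 + 8 * s))" for s
  define x :: "complex \<Rightarrow> complex" where "x s = 64 * s * (1 - s) ^ 3 / (1 + 8 * s) ^ 3" for s
  have S: "open S" "0 \<in> S" by (simp_all add: S_def)
  have nz: "1 - s \<noteq> 0" "1 + 8 * s \<noteq> 0" "1 - 20 * s - 8 * s\<^sup>2 \<noteq> 0" if "s \<in> S" for s
    using small_nonzero[of s] that by (simp_all add: S_def)
  have dw: "(w has_field_derivative - 2 / (1 + 8 * s) * w s) (at s)" if "s \<in> S" for s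
    unfolding w_def
    by (rule DERIV_cong[OF Ln_one_plus_deriv[of "\<lambda>s. 8 * s" s 8]])
      (use that in \<open>auto simp: S_def norm_mult intro!: derivative_eq_intros\<close>)
  have x1: "1 - x s = (1 - 20 * s - 8 * s\<^sup>2)\<^sup>2 / (1 + 8 * s) ^ 3" if "s \<in> S" for s
    using nz[OF that] by (simp add: x_def divide_simps) (simp add: eval_nat_numeral algebra_simps)
  have xh: "x holomorphic_on S" unfolding x_def by (intro holomorphic_intros) (use nz in auto)
  have wh: "w holomorphic_on S" by (rule holomorphic_fromI) (rule dw)
  have xi: "1 / s - 3 / (1 - s) - 24 / (1 + 8 * s) = (1 - 20 * s - 8 * s\<^sup>2) / (s * (1 - s) * (1 + 8 * s))" if "s \<in> S - {0}" for s
    using nz[of s] that by (simp add: divide_simps) (simp add: eval_nat_numeral algebra_simps)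
  have P: "solves_ode (\<lambda>s. 1 - s) (\<lambda>s. 1 - 2 * s) (\<lambda>_. - (of_real (1 / 3) * of_real (2 / 3)))
      (\<lambda>s. w s * hyp2f1 (of_real (1 / 12)) (of_real (5 / 12)) 1 (x s))"
  proof (rule hypergeo_pullback[where S = S
      and \<rho> = "\<lambda>s. - 2 / (1 + 8 * s)" and \<rho>' = "\<lambda>s. 16 / (1 + 8 * s)\<^sup>2"
      and \<xi> = "\<lambda>s. 1 / s - 3 / (1 - s) - 24 / (1 + 8 * s)" and \<xi>' = "\<lambda>s. - 1 / s\<^sup>2 - 3 / (1 - s)\<^sup>2 + 192 / (1 + 8 * s)\<^sup>2"
      and \<kappa> = "\<lambda>s. 64 * (1 - s) / (s * (1 + 8 * s)\<^sup>2)", OF _ _ _ _ S xh _ wh])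
    fix s assume s: "s \<in> S - {0}"
    hence s': "s \<in> S" "s \<noteq> 0" by auto
    note n = nz[OF s'(1)] s'(2)
    show "(w has_field_derivative - 2 / (1 + 8 * s) * w s) (at s)" by (rule dw[OF s'(1)])
    show "((\<lambda>s. - 2 / (1 + 8 * s)) has_field_derivative 16 / (1 + 8 * s)\<^sup>2) (at s)"
      using n by (auto intro!: derivative_eq_intros simp: power2_eq_square)
    show "(x has_field_derivative (1 / s - 3 / (1 - s) - 24 / (1 + 8 * s)) * x s) (at s)"
      unfolding xi[OF s] unfolding x_def using n
      by (auto intro!: derivative_eq_intros) (simp add: divide_simps, simp add: eval_nat_numeral algebra_simps)
    show "((\<lambda>s. 1 / s - 3 / (1 - s) - 24 / (1 + 8 * s)) has_field_derivative - 1 / s\<^sup>2 - 3 / (1 - s)\<^sup>2 + 192 / (1 + 8 * s)\<^sup>2) (at s)"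
      using n by (auto intro!: derivative_eq_intros simp: power2_eq_square)
    show "x s \<noteq> 0 \<and> x s \<noteq> 1 \<and> x s * (1 / s - 3 / (1 - s) - 24 / (1 + 8 * s))\<^sup>2 = 64 * (1 - s) / (s * (1 + 8 * s)\<^sup>2) * (1 - x s)"
    proof (intro conjI)
      show "x s \<noteq> 0" using n by (simp add: x_def)
      have "1 - x s \<noteq> 0" unfolding x1[OF s'(1)] using n by simp
      thus "x s \<noteq> 1" by auto
      have "64 * s * a ^ 3 / b ^ 3 * (c / (s * a * b))\<^sup>2 = 64 * a / (s * b\<^sup>2) * (c\<^sup>2 / b ^ 3)" if "a \<noteq> 0" "b \<noteq> 0" for a b c
        using that n(4) by (simp add: field_simps eval_nat_numeral)
      from this[OF n(1,2)] show "x s * (1 / s - 3 / (1 - s) - 24 / (1 + 8 * s))\<^sup>2 = 64 * (1 - s) / (s * (1 + 8 * s)\<^sup>2) * (1 - x s)"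
        unfolding xi[OF s] x1[OF s'(1)] unfolding x_def .
    qed
    show "s * (1 - s) * (2 * (- 2 / (1 + 8 * s)) * (1 / s - 3 / (1 - s) - 24 / (1 + 8 * s)) + (- 1 / s\<^sup>2 - 3 / (1 - s)\<^sup>2 + 192 / (1 + 8 * s)\<^sup>2) +
        (of_real (1 / 12) + of_real (5 / 12)) * (64 * (1 - s) / (s * (1 + 8 * s)\<^sup>2))) + (1 - 2 * s) * (1 / s - 3 / (1 - s) - 24 / (1 + 8 * s)) = 0"
      using n by (simp add: divide_simps) (simp add: eval_nat_numeral algebra_simps)
    show "s * (1 - s) * ((- 2 / (1 + 8 * s))\<^sup>2 + 16 / (1 + 8 * s)\<^sup>2 + of_real (1 / 12) * of_real (5 / 12) * (64 * (1 - s) / (s * (1 + 8 * s)\<^sup>2))) +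
        (1 - 2 * s) * (- 2 / (1 + 8 * s)) + - (of_real (1 / 3) * of_real (2 / 3)) = 0"
      using n by (simp add: divide_simps) (simp add: eval_nat_numeral algebra_simps)
  qed (simp_all add: x_def)
  have "\<forall>\<^sub>F s in nhds 0. w s * hyp2f1 (of_real (1 / 12)) (of_real (5 / 12)) 1 (x s) = hyp2f1 (of_real (1 / 3)) (of_real (2 / 3)) 1 s"
    by (rule singular_ode_unique[OF P hypergeo_self_ode]) (auto intro!: analytic_intros simp: hyp2f1_0 w_def x_def)
  moreover have "\<forall>\<^sub>F s in nhds 0. s \<in> S" using S by (rule eventually_nhds_in_open)
  ultimately show ?thesis
  proof eventually_elim
    case (elim s)
    have "w s ^ 4 * (1 + 8 * s) = 1"
    proof -
      have "w s ^ 4 = exp (- Ln (1 + 8 * s))" unfolding w_def by (simp flip: exp_of_nat_mult)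
      thus ?thesis using nz[OF elim(2)] by (simp add: exp_minus)
    qed
    moreover have "K_hat 3 s = w s * hyp2f1 (1/12) (5/12) 1 (x s)" using elim(1) by (simp add: K_hat_def)
    ultimately have "hyp2f1 (1/12) (5/12) 1 (x s) ^ 4 = (1 + 8 * s) * K_hat 3 s ^ 4" by (rule power_cancel_weight)
    thus ?case by (simp add: x_def)
  qed
qed

lemma quadratic_map:
  fixes s :: complex
  assumes "s \<noteq> 0" "1 + s \<noteq> 0" "1 - s \<noteq> 0"
  defines "x \<equiv> \<lambda>s. 4 * s / (1 + s)\<^sup>2"
  shows "(x has_field_derivative (1 / s - 2 / (1 + s)) * x s) (at s)"
    and "((\<lambda>s. 1 / s - 2 / (1 + s)) has_field_derivative - 1 / s\<^sup>2 + 2 / (1 + s)\<^sup>2) (at s)"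
    and "x s \<noteq> 0 \<and> x s \<noteq> 1 \<and> x s * (1 / s - 2 / (1 + s))\<^sup>2 = 4 / (s * (1 + s)\<^sup>2) * (1 - x s)"
proof -
  show "(x has_field_derivative (1 / s - 2 / (1 + s)) * x s) (at s)"
    unfolding x_def using assms
    by (auto intro!: derivative_eq_intros) (simp add: divide_simps, simp add: eval_nat_numeral algebra_simps)
  show "((\<lambda>s. 1 / s - 2 / (1 + s)) has_field_derivative - 1 / s\<^sup>2 + 2 / (1 + s)\<^sup>2) (at s)"
    using assms by (auto intro!: derivative_eq_intros simp: power2_eq_square)
  have x1: "1 - x s = (1 - s)\<^sup>2 / (1 + s)\<^sup>2"
    using assms unfolding x_def by (simp add: divide_simps) (simp add: eval_nat_numeral algebra_simps)
  have "1 - x s \<noteq> 0" unfolding x1 using assms by simp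
  hence "x s \<noteq> 1" by auto
  moreover have "x s \<noteq> 0" using assms by (simp add: x_def)
  moreover have "1 / s - 2 / (1 + s) = (1 - s) / (s * (1 + s))"
    using assms by (simp add: divide_simps)
  ultimately show "x s \<noteq> 0 \<and> x s \<noteq> 1 \<and> x s * (1 / s - 2 / (1 + s))\<^sup>2 = 4 / (s * (1 + s)\<^sup>2) * (1 - x s)"
    unfolding x1 unfolding x_def using assms by (simp add: divide_simps eval_nat_numeral)
qed

text \<open>After division by 1 + s both sides solve s (1 - s^2) f'' + (1 - 3 s^2) f' - s f = 0 with
  value 1 at 0: the left side as pullback along 4s / (1 + s)^2, the right side along s^2.\<close>

theorem landen:
  "\<forall>\<^sub>F s in nhds 0. K_hat 2 (4 * s / (1 + s)\<^sup>2) = (1 + s) * K_hat 2 (s\<^sup>2)"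
proof -
  define S :: "complex set" where "S = ball 0 (1 / 100)"
  have S: "open S" "0 \<in> S" by (simp_all add: S_def)
  have nz: "1 - s \<noteq> 0" "1 + s \<noteq> 0" if "s \<in> S" for s
    using small_nonzero[of s] that by (simp_all add: S_def)
  have dw: "((\<lambda>s. 1 / (1 + s)) has_field_derivative - 1 / (1 + s) * (1 / (1 + s))) (at s)" if "s \<in> S" for s
    using nz[OF that] by (auto intro!: derivative_eq_intros)
  let ?p = "\<lambda>s::complex. 1 - s\<^sup>2" and ?q = "\<lambda>s::complex. 1 - 3 * s\<^sup>2" and ?r = "\<lambda>s::complex. - s"
  have P: "solves_ode ?p ?q ?r (\<lambda>s. 1 / (1 + s) * hyp2f1 (of_real (1 / 2)) (of_real (1 / 2)) 1 (4 * s / (1 + s)\<^sup>2))"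
  proof (rule hypergeo_pullback[where S = S
      and \<rho> = "\<lambda>s. - 1 / (1 + s)" and \<rho>' = "\<lambda>s. 1 / (1 + s)\<^sup>2"
      and \<xi> = "\<lambda>s. 1 / s - 2 / (1 + s)" and \<xi>' = "\<lambda>s. - 1 / s\<^sup>2 + 2 / (1 + s)\<^sup>2"
      and \<kappa> = "\<lambda>s. 4 / (s * (1 + s)\<^sup>2)", OF _ _ _ _ S])
    fix s assume s: "s \<in> S - {0}"
    hence s': "s \<in> S" "s \<noteq> 0" by auto
    note n = nz[OF s'(1)] s'(2)
    note m = quadratic_map[OF n(3,2,1)]
    show "((\<lambda>s. 1 / (1 + s)) has_field_derivative - 1 / (1 + s) * (1 / (1 + s))) (at s)" by (rule dw[OF s'(1)])
    show "((\<lambda>s. - 1 / (1 + s)) has_field_derivative 1 / (1 + s)\<^sup>2) (at s)"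
      using n by (auto intro!: derivative_eq_intros simp: power2_eq_square)
    show "((\<lambda>s. 4 * s / (1 + s)\<^sup>2) has_field_derivative (1 / s - 2 / (1 + s)) * (4 * s / (1 + s)\<^sup>2)) (at s)" by (rule m(1))
    show "((\<lambda>s. 1 / s - 2 / (1 + s)) has_field_derivative - 1 / s\<^sup>2 + 2 / (1 + s)\<^sup>2) (at s)" by (rule m(2))
    show "4 * s / (1 + s)\<^sup>2 \<noteq> 0 \<and> 4 * s / (1 + s)\<^sup>2 \<noteq> 1 \<and> 4 * s / (1 + s)\<^sup>2 * (1 / s - 2 / (1 + s))\<^sup>2 = 4 / (s * (1 + s)\<^sup>2) * (1 - 4 * s / (1 + s)\<^sup>2)"
      by (rule m(3))
    show "s * (1 - s\<^sup>2) * (2 * (- 1 / (1 + s)) * (1 / s - 2 / (1 + s)) + (- 1 / s\<^sup>2 + 2 / (1 + s)\<^sup>2) +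
        (of_real (1 / 2) + of_real (1 / 2)) * (4 / (s * (1 + s)\<^sup>2))) + (1 - 3 * s\<^sup>2) * (1 / s - 2 / (1 + s)) = 0"
      using n by (simp add: divide_simps) (simp add: eval_nat_numeral algebra_simps)
    show "s * (1 - s\<^sup>2) * ((- 1 / (1 + s))\<^sup>2 + 1 / (1 + s)\<^sup>2 + of_real (1 / 2) * of_real (1 / 2) * (4 / (s * (1 + s)\<^sup>2))) +
        (1 - 3 * s\<^sup>2) * (- 1 / (1 + s)) + - s = 0"
      using n by (simp add: divide_simps) (simp add: eval_nat_numeral algebra_simps)
  qed (use nz in \<open>auto intro!: holomorphic_intros\<close>)
  have Q: "solves_ode ?p ?q ?r (\<lambda>s. 1 * hyp2f1 (of_real (1 / 2)) (of_real (1 / 2)) 1 (s\<^sup>2))"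
  proof (rule hypergeo_pullback[where S = S
      and \<rho> = "\<lambda>s. 0" and \<rho>' = "\<lambda>s. 0" and \<xi> = "\<lambda>s. 2 / s" and \<xi>' = "\<lambda>s. - 2 / s\<^sup>2"
      and \<kappa> = "\<lambda>s. 4 / (1 - s\<^sup>2)", OF _ _ _ _ S])
    fix s assume s: "s \<in> S - {0}"
    hence s': "s \<in> S" "s \<noteq> 0" by auto
    have "1 - s\<^sup>2 = (1 - s) * (1 + s)" by (simp add: power2_eq_square algebra_simps)
    hence n: "1 - s\<^sup>2 \<noteq> 0" "s \<noteq> 0" using nz[OF s'(1)] s'(2) by auto
    show "((\<lambda>s. s\<^sup>2) has_field_derivative 2 / s * s\<^sup>2) (at s)"
      using n by (auto intro!: derivative_eq_intros simp: power2_eq_square)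
    show "((\<lambda>s. 2 / s) has_field_derivative - 2 / s\<^sup>2) (at s)"
      using n by (auto intro!: derivative_eq_intros simp: power2_eq_square)
    show "s\<^sup>2 \<noteq> 0 \<and> s\<^sup>2 \<noteq> 1 \<and> s\<^sup>2 * (2 / s)\<^sup>2 = 4 / (1 - s\<^sup>2) * (1 - s\<^sup>2)"
    proof (intro conjI)
      show "s\<^sup>2 \<noteq> 0" using n by simp
      show "s\<^sup>2 \<noteq> 1" using n(1) by fastforce
      show "s\<^sup>2 * (2 / s)\<^sup>2 = 4 / (1 - s\<^sup>2) * (1 - s\<^sup>2)"
        unfolding nonzero_eq_divide_eq[OF n(1), THEN iffD2, OF refl, symmetric] times_divide_eq_left nonzero_mult_div_cancel_right[OF n(1)]
        using n(2) by (simp add: power_divide)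
    qed
    show "s * (1 - s\<^sup>2) * (2 * 0 * (2 / s) + - 2 / s\<^sup>2 + (of_real (1 / 2) + of_real (1 / 2)) * (4 / (1 - s\<^sup>2))) + (1 - 3 * s\<^sup>2) * (2 / s) = 0"
      using n by (simp add: divide_simps) (simp add: eval_nat_numeral algebra_simps)
    show "s * (1 - s\<^sup>2) * (0\<^sup>2 + 0 + of_real (1 / 2) * of_real (1 / 2) * (4 / (1 - s\<^sup>2))) + (1 - 3 * s\<^sup>2) * 0 + - s = 0"
      using n by (simp add: divide_simps)
  qed (auto intro!: holomorphic_intros)
  have "\<forall>\<^sub>F s in nhds 0. 1 / (1 + s) * hyp2f1 (of_real (1 / 2)) (of_real (1 / 2)) 1 (4 * s / (1 + s)\<^sup>2) =
      1 * hyp2f1 (of_real (1 / 2)) (of_real (1 / 2)) 1 (s\<^sup>2)"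
    by (rule singular_ode_unique[OF P Q]) (auto intro!: analytic_intros simp: hyp2f1_0)
  moreover have "\<forall>\<^sub>F s in nhds 0. s \<in> S" using S by (rule eventually_nhds_in_open)
  ultimately show ?thesis
  proof eventually_elim
    case (elim s)
    have "K_hat 2 z = hyp2f1 (of_real (1 / 2)) (of_real (1 / 2)) 1 z" for z by (simp add: K_hat_def)
    thus ?case using elim(1) nz[OF elim(2)] by (simp add: field_simps)
  qed
qed

text \<open>The map 4s / (1 + s)^2 carries alpha_2 to alpha_4 at the same nome. It is the argument
  of Landen's transformation again, with exponents 1/4 and 3/4 in place of 1/2 and 1/2.\<close>

theorem quartic_pullback:
  "\<forall>\<^sub>F s in nhds 0. K_hat 4 (4 * s / (1 + s)\<^sup>2) ^ 2 = (1 + s) * K_hat 2 s ^ 2"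
proof -
  define S :: "complex set" where "S = ball 0 (1 / 100)"
  define w :: "complex \<Rightarrow> complex" where "w s = exp (- 1 / 2 * Ln (1 + s))" for s
  have S: "open S" "0 \<in> S" by (simp_all add: S_def)
  have nz: "1 - s \<noteq> 0" "1 + s \<noteq> 0" if "s \<in> S" for s
    using small_nonzero[of s] that by (simp_all add: S_def)
  have dw: "(w has_field_derivative - 1 / (2 * (1 + s)) * w s) (at s)" if "s \<in> S" for s
    unfolding w_def
    by (rule DERIV_cong[OF Ln_one_plus_deriv[of "\<lambda>s. s" s 1]])
      (use that in \<open>auto simp: S_def intro!: derivative_eq_intros\<close>)
  have wh: "w holomorphic_on S" by (rule holomorphic_fromI) (rule dw)
  have P: "solves_ode (\<lambda>s. 1 - s) (\<lambda>s. 1 - 2 * s) (\<lambda>_. - (of_real (1 / 2) * of_real (1 / 2)))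
     (\<lambda>s. w s * hyp2f1 (of_real (1 / 4)) (of_real (3 / 4)) 1 (4 * s / (1 + s)\<^sup>2))"
  proof (rule hypergeo_pullback[where S = S
      and \<rho> = "\<lambda>s. - 1 / (2 * (1 + s))" and \<rho>' = "\<lambda>s. 1 / (2 * (1 + s)\<^sup>2)"
      and \<xi> = "\<lambda>s. 1 / s - 2 / (1 + s)" and \<xi>' = "\<lambda>s. - 1 / s\<^sup>2 + 2 / (1 + s)\<^sup>2"
      and \<kappa> = "\<lambda>s. 4 / (s * (1 + s)\<^sup>2)", OF _ _ _ _ S _ _ wh])
    fix s assume s: "s \<in> S - {0}"
    hence s': "s \<in> S" "s \<noteq> 0" by auto
    note n = nz[OF s'(1)] s'(2)
    have two: "2 + s * 2 = 2 * (1 + s)" "2 + 2 * s = 2 * (1 + s)" by (simp_all add: algebra_simps)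
    have n': "2 + s * 2 \<noteq> 0" "2 + 2 * s \<noteq> 0" using no_zero_divisors[of 2 "1 + s"] n(2) by (simp_all add: two del: distrib_left_numeral)
    note m = quadratic_map[OF n(3,2,1)]
    show "(w has_field_derivative - 1 / (2 * (1 + s)) * w s) (at s)" by (rule dw[OF s'(1)])
    have "((\<lambda>s. 1 / (1 + s)) has_field_derivative - 1 / (1 + s)\<^sup>2) (at s)"
      using n by (auto intro!: derivative_eq_intros simp: power2_eq_square)
    from DERIV_cmult[OF this, of "- 1 / 2"]
    show "((\<lambda>s. - 1 / (2 * (1 + s))) has_field_derivative 1 / (2 * (1 + s)\<^sup>2)) (at s)" by (simp only: times_divide_times_eq mult_1_right) simp
    show "((\<lambda>s. 4 * s / (1 + s)\<^sup>2) has_field_derivative (1 / s - 2 / (1 + s)) * (4 * s / (1 + s)\<^sup>2)) (at s)" by (rule m(1))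
    show "((\<lambda>s. 1 / s - 2 / (1 + s)) has_field_derivative - 1 / s\<^sup>2 + 2 / (1 + s)\<^sup>2) (at s)" by (rule m(2))
    show "4 * s / (1 + s)\<^sup>2 \<noteq> 0 \<and> 4 * s / (1 + s)\<^sup>2 \<noteq> 1 \<and> 4 * s / (1 + s)\<^sup>2 * (1 / s - 2 / (1 + s))\<^sup>2 = 4 / (s * (1 + s)\<^sup>2) * (1 - 4 * s / (1 + s)\<^sup>2)"
      by (rule m(3))
    show "s * (1 - s) * (2 * (- 1 / (2 * (1 + s))) * (1 / s - 2 / (1 + s)) + (- 1 / s\<^sup>2 + 2 / (1 + s)\<^sup>2) +
        (of_real (1 / 4) + of_real (3 / 4)) * (4 / (s * (1 + s)\<^sup>2))) + (1 - 2 * s) * (1 / s - 2 / (1 + s)) = 0"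
      using n n' by (simp add: divide_simps) (simp add: eval_nat_numeral algebra_simps)
    show "s * (1 - s) * ((- 1 / (2 * (1 + s)))\<^sup>2 + 1 / (2 * (1 + s)\<^sup>2) + of_real (1 / 4) * of_real (3 / 4) * (4 / (s * (1 + s)\<^sup>2))) +
        (1 - 2 * s) * (- 1 / (2 * (1 + s))) + - (of_real (1 / 2) * of_real (1 / 2)) = 0"
      using n n' by (simp add: divide_simps) (simp add: eval_nat_numeral algebra_simps)
  qed (use nz in \<open>auto intro!: holomorphic_intros\<close>)
  have "\<forall>\<^sub>F s in nhds 0. w s * hyp2f1 (of_real (1 / 4)) (of_real (3 / 4)) 1 (4 * s / (1 + s)\<^sup>2) = hyp2f1 (of_real (1 / 2)) (of_real (1 / 2)) 1 s"
    by (rule singular_ode_unique[OF P hypergeo_self_ode]) (auto intro!: analytic_intros simp: hyp2f1_0 w_def)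
  moreover have "\<forall>\<^sub>F s in nhds 0. s \<in> S" using S by (rule eventually_nhds_in_open)
  ultimately show ?thesis
  proof eventually_elim
    case (elim s)
    have "w s ^ 2 * (1 + s) = 1"
    proof -
      have "w s ^ 2 = exp (- Ln (1 + s))" unfolding w_def by (simp flip: exp_of_nat_mult)
      thus ?thesis using nz[OF elim(2)] by (simp add: exp_minus)
    qed
    moreover have "K_hat 2 s = w s * K_hat 4 (4 * s / (1 + s)\<^sup>2)" using elim(1) by (simp add: K_hat_def)
    ultimately show ?case by (rule power_cancel_weight)
  qed
qed

text \<open>The classical j = 256 (1 - s + s^2)^3 / (s^2 (1 - s)^2) in terms of the Legendre modulus
  s, inverted and multiplied by 1728; note 1728 / 256 = 27 / 4.\<close>

theorem sextic_pullback:
  "\<forall>\<^sub>F s in nhds 0. hyp2f1 (1/12) (5/12) 1 (27 * s\<^sup>2 * (1 - s)\<^sup>2 / (4 * (1 - s + s\<^sup>2) ^ 3)) ^ 4 = (1 - s + s\<^sup>2) * K_hat 2 s ^ 4"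
proof -
  define S :: "complex set" where "S = ball 0 (1 / 100)"
  define w :: "complex \<Rightarrow> complex" where "w s = exp (- 1 / 4 * Ln (1 + (s\<^sup>2 - s)))" for s
  define u :: "complex \<Rightarrow> complex" where "u s = 1 - s + s\<^sup>2" for s
  define x :: "complex \<Rightarrow> complex" where "x s = 27 * s\<^sup>2 * (1 - s)\<^sup>2 / (4 * u s ^ 3)" for s
  define N :: "complex \<Rightarrow> complex" where "N s = (1 + s) * (2 - s) * (1 - 2 * s)" for s
  have S: "open S" "0 \<in> S" by (simp_all add: S_def)
  have nz: "1 - s \<noteq> 0" "u s \<noteq> 0" "N s \<noteq> 0" if "s \<in> S" for s
    using small_nonzero[of s] that by (simp_all add: S_def u_def N_def)
  have du: "(u has_field_derivative 2 * s - 1) (at s)" for s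
    unfolding u_def by (auto intro!: derivative_eq_intros)
  have dw: "(w has_field_derivative - (2 * s - 1) / (4 * u s) * w s) (at s)" if "s \<in> S" for s
  proof -
    have s: "norm s < 1 / 100" using that by (simp add: S_def)
    have "norm (s\<^sup>2) \<le> norm s" using s by (simp add: norm_mult power2_eq_square mult_left_le)
    hence "norm (s\<^sup>2 - s) < 1" using norm_triangle_ineq4[of "s\<^sup>2" s] s by linarith
    moreover have "((\<lambda>s. s\<^sup>2 - s) has_field_derivative 2 * s - 1) (at s)" by (auto intro!: derivative_eq_intros)
    ultimately have "(w has_field_derivative (- 1 / 4) * (2 * s - 1) / (1 + (s\<^sup>2 - s)) * w s) (at s)"
      unfolding w_def by (rule Ln_one_plus_deriv)
    moreover have "1 + (s\<^sup>2 - s) = u s" by (simp add: u_def)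
    moreover have "(- 1 / 4) * (2 * s - 1) / u s * w s = - (2 * s - 1) / (4 * u s) * w s" by (cases "u s = 0") (simp_all add: divide_simps algebra_simps)
    ultimately show ?thesis by (simp only:)
  qed
  have x1: "1 - x s = (N s)\<^sup>2 / (4 * u s ^ 3)" if "s \<in> S" for s
  proof -
    have "4 * u s ^ 3 - 27 * s\<^sup>2 * (1 - s)\<^sup>2 = (N s)\<^sup>2" unfolding u_def N_def by algebra
    moreover have "1 - x s = (4 * u s ^ 3 - 27 * s\<^sup>2 * (1 - s)\<^sup>2) / (4 * u s ^ 3)"
      using nz[OF that] by (simp add: x_def diff_divide_distrib)
    ultimately show ?thesis by (simp only:)
  qed
  have uh: "u holomorphic_on S" unfolding u_def by (intro holomorphic_intros)
  have xh: "x holomorphic_on S" unfolding x_def by (intro holomorphic_intros uh) (use nz in auto)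
  have wh: "w holomorphic_on S" by (rule holomorphic_fromI) (rule dw)
  have xi: "2 / s - 2 / (1 - s) - 3 * (2 * s - 1) / u s = N s / (s * (1 - s) * u s)" if "s \<in> S - {0}" for s
  proof -
    have "2 * (1 - s) * u s - 2 * s * u s - 3 * (2 * s - 1) * (s * (1 - s)) = N s" unfolding u_def N_def by algebra
    moreover have "2 / s - 2 / (1 - s) - 3 * (2 * s - 1) / v = (2 * (1 - s) * v - 2 * s * v - 3 * (2 * s - 1) * (s * (1 - s))) / (s * (1 - s) * v)"
      if "v \<noteq> 0" for v
      using nz[of s] \<open>s \<in> S - {0}\<close> that by (simp add: divide_simps) (simp add: algebra_simps)
    ultimately show ?thesis using nz(2)[of s] that by (metis DiffD1)
  qed
  have P: "solves_ode (\<lambda>s. 1 - s) (\<lambda>s. 1 - 2 * s) (\<lambda>_. - (of_real (1 / 2) * of_real (1 / 2)))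
      (\<lambda>s. w s * hyp2f1 (of_real (1 / 12)) (of_real (5 / 12)) 1 (x s))"
  proof (rule hypergeo_pullback[where S = S
      and \<rho> = "\<lambda>s. - (2 * s - 1) / (4 * u s)" and \<rho>' = "\<lambda>s. - (2 * u s - (2 * s - 1)\<^sup>2) / (4 * (u s)\<^sup>2)"
      and \<xi> = "\<lambda>s. 2 / s - 2 / (1 - s) - 3 * (2 * s - 1) / u s" and \<xi>' = "\<lambda>s. - 2 / s\<^sup>2 - 2 / (1 - s)\<^sup>2 - 3 * (2 * u s - (2 * s - 1)\<^sup>2) / (u s)\<^sup>2"
      and \<kappa> = "\<lambda>s. 27 / (u s)\<^sup>2", OF _ _ _ _ S xh _ wh])
    fix s assume s: "s \<in> S - {0}"
    hence s': "s \<in> S" "s \<noteq> 0" by auto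
    note n = nz[OF s'(1)] s'(2)
    show "(w has_field_derivative - (2 * s - 1) / (4 * u s) * w s) (at s)" by (rule dw[OF s'(1)])
    show "((\<lambda>s. - (2 * s - 1) / (4 * u s)) has_field_derivative - (2 * u s - (2 * s - 1)\<^sup>2) / (4 * (u s)\<^sup>2)) (at s)"
      using n by (auto intro!: derivative_eq_intros du) (simp add: divide_simps, simp add: eval_nat_numeral algebra_simps)
    show "(x has_field_derivative (2 / s - 2 / (1 - s) - 3 * (2 * s - 1) / u s) * x s) (at s)"
      unfolding x_def using n
      by (auto intro!: derivative_eq_intros du) (simp add: divide_simps, simp add: eval_nat_numeral algebra_simps)
    show "((\<lambda>s. 2 / s - 2 / (1 - s) - 3 * (2 * s - 1) / u s) has_field_derivative - 2 / s\<^sup>2 - 2 / (1 - s)\<^sup>2 - 3 * (2 * u s - (2 * s - 1)\<^sup>2) / (u s)\<^sup>2) (at s)"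
      using n by (auto intro!: derivative_eq_intros du) (simp add: divide_simps, simp add: eval_nat_numeral algebra_simps)
    show "x s \<noteq> 0 \<and> x s \<noteq> 1 \<and> x s * (2 / s - 2 / (1 - s) - 3 * (2 * s - 1) / u s)\<^sup>2 = 27 / (u s)\<^sup>2 * (1 - x s)"
    proof (intro conjI)
      show "x s \<noteq> 0" using n by (simp add: x_def)
      have "1 - x s \<noteq> 0" unfolding x1[OF s'(1)] using n by simp
      thus "x s \<noteq> 1" by auto
      have "27 * s\<^sup>2 * a\<^sup>2 / (4 * b ^ 3) * (c / (s * a * b))\<^sup>2 = 27 / b\<^sup>2 * (c\<^sup>2 / (4 * b ^ 3))" if "a \<noteq> 0" "b \<noteq> 0" for a b c
        using that n(4) by (simp add: divide_simps power_mult_distrib)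
      from this[OF n(1,2)] show "x s * (2 / s - 2 / (1 - s) - 3 * (2 * s - 1) / u s)\<^sup>2 = 27 / (u s)\<^sup>2 * (1 - x s)"
        unfolding xi[OF s] x1[OF s'(1)] unfolding x_def .
    qed
    show "s * (1 - s) * (2 * (- (2 * s - 1) / (4 * u s)) * (2 / s - 2 / (1 - s) - 3 * (2 * s - 1) / u s) +
        (- 2 / s\<^sup>2 - 2 / (1 - s)\<^sup>2 - 3 * (2 * u s - (2 * s - 1)\<^sup>2) / (u s)\<^sup>2) +
        (of_real (1 / 12) + of_real (5 / 12)) * (27 / (u s)\<^sup>2)) + (1 - 2 * s) * (2 / s - 2 / (1 - s) - 3 * (2 * s - 1) / u s) = 0"
      using n by (simp add: divide_simps) (simp add: u_def, simp add: eval_nat_numeral algebra_simps)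
    show "s * (1 - s) * ((- (2 * s - 1) / (4 * u s))\<^sup>2 + - (2 * u s - (2 * s - 1)\<^sup>2) / (4 * (u s)\<^sup>2) + of_real (1 / 12) * of_real (5 / 12) * (27 / (u s)\<^sup>2)) +
        (1 - 2 * s) * (- (2 * s - 1) / (4 * u s)) + - (of_real (1 / 2) * of_real (1 / 2)) = 0"
      using n by (simp add: divide_simps) (simp add: u_def, simp add: eval_nat_numeral algebra_simps)
  qed (simp_all add: x_def)
  have "\<forall>\<^sub>F s in nhds 0. w s * hyp2f1 (of_real (1 / 12)) (of_real (5 / 12)) 1 (x s) = hyp2f1 (of_real (1 / 2)) (of_real (1 / 2)) 1 s"
    by (rule singular_ode_unique[OF P hypergeo_self_ode]) (auto intro!: analytic_intros simp: hyp2f1_0 w_def x_def)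
  moreover have "\<forall>\<^sub>F s in nhds 0. s \<in> S" using S by (rule eventually_nhds_in_open)
  ultimately show ?thesis
  proof eventually_elim
    case (elim s)
    have "w s ^ 4 * u s = 1"
    proof -
      have e: "1 + (s\<^sup>2 - s) = u s" by (simp add: u_def)
      have "w s ^ 4 = exp (- Ln (u s))" unfolding w_def e by (simp flip: exp_of_nat_mult)
      thus ?thesis using nz[OF elim(2)] by (simp add: exp_minus)
    qed
    moreover have "K_hat 2 s = w s * hyp2f1 (1/12) (5/12) 1 (x s)" using elim(1) by (simp add: K_hat_def)
    ultimately have "hyp2f1 (1/12) (5/12) 1 (x s) ^ 4 = u s * K_hat 2 s ^ 4" by (rule power_cancel_weight)
    thus ?case by (simp add: x_def u_def)
  qed
qed

section \<open>Hypergeometric functions at theta quotients\<close>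

lemma lambert_holomorphic:
  assumes "tame f"
  shows "lambert f holomorphic_on ball 0 1"
proof (rule power_series_holomorphic)
  fix w :: complex assume "w \<in> ball 0 1"
  hence "norm w < 1" by simp
  from lambert_divisors[OF this assms]
  have "((\<lambda>n. (\<Sum>d | d dvd n. f d (n div d)) * w ^ n) has_sum lambert f w) UNIV"
    by (rule has_sum_cong_neutral[THEN iffD1, rotated -1]) (auto simp: not_le)
  thus "(\<lambda>n. (\<Sum>d | d dvd n. f d (n div d)) * (w - 0) ^ n) sums lambert f w"
    by (simp add: has_sum_imp_sums)
qed

lemma phi_sq_holomorphic: "phi_sq holomorphic_on ball 0 1"
  and cubic_a_holomorphic: "cubic_a holomorphic_on ball 0 1"
  and eisen4_holomorphic: "eisen4 holomorphic_on ball 0 1"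
  and odd_sum_holomorphic: "odd_sum holomorphic_on ball 0 1"
proof -
  have t: "tame (\<lambda>m n. of_nat m ^ 3)" "tame (\<lambda>m n. if odd m then of_nat m else 0)"
    using tame_of_nat_pow[of 3] tame_if[OF tame_of_nat_pow[of 1], of "\<lambda>m n. odd m"] by (simp_all cong: if_cong)
  show "phi_sq holomorphic_on ball 0 1" "cubic_a holomorphic_on ball 0 1"
    "eisen4 holomorphic_on ball 0 1" "odd_sum holomorphic_on ball 0 1"
    unfolding phi_sq_def[abs_def] cubic_a_def[abs_def] eisen4_def[abs_def] odd_sum_def[abs_def] power_lambert_def[abs_def]
    by (intro holomorphic_intros lambert_holomorphic tame_chi t)+
qed

lemma theta_0: "phi_sq 0 = 1" "cubic_a 0 = 1" "eisen4 0 = 1" "odd_sum 0 = 1"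
  by (simp_all add: phi_sq_def cubic_a_def eisen4_def odd_sum_def power_lambert_0 lambert_0)

lemma isCont_ball: "f holomorphic_on ball 0 1 \<Longrightarrow> isCont f (0 :: complex)"
  by (metis at_within_interior centre_in_ball continuous_on_eq_continuous_within holomorphic_on_imp_continuous_on
      interior_ball zero_less_one)

lemmas theta_cont = isCont_ball[OF phi_sq_holomorphic] isCont_ball[OF cubic_a_holomorphic]
  isCont_ball[OF eisen4_holomorphic] isCont_ball[OF odd_sum_holomorphic] isCont_ball[OF euler_holomorphic]

lemma isCont_tendsto_nhds: "isCont f x \<Longrightarrow> (f \<longlongrightarrow> f x) (nhds x)"
  by (simp add: isCont_def tendsto_at_iff_tendsto_nhds)

lemma eventually_nhds_nonzero:
  fixes f :: "complex \<Rightarrow> complex"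
  assumes "isCont f 0" "f 0 \<noteq> 0"
  shows "\<forall>\<^sub>F z in nhds 0. f z \<noteq> 0"
  using tendsto_imp_eventually_ne[OF isCont_tendsto_nhds] assms by blast

lemma eventually_unit_disc: "\<forall>\<^sub>F z in nhds (0::complex). norm z < 1"
  using eventually_nhds_in_open[of "ball (0::complex) 1" 0] by simp

lemma eventually_nhds_compose:
  fixes f :: "complex \<Rightarrow> complex"
  assumes "isCont f 0" "f 0 = 0" "\<forall>\<^sub>F z in nhds 0. P z"
  shows "\<forall>\<^sub>F z in nhds 0. P (f z)"
  by (rule eventually_compose_filterlim[OF assms(3)]) (use isCont_tendsto_nhds[OF assms(1)] in \<open>simp add: assms(2)\<close>)

text \<open>Every number is an n-th power, so an identity proved at q^n can be read as one at
  q.\<close>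

lemma eventually_nhds_power:
  fixes P :: "complex \<Rightarrow> bool"
  assumes "\<forall>\<^sub>F q in nhds 0. P (q ^ n)" "n > 0"
  shows "\<forall>\<^sub>F q in nhds 0. P q"
proof -
  obtain r where r: "r > 0" "\<And>q. norm q < r \<Longrightarrow> P (q ^ n)"
    using assms(1) unfolding eventually_nhds_metric by (auto simp: dist_norm)
  have "P w" if "norm w < r ^ n" for w
  proof -
    obtain z where z: "w = z ^ n" using exists_complex_root[of n w] assms(2) by blast
    hence "norm z ^ n < r ^ n" using that by (simp add: norm_power)
    hence "norm z < r" using power_less_imp_less_base r(1) by fastforce
    thus ?thesis using r(2) z by blast
  qed
  thus ?thesis unfolding eventually_nhds_metric using r(1) by (intro exI[of _ "r ^ n"]) (auto simp: dist_norm)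
qed

text \<open>The quotient is an n-th root of unity close to 1, and the finitely many other roots of
  unity stay away from 1.\<close>

lemma eventually_eq_if_power_eq:
  fixes f g :: "'a \<Rightarrow> complex"
  assumes "(f \<longlongrightarrow> 1) F" "(g \<longlongrightarrow> 1) F" "\<forall>\<^sub>F x in F. f x ^ n = g x ^ n" "n > 0"
  shows "\<forall>\<^sub>F x in F. f x = g x"
proof -
  define A where "A = {z :: complex. z ^ n = 1} - {1}"
  have "finite A" unfolding A_def using finite_roots_unity[of n] assms(4) by simp
  hence "open (- A)" by (simp add: open_Compl finite_imp_closed)
  moreover have "((\<lambda>x. f x / g x) \<longlongrightarrow> 1) F" using tendsto_divide[OF assms(1,2)] by simp
  ultimately have "\<forall>\<^sub>F x in F. f x / g x \<in> - A" unfolding tendsto_def by (auto simp: A_def)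
  moreover have "\<forall>\<^sub>F x in F. g x \<noteq> 0" by (rule tendsto_imp_eventually_ne[OF assms(2)]) simp
  ultimately show ?thesis using assms(3)
    by eventually_elim (auto simp: A_def power_divide)
qed

lemma constant_if_square_invariant:
  fixes R :: "complex \<Rightarrow> complex"
  assumes "isCont R 0" "\<forall>\<^sub>F z in nhds 0. R z = R (z\<^sup>2)"
  shows "\<forall>\<^sub>F z in nhds 0. R z = R 0"
proof -
  obtain r where r: "r > 0" "\<And>z. norm z < r \<Longrightarrow> R z = R (z\<^sup>2)"
    using assms(2) unfolding eventually_nhds_metric by (auto simp: dist_norm)
  define d where "d = min r 1"
  have "R z = R 0" if z: "norm z < d" for z
  proof -
    have z1: "norm z < 1" using z by (simp add: d_def)
    have le: "norm (z ^ Suc n) \<le> norm z" for n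
      using power_le_one[of "norm z" n] z1 by (simp add: norm_mult norm_power mult_left_le)
    have "R (z ^ (2 ^ n)) = R z" for n
    proof (induction n)
      case (Suc n)
      obtain m where m: "(2::nat) ^ n = Suc m" by (metis not0_implies_Suc power_not_zero zero_neq_numeral)
      have "norm (z ^ (2 ^ n)) < r" using le[of m] z unfolding m d_def by linarith
      from r(2)[OF this] show ?case using Suc by (simp add: power_mult[symmetric] mult.commute)
    qed simp
    moreover have "(\<lambda>n. z ^ (2 ^ n)) \<longlonglongrightarrow> 0"
      using LIMSEQ_subseq_LIMSEQ[OF LIMSEQ_power_zero[OF z1], of "\<lambda>n. 2 ^ n"] by (simp add: strict_mono_def o_def)
    hence "(\<lambda>n. R (z ^ (2 ^ n))) \<longlonglongrightarrow> R 0" using assms(1) isCont_tendsto_compose by blast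
    ultimately show ?thesis by (simp add: LIMSEQ_const_iff)
  qed
  moreover have "d > 0" using r by (simp add: d_def)
  ultimately show ?thesis unfolding eventually_nhds_metric dist_norm diff_zero by blast
qed

lemma isCont_hyp2f1:
  fixes a b :: real
  assumes "0 < a" "a \<le> 1" "0 < b" "b \<le> 1"
  shows "isCont (hyp2f1 (of_real a) (of_real b) 1) 0"
  using hyp2f1_facts(1)[OF assms] by (rule isCont_ball)

lemma isCont_K_hat: "isCont (K_hat 2) 0" "isCont (K_hat 3) 0" "isCont (K_hat 4) 0"
proof -
  have "K_hat 2 = hyp2f1 (of_real (1/2)) (of_real (1/2)) 1" "K_hat 3 = hyp2f1 (of_real (1/3)) (of_real (2/3)) 1"
    "K_hat 4 = hyp2f1 (of_real (1/4)) (of_real (3/4)) 1"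
    by (simp_all add: fun_eq_iff K_hat_def)
  thus "isCont (K_hat 2) 0" "isCont (K_hat 3) 0" "isCont (K_hat 4) 0"
    by (simp_all only:) (rule isCont_hyp2f1; simp)+
qed

lemma K_hat_0: "K_hat r 0 = 1"
  by (simp add: K_hat_def hyp2f1_0)

text \<open>The squared elliptic modulus, 1 minus the fourth power of the ratio of theta functions
  at -q and q. It is alpha_2 as a function of the nome.\<close>

definition legendre :: "complex \<Rightarrow> complex"
  where "legendre q = 1 - (phi_sq (- q) / phi_sq q)\<^sup>2"

lemma isCont_legendre: "isCont legendre 0" and legendre_0: "legendre 0 = 0"
proof -
  have "isCont (\<lambda>q. phi_sq (- q)) 0"
    using isCont_o2[of 0 uminus phi_sq] theta_cont(1) by simp
  thus "isCont legendre 0" unfolding legendre_def[abs_def]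
    by (intro continuous_intros theta_cont) (simp_all add: theta_0)
  show "legendre 0 = 0" by (simp add: legendre_def theta_0)
qed

lemma phi_sq_nonzero: "norm q < 1 \<Longrightarrow> phi_sq q \<noteq> 0"
  unfolding phi_sq_product using euler_nonzero norm_power_lt[of q 2] norm_power_lt[of q 4] by simp

text \<open>With \<open>k\<close> as defined in the proof, \<open>phi_sq\<close> at z and -z is
  phi_sq (z^2) times 1 + k and 1 - k. Therefore \<open>legendre z\<close> = 4k / (1 + k)^2 and
  \<open>legendre (z^2)\<close> = k^2, precisely the two arguments in Landen's
  transformation.\<close>

theorem K_hat_2_legendre: "\<forall>\<^sub>F q in nhds 0. K_hat 2 (legendre q) = phi_sq q"
proof -
  define R where "R z = K_hat 2 (legendre z) / phi_sq z" for z
  define k where "k z = (phi_sq z - phi_sq (z\<^sup>2)) / phi_sq (z\<^sup>2)" for z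
  have c2: "isCont (\<lambda>z. phi_sq (z\<^sup>2)) 0"
    using isCont_o2[of 0 "\<lambda>z. z\<^sup>2" phi_sq] theta_cont(1) by simp
  have "isCont k 0" unfolding k_def by (intro continuous_intros theta_cont c2) (simp_all add: theta_0)
  moreover have "k 0 = 0" by (simp add: k_def)
  ultimately have "\<forall>\<^sub>F z in nhds 0. K_hat 2 (4 * k z / (1 + k z)\<^sup>2) = (1 + k z) * K_hat 2 ((k z)\<^sup>2)"
    by (rule eventually_nhds_compose) (rule landen)
  hence "\<forall>\<^sub>F z in nhds 0. R z = R (z\<^sup>2)"
    using eventually_unit_disc
  proof eventually_elim
    case (elim z)
    note z2 = norm_power_lt[OF elim(2), of 2]
    have u: "phi_sq (z\<^sup>2) \<noteq> 0" "phi_sq z \<noteq> 0" using elim(2) z2 by (auto intro!: phi_sq_nonzero)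
    have 1: "phi_sq z = phi_sq (z\<^sup>2) * (1 + k z)" using u by (simp add: k_def field_simps)
    have "phi_sq (- z) = 2 * phi_sq (z\<^sup>2) - phi_sq z" using phi_sq_add_minus[OF elim(2)] by (simp add: algebra_simps)
    hence 2: "phi_sq (- z) = phi_sq (z\<^sup>2) * (1 - k z)" unfolding 1 by (simp add: algebra_simps)
    have n: "1 + k z \<noteq> 0" using 1 u by auto
    have "1 - (u * (1 - k) / (u * (1 + k)))\<^sup>2 = 4 * k / (1 + k)\<^sup>2" if "u \<noteq> 0" "1 + k \<noteq> 0" for u k :: complex
      using that by (simp add: power_divide divide_simps) (simp add: power2_eq_square algebra_simps)
    from this[OF u(1) n] have l1: "legendre z = 4 * k z / (1 + k z)\<^sup>2" unfolding legendre_def 2 by (simp flip: 1)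
    have "phi_sq (- (z\<^sup>2)) ^ 2 = phi_sq (z\<^sup>2) ^ 2 * (1 - (k z)\<^sup>2)"
      unfolding phi_sq_mult_minus[OF elim(2), symmetric] 1 2 by (simp add: power2_eq_square algebra_simps)
    hence l2: "legendre (z\<^sup>2) = (k z)\<^sup>2" unfolding legendre_def power_divide using u by simp
    have "R z = (1 + k z) * K_hat 2 ((k z)\<^sup>2) / (phi_sq (z\<^sup>2) * (1 + k z))"
      unfolding R_def l1 elim(1) by (simp flip: 1)
    also have "\<dots> = R (z\<^sup>2)" unfolding R_def l2 using n by simp
    finally show ?case .
  qed
  moreover have "isCont R 0" unfolding R_def
    by (intro continuous_intros theta_cont isCont_o2[OF isCont_legendre]) (simp_all add: theta_0 legendre_0 isCont_K_hat)
  ultimately have "\<forall>\<^sub>F z in nhds 0. R z = R 0" by (rule constant_if_square_invariant[rotated])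
  thus ?thesis using eventually_unit_disc
    by eventually_elim (simp add: R_def legendre_0 K_hat_0 theta_0 phi_sq_nonzero field_simps)
qed

lemma phi_sq_squares:
  assumes "norm q < 1"
  shows "phi_sq q ^ 2 - phi_sq (- q) ^ 2 = 16 * q * euler (q ^ 4) ^ 8 / euler (q\<^sup>2) ^ 4"
    and "phi_sq q ^ 2 = euler (q\<^sup>2) ^ 20 / (euler q ^ 8 * euler (q ^ 4) ^ 8)"
    and "phi_sq (- q) ^ 2 = euler q ^ 8 / euler (q\<^sup>2) ^ 4"
proof -
  note n = norm_power_lt[OF assms]
  have e: "euler q \<noteq> 0" "euler (q\<^sup>2) \<noteq> 0" "euler (q ^ 4) \<noteq> 0" "euler (q ^ 8) \<noteq> 0"
    using assms by (auto intro!: euler_nonzero n)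
  have p: "(q\<^sup>2)\<^sup>2 = q ^ 4" "(q\<^sup>2) ^ 4 = q ^ 8" by (simp_all flip: power_mult)
  have "phi_sq q ^ 2 - phi_sq (- q) ^ 2 = (phi_sq q + phi_sq (- q)) * (2 * phi_sq q - (phi_sq q + phi_sq (- q)))"
    by (simp add: power2_eq_square algebra_simps)
  also have "\<dots> = 2 * phi_sq (q\<^sup>2) * (2 * (phi_sq q - phi_sq (q\<^sup>2)))"
    unfolding phi_sq_add_minus[OF assms] by simp
  also have "\<dots> = 16 * q * euler (q ^ 4) ^ 8 / euler (q\<^sup>2) ^ 4"
    unfolding phi_sq_dissection[OF assms] unfolding phi_sq_product[OF n[of 2, simplified]] p using e by (simp add: field_simps)
  finally show "phi_sq q ^ 2 - phi_sq (- q) ^ 2 = 16 * q * euler (q ^ 4) ^ 8 / euler (q\<^sup>2) ^ 4" .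
  show "phi_sq q ^ 2 = euler (q\<^sup>2) ^ 20 / (euler q ^ 8 * euler (q ^ 4) ^ 8)"
    "phi_sq (- q) ^ 2 = euler q ^ 8 / euler (q\<^sup>2) ^ 4"
    unfolding phi_sq_product[OF assms] phi_sq_minus_product[OF assms] power_divide power_mult_distrib
    by (simp_all flip: power_mult)
qed

text \<open>The sextic map at \<open>legendre q\<close> produces the data of q^2, since 1 - s + s^2
  is \<open>eisen4 (q^2)\<close> divided by phi_sq q ^ 4. The identity is therefore proved at q^2
  and transferred by \<open>eventually_nhds_power\<close>.\<close>

theorem eisen4_hypergeometric:
  "\<forall>\<^sub>F q in nhds 0. hyp2f1 (1/12) (5/12) 1 (1728 * (q * euler q ^ 24 / eisen4 q ^ 3)) ^ 4 = eisen4 q"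
proof (rule eventually_nhds_power)
  have "\<forall>\<^sub>F q in nhds 0. hyp2f1 (1/12) (5/12) 1 (27 * (legendre q)\<^sup>2 * (1 - legendre q)\<^sup>2 / (4 * (1 - legendre q + (legendre q)\<^sup>2) ^ 3)) ^ 4 =
      (1 - legendre q + (legendre q)\<^sup>2) * K_hat 2 (legendre q) ^ 4"
    by (rule eventually_nhds_compose[OF isCont_legendre legendre_0 sextic_pullback])
  moreover have "\<forall>\<^sub>F q in nhds 0. eisen4 q \<noteq> 0" by (rule eventually_nhds_nonzero) (simp_all add: theta_cont theta_0)
  hence "\<forall>\<^sub>F q in nhds 0. eisen4 (q\<^sup>2) \<noteq> 0" by (rule eventually_nhds_compose[rotated 2]) simp_all
  ultimately show "\<forall>\<^sub>F q in nhds 0. hyp2f1 (1/12) (5/12) 1 (1728 * (q\<^sup>2 * euler (q\<^sup>2) ^ 24 / eisen4 (q\<^sup>2) ^ 3)) ^ 4 = eisen4 (q\<^sup>2)"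
    using K_hat_2_legendre eventually_unit_disc
  proof eventually_elim
    case (elim q)
    define X Y where "X = phi_sq q ^ 2" and "Y = phi_sq (- q) ^ 2"
    have e: "euler q \<noteq> 0" "euler (q\<^sup>2) \<noteq> 0" "euler (q ^ 4) \<noteq> 0"
      using elim(4) by (auto intro!: euler_nonzero norm_power_lt)
    have X: "X \<noteq> 0" unfolding X_def using phi_sq_nonzero[OF elim(4)] by simp
    have l: "legendre q = 1 - Y / X" by (simp add: legendre_def X_def Y_def power_divide)
    have "eisen4 (q\<^sup>2) = X\<^sup>2 - X * Y + Y\<^sup>2"
      using eisen4_quartic(2)[OF elim(4)] by (simp add: X_def Y_def flip: power_mult)
    moreover have "1 - (1 - Y / X) + (1 - Y / X)\<^sup>2 = (X\<^sup>2 - X * Y + Y\<^sup>2) / X\<^sup>2"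
      using X by (simp add: field_simps power2_eq_square)
    ultimately have u: "1 - legendre q + (legendre q)\<^sup>2 = eisen4 (q\<^sup>2) / X\<^sup>2" unfolding l by simp
    have "((X - Y) * X * Y) = 16 * q * euler (q\<^sup>2) ^ 12"
      unfolding X_def Y_def phi_sq_squares(1)[OF elim(4)] unfolding phi_sq_squares[OF elim(4)] using e by (simp add: field_simps)
    \<comment> \<open>The discriminant at q^2 times 256; with the factor 27 / 4 of the sextic map
      this gives 1728.\<close>
    hence d: "((X - Y) * X * Y)\<^sup>2 = 256 * (q\<^sup>2 * euler (q\<^sup>2) ^ 24)" by (simp add: power_mult_distrib flip: power_mult)
    have "27 * (1 - Y / X)\<^sup>2 * (Y / X)\<^sup>2 / (4 * (E / X\<^sup>2) ^ 3) = 27 * ((X - Y) * X * Y)\<^sup>2 / (4 * E ^ 3)" if "E \<noteq> 0" for E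
    proof -
      have "1 - Y / X = (X - Y) / X" using X by (simp add: field_simps)
      thus ?thesis using X that by (simp add: power_divide power_mult_distrib field_simps eval_nat_numeral)
    qed
    from this[OF elim(2)] have x: "27 * (legendre q)\<^sup>2 * (1 - legendre q)\<^sup>2 / (4 * (1 - legendre q + (legendre q)\<^sup>2) ^ 3) =
        1728 * (q\<^sup>2 * euler (q\<^sup>2) ^ 24 / eisen4 (q\<^sup>2) ^ 3)"
      unfolding u d by (simp add: l)
    have "X\<^sup>2 = phi_sq q ^ 4" by (simp add: X_def flip: power_mult)
    hence "eisen4 (q\<^sup>2) / X\<^sup>2 * phi_sq q ^ 4 = eisen4 (q\<^sup>2)" using X by (metis nonzero_eq_divide_eq power_not_zero times_divide_eq_left)
    thus ?case using elim(1) unfolding x unfolding u elim(3) by (simp only:)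
  qed
qed simp

section \<open>Signatures 4 and 3 at theta quotients\<close>

definition quartic_modulus :: "complex \<Rightarrow> complex"
  where "quartic_modulus q = 64 * q * euler (q\<^sup>2) ^ 24 / (64 * q * euler (q\<^sup>2) ^ 24 + euler q ^ 24)"

text \<open>Since \<open>odd_sum\<close> is 2X - Y, its square is 4 X (X - Y) + Y^2, and by the
  product formulas the two summands are the two eta products on the left, up to the common
  factor.\<close>

lemma odd_sum_eta:
  assumes "norm q < 1"
  shows "64 * q * euler (q\<^sup>2) ^ 24 + euler q ^ 24 = odd_sum q ^ 2 * (euler q * euler (q\<^sup>2)) ^ 8"
proof -
  define X Y where "X = phi_sq q ^ 2" and "Y = phi_sq (- q) ^ 2"
  have e: "euler q \<noteq> 0" "euler (q\<^sup>2) \<noteq> 0" "euler (q ^ 4) \<noteq> 0"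
    using assms by (auto intro!: euler_nonzero norm_power_lt)
  have "odd_sum q = 2 * X - Y" using odd_sum_phi_sq[OF assms] by (simp add: X_def Y_def)
  hence "odd_sum q ^ 2 = 4 * ((X - Y) * X) + Y\<^sup>2" by (simp only:) (simp add: power2_eq_square algebra_simps)
  moreover have "(X - Y) * X * (euler q * euler (q\<^sup>2)) ^ 8 = 16 * q * euler (q\<^sup>2) ^ 24"
    unfolding X_def Y_def phi_sq_squares(1)[OF assms] unfolding phi_sq_squares(2)[OF assms] using e
    by (simp add: field_simps power_mult_distrib)
  moreover have "Y\<^sup>2 * (euler q * euler (q\<^sup>2)) ^ 8 = euler q ^ 24"
    unfolding Y_def phi_sq_squares(3)[OF assms] using e by (simp add: field_simps power_mult_distrib flip: power_mult)
  ultimately show ?thesis by (simp only: distrib_right mult.assoc) simp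
qed

theorem K_hat_4_quartic_modulus: "\<forall>\<^sub>F q in nhds 0. K_hat 4 (quartic_modulus q) ^ 2 = odd_sum q"
proof -
  have "\<forall>\<^sub>F q in nhds 0. K_hat 4 (4 * legendre q / (1 + legendre q)\<^sup>2) ^ 2 = (1 + legendre q) * K_hat 2 (legendre q) ^ 2"
    by (rule eventually_nhds_compose[OF isCont_legendre legendre_0 quartic_pullback])
  moreover have "\<forall>\<^sub>F q in nhds 0. odd_sum q \<noteq> 0" by (rule eventually_nhds_nonzero) (simp_all add: theta_cont theta_0)
  ultimately show ?thesis using K_hat_2_legendre eventually_unit_disc
  proof eventually_elim
    case (elim q)
    define X Y where "X = phi_sq q ^ 2" and "Y = phi_sq (- q) ^ 2"
    have e: "euler q \<noteq> 0" "euler (q\<^sup>2) \<noteq> 0" "euler (q ^ 4) \<noteq> 0"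
      using elim(4) by (auto intro!: euler_nonzero norm_power_lt)
    have X: "X \<noteq> 0" unfolding X_def using phi_sq_nonzero[OF elim(4)] by simp
    have l: "legendre q = (X - Y) / X" using X by (simp add: legendre_def X_def Y_def power_divide field_simps)
    have "1 + (X - Y) / X = (2 * X - Y) / X" using X by (simp add: field_simps)
    hence l1: "1 + legendre q = odd_sum q / X" unfolding l odd_sum_phi_sq[OF elim(4)] by (simp add: X_def Y_def)
    have "(X - Y) * X * (euler q * euler (q\<^sup>2)) ^ 8 = 16 * q * euler (q\<^sup>2) ^ 24"
      unfolding X_def Y_def phi_sq_squares(1)[OF elim(4)] unfolding phi_sq_squares(2)[OF elim(4)] using e
      by (simp add: field_simps power_mult_distrib)
    hence "64 * q * euler (q\<^sup>2) ^ 24 = 4 * ((X - Y) * X * (euler q * euler (q\<^sup>2)) ^ 8)" by simp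
    hence "64 * q * euler (q\<^sup>2) ^ 24 = 4 * (X - Y) * X * (euler q * euler (q\<^sup>2)) ^ 8" by (simp only: mult.assoc)
    hence "quartic_modulus q = 4 * (X - Y) * X * (euler q * euler (q\<^sup>2)) ^ 8 / (odd_sum q ^ 2 * (euler q * euler (q\<^sup>2)) ^ 8)"
      unfolding quartic_modulus_def odd_sum_eta[OF elim(4)] by simp
    also have "\<dots> = 4 * (X - Y) * X / odd_sum q ^ 2" using e by simp
    also have "\<dots> = 4 * legendre q / (1 + legendre q)\<^sup>2"
    proof -
      have "4 * D * X / o' ^ 2 = 4 * (D / X) / (o' / X)\<^sup>2" if "o' \<noteq> 0" for D o'
        using X that by (simp add: power_divide power2_eq_square)
      from this[OF elim(2)] show ?thesis unfolding l1 unfolding l .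
    qed
    finally show ?case using elim(1) X unfolding l1 elim(3) by (simp add: X_def)
  qed
qed

definition cubic_modulus :: "complex \<Rightarrow> complex"
  where "cubic_modulus q = 27 * q * euler (q ^ 3) ^ 12 / (27 * q * euler (q ^ 3) ^ 12 + euler q ^ 12)"

text \<open>The relations proved in a cube root z of q involve \<open>cubic_c_root z\<close> only
  through its cube c, which does not depend on the choice of z.\<close>

lemma cubic_eta:
  assumes "norm q < 1"
  defines "c \<equiv> 27 * q * euler (q ^ 3) ^ 9 / euler q ^ 3"
  shows "cubic_a q ^ 3 = cubic_b q ^ 3 + c" "eisen4 q = cubic_a q ^ 4 + 8 * cubic_a q * c"
    and "c * cubic_b q ^ 9 = 27 * q * euler q ^ 24"
    and "27 * q * euler (q ^ 3) ^ 12 + euler q ^ 12 = cubic_a q ^ 3 * (euler q * euler (q ^ 3)) ^ 3"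
    and "27 * q * euler (q ^ 3) ^ 12 = c * (euler q * euler (q ^ 3)) ^ 3"
proof -
  obtain z where z: "q = z ^ 3" using exists_complex_root[of 3 q] by auto
  have "norm z ^ 3 < 1 ^ 3" using assms(1) by (simp add: z norm_power)
  hence z1: "norm z < 1" using power_less_imp_less_base zero_le_one by blast
  have e: "euler q \<noteq> 0" "euler (q ^ 3) \<noteq> 0"
    using assms by (auto intro!: euler_nonzero norm_power_lt)
  have "cubic_c_root z ^ 3 = c"
    by (simp add: cubic_c_root_def c_def z power_mult_distrib power_divide flip: power_mult)
  thus 1: "cubic_a q ^ 3 = cubic_b q ^ 3 + c" "eisen4 q = cubic_a q ^ 4 + 8 * cubic_a q * c"
    using cubic_identity[OF z1] eisen4_cubic[OF z1] by (simp_all add: z)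
  show "c * cubic_b q ^ 9 = 27 * q * euler q ^ 24"
    unfolding c_def cubic_b_def using e by (simp add: power_divide field_simps flip: power_mult power_add)
  show 2: "27 * q * euler (q ^ 3) ^ 12 = c * (euler q * euler (q ^ 3)) ^ 3"
    unfolding c_def using e by (simp add: field_simps power_mult_distrib)
  have "euler q ^ 12 = cubic_b q ^ 3 * (euler q * euler (q ^ 3)) ^ 3"
    unfolding cubic_b_def using e by (simp add: field_simps power_mult_distrib power_divide flip: power_mult)
  thus "27 * q * euler (q ^ 3) ^ 12 + euler q ^ 12 = cubic_a q ^ 3 * (euler q * euler (q ^ 3)) ^ 3"
    unfolding 1 2 by (simp add: algebra_simps)
qed

lemma isCont_cubic_modulus: "isCont cubic_modulus 0" and cubic_modulus_0: "cubic_modulus 0 = 0"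
proof -
  have "isCont (\<lambda>q. euler (q ^ 3)) 0"
    using isCont_o2[of 0 "\<lambda>z. z ^ 3" euler] theta_cont(5) by simp
  thus "isCont cubic_modulus 0" unfolding cubic_modulus_def[abs_def]
    by (intro continuous_intros theta_cont) (simp_all add: euler_0)
  show "cubic_modulus 0 = 0" by (simp add: cubic_modulus_def)
qed

text \<open>At s = alpha_3 the left side of \<open>cubic_pullback\<close> is
  \<open>eisen4 q\<close>, and 1 + 8s is \<open>eisen4 q\<close> divided by cubic_a q ^ 4. So the
  fourth powers agree, and both functions tend to 1.\<close>

theorem K_hat_3_cubic_modulus: "\<forall>\<^sub>F q in nhds 0. K_hat 3 (cubic_modulus q) = cubic_a q"
proof (rule eventually_eq_if_power_eq[of _ _ _ 4])
  let ?s = cubic_modulus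
  show "((\<lambda>q. K_hat 3 (?s q)) \<longlongrightarrow> 1) (nhds 0)"
    using isCont_tendsto_nhds[OF isCont_o2[OF isCont_cubic_modulus, of "K_hat 3"]] isCont_K_hat(2)
    by (simp add: cubic_modulus_0 K_hat_0)
  show "(cubic_a \<longlongrightarrow> 1) (nhds 0)" using isCont_tendsto_nhds[OF theta_cont(2)] by (simp add: theta_0)
  have "\<forall>\<^sub>F q in nhds 0. hyp2f1 (1/12) (5/12) 1 (64 * ?s q * (1 - ?s q) ^ 3 / (1 + 8 * ?s q) ^ 3) ^ 4 = (1 + 8 * ?s q) * K_hat 3 (?s q) ^ 4"
    by (rule eventually_nhds_compose[OF isCont_cubic_modulus cubic_modulus_0 cubic_pullback])
  moreover have "\<forall>\<^sub>F q in nhds 0. eisen4 q \<noteq> 0" "\<forall>\<^sub>F q in nhds 0. cubic_a q \<noteq> 0"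
    by (rule eventually_nhds_nonzero; simp add: theta_cont theta_0)+
  ultimately show "\<forall>\<^sub>F q in nhds 0. K_hat 3 (?s q) ^ 4 = cubic_a q ^ 4"
    using eisen4_hypergeometric eventually_unit_disc
  proof eventually_elim
    case (elim q)
    define a b c where "a = cubic_a q" and "b = cubic_b q ^ 3" and "c = 27 * q * euler (q ^ 3) ^ 9 / euler q ^ 3"
    note E = cubic_eta[OF elim(5), folded c_def]
    have e: "euler q \<noteq> 0" "euler (q ^ 3) \<noteq> 0"
      using elim(5) by (auto intro!: euler_nonzero norm_power_lt)
    have a: "a \<noteq> 0" "a ^ 3 = b + c" "eisen4 q = a ^ 4 + 8 * a * c" using elim(3) E(1,2) by (simp_all add: a_def b_def)
    have s: "?s q = c / a ^ 3" unfolding cubic_modulus_def E(4) unfolding E(5) using e by (simp add: a_def)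
    have b: "b = a ^ 3 - c" using a(2) by simp
    have s1: "1 - c / a ^ 3 = b / a ^ 3" unfolding b using a(1) by (simp add: diff_divide_distrib)
    have s2: "1 + 8 * (c / a ^ 3) = eisen4 q / a ^ 4" unfolding a(3) using a(1) by (simp add: field_simps eval_nat_numeral)
    have "64 * (c / a ^ 3) * (b / a ^ 3) ^ 3 / (x / a ^ 4) ^ 3 = 64 * (c * b ^ 3) / x ^ 3" if "x \<noteq> 0" for x
      using a(1) that by (simp add: power_divide field_simps flip: power_mult power_add)
    from this[OF elim(2)] have "64 * ?s q * (1 - ?s q) ^ 3 / (1 + 8 * ?s q) ^ 3 = 64 * (c * b ^ 3) / eisen4 q ^ 3"
      unfolding s s1 s2 .
    \<comment> \<open>With the factor 64 of the cubic map this is 1728 times the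
      discriminant.\<close>
    also have "c * b ^ 3 = 27 * q * euler q ^ 24" using E(3) by (simp add: b_def flip: power_mult)
    finally have "64 * ?s q * (1 - ?s q) ^ 3 / (1 + 8 * ?s q) ^ 3 = 1728 * (q * euler q ^ 24 / eisen4 q ^ 3)" by simp
    from elim(1)[unfolded this elim(4)] have "eisen4 q = eisen4 q / a ^ 4 * K_hat 3 (?s q) ^ 4" unfolding s s2 .
    thus ?case using elim(2) a(1) by (simp add: a_def field_simps)
  qed
qed simp

section \<open>Functions of the nome on the upper half plane\<close>

lemma eventually_at_cusp: "(\<forall>\<^sub>F \<tau> in at_cusp. P \<tau>) \<longleftrightarrow> (\<exists>Y. \<forall>\<tau>. Y < Im \<tau> \<longrightarrow> P \<tau>)"
  unfolding at_cusp_def by (simp add: eventually_filtercomap_at_top_dense)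

lemma eventually_at_cusp_uhp: "\<forall>\<^sub>F \<tau> in at_cusp. \<tau> \<in> uhp"
  unfolding eventually_at_cusp uhp_def by auto

lemma at_cusp_nontrivial: "at_cusp \<noteq> bot"
proof
  assume "at_cusp = bot"
  hence "\<forall>\<^sub>F \<tau> in at_cusp. False" by simp
  then obtain Y where "\<forall>\<tau>. Y < Im \<tau> \<longrightarrow> False" unfolding eventually_at_cusp by blast
  from this[rule_format, of "\<i> * of_real (Y + 1)"] show False by simp
qed

lemma open_half_plane: "open {\<tau>. Y < Im \<tau>}" and convex_half_plane: "convex {\<tau>. Y < Im \<tau>}"
  by (simp_all add: open_halfspace_Im_gt convex_halfspace_Im_gt)

lemma half_plane_nonempty: "{\<tau>. Y < Im \<tau>} \<noteq> {}"
proof -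
  have "\<i> * of_real (Y + 1) \<in> {\<tau>. Y < Im \<tau>}" by simp
  thus ?thesis by blast
qed

lemma uhp_open: "open uhp" and uhp_connected: "connected uhp"
  unfolding uhp_def using open_half_plane[of 0] convex_connected[OF convex_half_plane[of 0]] by simp_all

lemma norm_qpow: "norm (qpow s \<tau>) = exp (- (2 * pi * s * Im \<tau>))"
  by (simp add: qpow_def norm_exp_eq_Re)

lemma qpow_nonzero: "qpow s \<tau> \<noteq> 0"
  by (simp add: qpow_def)

lemma qpow_add: "qpow s \<tau> * qpow t \<tau> = qpow (s + t) \<tau>"
  by (simp add: qpow_def algebra_simps flip: exp_add)

lemma qpow_power: "qpow s \<tau> ^ n = qpow (of_nat n * s) \<tau>"
  by (simp add: qpow_def algebra_simps flip: exp_of_nat_mult)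

lemma qpow_0: "qpow 0 \<tau> = 1"
  by (simp add: qpow_def)

lemma norm_qpow_less: "s > 0 \<Longrightarrow> \<tau> \<in> uhp \<Longrightarrow> norm (qpow s \<tau>) < 1"
  by (simp add: norm_qpow uhp_def)

lemma qpow_holomorphic: "qpow s holomorphic_on A"
  unfolding qpow_def[abs_def] by (intro holomorphic_intros)

lemma qpow_compose_holomorphic:
  assumes "s > 0" "F holomorphic_on ball 0 1"
  shows "(\<lambda>\<tau>. F (qpow s \<tau>)) holomorphic_on uhp"
proof -
  have "(F \<circ> qpow s) holomorphic_on uhp"
    by (rule holomorphic_on_compose_gen[OF qpow_holomorphic assms(2)]) (use norm_qpow_less[OF assms(1)] in auto)
  thus ?thesis by (simp add: o_def)
qed

lemma qpow_tendsto_0: "s > 0 \<Longrightarrow> filterlim (qpow s) (nhds 0) at_cusp"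
proof -
  assume s: "s > 0"
  have "((\<lambda>y. exp (- (2 * pi * s * y))) \<longlongrightarrow> 0) at_top"
    by (rule filterlim_compose[OF exp_at_bot])
      (use s filterlim_tendsto_pos_mult_at_top[OF tendsto_const[of "2 * pi * s"] _ filterlim_ident[of at_top]] in
        \<open>simp add: filterlim_uminus_at_bot\<close>)
  hence "((\<lambda>\<tau>. exp (- (2 * pi * s * Im \<tau>))) \<longlongrightarrow> 0) at_cusp"
    unfolding at_cusp_def by (rule filterlim_filtercomapI)
  thus ?thesis by (intro tendsto_norm_zero_cancel[of "qpow s"]) (simp only: norm_qpow)
qed

lemma eventually_at_cusp_nome:
  assumes "\<forall>\<^sub>F q in nhds 0. P q"
  shows "\<forall>\<^sub>F \<tau> in at_cusp. P (nome \<tau>)"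
  by (rule eventually_compose_filterlim[OF assms qpow_tendsto_0]) simp

lemma tendsto_at_cusp_nome:
  assumes "isCont F 0"
  shows "((\<lambda>\<tau>. F (nome \<tau>)) \<longlongrightarrow> F 0) at_cusp"
  by (rule filterlim_compose[OF isCont_tendsto_nhds[OF assms] qpow_tendsto_0]) simp

lemma qpow_of_nat_mult: "qpow s (of_nat m * \<tau>) = qpow (s * of_nat m) \<tau>"
  by (simp add: qpow_def mult.assoc)

lemma eta_at_euler: "eta_at m \<tau> = qpow (real m / 24) \<tau> * euler (nome \<tau> ^ m)"
proof -
  have "nome (of_nat m * \<tau>) = nome \<tau> ^ m" by (simp add: qpow_of_nat_mult qpow_power)
  thus ?thesis by (simp add: eta_at_def dedekind_eta_def euler_def qpoch_def qpow_of_nat_mult)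
qed

lemma eta_at_power: "eta_at m \<tau> ^ k = qpow (real (k * m) / 24) \<tau> * euler (nome \<tau> ^ m) ^ k"
  by (simp add: eta_at_euler power_mult_distrib qpow_power)

lemma norm_nome_power: "\<tau> \<in> uhp \<Longrightarrow> m > 0 \<Longrightarrow> norm (nome \<tau> ^ m) < 1"
  using norm_qpow_less[of 1 \<tau>] norm_power_lt by simp

lemma euler_nome_nonzero: "\<tau> \<in> uhp \<Longrightarrow> m > 0 \<Longrightarrow> euler (nome \<tau> ^ m) \<noteq> 0"
  by (rule euler_nonzero) (rule norm_nome_power)

lemma euler_nome_nonzero1: "\<tau> \<in> uhp \<Longrightarrow> euler (nome \<tau>) \<noteq> 0"
  using euler_nome_nonzero[of \<tau> 1] by simp

lemma euler_power_holomorphic: "m > 0 \<Longrightarrow> (\<lambda>q. euler (q ^ m)) holomorphic_on ball 0 1"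
  using holomorphic_on_compose_gen[of "\<lambda>q. q ^ m" "ball 0 1" euler "ball 0 1"] euler_holomorphic norm_power_lt
  by (force simp: o_def intro!: holomorphic_intros)

section \<open>Continuation to the upper half plane\<close>

lemma continue_uhp_eventually: "\<forall>\<^sub>F \<tau> in at_cusp. continue_uhp f \<tau> = f \<tau>"
proof (cases "\<exists>g. g holomorphic_on uhp \<and> (\<forall>\<^sub>F \<tau> in at_cusp. g \<tau> = f \<tau>)")
  case True
  from someI_ex[OF True] True show ?thesis by (simp add: continue_uhp_def)
next
  case False
  hence "continue_uhp f = f" unfolding continue_uhp_def by (rule if_not_P)
  thus ?thesis by simp
qed

lemma eq_on_uhp:
  assumes "f holomorphic_on uhp" "g holomorphic_on uhp" "\<forall>\<^sub>F \<tau> in at_cusp. f \<tau> = g \<tau>" "\<tau> \<in> uhp"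
  shows "f \<tau> = g \<tau>"
proof -
  obtain Y where Y: "\<And>\<tau>. Y < Im \<tau> \<Longrightarrow> f \<tau> = g \<tau>" using assms(3) unfolding eventually_at_cusp by blast
  show ?thesis
    by (rule analytic_continuation_open[of "{\<tau>. max Y 0 < Im \<tau>}" uhp, OF open_half_plane uhp_open half_plane_nonempty
        uhp_connected _ assms(1,2) _ assms(4)]) (auto simp: uhp_def Y)
qed

lemma continue_uhp_eq:
  assumes "g holomorphic_on uhp" "\<forall>\<^sub>F \<tau> in at_cusp. f \<tau> = g \<tau>" "\<tau> \<in> uhp"
  shows "continue_uhp f \<tau> = g \<tau>"
proof -
  have "\<exists>g. g holomorphic_on uhp \<and> (\<forall>\<^sub>F \<tau> in at_cusp. g \<tau> = f \<tau>)"
    using assms(1,2) by (intro exI[of _ g]) (auto elim: eventually_mono)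
  from someI_ex[OF this] this have "continue_uhp f holomorphic_on uhp" by (simp add: continue_uhp_def)
  thus ?thesis using assms(1)
    by (rule eq_on_uhp) (use continue_uhp_eventually[of f] assms(2,3) in \<open>auto elim: eventually_elim2\<close>)
qed

text \<open>Two logarithms of \<open>f\<close> differ by a constant, so the two powers have a constant ratio of
  modulus 1, which is positive.\<close>
lemma is_positive_power_unique:
  assumes "is_positive_power f c g" "is_positive_power f c h"
  shows "\<forall>\<^sub>F \<tau> in at_cusp. g \<tau> = h \<tau>"
proof -
  obtain Y1 L1 where 1: "L1 holomorphic_on {\<tau>. Y1 < Im \<tau>}" "\<And>\<tau>. Y1 < Im \<tau> \<Longrightarrow> exp (L1 \<tau>) = f \<tau>"
    "\<And>\<tau>. Y1 < Im \<tau> \<Longrightarrow> g \<tau> = exp (of_real c * L1 \<tau>)" "\<And>y. y > Y1 \<Longrightarrow> \<exists>p>0. g (\<i> * of_real y) = of_real p"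
    using assms(1) unfolding is_positive_power_def by blast
  obtain Y2 L2 where 2: "L2 holomorphic_on {\<tau>. Y2 < Im \<tau>}" "\<And>\<tau>. Y2 < Im \<tau> \<Longrightarrow> exp (L2 \<tau>) = f \<tau>"
    "\<And>\<tau>. Y2 < Im \<tau> \<Longrightarrow> h \<tau> = exp (of_real c * L2 \<tau>)" "\<And>y. y > Y2 \<Longrightarrow> \<exists>p>0. h (\<i> * of_real y) = of_real p"
    using assms(2) unfolding is_positive_power_def by blast
  define Y where "Y = max Y1 Y2"
  define H where "H = {\<tau>. Y < Im \<tau>}"
  define D where "D \<tau> = L1 \<tau> - L2 \<tau>" for \<tau>
  have "D holomorphic_on H" unfolding D_def
    by (intro holomorphic_intros holomorphic_on_subset[OF 1(1)] holomorphic_on_subset[OF 2(1)]) (auto simp: H_def Y_def)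
  moreover have e: "exp (D \<tau>) = 1" if "\<tau> \<in> H" for \<tau>
    using 1(2)[of \<tau>] 2(2)[of \<tau>] that unfolding D_def exp_diff H_def Y_def by (metis exp_not_eq_zero divide_self max_less_iff_conj mem_Collect_eq)
  have oH: "open H" unfolding H_def by (rule open_half_plane)
  have "(D has_field_derivative 0) (at \<tau> within H)" if t: "\<tau> \<in> H" for \<tau>
  proof -
    have d: "(D has_field_derivative deriv D \<tau>) (at \<tau>)"
      using \<open>D holomorphic_on H\<close> oH t by (rule holomorphic_derivI)
    from DERIV_fun_exp[OF this] have "((\<lambda>_. 1) has_field_derivative exp (D \<tau>) * deriv D \<tau>) (at \<tau>)"
      by (rule has_field_derivative_transform_within_open[OF _ oH t]) (rule e)
    hence "exp (D \<tau>) * deriv D \<tau> = 0" using DERIV_const DERIV_unique by blast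
    thus ?thesis using d has_field_derivative_at_within by fastforce
  qed
  then obtain k where k: "\<And>\<tau>. \<tau> \<in> H \<Longrightarrow> D \<tau> = k"
    using has_field_derivative_zero_constant[of H D] convex_half_plane[of Y] unfolding H_def by blast
  define w where "w = exp (of_real c * k)"
  have gh: "g \<tau> = w * h \<tau>" if "\<tau> \<in> H" for \<tau>
  proof -
    have "L1 \<tau> = k + L2 \<tau>" using k[OF that] by (simp add: D_def algebra_simps)
    thus ?thesis using 1(3)[of \<tau>] 2(3)[of \<tau>] that by (simp add: H_def Y_def w_def distrib_left exp_add)
  qed
  have i: "\<i> * of_real (Y + 1) \<in> H" by (simp add: H_def)
  have "exp k = 1" using e[OF i] k[OF i] by simp
  hence "Re k = 0" by (metis exp_eq_1)
  hence "norm w = 1" by (simp add: w_def norm_exp_eq_Re)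
  moreover obtain p p' where p: "p > 0" "p' > 0" "g (\<i> * of_real (Y + 1)) = of_real p" "h (\<i> * of_real (Y + 1)) = of_real p'"
  proof -
    have "Y1 < Y + 1" "Y2 < Y + 1" by (simp_all add: Y_def)
    from 1(4)[OF this(1)] 2(4)[OF this(2)] show ?thesis using that by blast
  qed
  from gh[OF i] p have wp: "of_real p = w * of_real p'" by simp
  hence "p = norm w * p'" using p(1,2) by (metis abs_of_pos norm_mult norm_of_real)
  hence "p = p'" using calculation by simp
  hence "w = 1" using wp p(2) by simp
  thus ?thesis unfolding eventually_at_cusp using gh by (intro exI[of _ Y]) (simp add: H_def)
qed

text \<open>On the positive imaginary axis the nome is real. A germ that is real there and equals 1
  at the cusp is positive near the cusp, which singles out the branch in
  \<open>is_positive_power\<close>.\<close>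

definition real_germ :: "(complex \<Rightarrow> complex) \<Rightarrow> bool"
  where "real_germ G \<longleftrightarrow> G analytic_on {0} \<and> G 0 = 1 \<and> (\<forall>\<^sub>F q in nhds 0. q \<in> \<real> \<longrightarrow> G q \<in> \<real>)"

text \<open>Here f is an integral power, possibly negative, of a function with a visible logarithm
  \<open>L\<close>: the winding is carried by the term linear in \<tau>, and the principal logarithm
  is applied only to G, which is close to 1. Then k * L is a logarithm of f, and the power 1 / k of
  f is exp L.\<close>

lemma is_positive_power_germ:
  assumes "real_germ G" "k \<noteq> 0" "c0 > 0"
    and f: "\<forall>\<^sub>F \<tau> in at_cusp. f \<tau> = (of_real c0 * qpow s \<tau> * G (nome \<tau>)) powi k"
  shows "is_positive_power f (1 / of_int k) (\<lambda>\<tau>. of_real c0 * qpow s \<tau> * G (nome \<tau>))"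
proof -
  have G: "G analytic_on {0}" "G 0 = 1" "\<forall>\<^sub>F q in nhds 0. q \<in> \<real> \<longrightarrow> G q \<in> \<real>" using assms(1) by (simp_all add: real_germ_def)
  obtain S where S: "open S" "0 \<in> S" "G holomorphic_on S" using G(1) by (auto simp: analytic_at)
  have "isCont G 0" using S by (meson continuous_on_eq_continuous_at holomorphic_on_imp_continuous_on)
  from isCont_tendsto_nhds[OF this] have "\<forall>\<^sub>F q in nhds 0. dist (G q) 1 < 1" unfolding G(2) by (rule tendstoD) simp
  hence "\<forall>\<^sub>F q in nhds 0. q \<in> S \<and> norm (G q - 1) < 1 \<and> (q \<in> \<real> \<longrightarrow> G q \<in> \<real>)"
    using G(3) eventually_nhds_in_open[OF S(1,2)] by eventually_elim (simp add: dist_norm)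
  from eventually_conj[OF eventually_at_cusp_nome[OF this] f]
  obtain Y0 where Y0: "\<And>\<tau>. Y0 < Im \<tau> \<Longrightarrow> nome \<tau> \<in> S" "\<And>\<tau>. Y0 < Im \<tau> \<Longrightarrow> norm (G (nome \<tau>) - 1) < 1"
    "\<And>\<tau>. Y0 < Im \<tau> \<Longrightarrow> nome \<tau> \<in> \<real> \<Longrightarrow> G (nome \<tau>) \<in> \<real>"
    "\<And>\<tau>. Y0 < Im \<tau> \<Longrightarrow> f \<tau> = (of_real c0 * qpow s \<tau> * G (nome \<tau>)) powi k"
    unfolding eventually_at_cusp by blast
  define Y where "Y = max Y0 1"
  define H where "H = {\<tau>. Y < Im \<tau>}"
  have Re: "Re (G (nome \<tau>)) > 0" if "\<tau> \<in> H" for \<tau>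
  proof -
    have "\<bar>Re (G (nome \<tau>) - 1)\<bar> < 1"
      using Y0(2)[of \<tau>] that abs_Re_le_cmod[of "G (nome \<tau>) - 1"] by (simp add: H_def Y_def)
    thus ?thesis by simp
  qed
  define L where "L \<tau> = 2 * of_real pi * \<i> * of_real s * \<tau> + of_real (ln c0) + Ln (G (nome \<tau>))" for \<tau>
  have GH: "(\<lambda>\<tau>. G (nome \<tau>)) holomorphic_on H"
    using holomorphic_on_compose_gen[OF qpow_holomorphic[of 1 H] S(3)] Y0(1) by (force simp: o_def H_def Y_def)
  have LH: "L holomorphic_on H" unfolding L_def
    by (intro holomorphic_intros GH) (use Re in \<open>force simp: complex_nonpos_Reals_iff\<close>)
  have eL: "exp (L \<tau>) = of_real c0 * qpow s \<tau> * G (nome \<tau>)" if "\<tau> \<in> H" for \<tau>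
  proof -
    have "G (nome \<tau>) \<noteq> 0" using Re[OF that] by auto
    moreover have "exp (complex_of_real (ln c0)) = of_real c0" using assms(3) by (metis exp_ln exp_of_real)
    ultimately show ?thesis by (simp add: L_def exp_add qpow_def)
  qed
  show ?thesis unfolding is_positive_power_def
  proof (rule exI[of _ Y], intro conjI exI[of _ "\<lambda>\<tau>. of_int k * L \<tau>"] allI impI)
    show "Y > 0" by (simp add: Y_def)
    show "(\<lambda>\<tau>. of_int k * L \<tau>) holomorphic_on {\<tau>. Y < Im \<tau>}"
      using LH unfolding H_def by (intro holomorphic_intros)
    fix \<tau> assume t: "Y < Im \<tau>"
    hence tH: "\<tau> \<in> H" by (simp add: H_def)
    show "exp (of_int k * L \<tau>) = f \<tau>"
      using Y0(4)[of \<tau>] t eL[OF tH] by (simp add: Y_def flip: exp_power_int)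
    have "of_real (1 / of_int k) * (of_int k * L \<tau>) = L \<tau>" using assms(2) by simp
    thus "of_real c0 * qpow s \<tau> * G (nome \<tau>) = exp (of_real (1 / of_int k) * (of_int k * L \<tau>))"
      using eL[OF tH] by simp
  next
    fix y assume y: "y > Y"
    hence tH: "\<i> * of_real y \<in> H" by (simp add: H_def)
    have re: "qpow r (\<i> * of_real y) = of_real (exp (- (2 * pi * r * y)))" for r
      by (simp add: qpow_def exp_of_real[symmetric] algebra_simps)
    have "G (nome (\<i> * of_real y)) \<in> \<real>" using Y0(3)[of "\<i> * of_real y"] y by (simp add: re Y_def)
    hence "G (nome (\<i> * of_real y)) = of_real (Re (G (nome (\<i> * of_real y))))" by simp
    moreover have "c0 * exp (- (2 * pi * s * y)) * Re (G (nome (\<i> * of_real y))) > 0" using Re[OF tH] assms(3) by simp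
    ultimately show "\<exists>p>0. of_real c0 * qpow s (\<i> * of_real y) * G (nome (\<i> * of_real y)) = of_real p"
      unfolding re[of s] by (metis of_real_mult)
  qed
qed

lemma cusp_power_germ:
  assumes "real_germ G" "k \<noteq> 0" "c0 > 0"
    and f: "\<forall>\<^sub>F \<tau> in at_cusp. f \<tau> = (of_real c0 * qpow s \<tau> * G (nome \<tau>)) powi k" and c: "c = 1 / of_int k"
  shows "\<forall>\<^sub>F \<tau> in at_cusp. cusp_power f c \<tau> = of_real c0 * qpow s \<tau> * G (nome \<tau>)"
    and "(\<lambda>\<tau>. of_real c0 * qpow s \<tau> * G (nome \<tau>)) holomorphic_on uhp \<Longrightarrow> \<tau> \<in> uhp \<Longrightarrow>
      cusp_power f c \<tau> = of_real c0 * qpow s \<tau> * G (nome \<tau>)"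
proof -
  let ?g = "\<lambda>\<tau>. of_real c0 * qpow s \<tau> * G (nome \<tau>)"
  have g: "is_positive_power f c ?g" unfolding c by (rule is_positive_power_germ[OF assms(1-4)])
  from someI[of "is_positive_power f c", OF g] is_positive_power_unique g
  have e: "\<forall>\<^sub>F \<tau> in at_cusp. (SOME g. is_positive_power f c g) \<tau> = ?g \<tau>" by blast
  thus "\<forall>\<^sub>F \<tau> in at_cusp. cusp_power f c \<tau> = ?g \<tau>"
    using continue_uhp_eventually[of "SOME g. is_positive_power f c g"] unfolding cusp_power_def
    by eventually_elim simp
  assume "?g holomorphic_on uhp" "\<tau> \<in> uhp"
  thus "cusp_power f c \<tau> = ?g \<tau>" unfolding cusp_power_def using e by (intro continue_uhp_eq)
qed

lemma real_germ_mult: "real_germ F \<Longrightarrow> real_germ G \<Longrightarrow> real_germ (\<lambda>q. F q * G q)"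
  unfolding real_germ_def by (auto intro!: analytic_intros elim: eventually_elim2)

lemma real_germ_divide: "real_germ F \<Longrightarrow> real_germ G \<Longrightarrow> real_germ (\<lambda>q. F q / G q)"
  unfolding real_germ_def by (auto intro!: analytic_intros elim: eventually_elim2)

lemma real_germ_power: "real_germ F \<Longrightarrow> real_germ (\<lambda>q. F q ^ n)"
  unfolding real_germ_def by (auto intro!: analytic_intros elim: eventually_mono)

lemma real_germ_holomorphic:
  assumes "F holomorphic_on ball 0 1" "F 0 = 1" "\<And>q. norm q < 1 \<Longrightarrow> q \<in> \<real> \<Longrightarrow> F q \<in> \<real>"
  shows "real_germ F"
  unfolding real_germ_def
proof (intro conjI)
  show "F analytic_on {0}" using assms(1) by (auto simp: analytic_at intro!: exI[of _ "ball 0 1"])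
  show "\<forall>\<^sub>F q in nhds 0. q \<in> \<real> \<longrightarrow> F q \<in> \<real>" using eventually_unit_disc by eventually_elim (use assms(3) in blast)
qed (rule assms(2))

lemma lambert_real:
  assumes "\<And>m n. f m n \<in> \<real>" "q \<in> \<real>"
  shows "lambert f q \<in> \<real>"
proof -
  have "cnj (f m n * q ^ (m * n)) = f m n * q ^ (m * n)" for m n
    using assms by (simp add: Reals_cnj_iff)
  hence "cnj (lambert f q) = lambert f q"
    unfolding lambert_def infsum_cnj[symmetric] by (intro infsum_cong) auto
  thus ?thesis by (simp add: Reals_cnj_iff)
qed

lemma euler_real:
  assumes "norm q < 1" "q \<in> \<real>"
  shows "euler q \<in> \<real>"
  unfolding euler_def
  by (rule Lim_in_closed_set[OF closed_complex_Reals _ _ qpoch_LIMSEQ[OF assms(1)]]) (use assms(2) in \<open>auto intro!: always_eventually\<close>)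

lemma real_germ_euler: "m > 0 \<Longrightarrow> real_germ (\<lambda>q. euler (q ^ m))"
  by (rule real_germ_holomorphic[OF euler_power_holomorphic])
    (auto simp: euler_0 power_0_left intro!: euler_real norm_power_lt)

lemma real_germ_theta: "real_germ phi_sq" "real_germ cubic_a" "real_germ odd_sum" "real_germ (\<lambda>q. phi_sq (- q))"
proof -
  have 1: "phi_sq q \<in> \<real>" "cubic_a q \<in> \<real>" "odd_sum q \<in> \<real>" if "q \<in> \<real>" for q
    unfolding phi_sq_def cubic_a_def odd_sum_def
    by (intro Reals_add Reals_mult Reals_1 Reals_numeral lambert_real that; simp add: chi3_def chi4_def)+
  thus "real_germ phi_sq" "real_germ cubic_a" "real_germ odd_sum"
    by (auto intro!: real_germ_holomorphic phi_sq_holomorphic cubic_a_holomorphic odd_sum_holomorphic simp: theta_0)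
  have "(phi_sq \<circ> uminus) holomorphic_on ball 0 1"
    by (rule holomorphic_on_compose_gen[OF _ phi_sq_holomorphic]) (auto intro!: holomorphic_intros)
  thus "real_germ (\<lambda>q. phi_sq (- q))" using 1 by (intro real_germ_holomorphic) (auto simp: o_def theta_0)
qed

lemma real_germ_csqrt_odd_sum: "real_germ (\<lambda>q. csqrt (odd_sum q))"
proof -
  note g = real_germ_theta(3)[unfolded real_germ_def]
  have "\<forall>\<^sub>F q in nhds 0. dist (odd_sum q) 1 < 1"
    using isCont_tendsto_nhds[OF theta_cont(4)] unfolding theta_0 by (rule tendstoD) simp
  hence "\<forall>\<^sub>F q in nhds 0. q \<in> \<real> \<longrightarrow> csqrt (odd_sum q) \<in> \<real>"
    using g[THEN conjunct2, THEN conjunct2]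
  proof eventually_elim
    case (elim q)
    show ?case
    proof
      assume "q \<in> \<real>"
      with elim(2) have r: "odd_sum q = of_real (Re (odd_sum q))" by simp
      have "\<bar>Re (odd_sum q - 1)\<bar> < 1" using elim(1) abs_Re_le_cmod[of "odd_sum q - 1"] by (simp add: dist_norm)
      hence "Re (odd_sum q) \<ge> 0" by simp
      thus "csqrt (odd_sum q) \<in> \<real>" using r by (metis Reals_of_real csqrt_of_real)
    qed
  qed
  thus ?thesis using g by (auto simp: real_germ_def intro!: analytic_intros)
qed

lemma real_germ_tendsto: "real_germ G \<Longrightarrow> ((\<lambda>\<tau>. G (nome \<tau>)) \<longlongrightarrow> 1) at_cusp"
  using tendsto_at_cusp_nome[of G] analytic_at_imp_isCont[of G 0] by (simp add: real_germ_def)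

section \<open>The modular invariant as a function of the Hauptmoduln\<close>

text \<open>A root of P is not a root of Q, so its linear factor divides R; it is cancelled, and the
  degree of P drops.\<close>

lemma dvd_if_no_common_root:
  fixes P Q R :: "complex poly"
  assumes "P dvd R * Q" "P \<noteq> 0" "\<And>z. poly P z = 0 \<Longrightarrow> poly Q z \<noteq> 0"
  shows "P dvd R"
  using assms
proof (induction "degree P" arbitrary: P R)
  case 0
  then obtain c where "P = [:c:]" "c \<noteq> 0" by (metis degree_eq_zeroE pCons_0_0)
  thus ?case by (simp add: is_unit_triv unit_imp_dvd)
next
  case (Suc n)
  have "\<not> constant (poly P)" using Suc.hyps(2) by (simp add: constant_degree)
  then obtain z where z: "poly P z = 0" using fundamental_theorem_of_algebra by blast
  then obtain P' where P': "P = [:- z, 1:] * P'" by (metis dvdE poly_eq_0_iff_dvd)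
  have P'0: "P' \<noteq> 0" using Suc.prems(2) P' by auto
  have "poly (R * Q) z = 0" using Suc.prems(1) z by (metis dvd_trans poly_eq_0_iff_dvd)
  hence "poly R z = 0" using Suc.prems(3)[OF z] by simp
  then obtain R' where R': "R = [:- z, 1:] * R'" by (metis dvdE poly_eq_0_iff_dvd)
  have "[:- z, 1:] * P' dvd [:- z, 1:] * (R' * Q)" using Suc.prems(1) unfolding P' R' by (simp only: mult.assoc)
  hence "P' dvd R' * Q" by (simp only: dvd_mult_cancel_left) simp
  moreover have "degree P = degree [:- z, 1:] + degree P'" unfolding P' by (rule degree_mult_eq) (use P'0 in auto)
  hence "n = degree P'" using Suc.hyps(2) by simp
  ultimately have "P' dvd R'" using Suc.hyps(1)[of P' R'] P'0 Suc.prems(3) by (simp add: P')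
  thus ?case unfolding P' R' by (rule mult_dvd_mono[OF dvd_refl])
qed

lemma coprime_iff_no_common_root:
  fixes P Q :: "complex poly"
  assumes "Q \<noteq> 0"
  shows "coprime P Q \<longleftrightarrow> (\<forall>z. poly P z = 0 \<longrightarrow> poly Q z \<noteq> 0)"
proof
  assume c: "coprime P Q"
  show "\<forall>z. poly P z = 0 \<longrightarrow> poly Q z \<noteq> 0"
  proof (intro allI impI notI)
    fix z assume "poly P z = 0" "poly Q z = 0"
    hence "[:- z, 1:] dvd P" "[:- z, 1:] dvd Q" by (simp_all add: poly_eq_0_iff_dvd)
    hence "is_unit [:- z, 1:]" using c by (meson coprime_common_divisor)
    thus False by (simp add: is_unit_poly_iff)
  qed
next
  assume r: "\<forall>z. poly P z = 0 \<longrightarrow> poly Q z \<noteq> 0"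
  show "coprime P Q"
  proof (rule coprimeI)
    fix c assume c: "c dvd P" "c dvd Q"
    have "degree c = 0"
    proof (rule ccontr)
      assume "degree c \<noteq> 0"
      hence "\<not> constant (poly c)" by (simp add: constant_degree)
      then obtain z where "poly c z = 0" using fundamental_theorem_of_algebra by blast
      thus False using r c by (meson dvd_trans poly_eq_0_iff_dvd)
    qed
    moreover have "c \<noteq> 0" using c(2) assms by auto
    ultimately show "is_unit c" by (metis degree_eq_zeroE is_unit_triv pCons_0_0)
  qed
qed

text \<open>Each numerator divides the other, so they differ by a unit of the polynomial ring, that
  is a nonzero constant.\<close>

lemma coprime_fractions_unique:
  fixes P Q P' Q' :: "complex poly"
  assumes c: "coprime P Q" "coprime P' Q'" and n: "P \<noteq> 0" "Q \<noteq> 0" "Q' \<noteq> 0" and e: "P * Q' = P' * Q"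
  shows "\<exists>d. d \<noteq> 0 \<and> P = smult d P' \<and> Q = smult d Q'"
proof -
  have P': "P' \<noteq> 0" using e n by auto
  have "P dvd P'"
    by (rule dvd_if_no_common_root[of _ _ Q]) (use c(1) n e in \<open>auto simp: coprime_iff_no_common_root simp flip: e\<close>)
  then obtain k where k: "P' = P * k" by blast
  have "P' dvd P"
    by (rule dvd_if_no_common_root[of _ _ Q']) (use c(2) n e P' in \<open>auto simp: coprime_iff_no_common_root\<close>)
  then obtain l where l: "P = P' * l" by blast
  have "P * (k * l) = P * 1" using l unfolding k by (simp add: mult.assoc)
  hence "k * l = 1" using n(1) by (simp only: mult_cancel_left) simp
  hence "is_unit l" by (metis dvd_triv_right)
  then obtain d where d: "l = [:d:]" "d dvd 1" unfolding is_unit_poly_iff by blast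
  hence d0: "d \<noteq> 0" by auto
  have Pd: "P = smult d P'" using l d by simp
  have "P' * smult d Q' = P' * Q" using e unfolding Pd by (simp add: mult.commute)
  hence "Q = smult d Q'" using P' by (simp only: mult_cancel_left) simp
  thus ?thesis using Pd d0 by blast
qed

lemma eisenstein4_nome:
  assumes "\<tau> \<in> uhp"
  shows "eisenstein4 \<tau> = eisen4 (nome \<tau>)"
proof -
  have "norm (nome \<tau>) < 1" using norm_qpow_less[OF _ assms, of 1] by simp
  from lambert_divisors[OF this, of "\<lambda>m n. of_nat m ^ 3"] tame_of_nat_pow[of 3]
  have "((\<lambda>n. (\<Sum>d | d dvd n. of_nat d ^ 3) * nome \<tau> ^ n) has_sum power_lambert 3 (nome \<tau>)) {1..}"
    by (simp add: power_lambert_def)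
  from infsumI[OF this] show ?thesis by (simp add: eisenstein4_def eisen4_def)
qed

lemma modular_j_nome:
  assumes "\<tau> \<in> uhp"
  shows "modular_j \<tau> = eisen4 (nome \<tau>) ^ 3 / (nome \<tau> * euler (nome \<tau>) ^ 24)"
proof -
  have "dedekind_eta \<tau> ^ 24 = eta_at 1 \<tau> ^ 24" by (simp add: eta_at_def)
  also have "\<dots> = nome \<tau> * euler (nome \<tau>) ^ 24" by (simp add: eta_at_power)
  finally show ?thesis by (simp add: modular_j_def eisenstein4_nome[OF assms])
qed

section \<open>The Hauptmoduln in terms of the nome, and the form h\<close>

definition haupt_disc :: "nat \<Rightarrow> complex \<Rightarrow> complex"
  where "haupt_disc M q = of_real (kappa M) * (q * (euler (q ^ M) / euler q) ^ (24 div (M - 1)))"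

lemma hauptmodul_nome:
  assumes "M \<in> {2, 3, 4}"
  shows "hauptmodul M \<tau> = haupt_disc M (nome \<tau>)"
proof -
  define k where "k = 24 div (M - 1)"
  have k: "real (k * M) / 24 = 1 + real k / 24" using assms by (auto simp: k_def)
  show ?thesis unfolding hauptmodul_def haupt_disc_def k_def[symmetric] eta_at_power k qpow_add[symmetric]
    by (simp add: qpow_nonzero power_divide)
qed

lemma haupt_disc_nonzero:
  assumes "norm q < 1" "q \<noteq> 0" "M > 0"
  shows "haupt_disc M q \<noteq> 0"
  using assms euler_nonzero[OF assms(1)] euler_nonzero[OF norm_power_lt[OF assms(1,3)]] by (simp add: haupt_disc_def kappa_def)

lemma hauptmodul_tendsto:
  assumes "M \<in> {2, 3, 4}"
  shows "(hauptmodul M \<longlongrightarrow> 0) at_cusp"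
proof -
  have "M > 0" using assms by auto
  hence "isCont (haupt_disc M) 0" unfolding haupt_disc_def[abs_def]
    by (intro continuous_intros isCont_ball[OF euler_power_holomorphic] theta_cont) (simp_all add: euler_0)
  moreover have "hauptmodul M = (\<lambda>\<tau>. haupt_disc M (nome \<tau>))" "haupt_disc M 0 = 0"
    using hauptmodul_nome[OF assms] by (simp_all add: fun_eq_iff haupt_disc_def)
  ultimately show ?thesis using tendsto_at_cusp_nome[of "haupt_disc M"] by simp
qed

lemma hauptmodul_nonzero:
  assumes "M \<in> {2, 3, 4}" "\<tau> \<in> uhp"
  shows "hauptmodul M \<tau> \<noteq> 0"
  unfolding hauptmodul_nome[OF assms(1)]
  by (rule haupt_disc_nonzero) (use assms norm_qpow_less[OF _ assms(2), of 1] in \<open>auto simp: qpow_nonzero\<close>)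

text \<open>It tends to 0 at the cusp without ever being 0, which is impossible with finitely many
  values.\<close>

lemma infinite_hauptmodul:
  assumes "M \<in> {2, 3, 4}"
  shows "infinite (hauptmodul M ` uhp)"
proof
  assume "finite (hauptmodul M ` uhp)"
  moreover have "0 \<notin> hauptmodul M ` uhp" using hauptmodul_nonzero[OF assms] by force
  ultimately have "open (- hauptmodul M ` uhp)" "0 \<in> - hauptmodul M ` uhp"
    by (auto simp: open_Compl finite_imp_closed)
  with hauptmodul_tendsto[OF assms] have "\<forall>\<^sub>F \<tau> in at_cusp. hauptmodul M \<tau> \<in> - hauptmodul M ` uhp"
    unfolding tendsto_def by blast
  hence "\<forall>\<^sub>F \<tau> in at_cusp. False" using eventually_at_cusp_uhp by eventually_elim auto
  thus False using at_cusp_nontrivial by simp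
qed

text \<open>\<open>j_fraction\<close> is an arbitrary choice of a reduced fraction. Since the
  Hauptmodul takes infinitely many values, any two choices agree as rational functions and differ by
  a constant, which cancels here.\<close>

lemma h_level_eq:
  assumes M: "M \<in> {2, 3, 4}" and c: "coprime P Q" and P0: "P \<noteq> 0"
    and j: "\<And>\<tau>. \<tau> \<in> uhp \<Longrightarrow> poly Q (hauptmodul M \<tau>) \<noteq> 0 \<and> modular_j \<tau> = poly P (hauptmodul M \<tau>) / poly Q (hauptmodul M \<tau>)"
  shows "h_level M t = (poly P t / poly P 0) powr (- 1 / 12) * hyp2f1 (1/12) (5/12) 1 (12 ^ 3 * poly Q t / poly P t)"
proof -
  let ?good = "\<lambda>(P, Q). coprime P Q \<and> (\<forall>\<tau>\<in>uhp. poly Q (hauptmodul M \<tau>) \<noteq> 0 \<and>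
       modular_j \<tau> = poly P (hauptmodul M \<tau>) / poly Q (hauptmodul M \<tau>))"
  obtain P' Q' where PQ: "j_fraction M = (P', Q')" by fastforce
  have "?good (P, Q)" using c j by simp
  hence "?good (j_fraction M)" unfolding j_fraction_def by (rule someI[of ?good])
  hence c': "coprime P' Q'" and j': "\<And>\<tau>. \<tau> \<in> uhp \<Longrightarrow> poly Q' (hauptmodul M \<tau>) \<noteq> 0"
    "\<And>\<tau>. \<tau> \<in> uhp \<Longrightarrow> modular_j \<tau> = poly P' (hauptmodul M \<tau>) / poly Q' (hauptmodul M \<tau>)"
    by (simp_all add: PQ)
  have i: "\<i> \<in> uhp" by (simp add: uhp_def)
  have Q0: "Q \<noteq> 0" "Q' \<noteq> 0" using j[OF i] j'(1)[OF i] by auto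
  have "P * Q' = P' * Q"
  proof (rule ccontr)
    assume "P * Q' \<noteq> P' * Q"
    hence "finite {t. poly (P * Q' - P' * Q) t = 0}" by (intro poly_roots_finite) simp
    moreover have "hauptmodul M ` uhp \<subseteq> {t. poly (P * Q' - P' * Q) t = 0}"
    proof clarify
      fix \<tau> assume t: "\<tau> \<in> uhp"
      have "poly P (hauptmodul M \<tau>) / poly Q (hauptmodul M \<tau>) = poly P' (hauptmodul M \<tau>) / poly Q' (hauptmodul M \<tau>)"
        using j[OF t] j'(2)[OF t] by metis
      thus "poly (P * Q' - P' * Q) (hauptmodul M \<tau>) = 0"
        using j[OF t] j'(1)[OF t] by (simp add: frac_eq_eq)
    qed
    ultimately show False using infinite_hauptmodul[OF M] finite_subset by blast
  qed
  from coprime_fractions_unique[OF c c' P0 Q0 this] obtain d where "d \<noteq> 0" "P = smult d P'" "Q = smult d Q'" by blast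
  thus ?thesis by (simp add: h_level_def PQ)
qed

text \<open>Hypothesis \<open>e\<close> is the twelfth power of the claim: the algebraic factor
  \<open>A\<close> has twelfth power P(0) / P(t), and the hypergeometric factor \<open>B\<close> has
  the cube of \<open>eisen4\<close> by \<open>eisen4_hypergeometric\<close>. As G is holomorphic on
  the whole disc, it also provides the continuation to \<open>uhp\<close>.\<close>

lemma h_form_eq:
  assumes M: "M \<in> {2, 3, 4}" and c: "coprime P Q" and P0: "poly P 0 \<noteq> 0"
    and j: "\<And>\<tau>. \<tau> \<in> uhp \<Longrightarrow> poly Q (hauptmodul M \<tau>) \<noteq> 0 \<and> modular_j \<tau> = poly P (hauptmodul M \<tau>) / poly Q (hauptmodul M \<tau>)"
    and G: "G holomorphic_on ball 0 1" "G 0 = 1"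
    and e: "\<And>q. norm q < 1 \<Longrightarrow> poly P (haupt_disc M q) * G q ^ 12 = poly P 0 * eisen4 q ^ 3"
    and \<tau>: "\<tau> \<in> uhp"
  shows "h_form M \<tau> = G (nome \<tau>)"
proof -
  define A where "A \<tau> = (poly P (hauptmodul M \<tau>) / poly P 0) powr (- 1 / 12)" for \<tau>
  define B where "B \<tau> = hyp2f1 (1/12) (5/12) 1 (1728 * (nome \<tau> * euler (nome \<tau>) ^ 24 / eisen4 (nome \<tau>) ^ 3))" for \<tau>
  have Pt: "((\<lambda>\<tau>. poly P (hauptmodul M \<tau>) / poly P 0) \<longlongrightarrow> 1) at_cusp"
    using tendsto_divide[OF isCont_tendsto_compose[OF poly_isCont[where p = P] hauptmodul_tendsto[OF M]] tendsto_const P0] P0 by simp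
  have Pn: "P \<noteq> 0" using P0 by auto
  have "((\<lambda>\<tau>. (poly P (hauptmodul M \<tau>) / poly P 0) powr (- 1 / 12)) \<longlongrightarrow> 1 powr (- 1 / 12)) at_cusp"
    by (intro tendsto_powr_complex Pt tendsto_const) simp
  hence A1: "(A \<longlongrightarrow> 1) at_cusp" by (simp add: A_def[abs_def])
  have "isCont (\<lambda>q. 1728 * (q * euler q ^ 24 / eisen4 q ^ 3)) 0"
    by (intro continuous_intros theta_cont) (simp add: theta_0)
  from isCont_o2[OF this, of "hyp2f1 (of_real (1/12)) (of_real (5/12)) 1"]
  have "isCont (\<lambda>q. hyp2f1 (1/12) (5/12) 1 (1728 * (q * euler q ^ 24 / eisen4 q ^ 3))) 0"
    using isCont_hyp2f1[of "1/12" "5/12"] by simp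
  from tendsto_at_cusp_nome[OF this] have B1: "(B \<longlongrightarrow> 1) at_cusp" by (simp add: B_def[abs_def] hyp2f1_0)
  have hl: "\<forall>\<^sub>F \<tau> in at_cusp. h_level M (hauptmodul M \<tau>) = A \<tau> * B \<tau>"
    using eventually_at_cusp_uhp
  proof eventually_elim
    case (elim \<tau>)
    have "12 ^ 3 * poly Q (hauptmodul M \<tau>) / poly P (hauptmodul M \<tau>) = 1728 / modular_j \<tau>"
      using j[OF elim] by simp
    also have "\<dots> = 1728 * (nome \<tau> * euler (nome \<tau>) ^ 24 / eisen4 (nome \<tau>) ^ 3)"
      unfolding modular_j_nome[OF elim] by simp
    finally have x: "12 ^ 3 * poly Q (hauptmodul M \<tau>) / poly P (hauptmodul M \<tau>) =
      1728 * (nome \<tau> * euler (nome \<tau>) ^ 24 / eisen4 (nome \<tau>) ^ 3)" .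
    have "h_level M t = (poly P t / poly P 0) powr (- 1 / 12) * hyp2f1 (1/12) (5/12) 1 (12 ^ 3 * poly Q t / poly P t)" for t
      by (rule h_level_eq[OF M c Pn j])
    from this[of "hauptmodul M \<tau>"] show ?case unfolding A_def B_def x .
  qed
  have "\<forall>\<^sub>F \<tau> in at_cusp. A \<tau> * B \<tau> = G (nome \<tau>)"
  proof (rule eventually_eq_if_power_eq[of _ _ _ 12])
    show "((\<lambda>\<tau>. A \<tau> * B \<tau>) \<longlongrightarrow> 1) at_cusp" using tendsto_mult[OF A1 B1] by simp
    show "((\<lambda>\<tau>. G (nome \<tau>)) \<longlongrightarrow> 1) at_cusp" using tendsto_at_cusp_nome[OF isCont_ball[OF G(1)]] G(2) by simp
    have "\<forall>\<^sub>F \<tau> in at_cusp. poly P (hauptmodul M \<tau>) / poly P 0 \<noteq> 0"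
      by (rule tendsto_imp_eventually_ne[OF Pt]) simp
    thus "\<forall>\<^sub>F \<tau> in at_cusp. (A \<tau> * B \<tau>) ^ 12 = G (nome \<tau>) ^ 12"
      using eventually_at_cusp_nome[OF eisen4_hypergeometric] eventually_at_cusp_uhp
    proof eventually_elim
      case (elim \<tau>)
      define z where "z = poly P (hauptmodul M \<tau>) / poly P 0"
      have z: "z \<noteq> 0" using elim(1) by (simp add: z_def)
      have "A \<tau> ^ 12 = exp (of_nat 12 * (- 1 / 12 * Ln z))"
        unfolding exp_of_nat_mult A_def z_def[symmetric] using z by (simp add: powr_def)
      also have "of_nat 12 * (- 1 / 12 * Ln z) = - Ln z" by simp
      also have "exp (- Ln z) = 1 / z" using z by (simp add: exp_minus inverse_eq_divide)
      finally have A: "A \<tau> ^ 12 = 1 / z" .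
      have "B \<tau> ^ 12 = (B \<tau> ^ 4) ^ 3" by (simp flip: power_mult)
      also have "B \<tau> ^ 4 = eisen4 (nome \<tau>)" unfolding B_def by (rule elim(2))
      finally have "(A \<tau> * B \<tau>) ^ 12 = poly P 0 * eisen4 (nome \<tau>) ^ 3 / poly P (hauptmodul M \<tau>)"
        unfolding power_mult_distrib A by (simp add: z_def)
      also have "\<dots> = G (nome \<tau>) ^ 12"
        using e[of "nome \<tau>"] norm_qpow_less[OF _ elim(3), of 1] elim(1) hauptmodul_nome[OF M, of \<tau>]
        by (simp flip: e)
      finally show ?case .
    qed
  qed simp
  with hl have "\<forall>\<^sub>F \<tau> in at_cusp. h_level M (hauptmodul M \<tau>) = G (nome \<tau>)" by eventually_elim simp
  thus ?thesis unfolding h_form_def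
    by (intro continue_uhp_eq \<tau> qpow_compose_holomorphic G) simp
qed

text \<open>In terms of X and Y, the squares of \<open>phi_sq\<close> at q and -q, the Hauptmoduln
  are t_4 = 16 (X - Y) / Y and t_2 = 256 X (X - Y) / Y^2.\<close>

lemma haupt_disc_2_4:
  assumes "norm q < 1"
  shows "phi_sq (- q) ^ 4 * (haupt_disc 2 q + 16) = 16 * eisen4 q"
    and "haupt_disc 2 q = haupt_disc 4 q * (haupt_disc 4 q + 16)"
    and "q * euler q ^ 24 * 4096 = haupt_disc 2 q * phi_sq (- q) ^ 12"
proof -
  define X Y where "X = phi_sq q ^ 2" and "Y = phi_sq (- q) ^ 2"
  have e: "euler q \<noteq> 0" "euler (q\<^sup>2) \<noteq> 0" "euler (q ^ 4) \<noteq> 0"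
    using assms by (auto intro!: euler_nonzero norm_power_lt)
  note XY = phi_sq_squares[OF assms, folded X_def Y_def]
  have Y: "Y \<noteq> 0" "X \<noteq> 0" unfolding XY(2,3) using e by simp_all
  have t4: "haupt_disc 4 q * Y = 16 * (X - Y)" unfolding XY(1) unfolding XY(3)
    using e by (simp add: haupt_disc_def kappa_def power_divide)
  hence "(haupt_disc 4 q + 16) * Y = 16 * X" by (simp add: algebra_simps)
  hence t4': "haupt_disc 4 q = 16 * (X - Y) / Y" "haupt_disc 4 q + 16 = 16 * X / Y"
    using t4 Y by (simp_all add: field_simps)
  have t2: "haupt_disc 2 q * Y\<^sup>2 = 256 * ((X - Y) * X)" unfolding XY(1) unfolding XY(2,3)
    using e by (simp add: haupt_disc_def kappa_def power_divide field_simps)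
  hence t2': "haupt_disc 2 q = 256 * ((X - Y) * X) / Y\<^sup>2" using Y by (simp add: field_simps)
  show "haupt_disc 2 q = haupt_disc 4 q * (haupt_disc 4 q + 16)" unfolding t2' t4'(2) unfolding t4'(1)
    using Y by (simp add: power2_eq_square)
  have p: "phi_sq (- q) ^ 4 = Y\<^sup>2" "phi_sq q ^ 4 = X\<^sup>2" "phi_sq (- q) ^ 12 = Y ^ 6" by (simp_all add: X_def Y_def flip: power_mult)
  have "phi_sq (- q) ^ 4 * (haupt_disc 2 q + 16) = 256 * ((X - Y) * X) + 16 * Y\<^sup>2"
    unfolding p using t2 by (simp add: algebra_simps)
  also have "\<dots> = 16 * eisen4 q" unfolding eisen4_quartic(1)[OF assms] p X_def[symmetric] Y_def[symmetric]
    by (simp add: power2_eq_square algebra_simps)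
  finally show "phi_sq (- q) ^ 4 * (haupt_disc 2 q + 16) = 16 * eisen4 q" .
  show "q * euler q ^ 24 * 4096 = haupt_disc 2 q * phi_sq (- q) ^ 12"
  proof -
    show ?thesis unfolding p XY(3) using e
      by (simp add: haupt_disc_def kappa_def power_divide flip: power_mult) (simp add: field_simps flip: power_add)
  qed
qed

text \<open>With b and c now standing for the cubes of the cubic theta functions, t_3 = 27 c / b and
  \<open>eisen4 q\<close> ^ 3 = (b + c)(b + 9c)^3; the factors become t + 27 and t + 3.\<close>

lemma haupt_disc_3:
  assumes "norm q < 1"
  shows "cubic_b q ^ 12 * ((haupt_disc 3 q + 27) * (haupt_disc 3 q + 3) ^ 3) = 729 * eisen4 q ^ 3"
    and "729 * (q * euler q ^ 24) = haupt_disc 3 q * cubic_b q ^ 12"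
proof -
  define a b c where "a = cubic_a q" and "b = cubic_b q ^ 3" and "c = 27 * q * euler (q ^ 3) ^ 9 / euler q ^ 3"
  have e: "euler q \<noteq> 0" "euler (q ^ 3) \<noteq> 0"
    using assms by (auto intro!: euler_nonzero norm_power_lt)
  note E = cubic_eta[OF assms, folded c_def a_def b_def]
  have b: "b \<noteq> 0" using e by (simp add: b_def cubic_b_def)
  have t: "haupt_disc 3 q * b = 27 * c"
    unfolding b_def c_def cubic_b_def using e by (simp add: haupt_disc_def kappa_def power_divide field_simps flip: power_mult)
  have b12: "cubic_b q ^ 12 = b ^ 4" "cubic_b q ^ 9 = b ^ 3" by (simp_all add: b_def flip: power_mult)
  have "b ^ 4 * ((haupt_disc 3 q + 27) * (haupt_disc 3 q + 3) ^ 3) =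
      (haupt_disc 3 q * b + 27 * b) * (haupt_disc 3 q * b + 3 * b) ^ 3"
    by (simp add: power4_eq_xxxx power3_eq_cube algebra_simps)
  also have "\<dots> = 729 * ((b + c) * (b + 9 * c) ^ 3)" unfolding t by (simp add: power3_eq_cube algebra_simps)
  also have "b + c = a ^ 3" using E(1) by simp
  also have "b + 9 * c = a ^ 3 + 8 * c" using E(1) by simp
  also have "a ^ 3 * (a ^ 3 + 8 * c) ^ 3 = (a * (a ^ 3 + 8 * c)) ^ 3" by (simp add: power_mult_distrib)
  also have "a * (a ^ 3 + 8 * c) = eisen4 q" unfolding E(2) by (simp add: algebra_simps power4_eq_xxxx power3_eq_cube)
  finally show "cubic_b q ^ 12 * ((haupt_disc 3 q + 27) * (haupt_disc 3 q + 3) ^ 3) = 729 * eisen4 q ^ 3"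
    unfolding b12 .
  have "729 * (q * euler q ^ 24) = 27 * (c * b ^ 3)" using E(3) unfolding b12 by simp
  also have "\<dots> = haupt_disc 3 q * b * b ^ 3" unfolding t by simp
  finally show "729 * (q * euler q ^ 24) = haupt_disc 3 q * cubic_b q ^ 12"
    unfolding b12 by (simp add: power4_eq_xxxx power3_eq_cube)
qed

lemma phi_sq_minus_holomorphic: "(\<lambda>q. phi_sq (- q)) holomorphic_on ball 0 1"
  using holomorphic_on_compose_gen[of uminus "ball 0 1" phi_sq "ball 0 1"] phi_sq_holomorphic
  by (force simp: o_def intro!: holomorphic_intros)

lemma cubic_b_0: "cubic_b 0 = 1"
  by (simp add: cubic_b_def euler_0)

lemma cubic_b_holomorphic: "cubic_b holomorphic_on ball 0 1"
  unfolding cubic_b_def[abs_def]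
  by (intro holomorphic_intros euler_power_holomorphic euler_holomorphic) (auto intro!: euler_nonzero norm_power_lt)

text \<open>At level 2 j = (t + 16)^3 / t. Substituting t_2 = t_4 (t_4 + 16) gives the fraction at
  level 4. Numerators correspond under the substitution and have the same value at 0, so both levels
  lead to the same form.\<close>

theorem h_form_2: "\<tau> \<in> uhp \<Longrightarrow> h_form 2 \<tau> = phi_sq (- nome \<tau>)"
  and h_form_4: "\<tau> \<in> uhp \<Longrightarrow> h_form 4 \<tau> = phi_sq (- nome \<tau>)"
proof -
  have key: "(haupt_disc 2 q + 16) ^ 3 * phi_sq (- q) ^ 12 = 4096 * eisen4 q ^ 3" if "norm q < 1" for q
  proof -
    have "(haupt_disc 2 q + 16) ^ 3 * phi_sq (- q) ^ 12 = (phi_sq (- q) ^ 4 * (haupt_disc 2 q + 16)) ^ 3"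
      by (simp add: power_mult_distrib flip: power_mult)
    thus ?thesis unfolding haupt_disc_2_4(1)[OF that] by (simp add: power_mult_distrib)
  qed
  have j: "haupt_disc 2 (nome \<tau>) \<noteq> 0 \<and> modular_j \<tau> = (haupt_disc 2 (nome \<tau>) + 16) ^ 3 / haupt_disc 2 (nome \<tau>)" if "\<tau> \<in> uhp" for \<tau>
  proof -
    have n: "norm (nome \<tau>) < 1" using norm_qpow_less[OF _ that, of 1] by simp
    have t: "haupt_disc 2 (nome \<tau>) \<noteq> 0" using haupt_disc_nonzero[OF n qpow_nonzero, of 2] by simp
    have p: "phi_sq (- nome \<tau>) \<noteq> 0" using phi_sq_nonzero[of "- nome \<tau>"] n by simp
    have "modular_j \<tau> = 4096 * eisen4 (nome \<tau>) ^ 3 / (nome \<tau> * euler (nome \<tau>) ^ 24 * 4096)"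
      unfolding modular_j_nome[OF that] by simp
    also have "\<dots> = (haupt_disc 2 (nome \<tau>) + 16) ^ 3 / haupt_disc 2 (nome \<tau>)"
      unfolding haupt_disc_2_4(3)[OF n] key[OF n, symmetric] using p by simp
    finally show ?thesis using t by simp
  qed
  assume \<tau>: "\<tau> \<in> uhp"
  show "h_form 2 \<tau> = phi_sq (- nome \<tau>)"
  proof (rule h_form_eq[of _ "[:16, 1:] ^ 3" "[:0, 1:]"])
    show "coprime ([:16, 1:] ^ 3) [:0, 1 :: complex:]" by (subst coprime_iff_no_common_root) (auto simp: poly_power)
    show "poly [:0, 1:] (hauptmodul 2 \<tau>) \<noteq> 0 \<and> modular_j \<tau> = poly ([:16, 1:] ^ 3) (hauptmodul 2 \<tau>) / poly [:0, 1:] (hauptmodul 2 \<tau>)"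
      if "\<tau> \<in> uhp" for \<tau>
      using j[OF that] by (simp add: hauptmodul_nome poly_power add.commute)
    show "poly ([:16, 1:] ^ 3) (haupt_disc 2 q) * phi_sq (- q) ^ 12 = poly ([:16, 1:] ^ 3) 0 * eisen4 q ^ 3" if "norm q < 1" for q
      using key[OF that] by (simp add: poly_power add.commute)
  qed (use \<tau> phi_sq_minus_holomorphic in \<open>simp_all add: theta_0 poly_power\<close>)
  have q: "poly ([:16, 16, 1:] ^ 3) (haupt_disc 4 q) = (haupt_disc 2 q + 16) ^ 3"
    "poly [:0, 16, 1:] (haupt_disc 4 q) = haupt_disc 2 q" if "norm q < 1" for q
    unfolding haupt_disc_2_4(2)[OF that] by (simp_all add: poly_power algebra_simps)
  show "h_form 4 \<tau> = phi_sq (- nome \<tau>)"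
  proof (rule h_form_eq[of _ "[:16, 16, 1:] ^ 3" "[:0, 16, 1:]"])
    show "coprime ([:16, 16, 1:] ^ 3) [:0, 16, 1 :: complex:]"
    proof (subst coprime_iff_no_common_root)
      show "\<forall>z. poly ([:16, 16, 1:] ^ 3) z = 0 \<longrightarrow> poly [:0, 16, 1:] z \<noteq> (0 :: complex)"
      proof (intro allI impI notI)
        fix z :: complex
        assume "poly ([:16, 16, 1:] ^ 3) z = 0" "poly [:0, 16, 1:] z = 0"
        hence z: "z * z + (16 + z * 16) = 0" "z * z + z * 16 = 0" by (simp_all add: poly_power algebra_simps)
        have "z * z + (16 + z * 16) = (z * z + z * 16) + 16" by simp
        thus False unfolding z by simp
      qed
    qed simp
    show "poly [:0, 16, 1:] (hauptmodul 4 \<tau>) \<noteq> 0 \<and> modular_j \<tau> = poly ([:16, 16, 1:] ^ 3) (hauptmodul 4 \<tau>) / poly [:0, 16, 1:] (hauptmodul 4 \<tau>)"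
      if "\<tau> \<in> uhp" for \<tau>
      using j[OF that] norm_qpow_less[OF _ that, of 1] by (simp only: hauptmodul_nome[of 4] insert_iff simp_thms q zero_less_one)
    show "poly ([:16, 16, 1:] ^ 3) (haupt_disc 4 q) * phi_sq (- q) ^ 12 = poly ([:16, 16, 1:] ^ 3) 0 * eisen4 q ^ 3" if "norm q < 1" for q
      using key[OF that] unfolding q(1)[OF that] by (simp add: poly_power)
  qed (use \<tau> phi_sq_minus_holomorphic in \<open>simp_all add: theta_0 poly_power\<close>)
qed

theorem h_form_3:
  assumes \<tau>: "\<tau> \<in> uhp"
  shows "h_form 3 \<tau> = cubic_b (nome \<tau>)"
proof (rule h_form_eq[of _ "[:27, 1:] * [:3, 1:] ^ 3" "[:0, 1:]"])
  let ?P = "[:27, 1:] * [:3, 1:] ^ 3 :: complex poly"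
  have P: "poly ?P t = (t + 27) * (t + 3) ^ 3" for t by (simp only: poly_mult poly_power) (simp add: add.commute)
  show "coprime ?P [:0, 1:]" by (subst coprime_iff_no_common_root) (auto simp: poly_power)
  show "poly [:0, 1:] (hauptmodul 3 \<tau>) \<noteq> 0 \<and> modular_j \<tau> = poly ?P (hauptmodul 3 \<tau>) / poly [:0, 1:] (hauptmodul 3 \<tau>)"
    if "\<tau> \<in> uhp" for \<tau>
  proof -
    have n: "norm (nome \<tau>) < 1" using norm_qpow_less[OF _ that, of 1] by simp
    have t: "haupt_disc 3 (nome \<tau>) \<noteq> 0" using haupt_disc_nonzero[OF n qpow_nonzero, of 3] by simp
    have b: "cubic_b (nome \<tau>) \<noteq> 0" using n euler_nonzero[OF n] euler_nonzero[OF norm_power_lt[OF n, of 3]] by (simp add: cubic_b_def)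
    have "modular_j \<tau> = 729 * eisen4 (nome \<tau>) ^ 3 / (729 * (nome \<tau> * euler (nome \<tau>) ^ 24))"
      unfolding modular_j_nome[OF that] by simp
    also have "\<dots> = poly ?P (haupt_disc 3 (nome \<tau>)) / haupt_disc 3 (nome \<tau>)"
      unfolding haupt_disc_3(2)[OF n] haupt_disc_3(1)[OF n, symmetric] P using b by simp
    finally show ?thesis using t by (simp add: hauptmodul_nome)
  qed
  show "poly ?P (haupt_disc 3 q) * cubic_b q ^ 12 = poly ?P 0 * eisen4 q ^ 3" if "norm q < 1" for q
    using haupt_disc_3(1)[OF that] unfolding P by (simp add: mult.commute)
qed (use \<tau> cubic_b_holomorphic in \<open>simp_all add: poly_power cubic_b_0\<close>)

section \<open>The weight-1 forms as eta quotients\<close>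

lemma nome_disc: "\<tau> \<in> uhp \<Longrightarrow> norm (nome \<tau>) < 1"
  by (rule norm_qpow_less) simp

lemma qpow_ratio:
  assumes "a = b + c"
  shows "qpow a \<tau> * E / (qpow b \<tau> * F) = qpow c \<tau> * (E / F)"
  using qpow_nonzero[of b \<tau>] unfolding assms qpow_add[symmetric] by simp

lemma eventually_disc_at_cusp:
  fixes F :: "complex \<Rightarrow> complex"
  assumes "isCont F 0" "F 0 \<noteq> 0"
  shows "\<forall>\<^sub>F \<tau> in at_cusp. \<tau> \<in> uhp \<and> norm (nome \<tau>) < 1 \<and> F (nome \<tau>) \<noteq> 0"
  using eventually_at_cusp_nome[OF eventually_nhds_nonzero[OF assms]] eventually_at_cusp_uhp
  by eventually_elim (simp add: nome_disc)

lemma eventually_theta_nonzero: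
  "\<forall>\<^sub>F \<tau> in at_cusp. \<tau> \<in> uhp \<and> norm (nome \<tau>) < 1 \<and> odd_sum (nome \<tau>) \<noteq> 0"
  "\<forall>\<^sub>F \<tau> in at_cusp. \<tau> \<in> uhp \<and> norm (nome \<tau>) < 1 \<and> cubic_a (nome \<tau>) \<noteq> 0"
  by (rule eventually_disc_at_cusp; simp add: theta_cont theta_0)+

text \<open>Clearing the denominator of the Hauptmodul and one factor sqrt kappa. At a pole of alpha
  both sides are 0, by the convention for division by 0.\<close>

lemma alpha_eta:
  assumes "\<tau> \<in> uhp"
  shows "alpha 4 \<tau> = 2^6 * eta_at 2 \<tau> ^ 24 / (2^6 * eta_at 2 \<tau> ^ 24 + eta_at 1 \<tau> ^ 24)"
    and "alpha 3 \<tau> = 3^3 * eta_at 3 \<tau> ^ 12 / (3^3 * eta_at 3 \<tau> ^ 12 + eta_at 1 \<tau> ^ 12)"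
    and "alpha 2 \<tau> = 2^4 * eta_at 4 \<tau> ^ 8 / (2^4 * eta_at 4 \<tau> ^ 8 + eta_at 1 \<tau> ^ 8)"
proof -
  have n: "eta_at 1 \<tau> \<noteq> 0" using euler_nome_nonzero1[OF assms] by (simp add: eta_at_euler qpow_nonzero)
  \<comment> \<open>Here s is the square root of kappa, that is 64, 27 or 16, and x / y is the eta
    quotient in the Hauptmodul.\<close>
  have *: "s\<^sup>2 * x / y / (s\<^sup>2 * x / y + s) = s * x / (s * x + y)" if "y \<noteq> 0" "s \<noteq> 0" for s x y :: complex
  proof -
    have 1: "s\<^sup>2 * x / y + s = s * ((s * x + y) / y)" using that by (simp add: field_simps power2_eq_square)
    have 2: "s\<^sup>2 * x / y = s * (s * x / y)" by (simp add: power2_eq_square)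
    show ?thesis unfolding 1 unfolding 2 using that by simp
  qed
  have r: "sqrt 4096 = 64" "sqrt 729 = 27" "sqrt 256 = 16" by (rule real_sqrt_unique; simp)+
  show "alpha 4 \<tau> = 2^6 * eta_at 2 \<tau> ^ 24 / (2^6 * eta_at 2 \<tau> ^ 24 + eta_at 1 \<tau> ^ 24)"
    using *[of "eta_at 1 \<tau> ^ 24" 64 "eta_at 2 \<tau> ^ 24"] n by (simp add: alpha_def level_def hauptmodul_def kappa_def r)
  show "alpha 3 \<tau> = 3^3 * eta_at 3 \<tau> ^ 12 / (3^3 * eta_at 3 \<tau> ^ 12 + eta_at 1 \<tau> ^ 12)"
    using *[of "eta_at 1 \<tau> ^ 12" 27 "eta_at 3 \<tau> ^ 12"] n by (simp add: alpha_def level_def hauptmodul_def kappa_def r)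
  show "alpha 2 \<tau> = 2^4 * eta_at 4 \<tau> ^ 8 / (2^4 * eta_at 4 \<tau> ^ 8 + eta_at 1 \<tau> ^ 8)"
    using *[of "eta_at 1 \<tau> ^ 8" 16 "eta_at 4 \<tau> ^ 8"] n by (simp add: alpha_def level_def hauptmodul_def kappa_def r)
qed

lemma eta_sums:
  fixes \<tau> defines "q \<equiv> nome \<tau>"
  shows "2^6 * eta_at 2 \<tau> ^ 24 + eta_at 1 \<tau> ^ 24 = q * (64 * q * euler (q\<^sup>2) ^ 24 + euler q ^ 24)"
    and "2^6 * eta_at 2 \<tau> ^ 24 = q * (64 * q * euler (q\<^sup>2) ^ 24)"
    and "3^3 * eta_at 3 \<tau> ^ 12 + eta_at 1 \<tau> ^ 12 = qpow (1/2) \<tau> * (27 * q * euler (q ^ 3) ^ 12 + euler q ^ 12)"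
    and "3^3 * eta_at 3 \<tau> ^ 12 = qpow (1/2) \<tau> * (27 * q * euler (q ^ 3) ^ 12)"
    and "2^4 * eta_at 4 \<tau> ^ 8 + eta_at 1 \<tau> ^ 8 = qpow (1/3) \<tau> * (16 * q * euler (q ^ 4) ^ 8 + euler q ^ 8)"
    and "2^4 * eta_at 4 \<tau> ^ 8 = qpow (1/3) \<tau> * (16 * q * euler (q ^ 4) ^ 8)"
proof -
  have "qpow 2 \<tau> = q * q" "qpow (3 / 2) \<tau> = qpow (1 / 2) \<tau> * q" "qpow (4 / 3) \<tau> = qpow (1 / 3) \<tau> * q"
    by (simp_all add: q_def qpow_add)
  thus "2^6 * eta_at 2 \<tau> ^ 24 + eta_at 1 \<tau> ^ 24 = q * (64 * q * euler (q\<^sup>2) ^ 24 + euler q ^ 24)"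
    "2^6 * eta_at 2 \<tau> ^ 24 = q * (64 * q * euler (q\<^sup>2) ^ 24)"
    "3^3 * eta_at 3 \<tau> ^ 12 + eta_at 1 \<tau> ^ 12 = qpow (1/2) \<tau> * (27 * q * euler (q ^ 3) ^ 12 + euler q ^ 12)"
    "3^3 * eta_at 3 \<tau> ^ 12 = qpow (1/2) \<tau> * (27 * q * euler (q ^ 3) ^ 12)"
    "2^4 * eta_at 4 \<tau> ^ 8 + eta_at 1 \<tau> ^ 8 = qpow (1/3) \<tau> * (16 * q * euler (q ^ 4) ^ 8 + euler q ^ 8)"
    "2^4 * eta_at 4 \<tau> ^ 8 = qpow (1/3) \<tau> * (16 * q * euler (q ^ 4) ^ 8)"
    unfolding eta_at_power by (simp_all add: q_def[symmetric] algebra_simps)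
qed

lemma phi_sq_eta:
  assumes "norm q < 1"
  shows "16 * q * euler (q ^ 4) ^ 8 = (phi_sq q ^ 2 - phi_sq (- q) ^ 2) * euler (q\<^sup>2) ^ 4"
    and "16 * q * euler (q ^ 4) ^ 8 + euler q ^ 8 = phi_sq q ^ 2 * euler (q\<^sup>2) ^ 4"
    and "legendre q = 16 * q * euler q ^ 8 * euler (q ^ 4) ^ 16 / euler (q\<^sup>2) ^ 24"
    and "1 - legendre q = euler q ^ 16 * euler (q ^ 4) ^ 8 / euler (q\<^sup>2) ^ 24"
proof -
  have e: "euler q \<noteq> 0" "euler (q\<^sup>2) \<noteq> 0" "euler (q ^ 4) \<noteq> 0"
    using assms by (auto intro!: euler_nonzero norm_power_lt)
  show 1: "16 * q * euler (q ^ 4) ^ 8 = (phi_sq q ^ 2 - phi_sq (- q) ^ 2) * euler (q\<^sup>2) ^ 4"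
    unfolding phi_sq_squares(1)[OF assms] using e by simp
  have "euler q ^ 8 = phi_sq (- q) ^ 2 * euler (q\<^sup>2) ^ 4" unfolding phi_sq_squares(3)[OF assms] using e by simp
  thus "16 * q * euler (q ^ 4) ^ 8 + euler q ^ 8 = phi_sq q ^ 2 * euler (q\<^sup>2) ^ 4"
    unfolding 1 by (simp add: algebra_simps)
  show 4: "1 - legendre q = euler q ^ 16 * euler (q ^ 4) ^ 8 / euler (q\<^sup>2) ^ 24"
    unfolding legendre_def power_divide phi_sq_squares(2,3)[OF assms] using e by (simp add: field_simps flip: power_add)
  have "legendre q = (phi_sq q ^ 2 - phi_sq (- q) ^ 2) / phi_sq q ^ 2"
    using phi_sq_nonzero[OF assms] by (simp add: legendre_def power_divide diff_divide_distrib)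
  also have "\<dots> = 16 * q * euler q ^ 8 * euler (q ^ 4) ^ 16 / euler (q\<^sup>2) ^ 24"
    unfolding phi_sq_squares(1)[OF assms] unfolding phi_sq_squares(2)[OF assms] using e by (simp add: field_simps flip: power_add)
  finally show "legendre q = 16 * q * euler q ^ 8 * euler (q ^ 4) ^ 16 / euler (q\<^sup>2) ^ 24" .
qed

lemma alpha_nome:
  assumes "\<tau> \<in> uhp"
  shows "alpha 4 \<tau> = quartic_modulus (nome \<tau>)" "alpha 3 \<tau> = cubic_modulus (nome \<tau>)" "alpha 2 \<tau> = legendre (nome \<tau>)"
proof -
  note n = nome_disc[OF assms]
  have e: "euler (nome \<tau> ^ 2) \<noteq> 0" using euler_nome_nonzero[OF assms] by simp
  show "alpha 4 \<tau> = quartic_modulus (nome \<tau>)" "alpha 3 \<tau> = cubic_modulus (nome \<tau>)"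
    unfolding alpha_eta[OF assms] eta_sums(1,3) unfolding eta_sums(2,4) quartic_modulus_def cubic_modulus_def
    by (simp_all add: qpow_nonzero)
  have "alpha 2 \<tau> = (phi_sq (nome \<tau>) ^ 2 - phi_sq (- nome \<tau>) ^ 2) / phi_sq (nome \<tau>) ^ 2"
    unfolding alpha_eta[OF assms] eta_sums(5) unfolding eta_sums(6) phi_sq_eta(2)[OF n] unfolding phi_sq_eta(1)[OF n] using e
    by (simp add: qpow_nonzero)
  thus "alpha 2 \<tau> = legendre (nome \<tau>)"
    using phi_sq_nonzero[OF n] by (simp add: legendre_def power_divide diff_divide_distrib)
qed

lemma formB_nome:
  assumes "\<tau> \<in> uhp"
  shows "formB 4 \<tau> = phi_sq (- nome \<tau>)" "formB 3 \<tau> = cubic_b (nome \<tau>)" "formB 2 \<tau> = phi_sq (- nome \<tau>)"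
  using h_form_2[OF assms] h_form_3[OF assms] h_form_4[OF assms] by (simp_all add: formB_def level_def)

lemma complement_quotient:
  fixes x y :: complex
  assumes "x + y \<noteq> 0"
  shows "1 - x / (x + y) = y / (x + y)" "(1 - x / (x + y)) / (x / (x + y)) = y / x"
proof -
  show "1 - x / (x + y) = y / (x + y)" using assms by (simp add: field_simps)
  thus "(1 - x / (x + y)) / (x / (x + y)) = y / x" using assms by simp
qed

lemma real_germ_euler1: "real_germ euler"
  using real_germ_euler[of 1] by simp

lemma cubic_b_nonzero: "norm q < 1 \<Longrightarrow> cubic_b q \<noteq> 0"
  unfolding cubic_b_def using euler_nonzero norm_power_lt[of q 3] by simp

lemma real_germ_cubic_b: "real_germ cubic_b"
  unfolding cubic_b_def[abs_def] by (intro real_germ_divide real_germ_power real_germ_euler1 real_germ_euler) simp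

text \<open>By the eta identities 1 - alpha_4 is phi_sq(-q)^4 / odd_sum(q)^2, so its power -1/4
  needs a square root of \<open>odd_sum\<close>. The principal root serves near the cusp, where
  \<open>odd_sum\<close> is close to 1; no value further down is claimed.\<close>

lemma formA_4_near_cusp: "\<forall>\<^sub>F \<tau> in at_cusp. formA 4 \<tau> = csqrt (odd_sum (nome \<tau>))"
proof -
  have G: "real_germ (\<lambda>q. csqrt (odd_sum q) / phi_sq (- q))"
    by (intro real_germ_divide real_germ_csqrt_odd_sum real_germ_theta)
  have "\<forall>\<^sub>F \<tau> in at_cusp. 1 - alpha 4 \<tau> = (of_real 1 * qpow 0 \<tau> * (csqrt (odd_sum (nome \<tau>)) / phi_sq (- nome \<tau>))) powi (- 4)"
    using eventually_theta_nonzero(1)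
  proof eventually_elim
    case (elim \<tau>)
    define q where "q = nome \<tau>"
    have q: "norm q < 1" "odd_sum q \<noteq> 0" and \<tau>: "\<tau> \<in> uhp" using elim by (auto simp: q_def)
    have e: "euler q \<noteq> 0" "euler (q\<^sup>2) \<noteq> 0" using q(1) by (auto intro!: euler_nonzero norm_power_lt)
    have D: "64 * q * euler (q\<^sup>2) ^ 24 + euler q ^ 24 \<noteq> 0" unfolding odd_sum_eta[OF q(1)] using q e by simp
    have "(csqrt (odd_sum q)) ^ 4 = odd_sum q ^ 2" by (metis numeral_Bit0 power2_csqrt power_mult mult_2)
    hence "(csqrt (odd_sum q) / phi_sq (- q)) powi (- 4) = phi_sq (- q) ^ 4 / odd_sum q ^ 2"
      by (simp add: power_int_minus power_divide)
    also have "phi_sq (- q) ^ 4 = (phi_sq (- q) ^ 2)\<^sup>2" by (simp flip: power_mult)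
    finally have p4: "(csqrt (odd_sum q) / phi_sq (- q)) powi (- 4) = (phi_sq (- q) ^ 2)\<^sup>2 / odd_sum q ^ 2" .
    note p4
    also have "(phi_sq (- q) ^ 2)\<^sup>2 / odd_sum q ^ 2 = euler q ^ 24 / (odd_sum q ^ 2 * (euler q * euler (q\<^sup>2)) ^ 8)"
      unfolding phi_sq_squares(3)[OF q(1)] using e q(2) by (simp add: power_mult_distrib field_simps flip: power_mult power_add)
    also have "\<dots> = 1 - alpha 4 \<tau>"
      unfolding alpha_nome[OF \<tau>] q_def[symmetric] quartic_modulus_def complement_quotient(1)[OF D] unfolding odd_sum_eta[OF q(1)] ..
    finally show ?case by (simp add: q_def qpow_0)
  qed
  from cusp_power_germ(1)[OF G _ _ this, of "- 1 / 4"]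
  have "\<forall>\<^sub>F \<tau> in at_cusp. cusp_power (\<lambda>\<tau>. 1 - alpha 4 \<tau>) (- 1 / 4) \<tau> = csqrt (odd_sum (nome \<tau>)) / phi_sq (- nome \<tau>)"
    by (simp add: qpow_0)
  thus ?thesis using eventually_at_cusp_uhp
  proof eventually_elim
    case (elim \<tau>)
    have "phi_sq (- nome \<tau>) \<noteq> 0" using phi_sq_nonzero[of "- nome \<tau>"] nome_disc[OF elim(2)] by simp
    thus ?case using elim by (simp add: formA_def formB_nome)
  qed
qed

lemma eta_root_4:
  "\<forall>\<^sub>F \<tau> in at_cusp. cusp_power (\<lambda>\<tau>. 2^6 * eta_at 2 \<tau> ^ 24 + eta_at 1 \<tau> ^ 24) (1/4) \<tau> / (eta_at 1 \<tau> ^ 2 * eta_at 2 \<tau> ^ 2) =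
    csqrt (odd_sum (nome \<tau>))"
proof -
  have k: "(4 :: int) \<noteq> 0" "1 / 4 = 1 / real_of_int 4" by simp_all
  have G: "real_germ (\<lambda>q. csqrt (odd_sum q) * (euler q ^ 2 * euler (q\<^sup>2) ^ 2))"
    by (intro real_germ_mult real_germ_csqrt_odd_sum real_germ_power real_germ_euler1 real_germ_euler) simp
  have "\<forall>\<^sub>F \<tau> in at_cusp. 2^6 * eta_at 2 \<tau> ^ 24 + eta_at 1 \<tau> ^ 24 =
      (of_real 1 * qpow (1/4) \<tau> * (csqrt (odd_sum (nome \<tau>)) * (euler (nome \<tau>) ^ 2 * euler (nome \<tau> ^ 2) ^ 2))) powi 4"
    using eventually_at_cusp_uhp
  proof eventually_elim
    case (elim \<tau>)
    have "(csqrt (odd_sum q)) ^ 4 = odd_sum q ^ 2" for q by (metis numeral_Bit0 power2_csqrt power_mult mult_2)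
    thus ?case unfolding eta_sums(1) odd_sum_eta[OF nome_disc[OF elim]]
      by (simp add: power_mult_distrib qpow_power flip: power_mult)
  qed
  from cusp_power_germ(1)[OF G k(1) zero_less_one this k(2)] show ?thesis
    using eventually_at_cusp_uhp
  proof eventually_elim
    case (elim \<tau>)
    have e: "euler (nome \<tau>) \<noteq> 0" "euler (nome \<tau> ^ 2) \<noteq> 0" using euler_nome_nonzero[OF elim(2)] euler_nome_nonzero1[OF elim(2)] by auto
    have "eta_at 1 \<tau> ^ 2 * eta_at 2 \<tau> ^ 2 = qpow (1/4) \<tau> * (euler (nome \<tau>) ^ 2 * euler (nome \<tau> ^ 2) ^ 2)"
      unfolding eta_at_power by (simp add: qpow_add[symmetric, of "1/12" "1/6", simplified])
    thus ?case using elim(1) e by (simp add: qpow_nonzero)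
  qed
qed

lemma germ_form_holomorphic:
  assumes "G holomorphic_on ball 0 1"
  shows "(\<lambda>\<tau>. of_real c0 * qpow s \<tau> * G (nome \<tau>)) holomorphic_on uhp"
  by (intro holomorphic_intros qpow_holomorphic qpow_compose_holomorphic assms) simp

lemma euler_quotient_holomorphic:
  assumes "m > 0" "n > 0"
  shows "(\<lambda>q. euler (q ^ m) ^ k / euler (q ^ n) ^ l) holomorphic_on ball 0 1"
  by (intro holomorphic_intros euler_power_holomorphic assms) (use assms euler_nonzero norm_power_lt in auto)

text \<open>The quotient (1 - alpha) / alpha is [1]^24 / (64 [2]^24) and the products have no zeros,
  so its power continues to all of \<open>uhp\<close>, although (1 - alpha)^(-1/4) is only treated
  near the cusp.\<close>

lemma formC_4_nome:
  assumes "\<tau> \<in> uhp"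
  shows "formC 4 \<tau> = of_real (2 powr (3/2)) * qpow (1/4) \<tau> * (euler (nome \<tau> ^ 2) ^ 4 / euler (nome \<tau>) ^ 2)"
proof -
  have G: "real_germ (\<lambda>q. euler (q\<^sup>2) ^ 6 / euler q ^ 6)"
    by (intro real_germ_divide real_germ_power real_germ_euler1 real_germ_euler) simp
  \<comment> \<open>The positive fourth root of the constant 64 in the eta quotient.\<close>
  have c: "complex_of_real (2 powr (3/2)) ^ 4 = 64"
  proof -
    have "(2 powr (3/2 :: real)) ^ 4 = 64" by (simp add: powr_power)
    thus ?thesis by (metis of_real_numeral of_real_power)
  qed
  have f: "\<forall>\<^sub>F \<tau> in at_cusp. (1 - alpha 4 \<tau>) / alpha 4 \<tau> =
      (of_real (2 powr (3/2)) * qpow (1/4) \<tau> * (euler (nome \<tau> ^ 2) ^ 6 / euler (nome \<tau>) ^ 6)) powi (- 4)"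
    using eventually_theta_nonzero(1)
  proof eventually_elim
    case (elim \<tau>)
    define q where "q = nome \<tau>"
    have q: "norm q < 1" "odd_sum q \<noteq> 0" and \<tau>: "\<tau> \<in> uhp" using elim by (auto simp: q_def)
    have e: "euler q \<noteq> 0" "euler (q\<^sup>2) \<noteq> 0" using q(1) by (auto intro!: euler_nonzero norm_power_lt)
    have D: "64 * q * euler (q\<^sup>2) ^ 24 + euler q ^ 24 \<noteq> 0" unfolding odd_sum_eta[OF q(1)] using q e by simp
    have "(of_real (2 powr (3/2)) * qpow (1/4) \<tau> * (euler (q\<^sup>2) ^ 6 / euler q ^ 6)) ^ 4 = 64 * q * (euler (q\<^sup>2) ^ 24 / euler q ^ 24)"
      unfolding power_mult_distrib c by (simp add: qpow_power q_def power_divide flip: power_mult)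
    hence "(of_real (2 powr (3/2)) * qpow (1/4) \<tau> * (euler (q\<^sup>2) ^ 6 / euler q ^ 6)) powi (- 4) = euler q ^ 24 / (64 * q * euler (q\<^sup>2) ^ 24)"
      by (simp add: power_int_minus)
    thus ?case unfolding alpha_nome[OF \<tau>] q_def[symmetric] quartic_modulus_def complement_quotient(2)[OF D] by simp
  qed
  have "(\<lambda>q. euler (q\<^sup>2) ^ 6 / euler q ^ 6) holomorphic_on ball 0 1" using euler_quotient_holomorphic[of 2 1 6 6] by simp
  from cusp_power_germ(2)[OF G _ _ f _ germ_form_holomorphic[OF this] assms, of "- 1 / 4"]
  have cp: "cusp_power (\<lambda>\<tau>. (1 - alpha 4 \<tau>) / alpha 4 \<tau>) (- 1 / 4) \<tau> =
      of_real (2 powr (3/2)) * qpow (1/4) \<tau> * (euler (nome \<tau> ^ 2) ^ 6 / euler (nome \<tau>) ^ 6)"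
    by simp
  have eq: "euler (nome \<tau> ^ 2) ^ 6 / euler (nome \<tau>) ^ 6 * phi_sq (- nome \<tau>) = euler (nome \<tau> ^ 2) ^ 4 / euler (nome \<tau>) ^ 2"
    unfolding phi_sq_minus_product[OF nome_disc[OF assms]]
    using euler_nome_nonzero[OF assms, of 2] euler_nome_nonzero1[OF assms] by (simp add: field_simps flip: power_add)
  have "formC 4 \<tau> = cusp_power (\<lambda>\<tau>. (1 - alpha 4 \<tau>) / alpha 4 \<tau>) (- 1 / 4) \<tau> * phi_sq (- nome \<tau>)"
    by (simp add: formC_def formB_nome[OF assms])
  thus ?thesis unfolding cp mult.assoc eq .
qed

text \<open>1 - alpha_3 is the cube of b / a, so the power -1/3 is a / b. This is holomorphic on the
  disc because b is a product without zeros, and multiplication by \<open>formB\<close> cancels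
  b.\<close>

lemma formA_3_nome:
  assumes "\<tau> \<in> uhp"
  shows "formA 3 \<tau> = cubic_a (nome \<tau>)"
proof -
  have G: "real_germ (\<lambda>q. cubic_a q / cubic_b q)" by (intro real_germ_divide real_germ_theta real_germ_cubic_b)
  have f: "\<forall>\<^sub>F \<tau> in at_cusp. 1 - alpha 3 \<tau> = (of_real 1 * qpow 0 \<tau> * (cubic_a (nome \<tau>) / cubic_b (nome \<tau>))) powi (- 3)"
    using eventually_theta_nonzero(2)
  proof eventually_elim
    case (elim \<tau>)
    define q where "q = nome \<tau>"
    have q: "norm q < 1" "cubic_a q \<noteq> 0" and \<tau>: "\<tau> \<in> uhp" using elim by (auto simp: q_def)
    have e: "euler q \<noteq> 0" "euler (q ^ 3) \<noteq> 0" using q(1) by (auto intro!: euler_nonzero norm_power_lt)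
    have D: "27 * q * euler (q ^ 3) ^ 12 + euler q ^ 12 \<noteq> 0" unfolding cubic_eta(4)[OF q(1)] using q e by simp
    have "(cubic_a q / cubic_b q) powi (- 3) = cubic_b q ^ 3 / cubic_a q ^ 3"
      by (simp add: power_int_minus power_divide)
    hence p3: "(cubic_a q / cubic_b q) powi (- 3) = cubic_b q ^ 3 / cubic_a q ^ 3" .
    note p3
    also have "cubic_b q ^ 3 / cubic_a q ^ 3 = euler q ^ 12 / (cubic_a q ^ 3 * (euler q * euler (q ^ 3)) ^ 3)"
      unfolding cubic_b_def using e q(2) by (simp add: power_divide power_mult_distrib field_simps flip: power_mult power_add)
    also have "\<dots> = 1 - alpha 3 \<tau>"
      unfolding alpha_nome[OF \<tau>] q_def[symmetric] cubic_modulus_def complement_quotient(1)[OF D] unfolding cubic_eta(4)[OF q(1)] ..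
    finally show ?case by (simp add: q_def qpow_0)
  qed
  have "(\<lambda>q. cubic_a q / cubic_b q) holomorphic_on ball 0 1"
    by (intro holomorphic_intros cubic_a_holomorphic cubic_b_holomorphic) (simp add: cubic_b_nonzero)
  from cusp_power_germ(2)[OF G _ _ f _ germ_form_holomorphic[OF this] assms, of "- 1 / 3"]
  have "cusp_power (\<lambda>\<tau>. 1 - alpha 3 \<tau>) (- 1 / 3) \<tau> = cubic_a (nome \<tau>) / cubic_b (nome \<tau>)" by (simp add: qpow_0)
  thus ?thesis using cubic_b_nonzero[OF nome_disc[OF assms]] by (simp add: formA_def formB_nome[OF assms])
qed

lemma eta_root_3:
  "\<forall>\<^sub>F \<tau> in at_cusp. cusp_power (\<lambda>\<tau>. 3^3 * eta_at 3 \<tau> ^ 12 + eta_at 1 \<tau> ^ 12) (1/3) \<tau> / (eta_at 1 \<tau> * eta_at 3 \<tau>) = cubic_a (nome \<tau>)"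
proof -
  have k: "(3 :: int) \<noteq> 0" "1 / 3 = 1 / real_of_int 3" by simp_all
  have G: "real_germ (\<lambda>q. cubic_a q * (euler q * euler (q ^ 3)))"
    by (intro real_germ_mult real_germ_theta real_germ_euler1 real_germ_euler) simp
  have "\<forall>\<^sub>F \<tau> in at_cusp. 3^3 * eta_at 3 \<tau> ^ 12 + eta_at 1 \<tau> ^ 12 =
      (of_real 1 * qpow (1/6) \<tau> * (cubic_a (nome \<tau>) * (euler (nome \<tau>) * euler (nome \<tau> ^ 3)))) powi 3"
    using eventually_at_cusp_uhp
  proof eventually_elim
    case (elim \<tau>)
    show ?case unfolding eta_sums(3) cubic_eta(4)[OF nome_disc[OF elim]]
      by (simp add: power_mult_distrib qpow_power)
  qed
  from cusp_power_germ(1)[OF G k(1) zero_less_one this k(2)] show ?thesis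
    using eventually_at_cusp_uhp
  proof eventually_elim
    case (elim \<tau>)
    have e: "euler (nome \<tau>) \<noteq> 0" "euler (nome \<tau> ^ 3) \<noteq> 0" using euler_nome_nonzero[OF elim(2)] euler_nome_nonzero1[OF elim(2)] by auto
    have "eta_at 1 \<tau> * eta_at 3 \<tau> = qpow (1/6) \<tau> * (euler (nome \<tau>) * euler (nome \<tau> ^ 3))"
      unfolding eta_at_euler by (simp add: qpow_add[symmetric, of "1/24" "1/8", simplified])
    thus ?case using elim(1) e by (simp add: qpow_nonzero)
  qed
qed

lemma formC_3_nome:
  assumes "\<tau> \<in> uhp"
  shows "formC 3 \<tau> = 3 * qpow (1/3) \<tau> * (euler (nome \<tau> ^ 3) ^ 3 / euler (nome \<tau>))"
proof -
  have G: "real_germ (\<lambda>q. euler (q ^ 3) ^ 4 / euler q ^ 4)"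
    by (intro real_germ_divide real_germ_power real_germ_euler1 real_germ_euler) simp
  have f: "\<forall>\<^sub>F \<tau> in at_cusp. (1 - alpha 3 \<tau>) / alpha 3 \<tau> =
      (of_real 3 * qpow (1/3) \<tau> * (euler (nome \<tau> ^ 3) ^ 4 / euler (nome \<tau>) ^ 4)) powi (- 3)"
    using eventually_theta_nonzero(2)
  proof eventually_elim
    case (elim \<tau>)
    define q where "q = nome \<tau>"
    have q: "norm q < 1" "cubic_a q \<noteq> 0" and \<tau>: "\<tau> \<in> uhp" using elim by (auto simp: q_def)
    have e: "euler q \<noteq> 0" "euler (q ^ 3) \<noteq> 0" using q(1) by (auto intro!: euler_nonzero norm_power_lt)
    have D: "27 * q * euler (q ^ 3) ^ 12 + euler q ^ 12 \<noteq> 0" unfolding cubic_eta(4)[OF q(1)] using q e by simp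
    have "(of_real 3 * qpow (1/3) \<tau> * (euler (q ^ 3) ^ 4 / euler q ^ 4)) ^ 3 = 27 * q * (euler (q ^ 3) ^ 12 / euler q ^ 12)"
      unfolding power_mult_distrib by (simp add: qpow_power q_def power_divide flip: power_mult)
    hence "(of_real 3 * qpow (1/3) \<tau> * (euler (q ^ 3) ^ 4 / euler q ^ 4)) powi (- 3) = euler q ^ 12 / (27 * q * euler (q ^ 3) ^ 12)"
      by (simp add: power_int_minus)
    thus ?case unfolding alpha_nome[OF \<tau>] q_def[symmetric] cubic_modulus_def complement_quotient(2)[OF D] by simp
  qed
  have "(\<lambda>q. euler (q ^ 3) ^ 4 / euler q ^ 4) holomorphic_on ball 0 1" using euler_quotient_holomorphic[of 3 1 4 4] by simp
  from cusp_power_germ(2)[OF G _ _ f _ germ_form_holomorphic[OF this] assms, of "- 1 / 3"]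
  have cp: "cusp_power (\<lambda>\<tau>. (1 - alpha 3 \<tau>) / alpha 3 \<tau>) (- 1 / 3) \<tau> =
      3 * qpow (1/3) \<tau> * (euler (nome \<tau> ^ 3) ^ 4 / euler (nome \<tau>) ^ 4)"
    by simp
  have eq: "euler (nome \<tau> ^ 3) ^ 4 / euler (nome \<tau>) ^ 4 * cubic_b (nome \<tau>) = euler (nome \<tau> ^ 3) ^ 3 / euler (nome \<tau>)"
    unfolding cubic_b_def
    using euler_nome_nonzero[OF assms, of 3] euler_nome_nonzero1[OF assms] by (simp add: field_simps eval_nat_numeral)
  have "formC 3 \<tau> = cusp_power (\<lambda>\<tau>. (1 - alpha 3 \<tau>) / alpha 3 \<tau>) (- 1 / 3) \<tau> * cubic_b (nome \<tau>)"
    by (simp add: formC_def formB_nome[OF assms])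
  thus ?thesis unfolding cp mult.assoc eq .
qed

lemma formA_2_nome:
  assumes "\<tau> \<in> uhp"
  shows "formA 2 \<tau> = phi_sq (nome \<tau>)"
proof -
  have G: "real_germ (\<lambda>q. phi_sq q / phi_sq (- q))" by (intro real_germ_divide real_germ_theta)
  have f: "\<forall>\<^sub>F \<tau> in at_cusp. 1 - alpha 2 \<tau> = (of_real 1 * qpow 0 \<tau> * (phi_sq (nome \<tau>) / phi_sq (- nome \<tau>))) powi (- 2)"
    using eventually_at_cusp_uhp
    by eventually_elim (simp add: alpha_nome legendre_def qpow_0 power_int_minus power_divide)
  have "(\<lambda>q. phi_sq q / phi_sq (- q)) holomorphic_on ball 0 1"
    by (intro holomorphic_intros phi_sq_holomorphic phi_sq_minus_holomorphic) (simp add: phi_sq_nonzero)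
  from cusp_power_germ(2)[OF G _ _ f _ germ_form_holomorphic[OF this] assms, of "- 1 / 2"]
  have "cusp_power (\<lambda>\<tau>. 1 - alpha 2 \<tau>) (- 1 / 2) \<tau> = phi_sq (nome \<tau>) / phi_sq (- nome \<tau>)" by (simp add: qpow_0)
  thus ?thesis using phi_sq_nonzero[of "- nome \<tau>"] nome_disc[OF assms] by (simp add: formA_def formB_nome[OF assms])
qed

lemma eta_root_2:
  "\<forall>\<^sub>F \<tau> in at_cusp. cusp_power (\<lambda>\<tau>. 2^4 * eta_at 4 \<tau> ^ 8 + eta_at 1 \<tau> ^ 8) (1/2) \<tau> / eta_at 2 \<tau> ^ 2 = phi_sq (nome \<tau>)"
proof -
  have k: "(2 :: int) \<noteq> 0" "1 / 2 = 1 / real_of_int 2" by simp_all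
  have G: "real_germ (\<lambda>q. phi_sq q * euler (q\<^sup>2) ^ 2)"
    by (intro real_germ_mult real_germ_theta real_germ_power real_germ_euler) simp
  have "\<forall>\<^sub>F \<tau> in at_cusp. 2^4 * eta_at 4 \<tau> ^ 8 + eta_at 1 \<tau> ^ 8 =
      (of_real 1 * qpow (1/6) \<tau> * (phi_sq (nome \<tau>) * euler (nome \<tau> ^ 2) ^ 2)) powi 2"
    using eventually_at_cusp_uhp
  proof eventually_elim
    case (elim \<tau>)
    show ?case unfolding eta_sums(5) phi_sq_eta(2)[OF nome_disc[OF elim]]
      by (simp add: power_mult_distrib qpow_power flip: power_mult)
  qed
  from cusp_power_germ(1)[OF G k(1) zero_less_one this k(2)] show ?thesis
    using eventually_at_cusp_uhp
  proof eventually_elim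
    case (elim \<tau>)
    have e: "euler (nome \<tau> ^ 2) \<noteq> 0" using euler_nome_nonzero[OF elim(2)] by auto
    have "eta_at 2 \<tau> ^ 2 = qpow (1/6) \<tau> * euler (nome \<tau> ^ 2) ^ 2"
      unfolding eta_at_power by simp
    thus ?case using elim(1) e by (simp add: qpow_nonzero)
  qed
qed

lemma formC_2_nome:
  assumes "\<tau> \<in> uhp"
  shows "formC 2 \<tau> = 4 * qpow (1/2) \<tau> * (euler (nome \<tau> ^ 4) ^ 4 / euler (nome \<tau> ^ 2) ^ 2)"
proof -
  have G: "real_germ (\<lambda>q. euler (q ^ 4) ^ 4 / euler q ^ 4)"
    by (intro real_germ_divide real_germ_power real_germ_euler1 real_germ_euler) simp
  have f: "\<forall>\<^sub>F \<tau> in at_cusp. (1 - alpha 2 \<tau>) / alpha 2 \<tau> =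
      (of_real 4 * qpow (1/2) \<tau> * (euler (nome \<tau> ^ 4) ^ 4 / euler (nome \<tau>) ^ 4)) powi (- 2)"
    using eventually_at_cusp_uhp
  proof eventually_elim
    case (elim \<tau>)
    define q where "q = nome \<tau>"
    have q: "norm q < 1" using nome_disc[OF elim] by (simp add: q_def)
    have e: "euler q \<noteq> 0" "euler (q\<^sup>2) \<noteq> 0" "euler (q ^ 4) \<noteq> 0" using q by (auto intro!: euler_nonzero norm_power_lt)
    have "(of_real 4 * qpow (1/2) \<tau> * (euler (q ^ 4) ^ 4 / euler q ^ 4)) ^ 2 = 16 * q * (euler (q ^ 4) ^ 8 / euler q ^ 8)"
      unfolding power_mult_distrib by (simp add: qpow_power q_def power_divide flip: power_mult)
    hence "(of_real 4 * qpow (1/2) \<tau> * (euler (q ^ 4) ^ 4 / euler q ^ 4)) powi (- 2) = euler q ^ 8 / (16 * q * euler (q ^ 4) ^ 8)"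
      by (simp add: power_int_minus)
    moreover have "q \<noteq> 0" by (simp add: q_def qpow_nonzero)
    hence "(1 - legendre q) / legendre q = euler q ^ 8 / (16 * q * euler (q ^ 4) ^ 8)"
      unfolding phi_sq_eta(4)[OF q] unfolding phi_sq_eta(3)[OF q]
      using e by (simp add: field_simps flip: power_add)
    ultimately show ?case unfolding alpha_nome[OF elim] q_def[symmetric] by (simp only:)
  qed
  have "(\<lambda>q. euler (q ^ 4) ^ 4 / euler q ^ 4) holomorphic_on ball 0 1" using euler_quotient_holomorphic[of 4 1 4 4] by simp
  from cusp_power_germ(2)[OF G _ _ f _ germ_form_holomorphic[OF this] assms, of "- 1 / 2"]
  have cp: "cusp_power (\<lambda>\<tau>. (1 - alpha 2 \<tau>) / alpha 2 \<tau>) (- 1 / 2) \<tau> =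
      4 * qpow (1/2) \<tau> * (euler (nome \<tau> ^ 4) ^ 4 / euler (nome \<tau>) ^ 4)"
    by simp
  have eq: "euler (nome \<tau> ^ 4) ^ 4 / euler (nome \<tau>) ^ 4 * phi_sq (- nome \<tau>) = euler (nome \<tau> ^ 4) ^ 4 / euler (nome \<tau> ^ 2) ^ 2"
    unfolding phi_sq_minus_product[OF nome_disc[OF assms]]
    using euler_nome_nonzero1[OF assms] by simp
  have "formC 2 \<tau> = cusp_power (\<lambda>\<tau>. (1 - alpha 2 \<tau>) / alpha 2 \<tau>) (- 1 / 2) \<tau> * phi_sq (- nome \<tau>)"
    by (simp add: formC_def formB_nome[OF assms])
  thus ?thesis unfolding cp mult.assoc eq .
qed

section \<open>Series expansions\<close>

lemma E1_divisor_sum: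
  assumes "n > 0"
  shows "of_int (E1 (rat_of_nat n) 4) = (\<Sum>d | d dvd n. chi4 d)"
    and "of_int (E1 (rat_of_nat n) 3) = (\<Sum>d | d dvd n. chi3 d)"
proof -
  define D where "D = {d. d dvd n}"
  have fin: "finite D" using assms by (simp add: D_def)
  have E: "E1 (rat_of_nat n) k = int (card {d \<in> D. [int d = 1] (mod int k)}) - int (card {d \<in> D. [int d = - 1] (mod int k)})" for k
  proof -
    have "{d::nat. 0 < d \<and> int d dvd int n \<and> Q d} = {d \<in> D. Q d}" for Q
      using assms by (auto simp: D_def intro!: Nat.gr0I)
    thus ?thesis by (simp add: E1_def)
  qed
  have c: "of_int (E1 (rat_of_nat n) k) = (\<Sum>d\<in>D. (if [int d = 1] (mod int k) then 1 else 0) - (if [int d = - 1] (mod int k) then 1 else 0) :: complex)" for k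
    unfolding E sum_subtractf using fin by (simp flip: sum.inter_filter)
  have 4: "(if [int d = 1] (mod 4) then 1 else 0) - (if [int d = - 1] (mod 4) then 1 else 0) = chi4 d" for d
  proof -
    have "[int d = 1] (mod 4) \<longleftrightarrow> d mod 4 = 1" "[int d = - 1] (mod 4) \<longleftrightarrow> d mod 4 = 3" unfolding cong_def by simp_all presburger+
    thus ?thesis by (simp add: chi4_def)
  qed
  have 3: "(if [int d = 1] (mod 3) then 1 else 0) - (if [int d = - 1] (mod 3) then 1 else 0) = chi3 d" for d
  proof -
    have "[int d = 1] (mod 3) \<longleftrightarrow> d mod 3 = 1" "[int d = - 1] (mod 3) \<longleftrightarrow> d mod 3 = 2" unfolding cong_def by simp_all presburger+
    thus ?thesis by (simp add: chi3_def)
  qed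
  show "of_int (E1 (rat_of_nat n) 4) = (\<Sum>d | d dvd n. chi4 d)" "of_int (E1 (rat_of_nat n) 3) = (\<Sum>d | d dvd n. chi3 d)"
    unfolding c[of 4, simplified] c[of 3, simplified] 4 3 D_def by simp_all
qed

lemma E1_1: "E1 (rat_of_nat 1) 4 = 1" "E1 (rat_of_nat 1) 3 = 1"
proof -
  have "of_int (E1 (rat_of_nat 1) 4) = (1 :: complex)" "of_int (E1 (rat_of_nat 1) 3) = (1 :: complex)"
    using E1_divisor_sum[of 1] by (simp_all add: chi4_def chi3_def)
  thus "E1 (rat_of_nat 1) 4 = 1" "E1 (rat_of_nat 1) 3 = 1" by (metis of_int_1 of_int_eq_iff)+
qed

lemma E1_series:
  assumes "norm q < 1"
  shows "((\<lambda>n. of_int (E1 (rat_of_nat n) 4) * q ^ n) has_sum lambert (\<lambda>m n. chi4 m) q) {1..}"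
    and "((\<lambda>n. of_int (E1 (rat_of_nat n) 3) * q ^ n) has_sum lambert (\<lambda>m n. chi3 m) q) {1..}"
  using lambert_divisors[OF assms tame_chi(3)] lambert_divisors[OF assms tame_chi(1)]
  by (auto simp: E1_divisor_sum elim!: has_sum_cong[THEN iffD1, rotated])

lemma phi_sq_series:
  assumes "norm q < 1"
  shows "phi_sq q = 1 + 4 * (\<Sum>\<^sub>\<infinity>n\<in>{1..}. of_int (E1 (rat_of_nat n) 4) * q ^ n)"
  using infsumI[OF E1_series(1)[OF assms]] by (simp add: phi_sq_def)

lemma cubic_a_series:
  assumes "norm q < 1"
  shows "cubic_a q = 1 + 6 * (\<Sum>\<^sub>\<infinity>n\<in>{1..}. of_int (E1 (rat_of_nat n) 3) * q ^ n)"
  using infsumI[OF E1_series(2)[OF assms]] by (simp add: cubic_a_def)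

lemma odd_sum_series:
  assumes "norm q < 1"
  shows "odd_sum q = 1 + 24 * (\<Sum>\<^sub>\<infinity>n\<in>{1..}. of_nat (\<Sum>d | d dvd n \<and> odd d. d) * q ^ n)"
proof -
  have t: "tame (\<lambda>m n. if odd m then of_nat m else 0)"
    using tame_if[OF tame_of_nat_pow[of 1], of "\<lambda>m n. odd m"] by (simp cong: if_cong)
  have c: "(\<Sum>d | d dvd n. if odd d then of_nat d else 0) = (of_nat (\<Sum>d | d dvd n \<and> odd d. d) :: complex)" if "n \<ge> 1" for n :: nat
    using that by (simp add: sum.inter_filter[symmetric])
  have "((\<lambda>n. of_nat (\<Sum>d | d dvd n \<and> odd d. d) * q ^ n) has_sum lambert (\<lambda>m n. if odd m then of_nat m else 0) q) {1..}"
    using lambert_divisors[OF assms t] by (rule has_sum_cong[THEN iffD1, rotated]) (simp only: c atLeast_iff)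
  from infsumI[OF this] show ?thesis by (simp add: odd_sum_def)
qed

text \<open>By \<open>cubic_b_product\<close> the function is (3 a(q^3) - a(q)) / 2. The series at
  q^3 supplies the terms with n divisible by 3; elsewhere E1 vanishes at n / 3.\<close>

lemma cubic_b_series:
  assumes "norm q < 1"
  shows "cubic_b q = 1 - 3 * (\<Sum>\<^sub>\<infinity>n\<in>{1..}. of_int (E1 (rat_of_nat n) 3 - 3 * E1 (rat_of_nat n / 3) 3) * q ^ n)"
proof -
  let ?L = "lambert (\<lambda>m n. chi3 m)"
  have "((\<lambda>n. of_int (E1 (rat_of_nat n) 3) * (q ^ 3) ^ n) has_sum ?L (q ^ 3)) {1..}"
    by (rule E1_series(2)) (use norm_power_lt[OF assms] in simp)
  hence "(((\<lambda>n. of_int (E1 (rat_of_nat n / 3) 3) * q ^ n) \<circ> (\<lambda>n. 3 * n)) has_sum ?L (q ^ 3)) {1..}"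
    by (simp add: o_def power_mult)
  hence hs: "((\<lambda>n. of_int (E1 (rat_of_nat n / 3) 3) * q ^ n) has_sum ?L (q ^ 3)) ((\<lambda>n. 3 * n) ` {1..})"
    by (subst has_sum_reindex) (auto simp: inj_on_def)
  have z: "E1 (rat_of_nat n / 3) 3 = 0" if n: "n \<in> {1..} - (\<lambda>n. 3 * n) ` {1..}" for n
  proof -
    have "rat_of_nat n / 3 \<notin> \<int>"
    proof
      assume "rat_of_nat n / 3 \<in> \<int>"
      then obtain k where "rat_of_nat n / 3 = of_int k" by (auto elim: Ints_cases)
      hence "rat_of_int (int n) = rat_of_int (3 * k)" by (simp add: field_simps)
      hence "int n = 3 * k" by (simp only: of_int_eq_iff)
      hence "n = 3 * nat k" "nat k \<ge> 1" using n by auto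
      thus False using n by auto
    qed
    thus ?thesis by (simp add: E1_def)
  qed
  from hs have "((\<lambda>n. of_int (E1 (rat_of_nat n / 3) 3) * q ^ n) has_sum ?L (q ^ 3)) {1..}"
  proof (rule has_sum_cong_neutral[THEN iffD1, rotated -1])
    fix n :: nat assume "n \<in> {1..} - (\<lambda>n. 3 * n) ` {1..}"
    from z[OF this] show "of_int (E1 (rat_of_nat n / 3) 3) * q ^ n = 0" by simp
  qed auto
  from has_sum_add[OF E1_series(2)[OF assms] has_sum_cmult_right[OF this, of "- 3"]]
  have "((\<lambda>n. of_int (E1 (rat_of_nat n) 3 - 3 * E1 (rat_of_nat n / 3) 3) * q ^ n) has_sum ?L q + (- 3) * ?L (q ^ 3)) {1..}"
    by (simp add: algebra_simps)
  note S = infsumI[OF this]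
  have "b = 1 - 3 * (l + (- 3) * l')" if "3 * (1 + 6 * l') - (1 + 6 * l) = 2 * b" for b l l' :: complex
  proof -
    have "2 * b = 2 * (1 - 3 * (l + (- 3) * l'))" unfolding that[symmetric] by (simp add: algebra_simps)
    thus ?thesis by (simp only: mult_left_cancel[OF zero_neq_numeral[symmetric]])
  qed
  from this[OF cubic_b_product[OF assms, unfolded cubic_a_def]] show ?thesis unfolding S cubic_b_def .
qed

lemma has_sum_finite_sum:
  fixes f :: "'k \<Rightarrow> 'a \<Rightarrow> complex"
  assumes "finite K" "\<And>k. k \<in> K \<Longrightarrow> (f k has_sum S k) A"
  shows "((\<lambda>n. \<Sum>k\<in>K. f k n) has_sum (\<Sum>k\<in>K. S k)) A"
  using assms by (induction K rule: finite_induct) (auto intro: has_sum_add)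

text \<open>A weighted average of L over roots of unity keeps only the exponents n = m j + 1. The
  term j = 0 is split off as \<open>c 1\<close>, to match series that start at 1.\<close>

lemma root_filter:
  fixes L c :: "_ \<Rightarrow> complex"
  assumes L: "\<And>w. norm w < 1 \<Longrightarrow> ((\<lambda>n. c n * w ^ n) has_sum L w) {1..}"
    and K: "finite K" "\<And>k. k \<in> K \<Longrightarrow> norm k = 1"
    and filter: "\<And>n. (\<Sum>k\<in>K. u k * k ^ n) = (if n mod m = 1 then 1 else 0)"
    and m: "m \<ge> 2" and z: "norm z < 1" "z \<noteq> 0"
  shows "z * (c 1 + (\<Sum>\<^sub>\<infinity>j\<in>{1..}. c (m * j + 1) * (z ^ m) ^ j)) = (\<Sum>k\<in>K. u k * L (k * z))"
proof -
  define S where "S = (\<Sum>k\<in>K. u k * L (k * z))"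
  have "((\<lambda>n. \<Sum>k\<in>K. u k * (c n * (k * z) ^ n)) has_sum S) {1..}"
    unfolding S_def by (intro has_sum_finite_sum has_sum_cmult_right L) (use K z in \<open>simp_all add: norm_mult\<close>)
  also have "(\<lambda>n. \<Sum>k\<in>K. u k * (c n * (k * z) ^ n)) = (\<lambda>n. if n mod m = 1 then c n * z ^ n else 0)"
  proof
    fix n
    have "(\<Sum>k\<in>K. u k * (c n * (k * z) ^ n)) = (\<Sum>k\<in>K. u k * k ^ n) * (c n * z ^ n)"
      unfolding sum_distrib_right by (rule sum.cong) (simp_all add: power_mult_distrib mult_ac)
    thus "(\<Sum>k\<in>K. u k * (c n * (k * z) ^ n)) = (if n mod m = 1 then c n * z ^ n else 0)" unfolding filter by simp
  qed
  finally have hs: "((\<lambda>n. if n mod m = 1 then c n * z ^ n else 0) has_sum S) {1..}" .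
  have md: "Suc (m * j) mod m = Suc 0" for j using m mod_mult_self2[of 1 m j] by simp
  from hs have "((\<lambda>n. c n * z ^ n) has_sum S) ((\<lambda>j. m * j + 1) ` UNIV)"
  proof (rule has_sum_cong_neutral[THEN iffD1, rotated -1])
    fix n assume "n \<in> {1..} - (\<lambda>j. m * j + 1) ` UNIV"
    hence "n mod m \<noteq> 1" by (metis DiffD2 mult_div_mod_eq rangeI)
    thus "(if n mod m = 1 then c n * z ^ n else 0) = 0" by simp
  qed (use m md in auto)
  hence "((\<lambda>j. c (m * j + 1) * z ^ (m * j + 1)) has_sum S) UNIV"
    by (subst (asm) has_sum_reindex) (use m in \<open>auto simp: inj_on_def o_def\<close>)
  from has_sum_cmult_right[OF this, of "1 / z"]
  have "((\<lambda>j. c (m * j + 1) * (z ^ m) ^ j) has_sum S / z) UNIV" using z by (simp add: power_mult)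
  moreover have "((\<lambda>j. c (m * j + 1) * (z ^ m) ^ j) has_sum (\<Sum>j\<in>{0}. c (m * j + 1) * (z ^ m) ^ j)) {0}"
    by (rule has_sum_finite) simp
  ultimately have "((\<lambda>j. c (m * j + 1) * (z ^ m) ^ j) has_sum S / z - (\<Sum>j\<in>{0}. c (m * j + 1) * (z ^ m) ^ j)) (UNIV - {0})"
    by (rule has_sum_Diff) simp
  moreover have "UNIV - {0} = {1 :: nat..}" by auto
  ultimately have "(\<Sum>\<^sub>\<infinity>j\<in>{1..}. c (m * j + 1) * (z ^ m) ^ j) = S / z - c 1" by (simp add: infsumI)
  thus ?thesis using z unfolding S_def[symmetric] by simp
qed

text \<open>The filter over 1 and -1 takes the odd part of \<open>phi_sq\<close>, which is
  \<open>phi_sq z\<close> - \<open>phi_sq (z^2)\<close> and thus known from the dissection.\<close>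

lemma eta_quotient_series_2:
  assumes "norm z < 1" "z \<noteq> 0"
  shows "euler (z ^ 8) ^ 4 / euler (z ^ 4) ^ 2 = 1 + (\<Sum>\<^sub>\<infinity>n\<in>{1..}. of_int (E1 (rat_of_nat (2 * n + 1)) 4) * (z\<^sup>2) ^ n)"
proof -
  define T :: complex where "T = (\<Sum>\<^sub>\<infinity>n\<in>{1..}. of_int (E1 (rat_of_nat (2 * n + 1)) 4) * (z\<^sup>2) ^ n)"
  define F where "F = euler (z ^ 8) ^ 4 / euler (z ^ 4) ^ 2"
  let ?L = "lambert (\<lambda>m n. chi4 m)"
  have "z * (of_int (E1 (rat_of_nat 1) 4) + T) =
      (\<Sum>k\<in>{1, - 1}. k / 2 * ?L (k * z))"
  unfolding T_def
  proof (rule root_filter[of "\<lambda>n. of_int (E1 (rat_of_nat n) 4)", OF E1_series(1)])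
    show "(\<Sum>k\<in>{1, - 1}. k / 2 * k ^ n) = (if n mod 2 = 1 then 1 else 0 :: complex)" for n
      by (cases "even n") (auto simp: odd_iff_mod_2_eq_one)
  qed (use assms in auto)
  also have "\<dots> = (phi_sq z - phi_sq (- z)) / 8" by (simp add: phi_sq_def)
  also have "phi_sq (- z) = 2 * phi_sq (z\<^sup>2) - phi_sq z" using phi_sq_add_minus[OF assms(1)] by (simp add: algebra_simps)
  also have "(phi_sq z - (2 * phi_sq (z\<^sup>2) - phi_sq z)) / 8 = (phi_sq z - phi_sq (z\<^sup>2)) / 4" by simp
  also have "\<dots> = z * F" unfolding phi_sq_dissection[OF assms(1)] F_def by simp
  finally have "z * (of_int (E1 (rat_of_nat 1) 4) + T) = z * F" .
  from mult_left_cancel[OF assms(2), THEN iffD1, OF this] show ?thesis unfolding E1_1 of_int_1 F_def T_def by (rule sym)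
qed

text \<open>For each fourth root of unity k the odd part at k * z is proportional to k * z, since
  the eta quotient in the dissection depends only on z^4. After weighting, the pairs 1, -1 and i, -i
  contribute equally. The quotient is the same as in \<open>eta_quotient_series_2\<close>, so only
  exponents 1 modulo 4 occur.\<close>

lemma eta_quotient_series_4:
  assumes "norm z < 1" "z \<noteq> 0"
  shows "euler (z ^ 8) ^ 4 / euler (z ^ 4) ^ 2 = 1 + (\<Sum>\<^sub>\<infinity>n\<in>{1..}. of_int (E1 (rat_of_nat (4 * n + 1)) 4) * (z ^ 4) ^ n)"
proof -
  define T :: complex where "T = (\<Sum>\<^sub>\<infinity>n\<in>{1..}. of_int (E1 (rat_of_nat (4 * n + 1)) 4) * (z ^ 4) ^ n)"
  define F where "F = euler (z ^ 8) ^ 4 / euler (z ^ 4) ^ 2"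
  let ?L = "lambert (\<lambda>m n. chi4 m)"
  have i4: "(k * z) ^ 4 = z ^ 4" "(k * z) ^ 8 = z ^ 8" if "k ^ 4 = 1" for k
  proof -
    have "k ^ 8 = (k ^ 4)\<^sup>2" by (simp flip: power_mult)
    thus "(k * z) ^ 4 = z ^ 4" "(k * z) ^ 8 = z ^ 8" using that by (simp_all add: power_mult_distrib)
  qed
  have D: "?L (k * z) - ?L (- (k * z)) = 2 * k * z * F" if "k ^ 4 = 1" "norm k = 1" for k
  proof -
    have n: "norm (k * z) < 1" using that assms by (simp add: norm_mult)
    have "4 * (?L (k * z) - ?L (- (k * z))) = phi_sq (k * z) - phi_sq (- (k * z))" by (simp add: phi_sq_def)
    also have "phi_sq (- (k * z)) = 2 * phi_sq ((k * z)\<^sup>2) - phi_sq (k * z)" using phi_sq_add_minus[OF n] by (simp add: algebra_simps)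
    also have "phi_sq (k * z) - (2 * phi_sq ((k * z)\<^sup>2) - phi_sq (k * z)) = 2 * (phi_sq (k * z) - phi_sq ((k * z)\<^sup>2))" by simp
    also have "\<dots> = 4 * (2 * k * z * F)" unfolding phi_sq_dissection[OF n] i4[OF that(1)] F_def by simp
    finally show ?thesis by (simp only: mult_left_cancel[OF zero_neq_numeral[symmetric]])
  qed
  have ne: "\<i> \<noteq> 1" "\<i> \<noteq> - 1" "- \<i> \<noteq> 1" "- \<i> \<noteq> - 1" "\<i> \<noteq> - \<i>" "(1 :: complex) \<noteq> - 1" by (simp_all add: complex_eq_iff)
  have "z * (of_int (E1 (rat_of_nat 1) 4) + T) =
      (\<Sum>k\<in>{1, - 1, \<i>, - \<i>}. 1 / (4 * k) * ?L (k * z))"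
  unfolding T_def
  proof (rule root_filter[of "\<lambda>n. of_int (E1 (rat_of_nat n) 4)", OF E1_series(1)])
    fix n :: nat
    define a r where "a = n div 4" and "r = n mod 4"
    have n: "n = 4 * a + r" and r: "r \<in> {0, 1, 2, 3}" by (auto simp: a_def r_def)
    have p: "k ^ n = k ^ r" if "k \<in> {1, - 1, \<i>, - \<i>}" for k :: complex
    proof -
      have "k ^ 4 = 1" using that by auto
      thus ?thesis unfolding n power_add power_mult by simp
    qed
    have "(\<Sum>k\<in>{1, - 1, \<i>, - \<i>}. 1 / (4 * k) * k ^ n) = (\<Sum>k\<in>{1, - 1, \<i>, - \<i>}. 1 / (4 * k) * k ^ r)"
      by (rule sum.cong) (simp_all only: p)
    also have "\<dots> = (if r = 1 then 1 else 0)"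
      using r ne by (auto simp: power2_eq_square power3_eq_cube)
    finally show "(\<Sum>k\<in>{1, - 1, \<i>, - \<i>}. 1 / (4 * k) * k ^ n) = (if n mod 4 = 1 then 1 else 0)" by (simp add: r_def)
  qed (use assms in auto)
  also have "\<dots> = ((?L (1 * z) - ?L (- (1 * z))) - \<i> * (?L (\<i> * z) - ?L (- (\<i> * z)))) / 4"
    using ne by (simp add: field_simps)
  also have "\<dots> = z * F" unfolding D[of 1, simplified power_one norm_one, OF refl refl] by (subst D) (simp_all add: mult.assoc[symmetric])
  finally have "z * (of_int (E1 (rat_of_nat 1) 4) + T) = z * F" .
  from mult_left_cancel[OF assms(2), THEN iffD1, OF this] show ?thesis unfolding E1_1 of_int_1 F_def T_def by (rule sym)
qed

text \<open>The filter over the cube roots of unity isolates \<open>cubic_c_root\<close>: among a +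
  2c, a + 2 omega c, a + 2 omega^2 c the contributions of a and of the constant term cancel.\<close>

lemma eta_quotient_series_3:
  assumes "norm z < 1" "z \<noteq> 0"
  shows "euler (z ^ 9) ^ 3 / euler (z ^ 3) = 1 + (\<Sum>\<^sub>\<infinity>n\<in>{1..}. of_int (E1 (rat_of_nat (3 * n + 1)) 3) * (z ^ 3) ^ n)"
proof -
  define T :: complex where "T = (\<Sum>\<^sub>\<infinity>n\<in>{1..}. of_int (E1 (rat_of_nat (3 * n + 1)) 3) * (z ^ 3) ^ n)"
  let ?L = "lambert (\<lambda>m n. chi3 m)"
  have "(omega\<^sup>2)\<^sup>2 = omega" using omega_cube by algebra
  hence o: "omega * omega = omega\<^sup>2" "(omega\<^sup>2)\<^sup>2 = omega" by (simp_all add: power2_eq_square)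
  have ne: "omega \<noteq> 1" "omega\<^sup>2 \<noteq> 1" "omega \<noteq> omega\<^sup>2"
  proof -
    show "omega \<noteq> 1" using omega_ne by simp
    show "omega\<^sup>2 \<noteq> 1"
    proof
      assume h: "omega\<^sup>2 = 1"
      from o(2)[unfolded h] show False using \<open>omega \<noteq> 1\<close> by simp
    qed
    show "omega \<noteq> omega\<^sup>2" using o \<open>omega \<noteq> 1\<close> by (metis omega_cube mult.commute power2_eq_square power3_eq_cube)
  qed
  have "z * (of_int (E1 (rat_of_nat 1) 3) + T) =
      (\<Sum>k\<in>{1, omega, omega\<^sup>2}. k\<^sup>2 / 3 * ?L (k * z))"
  unfolding T_def
  proof (rule root_filter[of "\<lambda>n. of_int (E1 (rat_of_nat n) 3)", OF E1_series(2)])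
    fix n :: nat
    have "(\<Sum>k\<in>{1, omega, omega\<^sup>2}. k\<^sup>2 / 3 * k ^ n) = (1 + omega ^ (n + 2) + (omega\<^sup>2) ^ (n + 2)) / 3"
      using ne by (simp add: power_add add_divide_distrib mult.commute o(1))
    also have "\<dots> = (if n mod 3 = 1 then 1 else 0)"
    proof -
      have "3 dvd (n + 2) \<longleftrightarrow> n mod 3 = 1" by presburger
      thus ?thesis unfolding omega_power_sum by simp
    qed
    finally show "(\<Sum>k\<in>{1, omega, omega\<^sup>2}. k\<^sup>2 / 3 * k ^ n) = (if n mod 3 = 1 then 1 else 0)" .
  qed (use assms in \<open>auto simp: norm_omega norm_power\<close>)
  also have "\<dots> = (?L z + omega\<^sup>2 * ?L (omega * z) + omega * ?L (omega\<^sup>2 * z)) / 3"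
    using ne by (simp add: o(2)[simplified] add_divide_distrib)
  also have "\<dots> = ((cubic_a z - 1) + omega\<^sup>2 * (cubic_a (omega * z) - 1) + omega * (cubic_a (omega\<^sup>2 * z) - 1)) / 18"
    by (simp add: cubic_a_def)
  also have "\<dots> = cubic_c_root z / 3"
  proof -
    have e: "(a + 2 * c - 1) + omega\<^sup>2 * (a + 2 * omega * c - 1) + omega * (a + 2 * omega\<^sup>2 * c - 1) = 6 * c" for a c
      using omega_sq omega_cube by algebra
    show ?thesis unfolding cubic_relations(1-3)[OF assms(1)] unfolding e by simp
  qed
  also have "\<dots> = z * (euler (z ^ 9) ^ 3 / euler (z ^ 3))" by (simp add: cubic_c_root_def)
  finally have "z * (of_int (E1 (rat_of_nat 1) 3) + T) = z * (euler (z ^ 9) ^ 3 / euler (z ^ 3))" .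
  from mult_left_cancel[OF assms(2), THEN iffD1, OF this] show ?thesis unfolding E1_1 of_int_1 T_def by (rule sym)
qed

lemma eta_quotients:
  assumes "\<tau> \<in> uhp"
  shows "eta_at 1 \<tau> ^ 4 / eta_at 2 \<tau> ^ 2 = phi_sq (- nome \<tau>)"
    and "eta_at 2 \<tau> ^ 10 / (eta_at 1 \<tau> ^ 4 * eta_at 4 \<tau> ^ 4) = phi_sq (nome \<tau>)"
    and "eta_at 1 \<tau> ^ 3 / eta_at 3 \<tau> = cubic_b (nome \<tau>)"
    and "eta_at 2 \<tau> ^ 4 / eta_at 1 \<tau> ^ 2 = qpow (1/4) \<tau> * (euler (nome \<tau> ^ 2) ^ 4 / euler (nome \<tau>) ^ 2)"
    and "eta_at 3 \<tau> ^ 3 / eta_at 1 \<tau> = qpow (1/3) \<tau> * (euler (nome \<tau> ^ 3) ^ 3 / euler (nome \<tau>))"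
    and "eta_at 4 \<tau> ^ 4 / eta_at 2 \<tau> ^ 2 = qpow (1/2) \<tau> * (euler (nome \<tau> ^ 4) ^ 4 / euler (nome \<tau> ^ 2) ^ 2)"
    and "2^4 * eta_at 1 \<tau> ^ 8 * eta_at 4 \<tau> ^ 16 / eta_at 2 \<tau> ^ 24 = legendre (nome \<tau>)"
    and "eta_at 1 \<tau> ^ 16 * eta_at 4 \<tau> ^ 8 / eta_at 2 \<tau> ^ 24 = 1 - legendre (nome \<tau>)"
proof -
  note n = nome_disc[OF assms]
  note 1 = qpow_ratio[of _ _ 0, unfolded qpow_0 mult_1_left]
  show "eta_at 1 \<tau> ^ 4 / eta_at 2 \<tau> ^ 2 = phi_sq (- nome \<tau>)"
    unfolding eta_at_power phi_sq_minus_product[OF n] by (subst 1) simp_all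
  have "eta_at 1 \<tau> ^ 4 * eta_at 4 \<tau> ^ 4 = qpow (5/6) \<tau> * (euler (nome \<tau>) ^ 4 * euler (nome \<tau> ^ 4) ^ 4)"
    unfolding eta_at_power using qpow_add[of "1/6" \<tau> "2/3"] by (simp add: mult_ac)
  thus "eta_at 2 \<tau> ^ 10 / (eta_at 1 \<tau> ^ 4 * eta_at 4 \<tau> ^ 4) = phi_sq (nome \<tau>)"
    unfolding phi_sq_product[OF n] by (simp only: eta_at_power) (subst 1, simp_all)
  show "eta_at 1 \<tau> ^ 3 / eta_at 3 \<tau> = cubic_b (nome \<tau>)"
    unfolding eta_at_power unfolding eta_at_euler cubic_b_def by (subst 1) simp_all
  show "eta_at 2 \<tau> ^ 4 / eta_at 1 \<tau> ^ 2 = qpow (1/4) \<tau> * (euler (nome \<tau> ^ 2) ^ 4 / euler (nome \<tau>) ^ 2)"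
    unfolding eta_at_power by (subst qpow_ratio[of _ _ "1/4"]) simp_all
  show "eta_at 3 \<tau> ^ 3 / eta_at 1 \<tau> = qpow (1/3) \<tau> * (euler (nome \<tau> ^ 3) ^ 3 / euler (nome \<tau>))"
    unfolding eta_at_power unfolding eta_at_euler by (subst qpow_ratio[of _ _ "1/3"]) simp_all
  show "eta_at 4 \<tau> ^ 4 / eta_at 2 \<tau> ^ 2 = qpow (1/2) \<tau> * (euler (nome \<tau> ^ 4) ^ 4 / euler (nome \<tau> ^ 2) ^ 2)"
    unfolding eta_at_power by (subst qpow_ratio[of _ _ "1/2"]) simp_all
  have "eta_at 1 \<tau> ^ 16 * eta_at 4 \<tau> ^ 8 = qpow 2 \<tau> * (euler (nome \<tau>) ^ 16 * euler (nome \<tau> ^ 4) ^ 8)"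
    unfolding eta_at_power using qpow_add[of "2/3" \<tau> "4/3"] by (simp add: mult_ac)
  thus "eta_at 1 \<tau> ^ 16 * eta_at 4 \<tau> ^ 8 / eta_at 2 \<tau> ^ 24 = 1 - legendre (nome \<tau>)"
    unfolding phi_sq_eta(4)[OF n] by (simp only: eta_at_power) (subst 1, simp_all)
  have "2^4 * eta_at 1 \<tau> ^ 8 * eta_at 4 \<tau> ^ 16 = qpow 3 \<tau> * (16 * (euler (nome \<tau>) ^ 8 * euler (nome \<tau> ^ 4) ^ 16))"
    unfolding eta_at_power using qpow_add[of "1/3" \<tau> "8/3"] by (simp add: mult_ac)
  hence "2^4 * eta_at 1 \<tau> ^ 8 * eta_at 4 \<tau> ^ 16 / eta_at 2 \<tau> ^ 24 = nome \<tau> * (16 * (euler (nome \<tau>) ^ 8 * euler (nome \<tau> ^ 4) ^ 16) / euler (nome \<tau> ^ 2) ^ 24)"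
    by (simp only: eta_at_power) (subst qpow_ratio[of _ _ 1], simp_all)
  thus "2^4 * eta_at 1 \<tau> ^ 8 * eta_at 4 \<tau> ^ 16 / eta_at 2 \<tau> ^ 24 = legendre (nome \<tau>)"
    unfolding phi_sq_eta(3)[OF n] by simp
qed

text \<open>Up to products without zeros this is the square of \<open>phi_sq\<close>, itself such a
  product; hence alpha_2 has no poles.\<close>

lemma eta_denominator_nonzero:
  assumes "\<tau> \<in> uhp"
  shows "2^4 * eta_at 4 \<tau> ^ 8 + eta_at 1 \<tau> ^ 8 \<noteq> 0"
  unfolding eta_sums(5) phi_sq_eta(2)[OF nome_disc[OF assms]]
  using phi_sq_nonzero[OF nome_disc[OF assms]] euler_nome_nonzero[OF assms] by (simp add: qpow_nonzero)

lemma qpow_root: "m > 0 \<Longrightarrow> qpow (1 / of_nat m) \<tau> ^ (m * k) = nome \<tau> ^ k"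
  by (simp add: qpow_power)

lemma qpow_root_simps:
  "qpow (1/4) \<tau> ^ 4 = nome \<tau>" "qpow (1/4) \<tau> ^ 8 = nome \<tau> ^ 2"
  "qpow (1/3) \<tau> ^ 3 = nome \<tau>" "qpow (1/3) \<tau> ^ 9 = nome \<tau> ^ 3"
  "qpow (1/2) \<tau> ^ 2 = nome \<tau>" "qpow (1/2) \<tau> ^ 4 = nome \<tau> ^ 2" "qpow (1/2) \<tau> ^ 8 = nome \<tau> ^ 4"
  using qpow_root[of 4 \<tau> 1] qpow_root[of 4 \<tau> 2] qpow_root[of 3 \<tau> 1] qpow_root[of 3 \<tau> 3]
    qpow_root[of 2 \<tau> 1] qpow_root[of 2 \<tau> 2] qpow_root[of 2 \<tau> 4]
  by simp_all

lemma formC_series: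
  assumes "\<tau> \<in> uhp"
  shows "formC 4 \<tau> = of_real (2 powr (3/2)) * qpow (1/4) \<tau> *
      (1 + (\<Sum>\<^sub>\<infinity>n\<in>{1..}. of_int (E1 (rat_of_nat (4 * n + 1)) 4) * nome \<tau> ^ n))"
    and "formC 3 \<tau> = 3 * qpow (1/3) \<tau> *
      (1 + (\<Sum>\<^sub>\<infinity>n\<in>{1..}. of_int (E1 (rat_of_nat (3 * n + 1)) 3) * nome \<tau> ^ n))"
    and "formC 2 \<tau> = 4 * qpow (1/2) \<tau> *
      (1 + (\<Sum>\<^sub>\<infinity>n\<in>{1..}. of_int (E1 (rat_of_nat (2 * n + 1)) 4) * nome \<tau> ^ n))"
  unfolding formC_4_nome[OF assms] formC_3_nome[OF assms] formC_2_nome[OF assms]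
  using eta_quotient_series_4[OF norm_qpow_less[OF _ assms] qpow_nonzero, of "1/4"]
    eta_quotient_series_3[OF norm_qpow_less[OF _ assms] qpow_nonzero, of "1/3"]
    eta_quotient_series_2[OF norm_qpow_less[OF _ assms] qpow_nonzero, of "1/2"]
  unfolding qpow_root_simps by simp_all

lemma formA_4_tendsto: "(formA 4 \<longlongrightarrow> 1) at_cusp"
  by (rule Lim_transform_eventually[OF real_germ_tendsto[OF real_germ_csqrt_odd_sum]])
    (use formA_4_near_cusp in \<open>auto elim: eventually_mono\<close>)

lemma tendsto_from_uhp:
  assumes "real_germ G" "\<And>\<tau>. \<tau> \<in> uhp \<Longrightarrow> f \<tau> = G (nome \<tau>)"
  shows "(f \<longlongrightarrow> 1) at_cusp"
  by (rule Lim_transform_eventually[OF real_germ_tendsto[OF assms(1)]])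
    (use eventually_at_cusp_uhp assms(2) in \<open>auto elim: eventually_mono\<close>)

text \<open>Both sides tend to 1 and have the same square, by
  \<open>K_hat_4_quartic_modulus\<close>.\<close>

lemma K_hat_4_near_cusp: "\<forall>\<^sub>F \<tau> in at_cusp. csqrt (odd_sum (nome \<tau>)) = K_hat 4 (alpha 4 \<tau>)"
proof -
  have "isCont (\<lambda>q. K_hat 4 (quartic_modulus q)) 0"
  proof (rule isCont_o2[of 0 quartic_modulus "K_hat 4"])
    have "isCont (\<lambda>q. euler (q\<^sup>2)) 0" by (rule isCont_ball[OF euler_power_holomorphic]) simp
    thus "isCont quartic_modulus 0" unfolding quartic_modulus_def[abs_def]
      by (intro continuous_intros theta_cont) (simp_all add: euler_0)
    show "isCont (K_hat 4) (quartic_modulus 0)" using isCont_K_hat(3) by (simp add: quartic_modulus_def)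
  qed
  from tendsto_at_cusp_nome[OF this]
  have "((\<lambda>\<tau>. K_hat 4 (quartic_modulus (nome \<tau>))) \<longlongrightarrow> 1) at_cusp" by (simp add: quartic_modulus_def K_hat_0)
  hence "\<forall>\<^sub>F \<tau> in at_cusp. csqrt (odd_sum (nome \<tau>)) = K_hat 4 (quartic_modulus (nome \<tau>))"
    by (rule eventually_eq_if_power_eq[where n = 2, OF real_germ_tendsto[OF real_germ_csqrt_odd_sum]])
      (use eventually_at_cusp_nome[OF K_hat_4_quartic_modulus] in \<open>auto elim: eventually_mono\<close>)
  thus ?thesis using eventually_at_cusp_uhp by eventually_elim (simp add: alpha_nome)
qed

text \<open>Where a denominator of alpha_4 or alpha_3 vanishes, division by 0 would make 1 - alpha
  equal to 1 but its eta quotient 0; this explains the guards, which are absent for alpha_2.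
  Statements with \<open>K_hat\<close> or a root are germs at the cusp, and the limit 1 there fixes
  the root.\<close>

theorem theorem10p1:
  shows
  "(\<comment> \<open>\<open>r = 4\<close>, \<open>M = 2\<close>; \<open>\<alpha>\<^sub>4\<close> has poles in the upper half plane\<close>
    (\<forall>\<tau>\<in>uhp. 2^6 * eta_at 2 \<tau> ^ 24 + eta_at 1 \<tau> ^ 24 \<noteq> 0 \<longrightarrow>
       alpha 4 \<tau> = 2^6 * eta_at 2 \<tau> ^ 24 / (2^6 * eta_at 2 \<tau> ^ 24 + eta_at 1 \<tau> ^ 24) \<and>
       1 - alpha 4 \<tau> = eta_at 1 \<tau> ^ 24 / (2^6 * eta_at 2 \<tau> ^ 24 + eta_at 1 \<tau> ^ 24)) \<and>
    (formA 4 \<longlongrightarrow> 1) at_cusp \<and>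
    (\<forall>\<^sub>F \<tau> in at_cusp.
       formA 4 \<tau> = K_hat 4 (alpha 4 \<tau>) \<and>
       formA 4 \<tau> = cusp_power (\<lambda>\<tau>. 2^6 * eta_at 2 \<tau> ^ 24 + eta_at 1 \<tau> ^ 24) (1/4) \<tau>
                     / (eta_at 1 \<tau> ^ 2 * eta_at 2 \<tau> ^ 2) \<and>
       formA 4 \<tau> = csqrt (1 + 24 * (\<Sum>\<^sub>\<infinity>n\<in>{1..}.
                     of_nat (\<Sum>d | d dvd n \<and> odd d. d) * nome \<tau> ^ n))) \<and>
    (\<forall>\<tau>\<in>uhp.
       formB 4 \<tau> = eta_at 1 \<tau> ^ 4 / eta_at 2 \<tau> ^ 2 \<and>
       formB 4 \<tau> = 1 + 4 * (\<Sum>\<^sub>\<infinity>n\<in>{1..}. of_int (E1 (rat_of_nat n) 4) * (- nome \<tau>) ^ n)) \<and>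
    (\<forall>\<tau>\<in>uhp.
       formC 4 \<tau> = of_real (2 powr (3/2)) * eta_at 2 \<tau> ^ 4 / eta_at 1 \<tau> ^ 2 \<and>
       formC 4 \<tau> = of_real (2 powr (3/2)) * qpow (1/4) \<tau> *
         (1 + (\<Sum>\<^sub>\<infinity>n\<in>{1..}. of_int (E1 (rat_of_nat (4 * n + 1)) 4) * nome \<tau> ^ n)))) \<and>

   (\<comment> \<open>\<open>r = 3\<close>, \<open>M = 3\<close>; \<open>\<alpha>\<^sub>3\<close> has poles in the upper half plane\<close>
    (\<forall>\<tau>\<in>uhp. 3^3 * eta_at 3 \<tau> ^ 12 + eta_at 1 \<tau> ^ 12 \<noteq> 0 \<longrightarrow>
       alpha 3 \<tau> = 3^3 * eta_at 3 \<tau> ^ 12 / (3^3 * eta_at 3 \<tau> ^ 12 + eta_at 1 \<tau> ^ 12) \<and>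
       1 - alpha 3 \<tau> = eta_at 1 \<tau> ^ 12 / (3^3 * eta_at 3 \<tau> ^ 12 + eta_at 1 \<tau> ^ 12)) \<and>
    (formA 3 \<longlongrightarrow> 1) at_cusp \<and>
    (\<forall>\<^sub>F \<tau> in at_cusp.
       formA 3 \<tau> = K_hat 3 (alpha 3 \<tau>) \<and>
       formA 3 \<tau> = cusp_power (\<lambda>\<tau>. 3^3 * eta_at 3 \<tau> ^ 12 + eta_at 1 \<tau> ^ 12) (1/3) \<tau>
                     / (eta_at 1 \<tau> * eta_at 3 \<tau>)) \<and>
    (\<forall>\<tau>\<in>uhp.
       formA 3 \<tau> = 1 + 6 * (\<Sum>\<^sub>\<infinity>n\<in>{1..}. of_int (E1 (rat_of_nat n) 3) * nome \<tau> ^ n)) \<and>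
    (\<forall>\<tau>\<in>uhp.
       formB 3 \<tau> = eta_at 1 \<tau> ^ 3 / eta_at 3 \<tau> \<and>
       formB 3 \<tau> = 1 - 3 * (\<Sum>\<^sub>\<infinity>n\<in>{1..}.
         of_int (E1 (rat_of_nat n) 3 - 3 * E1 (rat_of_nat n / 3) 3) * nome \<tau> ^ n)) \<and>
    (\<forall>\<tau>\<in>uhp.
       formC 3 \<tau> = 3 * eta_at 3 \<tau> ^ 3 / eta_at 1 \<tau> \<and>
       formC 3 \<tau> = 3 * qpow (1/3) \<tau> *
         (1 + (\<Sum>\<^sub>\<infinity>n\<in>{1..}. of_int (E1 (rat_of_nat (3 * n + 1)) 3) * nome \<tau> ^ n)))) \<and>

   (\<comment> \<open>\<open>r = 2\<close>, \<open>M = 4\<close>\<close>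
    (\<forall>\<tau>\<in>uhp.
       alpha 2 \<tau> = 2^4 * eta_at 4 \<tau> ^ 8 / (2^4 * eta_at 4 \<tau> ^ 8 + eta_at 1 \<tau> ^ 8) \<and>
       alpha 2 \<tau> = 2^4 * eta_at 1 \<tau> ^ 8 * eta_at 4 \<tau> ^ 16 / eta_at 2 \<tau> ^ 24 \<and>
       1 - alpha 2 \<tau> = eta_at 1 \<tau> ^ 8 / (2^4 * eta_at 4 \<tau> ^ 8 + eta_at 1 \<tau> ^ 8) \<and>
       1 - alpha 2 \<tau> = eta_at 1 \<tau> ^ 16 * eta_at 4 \<tau> ^ 8 / eta_at 2 \<tau> ^ 24) \<and>
    (formA 2 \<longlongrightarrow> 1) at_cusp \<and>
    (\<forall>\<^sub>F \<tau> in at_cusp.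
       formA 2 \<tau> = K_hat 2 (alpha 2 \<tau>) \<and>
       formA 2 \<tau> = cusp_power (\<lambda>\<tau>. 2^4 * eta_at 4 \<tau> ^ 8 + eta_at 1 \<tau> ^ 8) (1/2) \<tau>
                     / eta_at 2 \<tau> ^ 2) \<and>
    (\<forall>\<tau>\<in>uhp.
       formA 2 \<tau> = eta_at 2 \<tau> ^ 10 / (eta_at 1 \<tau> ^ 4 * eta_at 4 \<tau> ^ 4) \<and>
       formA 2 \<tau> = 1 + 4 * (\<Sum>\<^sub>\<infinity>n\<in>{1..}. of_int (E1 (rat_of_nat n) 4) * nome \<tau> ^ n)) \<and>
    (\<forall>\<tau>\<in>uhp.
       formB 2 \<tau> = eta_at 1 \<tau> ^ 4 / eta_at 2 \<tau> ^ 2 \<and>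
       formB 2 \<tau> = 1 + 4 * (\<Sum>\<^sub>\<infinity>n\<in>{1..}. of_int (E1 (rat_of_nat n) 4) * (- nome \<tau>) ^ n)) \<and>
    (\<forall>\<tau>\<in>uhp.
       formC 2 \<tau> = 2^2 * eta_at 4 \<tau> ^ 4 / eta_at 2 \<tau> ^ 2 \<and>
       formC 2 \<tau> = 4 * qpow (1/2) \<tau> *
         (1 + (\<Sum>\<^sub>\<infinity>n\<in>{1..}. of_int (E1 (rat_of_nat (2 * n + 1)) 4) * nome \<tau> ^ n))))"
proof (intro conjI)
  show "\<forall>\<tau>\<in>uhp. 2^6 * eta_at 2 \<tau> ^ 24 + eta_at 1 \<tau> ^ 24 \<noteq> 0 \<longrightarrow>
       alpha 4 \<tau> = 2^6 * eta_at 2 \<tau> ^ 24 / (2^6 * eta_at 2 \<tau> ^ 24 + eta_at 1 \<tau> ^ 24) \<and>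
       1 - alpha 4 \<tau> = eta_at 1 \<tau> ^ 24 / (2^6 * eta_at 2 \<tau> ^ 24 + eta_at 1 \<tau> ^ 24)"
    by (intro ballI impI) (simp only: alpha_eta(1) complement_quotient(1) simp_thms)
  show "\<forall>\<tau>\<in>uhp. 3^3 * eta_at 3 \<tau> ^ 12 + eta_at 1 \<tau> ^ 12 \<noteq> 0 \<longrightarrow>
       alpha 3 \<tau> = 3^3 * eta_at 3 \<tau> ^ 12 / (3^3 * eta_at 3 \<tau> ^ 12 + eta_at 1 \<tau> ^ 12) \<and>
       1 - alpha 3 \<tau> = eta_at 1 \<tau> ^ 12 / (3^3 * eta_at 3 \<tau> ^ 12 + eta_at 1 \<tau> ^ 12)"
    by (intro ballI impI) (simp only: alpha_eta(2) complement_quotient(1) simp_thms)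
  show "\<forall>\<tau>\<in>uhp.
       alpha 2 \<tau> = 2^4 * eta_at 4 \<tau> ^ 8 / (2^4 * eta_at 4 \<tau> ^ 8 + eta_at 1 \<tau> ^ 8) \<and>
       alpha 2 \<tau> = 2^4 * eta_at 1 \<tau> ^ 8 * eta_at 4 \<tau> ^ 16 / eta_at 2 \<tau> ^ 24 \<and>
       1 - alpha 2 \<tau> = eta_at 1 \<tau> ^ 8 / (2^4 * eta_at 4 \<tau> ^ 8 + eta_at 1 \<tau> ^ 8) \<and>
       1 - alpha 2 \<tau> = eta_at 1 \<tau> ^ 16 * eta_at 4 \<tau> ^ 8 / eta_at 2 \<tau> ^ 24"
  proof (intro ballI conjI)
    fix \<tau> assume \<tau>: "\<tau> \<in> uhp"
    show "alpha 2 \<tau> = 2^4 * eta_at 4 \<tau> ^ 8 / (2^4 * eta_at 4 \<tau> ^ 8 + eta_at 1 \<tau> ^ 8)" by (rule alpha_eta(3)[OF \<tau>])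
    show "1 - alpha 2 \<tau> = eta_at 1 \<tau> ^ 8 / (2^4 * eta_at 4 \<tau> ^ 8 + eta_at 1 \<tau> ^ 8)"
      unfolding alpha_eta(3)[OF \<tau>] by (rule complement_quotient(1)[OF eta_denominator_nonzero[OF \<tau>]])
    show "alpha 2 \<tau> = 2^4 * eta_at 1 \<tau> ^ 8 * eta_at 4 \<tau> ^ 16 / eta_at 2 \<tau> ^ 24"
      "1 - alpha 2 \<tau> = eta_at 1 \<tau> ^ 16 * eta_at 4 \<tau> ^ 8 / eta_at 2 \<tau> ^ 24"
      unfolding eta_quotients(7,8)[OF \<tau>] alpha_nome(3)[OF \<tau>] by (rule refl)+
  qed
  show "(formA 4 \<longlongrightarrow> 1) at_cusp" by (rule formA_4_tendsto)
  show "(formA 3 \<longlongrightarrow> 1) at_cusp" by (rule tendsto_from_uhp[OF real_germ_theta(2) formA_3_nome])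
  show "(formA 2 \<longlongrightarrow> 1) at_cusp" by (rule tendsto_from_uhp[OF real_germ_theta(1) formA_2_nome])
  show "\<forall>\<^sub>F \<tau> in at_cusp.
       formA 4 \<tau> = K_hat 4 (alpha 4 \<tau>) \<and>
       formA 4 \<tau> = cusp_power (\<lambda>\<tau>. 2^6 * eta_at 2 \<tau> ^ 24 + eta_at 1 \<tau> ^ 24) (1/4) \<tau>
                     / (eta_at 1 \<tau> ^ 2 * eta_at 2 \<tau> ^ 2) \<and>
       formA 4 \<tau> = csqrt (1 + 24 * (\<Sum>\<^sub>\<infinity>n\<in>{1..}.
                     of_nat (\<Sum>d | d dvd n \<and> odd d. d) * nome \<tau> ^ n))"
    using formA_4_near_cusp K_hat_4_near_cusp eta_root_4 eventually_at_cusp_uhp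
  proof eventually_elim
    case (elim \<tau>)
    show ?case unfolding elim(3) elim(1) odd_sum_series[OF nome_disc[OF elim(4)], symmetric] elim(2)[symmetric] by simp
  qed
  show "\<forall>\<^sub>F \<tau> in at_cusp.
       formA 3 \<tau> = K_hat 3 (alpha 3 \<tau>) \<and>
       formA 3 \<tau> = cusp_power (\<lambda>\<tau>. 3^3 * eta_at 3 \<tau> ^ 12 + eta_at 1 \<tau> ^ 12) (1/3) \<tau>
                     / (eta_at 1 \<tau> * eta_at 3 \<tau>)"
    using eventually_at_cusp_nome[OF K_hat_3_cubic_modulus] eta_root_3 eventually_at_cusp_uhp
  proof eventually_elim
    case (elim \<tau>)
    show ?case unfolding elim(2) formA_3_nome[OF elim(3)] alpha_nome(2)[OF elim(3)] elim(1) by simp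
  qed
  show "\<forall>\<^sub>F \<tau> in at_cusp.
       formA 2 \<tau> = K_hat 2 (alpha 2 \<tau>) \<and>
       formA 2 \<tau> = cusp_power (\<lambda>\<tau>. 2^4 * eta_at 4 \<tau> ^ 8 + eta_at 1 \<tau> ^ 8) (1/2) \<tau>
                     / eta_at 2 \<tau> ^ 2"
    using eventually_at_cusp_nome[OF K_hat_2_legendre] eta_root_2 eventually_at_cusp_uhp
  proof eventually_elim
    case (elim \<tau>)
    show ?case unfolding elim(2) formA_2_nome[OF elim(3)] alpha_nome(3)[OF elim(3)] elim(1) by simp
  qed
  show "\<forall>\<tau>\<in>uhp. formA 3 \<tau> = 1 + 6 * (\<Sum>\<^sub>\<infinity>n\<in>{1..}. of_int (E1 (rat_of_nat n) 3) * nome \<tau> ^ n)"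
    by (intro ballI) (simp only: formA_3_nome cubic_a_series[OF nome_disc])
  show "\<forall>\<tau>\<in>uhp.
       formA 2 \<tau> = eta_at 2 \<tau> ^ 10 / (eta_at 1 \<tau> ^ 4 * eta_at 4 \<tau> ^ 4) \<and>
       formA 2 \<tau> = 1 + 4 * (\<Sum>\<^sub>\<infinity>n\<in>{1..}. of_int (E1 (rat_of_nat n) 4) * nome \<tau> ^ n)"
    by (intro ballI conjI) (simp_all only: formA_2_nome eta_quotients phi_sq_series[OF nome_disc, symmetric])
  show B: "\<forall>\<tau>\<in>uhp.
       formB 4 \<tau> = eta_at 1 \<tau> ^ 4 / eta_at 2 \<tau> ^ 2 \<and>
       formB 4 \<tau> = 1 + 4 * (\<Sum>\<^sub>\<infinity>n\<in>{1..}. of_int (E1 (rat_of_nat n) 4) * (- nome \<tau>) ^ n)"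
  proof (intro ballI conjI)
    fix \<tau> assume \<tau>: "\<tau> \<in> uhp"
    show "formB 4 \<tau> = eta_at 1 \<tau> ^ 4 / eta_at 2 \<tau> ^ 2" by (simp only: formB_nome[OF \<tau>] eta_quotients[OF \<tau>])
    show "formB 4 \<tau> = 1 + 4 * (\<Sum>\<^sub>\<infinity>n\<in>{1..}. of_int (E1 (rat_of_nat n) 4) * (- nome \<tau>) ^ n)"
      unfolding formB_nome[OF \<tau>] by (rule phi_sq_series) (simp add: nome_disc[OF \<tau>])
  qed
  thus "\<forall>\<tau>\<in>uhp.
       formB 2 \<tau> = eta_at 1 \<tau> ^ 4 / eta_at 2 \<tau> ^ 2 \<and>
       formB 2 \<tau> = 1 + 4 * (\<Sum>\<^sub>\<infinity>n\<in>{1..}. of_int (E1 (rat_of_nat n) 4) * (- nome \<tau>) ^ n)"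
    by (metis formB_nome(1,3))
  show "\<forall>\<tau>\<in>uhp.
       formB 3 \<tau> = eta_at 1 \<tau> ^ 3 / eta_at 3 \<tau> \<and>
       formB 3 \<tau> = 1 - 3 * (\<Sum>\<^sub>\<infinity>n\<in>{1..}.
         of_int (E1 (rat_of_nat n) 3 - 3 * E1 (rat_of_nat n / 3) 3) * nome \<tau> ^ n)"
    by (intro ballI conjI) (simp_all only: formB_nome eta_quotients cubic_b_series[OF nome_disc, symmetric])
  show "\<forall>\<tau>\<in>uhp.
       formC 4 \<tau> = of_real (2 powr (3/2)) * eta_at 2 \<tau> ^ 4 / eta_at 1 \<tau> ^ 2 \<and>
       formC 4 \<tau> = of_real (2 powr (3/2)) * qpow (1/4) \<tau> *
         (1 + (\<Sum>\<^sub>\<infinity>n\<in>{1..}. of_int (E1 (rat_of_nat (4 * n + 1)) 4) * nome \<tau> ^ n))"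
  proof (intro ballI conjI)
    fix \<tau> assume \<tau>: "\<tau> \<in> uhp"
    have "of_real (2 powr (3/2)) * eta_at 2 \<tau> ^ 4 / eta_at 1 \<tau> ^ 2 = of_real (2 powr (3/2)) * (eta_at 2 \<tau> ^ 4 / eta_at 1 \<tau> ^ 2)" by simp
    thus "formC 4 \<tau> = of_real (2 powr (3/2)) * eta_at 2 \<tau> ^ 4 / eta_at 1 \<tau> ^ 2"
      by (simp only: formC_4_nome[OF \<tau>] eta_quotients[OF \<tau>] mult.assoc)
  qed (rule formC_series)
  show "\<forall>\<tau>\<in>uhp.
       formC 3 \<tau> = 3 * eta_at 3 \<tau> ^ 3 / eta_at 1 \<tau> \<and>
       formC 3 \<tau> = 3 * qpow (1/3) \<tau> *
         (1 + (\<Sum>\<^sub>\<infinity>n\<in>{1..}. of_int (E1 (rat_of_nat (3 * n + 1)) 3) * nome \<tau> ^ n))"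
  proof (intro ballI conjI)
    fix \<tau> assume \<tau>: "\<tau> \<in> uhp"
    have "3 * eta_at 3 \<tau> ^ 3 / eta_at 1 \<tau> = 3 * (eta_at 3 \<tau> ^ 3 / eta_at 1 \<tau>)" by simp
    thus "formC 3 \<tau> = 3 * eta_at 3 \<tau> ^ 3 / eta_at 1 \<tau>"
      by (simp only: formC_3_nome[OF \<tau>] eta_quotients[OF \<tau>] mult.assoc)
  qed (rule formC_series)
  show "\<forall>\<tau>\<in>uhp.
       formC 2 \<tau> = 2^2 * eta_at 4 \<tau> ^ 4 / eta_at 2 \<tau> ^ 2 \<and>
       formC 2 \<tau> = 4 * qpow (1/2) \<tau> *
         (1 + (\<Sum>\<^sub>\<infinity>n\<in>{1..}. of_int (E1 (rat_of_nat (2 * n + 1)) 4) * nome \<tau> ^ n))"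
  proof (intro ballI conjI)
    fix \<tau> assume \<tau>: "\<tau> \<in> uhp"
    have "2^2 * eta_at 4 \<tau> ^ 4 / eta_at 2 \<tau> ^ 2 = 4 * (eta_at 4 \<tau> ^ 4 / eta_at 2 \<tau> ^ 2)" by simp
    thus "formC 2 \<tau> = 2^2 * eta_at 4 \<tau> ^ 4 / eta_at 2 \<tau> ^ 2"
      by (simp only: formC_2_nome[OF \<tau>] eta_quotients[OF \<tau>] mult.assoc)
  qed (rule formC_series)
qed

end
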